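(* Assume that $\mathbb{L}$ and its Green function $G^\Omega$ satisfy properties (L1)–(L4) and (G1)–(G3) listed in the context. Let $\mu\in\mathcal{M}(\Omega,\delta^\gamma)$ and let $g:\mathbb{R}\to\mathbb{R}$ be a nondecreasing continuous function with $g(0)=0$. Assume in addition that $$g(-\mathbb{G}^\Omega[\mu^-]),\ g(\mathbb{G}^\Omega[\mu^+])\in L^1(\Omega,\delta^\gamma).$$ Then the problem $$\mathbb{L}u+g(u)=\mu\ \text{ in }\Omega,\qquad u=0\ \text{ on }\partial\Omega\ \text{ or in }\mathbb{R}^N\setminus\Omega\ \text{(if applicable)}$$ admits a unique weak-dual solution $u$. This solution satisfies $$-\mathbb{G}^\Omega[\mu^-]\le u\le\mathbb{G}^\Omega[\mu^+]\quad\text{a.e. in }\Omega.$$ Moreover, there exists a positive constant $C=C(N,\Omega,s,\gamma)$ such that $$\|u\|_{L^1(\Omega,\delta^\gamma)}+\|g(u)\|_{L^1(\Omega,\delta^\gamma)}\le C\|\mu\|_{\mathcal{M}(\Omega,\delta^\gamma)}.$$ Furthermore, the map $\mu\mapsto u$ is nondecreasing (i.e. if $\mu_1\le\mu_2$ and $u_1,u_2$ are the corresponding solutions, then $u_1\le u_2$ a.e. in $\Omega$).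
   Context: Throughout, $N\ge 3$, $\Omega\subset\mathbb{R}^N$ is a bounded $C^2$ domain, $\delta(x)=\operatorname{dist}(x,\mathbb{R}^N\setminus\Omega)$, $D_\Omega=\{(x,x):x\in\Omega\}$, $a\wedge b=\min\{a,b\}$; $f\asymp g$ means $C^{-1}g\le f\le Cg$ for some constant $C>0$. Operator: (L1) $\mathbb{L}:C_c^\infty(\Omega)\to L^2(\Omega)$ is given by $\mathbb{L}u(x)=\lim_{\varepsilon\to0^+}\mathbb{L}_\varepsilon u(x)$, where $\mathbb{L}_\varepsilon u(x)=\int_{\{y\in\Omega:|x-y|>\varepsilon\}}J(x,y)(u(x)-u(y))\,dy+B(x)u(x)$; $J,B$ are measurable, $J$ is nonnegative, symmetric, finite on $(\Omega\times\Omega)\setminus D_\Omega$, $\int_\Omega\int_\Omega|x-y|^2J(x,y)\,dx\,dy<\infty$, and $B$ is nonnegative and locally bounded in $\Omega$. (L2) For every $u\in C_c^\infty(\Omega)$ there exist $\varphi_u\in L^1_{\rm loc}(\Omega)$ and $\varepsilon_0>0$ with $|\mathbb{L}_\varepsilon u|\le\varphi_u$ a.e. in $\Omega$ for all $\varepsilon\in(0,\varepsilon_0]$. Put $\mathcal{E}(u,v)=\frac12\int_\Omega\int_\Omega J(x,y)(u(x)-u(y))(v(x)-v(y))\,dx\,dy+\int_\Omega Buv\,dx$ on $\mathcal{D}(\mathcal{E})=\{u\in L^2(\Omega):\mathcal{E}(u,u)<\infty\}$, with inner product $\langle u,v\rangle_{L^2(\Omega)}+\mathcal{E}(u,v)$;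 $\mathbb{H}(\Omega)$ is the closure of $C_c^\infty(\Omega)$ in $\mathcal{D}(\mathcal{E})$. $\mathbb{L}$ also denotes its Friedrichs extension, the nonnegative self-adjoint operator on $L^2(\Omega)$ associated with $\mathcal{E}|_{\mathbb{H}(\Omega)}$. (L3) There is $\Lambda>0$ with $\|u\|_{L^2(\Omega)}^2\le\Lambda\langle\mathbb{L}u,u\rangle_{L^2(\Omega)}$ for all $u\in C_c^\infty(\Omega)$. (L4) $\mathbb{H}(\Omega)=H^s_{00}(\Omega):=\{u\in H^s(\Omega):u/\delta^s\in L^2(\Omega)\}$, a Banach space with norm $\|u\|^2_{H^s_{00}(\Omega)}=\int_\Omega(1+\delta^{-2s})|u|^2dx+\int_\Omega\int_\Omega\frac{|u(x)-u(y)|^2}{|x-y|^{N+2s}}dx\,dy$ ($s$ as in (G1)). Green operator: for $f\in L^2(\Omega)$, $\mathbb{G}^\Omega[f]$ is the unique $u\in\mathbb{H}(\Omega)$ with $\mathcal{E}(u,v)=\int_\Omega fv\,dx$ for all $v\in\mathbb{H}(\Omega)$. (G1) $\mathbb{G}^\Omega[f](x)=\int_\Omega G^\Omega(x,y)f(y)\,dy$, where $G^\Omega:(\Omega\times\Omega)\setminus D_\Omega\to(0,\infty)$ is Borel measurable, symmetric, and for some $s,\gamma\in(0,1]$, $N>2s$, $$G^\Omega(x,y)\asymp\frac{1}{|x-y|^{N-2s}}\Big(\frac{\delta(x)}{|x-y|}\wedge1\Big)^\gamma\Big(\frac{\delta(y)}{|x-y|}\wedge1\Big)^\gamma,\quad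 x\ne y.$$ (G2) $G^\Omega$ is jointly continuous in $(\Omega\times\Omega)\setminus D_\Omega$. (G3) For every $x_0\in\Omega$, $z_0\in\partial\Omega$ the limit $M^\Omega(x_0,z_0)=\lim_{(x,y)\to(x_0,z_0)}\frac{G^\Omega(x,y)}{\delta(y)^\gamma}$ exists, and $M^\Omega:\Omega\times\partial\Omega\to\mathbb{R}^+$ is continuous. Spaces: $L^1(\Omega,\delta^\gamma)$ has norm $\int_\Omega|u|\delta^\gamma dx$; $\delta^\gamma L^\infty(\Omega)=\{\delta^\gamma u:u\in L^\infty(\Omega)\}$; $\mathcal{M}(\Omega,\delta^\gamma)$ is the space of signed Radon measures on $\Omega$ with $\|\mu\|_{\mathcal{M}(\Omega,\delta^\gamma)}=\int_\Omega\delta^\gamma d|\mu|<\infty$; $\mu^\pm$ are the positive and negative parts of $\mu$. For such $\mu$, $\mathbb{G}^\Omega[\mu](x)=\int_\Omega G^\Omega(x,y)\,d\mu(y)$, and for $f\in L^1(\Omega,\delta^\gamma)$, $\mathbb{G}^\Omega[f](x)=\int_\Omega G^\Omega(x,y)f(y)\,dy$. Weak-dual solution: $u$ is a weak-dual solution of the problem if $u\in L^1(\Omega,\delta^\gamma)$, $g(u)\in L^1(\Omega,\delta^\gamma)$ and $$\int_\Omega u\xi\,dx+\int_\Omega g(u)\mathbb{G}^\Omega[\xi]\,dx=\int_\Omega\mathbb{G}^\Omega[\xi]\,d\mu\quad\text{for all }\xi\in\delta^\gamma L^\infty(\Omega).$$ The kernel $G^\Omega$ is fixed; the notation $C(\cdot)$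 for constants suppresses dependence on the comparison constants in (G1). *)

theory Defs
  imports "HOL-Analysis.Analysis"
begin

section \<open>Domains and function spaces\<close>

text \<open>
  Functions on \<open>\<Omega>\<close> are total functions whose values outside \<open>\<Omega>\<close> are irrelevant, since only
  the measure \<open>lebesgue_on \<Omega>\<close> is used. Spaces of classes of functions are represented by sets of
  representatives, and equality in them by almost everywhere equality on \<open>\<Omega>\<close>.
\<close>

text \<open>\<open>C_k_on k f S\<close> is meant for open \<open>S\<close>: \<open>f\<close> is \<open>k\<close> times continuously differentiable.\<close>

primrec C_k_on :: "nat \<Rightarrow> ('a::real_normed_vector \<Rightarrow> real) \<Rightarrow> 'a set \<Rightarrow> bool" where
  "C_k_on 0 f S \<longleftrightarrow> continuous_on S f"
| "C_k_on (Suc k) f S \<longleftrightarrow>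
     (\<forall>x\<in>S. f differentiable (at x)) \<and>
     (\<forall>v. C_k_on k (\<lambda>x. frechet_derivative f (at x) v) S)"

text \<open>
  Near each boundary point, \<open>\<Omega>\<close> is the part of a ball lying above the graph of a \<open>C\<^sup>2\<close> function
  over a hyperplane orthogonal to a unit vector \<open>e\<close>. The function \<open>h\<close> is defined on the whole
  space but is only evaluated on that hyperplane.
\<close>

definition C2_boundary :: "'a::euclidean_space set \<Rightarrow> bool" where
  "C2_boundary \<Omega> \<longleftrightarrow>
     (\<forall>z\<in>frontier \<Omega>. \<exists>r>0. \<exists>e h. norm e = 1 \<and> C_k_on 2 h UNIV \<and>
        \<Omega> \<inter> ball z r = {x \<in> ball z r. h (x - (x \<bullet> e) *\<^sub>R e) < x \<bullet> e})"

definition bounded_C2_domain :: "'a::euclidean_space set \<Rightarrow> bool" where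
  "bounded_C2_domain \<Omega> \<longleftrightarrow>
     open \<Omega> \<and> connected \<Omega> \<and> \<Omega> \<noteq> {} \<and> bounded \<Omega> \<and> C2_boundary \<Omega>"

definition bdist :: "'a::euclidean_space set \<Rightarrow> 'a \<Rightarrow> real" where
  "bdist \<Omega> x = infdist x (- \<Omega>)"

definition off_diag :: "'a set \<Rightarrow> ('a \<times> 'a) set" where
  "off_diag \<Omega> = {(x, y). x \<in> \<Omega> \<and> y \<in> \<Omega> \<and> x \<noteq> y}"

text \<open>Test functions on \<open>\<Omega>\<close> are identified with their extensions by zero.\<close>

definition test_functions :: "'a::euclidean_space set \<Rightarrow> ('a \<Rightarrow> real) set" where
  "test_functions \<Omega> =
     {\<phi>. (\<forall>k. C_k_on k \<phi> UNIV) \<and> compact (closure {x. \<phi> x \<noteq> 0}) \<and> closure {x. \<phi> x \<noteq> 0} \<subseteq> \<Omega>}"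

definition L2_space :: "'a::euclidean_space set \<Rightarrow> ('a \<Rightarrow> real) set" where
  "L2_space \<Omega> =
     {u \<in> borel_measurable (lebesgue_on \<Omega>). integrable (lebesgue_on \<Omega>) (\<lambda>x. (u x)\<^sup>2)}"

definition L1_loc :: "'a::euclidean_space set \<Rightarrow> ('a \<Rightarrow> real) set" where
  "L1_loc \<Omega> = {u. \<forall>K. compact K \<and> K \<subseteq> \<Omega> \<longrightarrow> integrable (lebesgue_on K) u}"

definition Linfty :: "'a::euclidean_space set \<Rightarrow> ('a \<Rightarrow> real) set" where
  "Linfty \<Omega> =
     {w \<in> borel_measurable (lebesgue_on \<Omega>). \<exists>C. AE x in lebesgue_on \<Omega>. \<bar>w x\<bar> \<le> C}"

definition L1_weighted :: "'a::euclidean_space set \<Rightarrow> real \<Rightarrow> ('a \<Rightarrow> real) set" where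
  "L1_weighted \<Omega> \<gamma> =
     {u \<in> borel_measurable (lebesgue_on \<Omega>).
        integrable (lebesgue_on \<Omega>) (\<lambda>x. \<bar>u x\<bar> * bdist \<Omega> x powr \<gamma>)}"

definition L1_weighted_norm :: "'a::euclidean_space set \<Rightarrow> real \<Rightarrow> ('a \<Rightarrow> real) \<Rightarrow> real" where
  "L1_weighted_norm \<Omega> \<gamma> u = (\<integral>x. \<bar>u x\<bar> * bdist \<Omega> x powr \<gamma> \<partial>lebesgue_on \<Omega>)"

definition weighted_Linfty :: "'a::euclidean_space set \<Rightarrow> real \<Rightarrow> ('a \<Rightarrow> real) set" where
  "weighted_Linfty \<Omega> \<gamma> = (\<lambda>w x. bdist \<Omega> x powr \<gamma> * w x) ` Linfty \<Omega>"

text \<open>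
  For \<open>0 < s < 1\<close> this is the fractional space given by the Gagliardo seminorm; for \<open>s = 1\<close>, where
  that seminorm is infinite on nonconstant functions, it is the classical space \<open>H\<^sup>1\<close> defined by
  weak derivatives.
\<close>

definition sobolev_H :: "real \<Rightarrow> 'a::euclidean_space set \<Rightarrow> ('a \<Rightarrow> real) set" where
  "sobolev_H s \<Omega> =
     (if s = 1 then
        {u \<in> L2_space \<Omega>. \<forall>b\<in>Basis. \<exists>w\<in>L2_space \<Omega>. \<forall>\<phi>\<in>test_functions \<Omega>.
           (\<integral>x. u x * frechet_derivative \<phi> (at x) b \<partial>lebesgue_on \<Omega>) =
           - (\<integral>x. w x * \<phi> x \<partial>lebesgue_on \<Omega>)}
      else
        {u \<in> L2_space \<Omega>. integrable (lebesgue_on (\<Omega> \<times> \<Omega>))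
           (\<lambda>(x, y). (u x - u y)\<^sup>2 / dist x y powr (real DIM('a) + 2 * s))})"

definition sobolev_H00 :: "real \<Rightarrow> 'a::euclidean_space set \<Rightarrow> ('a \<Rightarrow> real) set" where
  "sobolev_H00 s \<Omega> = {u \<in> sobolev_H s \<Omega>. (\<lambda>x. u x / bdist \<Omega> x powr s) \<in> L2_space \<Omega>}"


section \<open>The operator and its bilinear form\<close>

definition L_eps ::
  "'a::euclidean_space set \<Rightarrow> ('a \<Rightarrow> 'a \<Rightarrow> real) \<Rightarrow> ('a \<Rightarrow> real) \<Rightarrow> real \<Rightarrow> ('a \<Rightarrow> real) \<Rightarrow> 'a \<Rightarrow> real"
where
  "L_eps \<Omega> J B \<epsilon> u x =
     (\<integral>y. J x y * (u x - u y) \<partial>lebesgue_on {y \<in> \<Omega>. dist x y > \<epsilon>}) + B x * u x"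

definition L_op ::
  "'a::euclidean_space set \<Rightarrow> ('a \<Rightarrow> 'a \<Rightarrow> real) \<Rightarrow> ('a \<Rightarrow> real) \<Rightarrow> ('a \<Rightarrow> real) \<Rightarrow> 'a \<Rightarrow> real"
where
  "L_op \<Omega> J B u x = Lim (at_right 0) (\<lambda>\<epsilon>. L_eps \<Omega> J B \<epsilon> u x)"

definition cond_L1 ::
  "'a::euclidean_space set \<Rightarrow> ('a \<Rightarrow> 'a \<Rightarrow> real) \<Rightarrow> ('a \<Rightarrow> real) \<Rightarrow> bool"
where
  "cond_L1 \<Omega> J B \<longleftrightarrow>
     (\<lambda>(x, y). J x y) \<in> borel_measurable (lebesgue_on (\<Omega> \<times> \<Omega>)) \<and>
     (\<forall>(x, y)\<in>off_diag \<Omega>. 0 \<le> J x y \<and> J x y = J y x) \<and>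
     integrable (lebesgue_on (\<Omega> \<times> \<Omega>)) (\<lambda>(x, y). (dist x y)\<^sup>2 * J x y) \<and>
     B \<in> borel_measurable (lebesgue_on \<Omega>) \<and>
     (\<forall>x\<in>\<Omega>. 0 \<le> B x) \<and>
     (\<forall>K. compact K \<and> K \<subseteq> \<Omega> \<longrightarrow> bounded (B ` K)) \<and>
     (\<forall>u\<in>test_functions \<Omega>.
        (AE x in lebesgue_on \<Omega>. ((\<lambda>\<epsilon>. L_eps \<Omega> J B \<epsilon> u x) \<longlongrightarrow> L_op \<Omega> J B u x) (at_right 0)) \<and>
        L_op \<Omega> J B u \<in> L2_space \<Omega>)"

definition cond_L2 ::
  "'a::euclidean_space set \<Rightarrow> ('a \<Rightarrow> 'a \<Rightarrow> real) \<Rightarrow> ('a \<Rightarrow> real) \<Rightarrow> bool"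
where
  "cond_L2 \<Omega> J B \<longleftrightarrow>
     (\<forall>u\<in>test_functions \<Omega>. \<exists>\<phi>\<in>L1_loc \<Omega>. \<exists>\<epsilon>\<^sub>0>0. \<forall>\<epsilon>\<in>{0<..\<epsilon>\<^sub>0}.
        AE x in lebesgue_on \<Omega>. \<bar>L_eps \<Omega> J B \<epsilon> u x\<bar> \<le> \<phi> x)"

definition energy ::
  "'a::euclidean_space set \<Rightarrow> ('a \<Rightarrow> 'a \<Rightarrow> real) \<Rightarrow> ('a \<Rightarrow> real) \<Rightarrow> ('a \<Rightarrow> real) \<Rightarrow> ('a \<Rightarrow> real) \<Rightarrow> real"
where
  "energy \<Omega> J B u v =
     1 / 2 * (\<integral>(x, y). J x y * (u x - u y) * (v x - v y) \<partial>lebesgue_on (\<Omega> \<times> \<Omega>)) +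
     (\<integral>x. B x * u x * v x \<partial>lebesgue_on \<Omega>)"

text \<open>As \<open>J\<close> and \<open>B\<close> are nonnegative, finiteness of the energy of \<open>u\<close> is integrability of both terms.\<close>

definition energy_domain ::
  "'a::euclidean_space set \<Rightarrow> ('a \<Rightarrow> 'a \<Rightarrow> real) \<Rightarrow> ('a \<Rightarrow> real) \<Rightarrow> ('a \<Rightarrow> real) set"
where
  "energy_domain \<Omega> J B =
     {u \<in> L2_space \<Omega>.
        integrable (lebesgue_on (\<Omega> \<times> \<Omega>)) (\<lambda>(x, y). J x y * (u x - u y)\<^sup>2) \<and>
        integrable (lebesgue_on \<Omega>) (\<lambda>x. B x * (u x)\<^sup>2)}"

text \<open>The closure of the test functions in the energy domain, for the norm whose square is below.\<close>

definition energy_norm_sq ::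
  "'a::euclidean_space set \<Rightarrow> ('a \<Rightarrow> 'a \<Rightarrow> real) \<Rightarrow> ('a \<Rightarrow> real) \<Rightarrow> ('a \<Rightarrow> real) \<Rightarrow> real"
where
  "energy_norm_sq \<Omega> J B u = (\<integral>x. (u x)\<^sup>2 \<partial>lebesgue_on \<Omega>) + energy \<Omega> J B u u"

definition form_space ::
  "'a::euclidean_space set \<Rightarrow> ('a \<Rightarrow> 'a \<Rightarrow> real) \<Rightarrow> ('a \<Rightarrow> real) \<Rightarrow> ('a \<Rightarrow> real) set"
where
  "form_space \<Omega> J B =
     {u \<in> energy_domain \<Omega> J B. \<forall>\<epsilon>>0. \<exists>\<phi>\<in>test_functions \<Omega>.
        energy_norm_sq \<Omega> J B (\<lambda>x. u x - \<phi> x) < \<epsilon>\<^sup>2}"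

definition cond_L3 ::
  "'a::euclidean_space set \<Rightarrow> ('a \<Rightarrow> 'a \<Rightarrow> real) \<Rightarrow> ('a \<Rightarrow> real) \<Rightarrow> bool"
where
  "cond_L3 \<Omega> J B \<longleftrightarrow>
     (\<exists>\<Lambda>>0. \<forall>u\<in>test_functions \<Omega>.
        (\<integral>x. (u x)\<^sup>2 \<partial>lebesgue_on \<Omega>) \<le> \<Lambda> * (\<integral>x. L_op \<Omega> J B u x * u x \<partial>lebesgue_on \<Omega>))"

definition cond_L4 ::
  "'a::euclidean_space set \<Rightarrow> ('a \<Rightarrow> 'a \<Rightarrow> real) \<Rightarrow> ('a \<Rightarrow> real) \<Rightarrow> real \<Rightarrow> bool"
where
  "cond_L4 \<Omega> J B s \<longleftrightarrow> form_space \<Omega> J B = sobolev_H00 s \<Omega>"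


section \<open>The Green function\<close>

text \<open>
  \<open>G\<close> is a total function; its values on the diagonal and outside \<open>\<Omega> \<times> \<Omega>\<close> are unconstrained.
\<close>

definition green_fun ::
  "'a::euclidean_space set \<Rightarrow> ('a \<Rightarrow> 'a \<Rightarrow> real) \<Rightarrow> ('a \<Rightarrow> real) \<Rightarrow> 'a \<Rightarrow> real"
where
  "green_fun \<Omega> G f x = (\<integral>y. G x y * f y \<partial>lebesgue_on \<Omega>)"

text \<open>
  The Green potential of a nonnegative measure. For measures that are finite against the weight it
  converges for almost every \<open>x\<close>, and only its almost everywhere class matters below; in particular
  the values of \<open>G\<close> on the diagonal, seen only where the measure has an atom, are irrelevant.
\<close>

definition green_meas :: "('a \<Rightarrow> 'a \<Rightarrow> real) \<Rightarrow> 'a measure \<Rightarrow> 'a \<Rightarrow> real" where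
  "green_meas G \<nu> x = (\<integral>y. G x y \<partial>\<nu>)"

text \<open>\<open>u\<close> represents the image of \<open>f\<close> under the Green operator of the form.\<close>

definition is_green_image ::
  "'a::euclidean_space set \<Rightarrow> ('a \<Rightarrow> 'a \<Rightarrow> real) \<Rightarrow> ('a \<Rightarrow> real) \<Rightarrow> ('a \<Rightarrow> real) \<Rightarrow> ('a \<Rightarrow> real) \<Rightarrow> bool"
where
  "is_green_image \<Omega> J B f u \<longleftrightarrow>
     u \<in> form_space \<Omega> J B \<and>
     (\<forall>v\<in>form_space \<Omega> J B. energy \<Omega> J B u v = (\<integral>x. f x * v x \<partial>lebesgue_on \<Omega>))"

definition green_model :: "'a::euclidean_space set \<Rightarrow> real \<Rightarrow> real \<Rightarrow> 'a \<Rightarrow> 'a \<Rightarrow> real" where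
  "green_model \<Omega> s \<gamma> x y =
     1 / dist x y powr (real DIM('a) - 2 * s) *
     (min (bdist \<Omega> x / dist x y) 1) powr \<gamma> * (min (bdist \<Omega> y / dist x y) 1) powr \<gamma>"

text \<open>\<open>c\<close> is the constant in the two-sided comparison.\<close>

definition cond_G1 ::
  "'a::euclidean_space set \<Rightarrow> ('a \<Rightarrow> 'a \<Rightarrow> real) \<Rightarrow> ('a \<Rightarrow> real) \<Rightarrow> real \<Rightarrow> real \<Rightarrow> real \<Rightarrow>
   ('a \<Rightarrow> 'a \<Rightarrow> real) \<Rightarrow> bool"
where
  "cond_G1 \<Omega> J B s \<gamma> c G \<longleftrightarrow>
     (\<forall>f\<in>L2_space \<Omega>. is_green_image \<Omega> J B f (green_fun \<Omega> G f)) \<and>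
     (\<lambda>(x, y). G x y) \<in> borel_measurable (restrict_space borel (off_diag \<Omega>)) \<and>
     (\<forall>(x, y)\<in>off_diag \<Omega>.
        0 < G x y \<and> G x y = G y x \<and>
        inverse c * green_model \<Omega> s \<gamma> x y \<le> G x y \<and> G x y \<le> c * green_model \<Omega> s \<gamma> x y)"

definition cond_G2 :: "'a::euclidean_space set \<Rightarrow> ('a \<Rightarrow> 'a \<Rightarrow> real) \<Rightarrow> bool" where
  "cond_G2 \<Omega> G \<longleftrightarrow> continuous_on (off_diag \<Omega>) (\<lambda>(x, y). G x y)"

definition cond_G3 :: "'a::euclidean_space set \<Rightarrow> real \<Rightarrow> ('a \<Rightarrow> 'a \<Rightarrow> real) \<Rightarrow> bool" where
  "cond_G3 \<Omega> \<gamma> G \<longleftrightarrow>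
     (\<exists>M. continuous_on (\<Omega> \<times> frontier \<Omega>) M \<and>
        (\<forall>p\<in>\<Omega> \<times> frontier \<Omega>. 0 < M p \<and>
           ((\<lambda>(x, y). G x y / bdist \<Omega> y powr \<gamma>) \<longlongrightarrow> M p) (at p within off_diag \<Omega>)))"


section \<open>Signed Radon measures\<close>

text \<open>
  A signed Radon measure on \<open>\<Omega>\<close> need not be finite, and then it has no value on sets on which both
  its positive and its negative part are infinite. It is therefore encoded by its Jordan
  decomposition: two mutually singular nonnegative Borel measures on \<open>\<Omega>\<close> that are finite on compact
  sets. Such a pair is uniquely determined by the signed measure, whose values on relatively compact
  Borel subsets of \<open>\<Omega>\<close> are given by \<open>signed_value\<close>.
\<close>

datatype 'a jordan = Jordan (pos_part: "'a measure") (neg_part: "'a measure")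

definition radon_measure :: "'a::euclidean_space set \<Rightarrow> 'a measure \<Rightarrow> bool" where
  "radon_measure \<Omega> \<nu> \<longleftrightarrow>
     sets \<nu> = sets (restrict_space borel \<Omega>) \<and>
     (\<forall>K. compact K \<and> K \<subseteq> \<Omega> \<longrightarrow> emeasure \<nu> K < \<infinity>)"

definition signed_radon_measure :: "'a::euclidean_space set \<Rightarrow> 'a jordan \<Rightarrow> bool" where
  "signed_radon_measure \<Omega> \<mu> \<longleftrightarrow>
     radon_measure \<Omega> (pos_part \<mu>) \<and> radon_measure \<Omega> (neg_part \<mu>) \<and>
     (\<exists>A\<in>sets (restrict_space borel \<Omega>).
        emeasure (pos_part \<mu>) (\<Omega> - A) = 0 \<and> emeasure (neg_part \<mu>) A = 0)"

definition signed_value :: "'a jordan \<Rightarrow> 'a set \<Rightarrow> real" where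
  "signed_value \<mu> A = measure (pos_part \<mu>) A - measure (neg_part \<mu>) A"

definition signed_integral :: "'a jordan \<Rightarrow> ('a \<Rightarrow> real) \<Rightarrow> real" where
  "signed_integral \<mu> f = (\<integral>x. f x \<partial>pos_part \<mu>) - (\<integral>x. f x \<partial>neg_part \<mu>)"

definition signed_le :: "'a::euclidean_space set \<Rightarrow> 'a jordan \<Rightarrow> 'a jordan \<Rightarrow> bool" where
  "signed_le \<Omega> \<mu>\<^sub>1 \<mu>\<^sub>2 \<longleftrightarrow>
     (\<forall>A\<in>sets borel. compact (closure A) \<and> closure A \<subseteq> \<Omega> \<longrightarrow>
        signed_value \<mu>\<^sub>1 A \<le> signed_value \<mu>\<^sub>2 A)"

text \<open>The total variation measure is the sum of the positive and negative parts.\<close>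

definition weighted_measures :: "'a::euclidean_space set \<Rightarrow> real \<Rightarrow> 'a jordan set" where
  "weighted_measures \<Omega> \<gamma> =
     {\<mu>. signed_radon_measure \<Omega> \<mu> \<and>
         integrable (pos_part \<mu>) (\<lambda>x. bdist \<Omega> x powr \<gamma>) \<and>
         integrable (neg_part \<mu>) (\<lambda>x. bdist \<Omega> x powr \<gamma>)}"

definition weighted_measure_norm :: "'a::euclidean_space set \<Rightarrow> real \<Rightarrow> 'a jordan \<Rightarrow> real" where
  "weighted_measure_norm \<Omega> \<gamma> \<mu> =
     (\<integral>x. bdist \<Omega> x powr \<gamma> \<partial>pos_part \<mu>) + (\<integral>x. bdist \<Omega> x powr \<gamma> \<partial>neg_part \<mu>)"


section \<open>Weak-dual solutions\<close>

definition weak_dual_solution ::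
  "'a::euclidean_space set \<Rightarrow> real \<Rightarrow> ('a \<Rightarrow> 'a \<Rightarrow> real) \<Rightarrow> (real \<Rightarrow> real) \<Rightarrow> 'a jordan \<Rightarrow>
   ('a \<Rightarrow> real) \<Rightarrow> bool"
where
  "weak_dual_solution \<Omega> \<gamma> G g \<mu> u \<longleftrightarrow>
     u \<in> L1_weighted \<Omega> \<gamma> \<and> (\<lambda>x. g (u x)) \<in> L1_weighted \<Omega> \<gamma> \<and>
     (\<forall>\<xi>\<in>weighted_Linfty \<Omega> \<gamma>.
        (\<integral>x. u x * \<xi> x \<partial>lebesgue_on \<Omega>) + (\<integral>x. g (u x) * green_fun \<Omega> G \<xi> x \<partial>lebesgue_on \<Omega>) =
        signed_integral \<mu> (green_fun \<Omega> G \<xi>))"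

definition admissible_measure ::
  "'a::euclidean_space set \<Rightarrow> real \<Rightarrow> ('a \<Rightarrow> 'a \<Rightarrow> real) \<Rightarrow> (real \<Rightarrow> real) \<Rightarrow> 'a jordan \<Rightarrow> bool"
where
  "admissible_measure \<Omega> \<gamma> G g \<mu> \<longleftrightarrow>
     \<mu> \<in> weighted_measures \<Omega> \<gamma> \<and>
     (\<lambda>x. g (- green_meas G (neg_part \<mu>) x)) \<in> L1_weighted \<Omega> \<gamma> \<and>
     (\<lambda>x. g (green_meas G (pos_part \<mu>) x)) \<in> L1_weighted \<Omega> \<gamma>"

end

theory Submission
  imports Defs
begin

text \<open>
  In terms of \<open>G\<close>, a weak-dual solution is a function with \<open>u = G[\<mu>] - G[g(u)]\<close> almost everywhere, and everything
  rests on Kato's inequality for such functions: with \<open>\<rho> = \<delta> powr \<gamma>\<close> and \<open>\<phi> = G[\<rho>]\<close>, which is comparable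
  to \<open>\<rho>\<close>, the solution \<open>w\<close> of the linear problem with datum \<open>f\<close> satisfies
  \<open>\<integral> \<bar>w\<bar> \<rho> \<le> \<integral> f sgn(w) \<phi>\<close>. For bounded \<open>f\<close> this follows by testing the form with \<open>j'(w) \<phi>\<close>, where \<open>j\<close> is a
  smooth convex approximation of the absolute value; the test function is admissible since the form
  space is closed under bounded almost everywhere limits. Measures are approximated by their averages
  over small balls, whose potentials converge in the weighted \<open>L\<^sup>1\<close> space.

  Uniqueness, monotonicity and the estimate are direct consequences. For existence, \<open>g(u)\<close> is truncated to
  \<open>g(max (-G[\<mu>\<^sup>-]) (min u (G[\<mu>\<^sup>+])))\<close>, which is dominated by an integrable function. Lipschitz
  approximations of the truncated problem are solved by a contraction in the norm of the form, Kato's inequality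
  passes to the limit, and applied to \<open>u - G[\<mu>\<^sup>+]\<close> and \<open>-G[\<mu>\<^sup>-] - u\<close> it removes the truncation.
\<close>

section \<open>Smooth functions of test functions\<close>

text \<open>Three obstacles shape the proof. The form space is the closure of the test functions, so
  every nonlinear function of its elements has to be reached through test functions. All
  compositions are therefore smooth ones built from \<open>sqrt (t\<^sup>2 + e\<^sup>2)\<close>, and
  the sign function appears only after \<open>e\<close> has tended to 0. The potential of a measure
  need not have finite energy, so the passage from bounded data to measures takes place outside the
  form space. It rests on the continuity of \<open>y \<mapsto> G(\<cdot>, y)\<close> into L^1, which
  combines the continuity of the kernel off the diagonal with the uniform integrability of the Riesz
  kernel. The averages are normalised values of the measure on sets with compact closure in
  \<Omega>, so the order of signed measures passes to them directly. Finally, the constant of the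
  estimate has to be fixed before the operator.\<close>

lemma C_k_on_closed_class:
  assumes "\<And>f x. f \<in> F \<Longrightarrow> f differentiable (at x)"
    and "\<And>f v. f \<in> F \<Longrightarrow> (\<lambda>x. frechet_derivative f (at x) v) \<in> F"
    and "f \<in> F"
  shows "C_k_on k f UNIV"
  using assms(3)
proof (induction k arbitrary: f)
  case 0
  then show ?case
    using assms(1) by (auto intro!: differentiable_imp_continuous_on simp: differentiable_on_def)
next
  case (Suc k)
  then show ?case using assms(1,2) by simp
qed

text \<open>With \<open>r\<close> the generator \<open>rsqrt\<close>, its derivative is
  \<open>- r * r * r * f\<close> times that of \<open>f\<close>. The algebra is thus stable under
  directional derivatives, and \<open>C_k_on_closed_class\<close> makes its members smooth to every
  order without product or chain rules for \<open>C_k_on\<close>. It contains the regularised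
  absolute value and sign of a test function.\<close>

inductive_set smooth_alg :: "('a::euclidean_space \<Rightarrow> real) set" where
  smooth: "(\<And>k. C_k_on k f UNIV) \<Longrightarrow> f \<in> smooth_alg"
| const: "(\<lambda>x. c) \<in> smooth_alg"
| add: "f \<in> smooth_alg \<Longrightarrow> g \<in> smooth_alg \<Longrightarrow> (\<lambda>x. f x + g x) \<in> smooth_alg"
| mult: "f \<in> smooth_alg \<Longrightarrow> g \<in> smooth_alg \<Longrightarrow> (\<lambda>x. f x * g x) \<in> smooth_alg"
| rsqrt: "f \<in> smooth_alg \<Longrightarrow> \<epsilon> > 0 \<Longrightarrow> (\<lambda>x. inverse (sqrt ((f x)\<^sup>2 + \<epsilon>\<^sup>2))) \<in> smooth_alg"

lemma smooth_alg_derivative: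
  "f \<in> smooth_alg \<Longrightarrow>
     \<exists>D. (\<forall>x. (f has_derivative D x) (at x)) \<and> (\<forall>v. (\<lambda>x. D x v) \<in> smooth_alg)"
proof (induction rule: smooth_alg.induct)
  case (smooth f)
  have "(f has_derivative frechet_derivative f (at x)) (at x)" for x
    using smooth[of "Suc 0"] frechet_derivative_works[THEN iffD1] by auto
  moreover have "(\<lambda>x. frechet_derivative f (at x) v) \<in> smooth_alg" for v
    using smooth[of "Suc _"] by (intro smooth_alg.smooth) simp
  ultimately show ?case
    by (intro exI[of _ "\<lambda>x. frechet_derivative f (at x)"] conjI allI)
next
  case (const c)
  have "\<forall>x::'a. ((\<lambda>x. c) has_derivative (\<lambda>v. 0)) (at x)" by simp
  then show ?case
    by (intro exI[of _ "\<lambda>x v. 0"] conjI allI smooth_alg.const) simp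
next
  case (add f g)
  then obtain D E where D: "\<And>x. (f has_derivative D x) (at x)" "\<And>v. (\<lambda>x. D x v) \<in> smooth_alg"
    and E: "\<And>x. (g has_derivative E x) (at x)" "\<And>v. (\<lambda>x. E x v) \<in> smooth_alg"
    by blast
  have "\<forall>x. ((\<lambda>x. f x + g x) has_derivative (\<lambda>v. D x v + E x v)) (at x)"
    using D(1) E(1) by (intro allI has_derivative_add) auto
  then show ?case using smooth_alg.add[OF D(2) E(2)] by (intro exI[of _ "\<lambda>x v. D x v + E x v"] conjI allI) auto
next
  case (mult f g)
  then obtain D E where D: "\<And>x. (f has_derivative D x) (at x)" "\<And>v. (\<lambda>x. D x v) \<in> smooth_alg"
    and E: "\<And>x. (g has_derivative E x) (at x)" "\<And>v. (\<lambda>x. E x v) \<in> smooth_alg"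
    by blast
  have "\<forall>x. ((\<lambda>x. f x * g x) has_derivative (\<lambda>v. f x * E x v + D x v * g x)) (at x)"
    using D(1) E(1) by (intro allI has_derivative_mult) auto
  moreover have "(\<lambda>x. f x * E x v + D x v * g x) \<in> smooth_alg" for v
    using mult(1,2) D(2) E(2) by (intro smooth_alg.add smooth_alg.mult) auto
  ultimately show ?case by (intro exI[of _ "\<lambda>x v. f x * E x v + D x v * g x"] conjI allI) auto
next
  case (rsqrt f \<epsilon>)
  then obtain D where D: "\<And>x. (f has_derivative D x) (at x)" "\<And>v. (\<lambda>x. D x v) \<in> smooth_alg"
    by blast
  define r where "r = (\<lambda>x. inverse (sqrt ((f x)\<^sup>2 + \<epsilon>\<^sup>2)))"
  have r: "r \<in> smooth_alg" unfolding r_def using rsqrt by (intro smooth_alg.rsqrt)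
  have "(r has_derivative (\<lambda>v. (- 1) * (r x * (r x * r x)) * f x * D x v)) (at x)" for x
  proof -
    have p: "(f x)\<^sup>2 + \<epsilon>\<^sup>2 > 0" using rsqrt(2) by (simp add: add_nonneg_pos)
    have "((\<lambda>t. inverse (sqrt (t\<^sup>2 + \<epsilon>\<^sup>2))) has_real_derivative
        (- 1) * (r x * (r x * r x)) * f x) (at (f x))"
    proof -
      have "((\<lambda>t. inverse (sqrt (t\<^sup>2 + \<epsilon>\<^sup>2))) has_real_derivative
          - (inverse (sqrt ((f x)\<^sup>2 + \<epsilon>\<^sup>2)) * (inverse (sqrt ((f x)\<^sup>2 + \<epsilon>\<^sup>2)) / 2 * (2 * f x)) *
             inverse (sqrt ((f x)\<^sup>2 + \<epsilon>\<^sup>2)))) (at (f x))"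
        using p by (auto intro!: derivative_eq_intros simp del: mult_minus_left mult_minus_right)
      then show ?thesis unfolding r_def by (simp add: mult_ac)
    qed
    from has_derivative_compose[OF D(1) this[unfolded has_field_derivative_def]]
    show ?thesis unfolding r_def .
  qed
  moreover have "(\<lambda>x. (- 1) * (r x * (r x * r x)) * f x * D x v) \<in> smooth_alg" for v
    using r rsqrt(1) D(2) by (intro smooth_alg.mult smooth_alg.const)
  ultimately show ?case unfolding r_def[symmetric]
    by (intro exI[of _ "\<lambda>x v. (- 1) * (r x * (r x * r x)) * f x * D x v"] conjI allI)
qed

lemma smooth_alg_C_k_on: "f \<in> smooth_alg \<Longrightarrow> C_k_on k f UNIV"
proof (rule C_k_on_closed_class[where F = smooth_alg])
  fix f :: "'a \<Rightarrow> real" and x v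
  assume "f \<in> smooth_alg"
  then obtain D where D: "\<And>x. (f has_derivative D x) (at x)" "\<And>v. (\<lambda>x. D x v) \<in> smooth_alg"
    using smooth_alg_derivative by blast
  show "f differentiable (at x)" using D(1) by (rule differentiableI)
  have "frechet_derivative f (at x) = D x" for x using D(1) by (rule frechet_derivative_at[symmetric])
  then show "(\<lambda>x. frechet_derivative f (at x) v) \<in> smooth_alg" using D(2) by simp
qed

text \<open>Vanishing wherever a given test function vanishes confines the support, so its
  compactness is inherited. This covers every composition of a test function with a function that is
  0 at 0.\<close>

lemma test_functionsI:
  assumes "\<phi> \<in> test_functions \<Omega>" "f \<in> smooth_alg" "\<And>x. \<phi> x = 0 \<Longrightarrow> f x = 0"
  shows "f \<in> test_functions \<Omega>"
proof -
  have sub: "closure {x. f x \<noteq> 0} \<subseteq> closure {x. \<phi> x \<noteq> 0}"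
    using assms(3) by (intro closure_mono) auto
  have "compact (closure {x. f x \<noteq> 0})"
    using assms(1) bounded_subset[OF _ sub] by (simp add: test_functions_def compact_eq_bounded_closed)
  then show ?thesis
    using assms(1,2) sub smooth_alg_C_k_on by (auto simp: test_functions_def)
qed

lemma test_functions_smooth: "\<phi> \<in> test_functions \<Omega> \<Longrightarrow> \<phi> \<in> smooth_alg"
  by (rule smooth_alg.smooth) (simp add: test_functions_def)

lemma test_functions_add:
  assumes "\<phi> \<in> test_functions \<Omega>" "\<psi> \<in> test_functions \<Omega>"
  shows "(\<lambda>x. \<phi> x + \<psi> x) \<in> test_functions \<Omega>"
proof -
  have sub: "closure {x. \<phi> x + \<psi> x \<noteq> 0} \<subseteq> closure {x. \<phi> x \<noteq> 0} \<union> closure {x. \<psi> x \<noteq> 0}"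
    by (subst closure_Un[symmetric], rule closure_mono) auto
  have "compact (closure {x. \<phi> x \<noteq> 0} \<union> closure {x. \<psi> x \<noteq> 0})"
    using assms by (intro compact_Un) (simp_all add: test_functions_def)
  then have "compact (closure {x. \<phi> x + \<psi> x \<noteq> 0})"
    using bounded_subset[OF _ sub] by (simp add: compact_eq_bounded_closed)
  moreover have "\<forall>k. C_k_on k (\<lambda>x. \<phi> x + \<psi> x) UNIV"
    using assms by (intro allI smooth_alg_C_k_on smooth_alg.add test_functions_smooth)
  ultimately show ?thesis
    using assms sub by (auto simp: test_functions_def)
qed

lemma test_functions_cmult: "\<phi> \<in> test_functions \<Omega> \<Longrightarrow> (\<lambda>x. c * \<phi> x) \<in> test_functions \<Omega>"
  by (rule test_functionsI) (auto intro: smooth_alg.intros test_functions_smooth)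

lemma test_functions_continuous: "\<phi> \<in> test_functions \<Omega> \<Longrightarrow> continuous_on UNIV \<phi>"
  by (auto simp: test_functions_def dest: spec[of _ 0])

lemma test_functions_outside:
  "\<phi> \<in> test_functions \<Omega> \<Longrightarrow> \<exists>S. compact S \<and> S \<subseteq> \<Omega> \<and> (\<forall>x. x \<notin> S \<longrightarrow> \<phi> x = 0)"
  unfolding test_functions_def using closure_subset[of "{x. \<phi> x \<noteq> 0}"]
  by (intro exI[of _ "closure {x. \<phi> x \<noteq> 0}"]) auto

lemma test_functions_bounded:
  assumes "\<phi> \<in> test_functions \<Omega>"
  shows "\<exists>C. \<forall>x. \<bar>\<phi> x\<bar> \<le> C"
proof -
  obtain S where S: "compact S" "\<And>x. x \<notin> S \<Longrightarrow> \<phi> x = 0" using test_functions_outside[OF assms] by blast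
  have "bounded (\<phi> ` S)"
    using S(1) test_functions_continuous[OF assms]
    by (intro compact_imp_bounded compact_continuous_image) (auto intro: continuous_on_subset)
  then obtain C where "C > 0" "\<forall>y\<in>\<phi> ` S. norm y \<le> C" using bounded_pos by blast
  then have "\<bar>\<phi> x\<bar> \<le> C" for x using S(2)[of x] by (cases "x \<in> S") auto
  then show ?thesis by blast
qed

text \<open>The energy of a test function is compared with the integral of |x - y|^2 J(x, y), which
  takes a global Lipschitz constant. Directional derivatives are what \<open>C_k_on\<close>
  controls, so each basis direction is bounded separately and the bounds are added.\<close>

lemma test_functions_lipschitz:
  assumes "\<phi> \<in> test_functions \<Omega>"
  shows "\<exists>L\<ge>0. \<forall>x y. \<bar>\<phi> x - \<phi> y\<bar> \<le> L * dist x y"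
proof -
  define D where "D = (\<lambda>x. frechet_derivative \<phi> (at x))"
  have C2: "C_k_on (Suc (Suc 0)) \<phi> UNIV" using assms by (simp only: test_functions_def mem_Collect_eq)
  have D: "(\<phi> has_derivative D x) (at x)" for x
    using C2 frechet_derivative_works[THEN iffD1] unfolding D_def by auto
  have Dc: "continuous_on UNIV (\<lambda>x. D x v)" for v
  proof -
    have "(\<lambda>x. D x v) differentiable (at x)" for x using C2 unfolding D_def by simp
    then show ?thesis by (auto intro!: differentiable_imp_continuous_on simp: differentiable_on_def)
  qed
  obtain S where S: "compact S" "\<And>x. x \<notin> S \<Longrightarrow> \<phi> x = 0" using test_functions_outside[OF assms] by blast
  \<comment> \<open>The function vanishes on the open complement of \<open>S\<close>, hence so does
    its derivative there, and a bound on the compact set \<open>S\<close> is a global one.\<close>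
  have out: "D x v = 0" if "x \<notin> S" for x v
  proof -
    have "open (- S)" using S(1) compact_imp_closed by blast
    then have "(\<phi> has_derivative (\<lambda>v. 0)) (at x)"
      using has_derivative_transform_within_open[of "\<lambda>_. 0" "\<lambda>v. 0" x UNIV "- S" \<phi>] S(2) that by simp
    then show ?thesis using has_derivative_unique[OF D] by metis
  qed
  have "\<exists>C\<ge>0. \<forall>x. \<bar>D x v\<bar> \<le> C" for v
  proof -
    have "bounded ((\<lambda>x. D x v) ` S)"
      using S(1) Dc by (intro compact_imp_bounded compact_continuous_image) (auto intro: continuous_on_subset)
    then obtain C where "C > 0" "\<forall>y\<in>(\<lambda>x. D x v) ` S. norm y \<le> C" using bounded_pos by blast
    then have "\<bar>D x v\<bar> \<le> C" for x using out[of x] by (cases "x \<in> S") auto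
    then show ?thesis using \<open>C > 0\<close> by (intro exI[of _ C]) auto
  qed
  then obtain C where C: "\<And>v. C v \<ge> 0" "\<And>x v. \<bar>D x v\<bar> \<le> C v" by metis
  define L where "L = (\<Sum>b\<in>Basis. C b)"
  have L: "\<bar>D x h\<bar> \<le> L * norm h" for x h
  proof -
    interpret linear "D x" using D has_derivative_linear by blast
    have "D x h = D x (\<Sum>b\<in>Basis. (h \<bullet> b) *\<^sub>R b)" by (simp add: euclidean_representation)
    also have "\<dots> = (\<Sum>b\<in>Basis. (h \<bullet> b) * D x b)" by (simp add: sum scale)
    also have "\<bar>\<dots>\<bar> \<le> (\<Sum>b\<in>Basis. \<bar>(h \<bullet> b) * D x b\<bar>)" by (rule sum_abs)
    also have "\<dots> \<le> (\<Sum>b\<in>Basis. C b * norm h)"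
    proof (rule sum_mono)
      fix b :: 'a assume "b \<in> Basis"
      then have "\<bar>h \<bullet> b\<bar> * \<bar>D x b\<bar> \<le> norm h * C b"
        using C Basis_le_norm by (intro mult_mono) auto
      then show "\<bar>(h \<bullet> b) * D x b\<bar> \<le> C b * norm h" by (simp add: abs_mult mult.commute)
    qed
    finally show ?thesis by (simp add: L_def sum_distrib_right)
  qed
  have "norm (\<phi> x - \<phi> y) \<le> L * norm (x - y)" for x y
    by (rule differentiable_bound[where S = UNIV and f' = D])
      (use D L in \<open>auto intro!: onorm_le\<close>)
  moreover have "L \<ge> 0" unfolding L_def using C(1) by (intro sum_nonneg) auto
  ultimately show ?thesis by (auto simp: dist_norm)
qed

section \<open>The energy form\<close>

text \<open>These are the dyadic convex combinations of the tail of \<open>w\<close> that starts at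
  index \<open>n\<close>. Midpoints are all that the parallelogram identity produces, and they allow
  every property to be proved by induction.\<close>

inductive_set midpoints :: "(nat \<Rightarrow> 'a \<Rightarrow> real) \<Rightarrow> nat \<Rightarrow> ('a \<Rightarrow> real) set"
  for w :: "nat \<Rightarrow> 'a \<Rightarrow> real" and n :: nat where
  base: "n \<le> k \<Longrightarrow> w k \<in> midpoints w n"
| mid: "f \<in> midpoints w n \<Longrightarrow> g \<in> midpoints w n \<Longrightarrow> (\<lambda>x. (f x + g x) / 2) \<in> midpoints w n"

lemma midpoints_antimono:
  assumes "m \<le> n" "f \<in> midpoints w n"
  shows "f \<in> midpoints w m"
  using assms(2) by induction (use assms(1) in \<open>auto intro: midpoints.intros\<close>)

lemma midpoints_close:
  assumes "f \<in> midpoints w n" "\<And>k. n \<le> k \<Longrightarrow> \<bar>w k x - c\<bar> \<le> e"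
  shows "\<bar>f x - c\<bar> \<le> e"
  using assms(1) by induction (use assms(2) in \<open>auto simp: abs_if field_simps split: if_splits\<close>)

text \<open>Fatou's lemma is applied to the three terms of the energy norm one by one; this
  recombines the lower limits.\<close>

lemma liminf_add_le_ennreal:
  fixes f g :: "nat \<Rightarrow> ennreal"
  shows "liminf f + liminf g \<le> liminf (\<lambda>n. f n + g n)"
proof -
  have "liminf f + liminf g = (SUP n. (INF m\<in>{n..}. f m) + (INF m\<in>{n..}. g m))"
    unfolding liminf_SUP_INF
    by (subst ennreal_SUP_add) (auto intro!: INF_superset_mono monoI)
  also have "\<dots> \<le> liminf (\<lambda>n. f n + g n)"
    unfolding liminf_SUP_INF by (intro SUP_mono' INF_greatest add_mono INF_lower) auto
  finally show ?thesis .
qed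

text \<open>Between completed spaces a projection must also pull null sets back to null sets. Such a
  preimage is a cylinder over a null set, of product measure 0 times infinity, that is 0.\<close>

lemma fst_measurable_lebesgue:
    "fst \<in> (lebesgue :: ('a::euclidean_space \<times> 'b::euclidean_space) measure) \<rightarrow>\<^sub>M lebesgue"
  and snd_measurable_lebesgue: "snd \<in> (lebesgue :: ('a \<times> 'b) measure) \<rightarrow>\<^sub>M lebesgue"
  and AE_lebesgue_fst: "(AE x in lebesgue. P x) \<Longrightarrow> (AE z in (lebesgue :: ('a \<times> 'b) measure). P (fst z))"
  and AE_lebesgue_snd: "(AE x in lebesgue. R x) \<Longrightarrow> (AE z in (lebesgue :: ('a \<times> 'b) measure). R (snd z))"
proof -
  have n1: "fst -` N \<in> null_sets (lborel :: ('a \<times> 'b) measure)" if "N \<in> null_sets lborel" for N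
  proof -
    have "emeasure (lborel \<Otimes>\<^sub>M lborel) (N \<times> (UNIV::'b set)) = emeasure lborel N * emeasure lborel (UNIV::'b set)"
      using that by (intro lborel.emeasure_pair_measure_Times) auto
    also have "\<dots> = 0" using that by auto
    finally show ?thesis using that
      by (auto simp: null_sets_def lborel_prod fst_vimage_eq_Times simp flip: borel_prod)
  qed
  have n2: "snd -` N \<in> null_sets (lborel :: ('a \<times> 'b) measure)" if "N \<in> null_sets lborel" for N
  proof -
    have "emeasure (lborel \<Otimes>\<^sub>M lborel) ((UNIV::'a set) \<times> N) = emeasure lborel (UNIV::'a set) * emeasure lborel N"
      using that by (intro lborel.emeasure_pair_measure_Times) auto
    also have "\<dots> = 0" using that by auto
    finally show ?thesis using that
      by (auto simp: null_sets_def lborel_prod snd_vimage_eq_Times simp flip: borel_prod)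
  qed
  have f: "fst \<in> (lebesgue :: ('a \<times> 'b) measure) \<rightarrow>\<^sub>M lborel"
    by (rule measurable_completion)
      (simp add: borel_measurable_continuous_onI continuous_on_fst continuous_on_snd)
  have s: "snd \<in> (lebesgue :: ('a \<times> 'b) measure) \<rightarrow>\<^sub>M lborel"
    by (rule measurable_completion)
      (simp add: borel_measurable_continuous_onI continuous_on_fst continuous_on_snd)
  show "fst \<in> (lebesgue :: ('a \<times> 'b) measure) \<rightarrow>\<^sub>M lebesgue"
    using f n1 by (intro completion.measurable_completion2)
      (auto simp: null_sets_def emeasure_distr)
  show "snd \<in> (lebesgue :: ('a \<times> 'b) measure) \<rightarrow>\<^sub>M lebesgue"
    using s n2 by (intro completion.measurable_completion2)
      (auto simp: null_sets_def emeasure_distr)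
  show "AE z in (lebesgue :: ('a \<times> 'b) measure). P (fst z)" if ae: "AE x in lebesgue. P x"
  proof -
    obtain N where "N \<in> null_sets lborel" "{x. \<not> P x} \<subseteq> N"
      using ae unfolding AE_completion_iff by (auto simp: eventually_ae_filter)
    then show ?thesis using n1
      by (intro AE_completion) (auto simp: eventually_ae_filter intro!: bexI[of _ "fst -` N"])
  qed
  show "AE z in (lebesgue :: ('a \<times> 'b) measure). R (snd z)" if ae: "AE x in lebesgue. R x"
  proof -
    obtain N where "N \<in> null_sets lborel" "{x. \<not> R x} \<subseteq> N"
      using ae unfolding AE_completion_iff by (auto simp: eventually_ae_filter)
    then show ?thesis using n2
      by (intro AE_completion) (auto simp: eventually_ae_filter intro!: bexI[of _ "snd -` N"])
  qed
qed

lemma sets_lebesgue_Times_open: "open \<Omega> \<Longrightarrow> \<Omega> \<times> \<Omega> \<in> sets (lebesgue :: ('a::euclidean_space \<times> 'a) measure)"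
  by (intro sets_completionI_sets) (auto simp: open_Times)

lemma AE_lebesgue_on_Times:
  fixes \<Omega> :: "'a::euclidean_space set"
  assumes "open \<Omega>" "AE x in lebesgue_on \<Omega>. P x"
  shows "AE z in lebesgue_on (\<Omega> \<times> \<Omega>). P (fst z) \<and> P (snd z)"
proof -
  have "AE x in lebesgue. x \<in> \<Omega> \<longrightarrow> P x"
    using assms by (subst (asm) AE_restrict_space_iff) (auto simp: borel_open)
  from AE_lebesgue_fst[OF this] AE_lebesgue_snd[OF this]
  have "AE z in lebesgue. z \<in> \<Omega> \<times> \<Omega> \<longrightarrow> P (fst z) \<and> P (snd z)"
    by eventually_elim auto
  then show ?thesis
    using sets_lebesgue_Times_open[OF assms(1)] by (subst AE_restrict_space_iff) auto
qed

lemma measurable_lebesgue_on_Times: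
  fixes \<Omega> :: "'a::euclidean_space set" and u :: "'a \<Rightarrow> real"
  assumes "u \<in> borel_measurable (lebesgue_on \<Omega>)"
  shows "(\<lambda>z. u (fst z)) \<in> borel_measurable (lebesgue_on (\<Omega> \<times> \<Omega>))"
    and "(\<lambda>z. u (snd z)) \<in> borel_measurable (lebesgue_on (\<Omega> \<times> \<Omega>))"
proof -
  have "fst \<in> lebesgue_on (\<Omega> \<times> \<Omega>) \<rightarrow>\<^sub>M lebesgue_on \<Omega>" "snd \<in> lebesgue_on (\<Omega> \<times> \<Omega>) \<rightarrow>\<^sub>M lebesgue_on \<Omega>"
    by (auto intro!: measurable_restrict_space3 fst_measurable_lebesgue snd_measurable_lebesgue)
  then show "(\<lambda>z. u (fst z)) \<in> borel_measurable (lebesgue_on (\<Omega> \<times> \<Omega>))"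
    "(\<lambda>z. u (snd z)) \<in> borel_measurable (lebesgue_on (\<Omega> \<times> \<Omega>))"
    using assms by (auto intro: measurable_compose)
qed

section \<open>The energy form and its squared norm in the extended reals\<close>

locale energy_form =
  fixes \<Omega> :: "'a::euclidean_space set" and J :: "'a \<Rightarrow> 'a \<Rightarrow> real" and B :: "'a \<Rightarrow> real"
  assumes open_domain: "open \<Omega>" and bounded_domain: "bounded \<Omega>" and cond_L1: "cond_L1 \<Omega> J B"
begin

abbreviation M where "M \<equiv> lebesgue_on \<Omega>"
abbreviation W where "W \<equiv> lebesgue_on (\<Omega> \<times> \<Omega>)"

text \<open>The extended-valued version of \<open>energy_norm_sq\<close>. It is meaningful for every
  measurable function, so domination and Fatou arguments carry no integrability conditions, and its
  finiteness is membership in the energy domain.\<close>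

definition qe :: "('a \<Rightarrow> real) \<Rightarrow> ennreal" where
  "qe v = (\<integral>\<^sup>+x. ennreal ((v x)\<^sup>2) \<partial>M) +
     ((\<integral>\<^sup>+z. ennreal (1 / 2 * (J (fst z) (snd z) * (v (fst z) - v (snd z))\<^sup>2)) \<partial>W) +
      (\<integral>\<^sup>+x. ennreal (B x * (v x)\<^sup>2) \<partial>M))"

sublocale finite_measure M
  using open_domain bounded_domain by (intro finite_measure_lebesgue_on lmeasurable_open)

lemma space_W [simp]: "space W = \<Omega> \<times> \<Omega>"
  using sets_lebesgue_Times_open[OF open_domain] open_domain by auto

lemma J_measurable [measurable]: "(\<lambda>z. J (fst z) (snd z)) \<in> borel_measurable W"
  using cond_L1 by (simp add: cond_L1_def case_prod_beta')

lemma B_measurable [measurable]: "B \<in> borel_measurable M"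
  using cond_L1 by (simp add: cond_L1_def)

lemma B_nonneg: "x \<in> \<Omega> \<Longrightarrow> 0 \<le> B x"
  using cond_L1 by (simp add: cond_L1_def)

lemma J_nonneg: "x \<in> \<Omega> \<Longrightarrow> y \<in> \<Omega> \<Longrightarrow> x \<noteq> y \<Longrightarrow> 0 \<le> J x y"
  using cond_L1 by (auto simp: cond_L1_def off_diag_def)

text \<open>The sign of \<open>J\<close> is prescribed off the diagonal; on the diagonal the
  increment is 0.\<close>

lemma J_sq_nonneg: "x \<in> \<Omega> \<Longrightarrow> y \<in> \<Omega> \<Longrightarrow> 0 \<le> J x y * (u x - u y)\<^sup>2"
  using J_nonneg[of x y] by (cases "x = y") auto

lemmas product_measurable [measurable (raw)] = measurable_lebesgue_on_Times

lemma energy_domain_iff: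
  assumes [measurable]: "v \<in> borel_measurable M"
  shows "v \<in> energy_domain \<Omega> J B \<longleftrightarrow> qe v < \<infinity>"
proof -
  have a: "integrable M (\<lambda>x. (v x)\<^sup>2) \<longleftrightarrow> (\<integral>\<^sup>+x. ennreal ((v x)\<^sup>2) \<partial>M) < \<infinity>"
    by (simp add: integrable_iff_bounded)
  have b: "integrable M (\<lambda>x. B x * (v x)\<^sup>2) \<longleftrightarrow> (\<integral>\<^sup>+x. ennreal (B x * (v x)\<^sup>2) \<partial>M) < \<infinity>"
  proof -
    have "(\<integral>\<^sup>+x. ennreal (norm (B x * (v x)\<^sup>2)) \<partial>M) = (\<integral>\<^sup>+x. ennreal (B x * (v x)\<^sup>2) \<partial>M)"
      using B_nonneg by (intro nn_integral_cong) (simp add: abs_mult)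
    then show ?thesis by (simp only: integrable_iff_bounded) simp
  qed
  \<comment> \<open>The trivial disjunct is the shape in which
    \<open>integrable_mult_left_iff\<close> treats a constant factor; it introduces the 1/2 of the
    form.\<close>
  have "integrable W (\<lambda>z. J (fst z) (snd z) * (v (fst z) - v (snd z))\<^sup>2) \<longleftrightarrow>
      1 / 2 = (0::real) \<or> integrable W (\<lambda>z. J (fst z) (snd z) * (v (fst z) - v (snd z))\<^sup>2)"
    by simp
  also have "\<dots> \<longleftrightarrow> integrable W (\<lambda>z. 1 / 2 * (J (fst z) (snd z) * (v (fst z) - v (snd z))\<^sup>2))"
    by (rule integrable_mult_left_iff[symmetric])
  also have "\<dots> \<longleftrightarrow>
      (\<integral>\<^sup>+z. ennreal (1 / 2 * (J (fst z) (snd z) * (v (fst z) - v (snd z))\<^sup>2)) \<partial>W) < \<infinity>"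
  proof -
    have "(\<integral>\<^sup>+z. ennreal (norm (1 / 2 * (J (fst z) (snd z) * (v (fst z) - v (snd z))\<^sup>2))) \<partial>W) =
        (\<integral>\<^sup>+z. ennreal (1 / 2 * (J (fst z) (snd z) * (v (fst z) - v (snd z))\<^sup>2)) \<partial>W)"
    proof (rule nn_integral_cong)
      fix z assume "z \<in> space W"
      then show "ennreal (norm (1 / 2 * (J (fst z) (snd z) * (v (fst z) - v (snd z))\<^sup>2))) =
          ennreal (1 / 2 * (J (fst z) (snd z) * (v (fst z) - v (snd z))\<^sup>2))"
        using J_sq_nonneg[of "fst z" "snd z" v] by (intro arg_cong[where f = ennreal]) auto
    qed
    then show ?thesis by (simp only: integrable_iff_bounded) simp
  qed
  finally show ?thesis
    using a b by (auto simp: energy_domain_def L2_space_def case_prod_beta' qe_def)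
qed

lemma energy_domain_measurable: "v \<in> energy_domain \<Omega> J B \<Longrightarrow> v \<in> borel_measurable M"
  by (simp add: energy_domain_def L2_space_def)

lemma qe_eq:
  assumes "v \<in> energy_domain \<Omega> J B"
  shows "qe v = ennreal (energy_norm_sq \<Omega> J B v)"
proof -
  have [measurable]: "v \<in> borel_measurable M" by (rule energy_domain_measurable) fact
  have i: "integrable M (\<lambda>x. (v x)\<^sup>2)" "integrable M (\<lambda>x. B x * (v x)\<^sup>2)"
    "integrable W (\<lambda>z. J (fst z) (snd z) * (v (fst z) - v (snd z))\<^sup>2)"
    using assms by (auto simp: energy_domain_def L2_space_def case_prod_beta')
  have J0: "AE z in W. 0 \<le> 1 / 2 * (J (fst z) (snd z) * (v (fst z) - v (snd z))\<^sup>2)"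
    by (intro AE_I2) (auto simp: J_sq_nonneg)
  have B0: "AE x in M. 0 \<le> B x * (v x)\<^sup>2" using B_nonneg by (intro AE_I2) auto
  have n: "0 \<le> (\<integral>z. 1 / 2 * (J (fst z) (snd z) * (v (fst z) - v (snd z))\<^sup>2) \<partial>W)"
    "0 \<le> (\<integral>x. B x * (v x)\<^sup>2 \<partial>M)" "0 \<le> (\<integral>x. (v x)\<^sup>2 \<partial>M)"
    using J0 B0 by (auto intro!: integral_nonneg_AE)
  have "qe v = ennreal (\<integral>x. (v x)\<^sup>2 \<partial>M) +
     (ennreal (\<integral>z. 1 / 2 * (J (fst z) (snd z) * (v (fst z) - v (snd z))\<^sup>2) \<partial>W) +
      ennreal (\<integral>x. B x * (v x)\<^sup>2 \<partial>M))"
    unfolding qe_def using i J0 B0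
    by (subst (1 2 3) nn_integral_eq_integral) (auto simp del: integral_mult_right_zero)
  also have "\<dots> = ennreal (energy_norm_sq \<Omega> J B v)"
    using n by (simp add: energy_norm_sq_def energy_def case_prod_beta' power2_eq_square mult.assoc
        flip: ennreal_plus)
  finally show ?thesis .
qed

text \<open>All three terms integrate squares of values or of increments against nonnegative
  weights, so a pointwise quadratic bound for both carries over. Every estimate for compositions,
  products and midpoints below is an instance.\<close>

lemma qe_combine:
  assumes [measurable]: "v \<in> borel_measurable M" "u \<in> borel_measurable M" "w \<in> borel_measurable M"
    and a: "0 \<le> a" "0 \<le> b"
    and le: "\<And>x. x \<in> \<Omega> \<Longrightarrow> (v x)\<^sup>2 \<le> a * (u x)\<^sup>2 + b * (w x)\<^sup>2"
    and le2: "\<And>x y. x \<in> \<Omega> \<Longrightarrow> y \<in> \<Omega> \<Longrightarrow> (v x - v y)\<^sup>2 \<le> a * (u x - u y)\<^sup>2 + b * (w x - w y)\<^sup>2"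
  shows "qe v \<le> ennreal a * qe u + ennreal b * qe w"
proof -
  have 1: "(\<integral>\<^sup>+x. ennreal ((v x)\<^sup>2) \<partial>M) \<le>
      ennreal a * (\<integral>\<^sup>+x. ennreal ((u x)\<^sup>2) \<partial>M) + ennreal b * (\<integral>\<^sup>+x. ennreal ((w x)\<^sup>2) \<partial>M)"
  proof -
    have "(\<integral>\<^sup>+x. ennreal ((v x)\<^sup>2) \<partial>M) \<le>
        (\<integral>\<^sup>+x. ennreal a * ennreal ((u x)\<^sup>2) + ennreal b * ennreal ((w x)\<^sup>2) \<partial>M)"
    proof (rule nn_integral_mono)
      fix x assume "x \<in> space M"
      then show "ennreal ((v x)\<^sup>2) \<le> ennreal a * ennreal ((u x)\<^sup>2) + ennreal b * ennreal ((w x)\<^sup>2)"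
        using le[of x] a by (simp flip: ennreal_mult ennreal_plus add: ennreal_leI)
    qed
    then show ?thesis by (simp add: nn_integral_add nn_integral_cmult)
  qed
  have 2: "(\<integral>\<^sup>+x. ennreal (B x * (v x)\<^sup>2) \<partial>M) \<le>
      ennreal a * (\<integral>\<^sup>+x. ennreal (B x * (u x)\<^sup>2) \<partial>M) + ennreal b * (\<integral>\<^sup>+x. ennreal (B x * (w x)\<^sup>2) \<partial>M)"
  proof -
    have "(\<integral>\<^sup>+x. ennreal (B x * (v x)\<^sup>2) \<partial>M) \<le>
        (\<integral>\<^sup>+x. ennreal a * ennreal (B x * (u x)\<^sup>2) + ennreal b * ennreal (B x * (w x)\<^sup>2) \<partial>M)"
    proof (rule nn_integral_mono)
      fix x assume x: "x \<in> space M"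
      then have "B x * (v x)\<^sup>2 \<le> a * (B x * (u x)\<^sup>2) + b * (B x * (w x)\<^sup>2)"
        using mult_left_mono[OF le B_nonneg, of x x] by (simp add: algebra_simps)
      then show "ennreal (B x * (v x)\<^sup>2) \<le> ennreal a * ennreal (B x * (u x)\<^sup>2) + ennreal b * ennreal (B x * (w x)\<^sup>2)"
        using a B_nonneg[of x] x by (simp flip: ennreal_mult ennreal_plus add: ennreal_leI)
    qed
    then show ?thesis by (simp add: nn_integral_add nn_integral_cmult)
  qed
  let ?j = "\<lambda>v z. 1 / 2 * (J (fst z) (snd z) * (v (fst z) - v (snd z))\<^sup>2)"
  have 3: "(\<integral>\<^sup>+z. ennreal (?j v z) \<partial>W) \<le>
      ennreal a * (\<integral>\<^sup>+z. ennreal (?j u z) \<partial>W) + ennreal b * (\<integral>\<^sup>+z. ennreal (?j w z) \<partial>W)"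
  proof -
    have "(\<integral>\<^sup>+z. ennreal (?j v z) \<partial>W) \<le>
        (\<integral>\<^sup>+z. ennreal a * ennreal (?j u z) + ennreal b * ennreal (?j w z) \<partial>W)"
    proof (rule nn_integral_mono)
      fix z assume "z \<in> space W"
      then have z: "fst z \<in> \<Omega>" "snd z \<in> \<Omega>" by auto
      have "?j v z \<le> a * ?j u z + b * ?j w z"
      proof (cases "fst z = snd z")
        case False
        from mult_left_mono[OF le2 J_nonneg, OF z z False] show ?thesis by (simp add: algebra_simps)
      qed simp
      moreover have "0 \<le> ?j u z" "0 \<le> ?j w z" using J_sq_nonneg[OF z] by simp_all
      ultimately show "ennreal (?j v z) \<le> ennreal a * ennreal (?j u z) + ennreal b * ennreal (?j w z)"
        using a by (simp only: ennreal_mult[symmetric] ennreal_plus[symmetric] ennreal_leI mult_nonneg_nonneg)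
    qed
    then show ?thesis by (simp add: nn_integral_add nn_integral_cmult del: times_divide_eq_left)
  qed
  have "qe v \<le> (ennreal a * (\<integral>\<^sup>+x. ennreal ((u x)\<^sup>2) \<partial>M) + ennreal b * (\<integral>\<^sup>+x. ennreal ((w x)\<^sup>2) \<partial>M)) +
     ((ennreal a * (\<integral>\<^sup>+z. ennreal (?j u z) \<partial>W) + ennreal b * (\<integral>\<^sup>+z. ennreal (?j w z) \<partial>W)) +
      (ennreal a * (\<integral>\<^sup>+x. ennreal (B x * (u x)\<^sup>2) \<partial>M) + ennreal b * (\<integral>\<^sup>+x. ennreal (B x * (w x)\<^sup>2) \<partial>M)))"
    unfolding qe_def by (intro add_mono 1 2 3)
  also have "\<dots> = ennreal a * qe u + ennreal b * qe w"
    by (simp add: qe_def distrib_left ac_simps)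
  finally show ?thesis .
qed

text \<open>The scalar identity applies to values, and also to increments, since sums and
  differences commute with taking increments. It serves as uniform convexity: two functions of
  nearly minimal norm whose midpoint is not much smaller must be close.\<close>

lemma qe_parallelogram:
  assumes [measurable]: "u \<in> borel_measurable M" "v \<in> borel_measurable M"
  shows "qe (\<lambda>x. u x - v x) + 4 * qe (\<lambda>x. (u x + v x) / 2) \<le> 2 * qe u + 2 * qe v"
proof -
  let ?j = "\<lambda>v z. 1 / 2 * (J (fst z) (snd z) * (v (fst z) - v (snd z))\<^sup>2)"
  let ?m = "\<lambda>x. (u x + v x) / 2" and ?d = "\<lambda>x. u x - v x"
  have p: "(a - b)\<^sup>2 + 4 * ((a + b) / 2)\<^sup>2 = 2 * a\<^sup>2 + 2 * b\<^sup>2" for a b :: real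
    by (simp add: power2_eq_square field_simps)
  have 1: "(\<integral>\<^sup>+x. ennreal ((?d x)\<^sup>2) \<partial>M) + 4 * (\<integral>\<^sup>+x. ennreal ((?m x)\<^sup>2) \<partial>M) =
      2 * (\<integral>\<^sup>+x. ennreal ((u x)\<^sup>2) \<partial>M) + 2 * (\<integral>\<^sup>+x. ennreal ((v x)\<^sup>2) \<partial>M)"
  proof -
    have "(\<integral>\<^sup>+x. ennreal ((?d x)\<^sup>2) + 4 * ennreal ((?m x)\<^sup>2) \<partial>M) =
        (\<integral>\<^sup>+x. 2 * ennreal ((u x)\<^sup>2) + 2 * ennreal ((v x)\<^sup>2) \<partial>M)"
      using p by (intro nn_integral_cong)
        (simp flip: ennreal_numeral ennreal_mult ennreal_plus del: power_divide)
    then show ?thesis by (simp add: nn_integral_add nn_integral_cmult)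
  qed
  have 2: "(\<integral>\<^sup>+x. ennreal (B x * (?d x)\<^sup>2) \<partial>M) + 4 * (\<integral>\<^sup>+x. ennreal (B x * (?m x)\<^sup>2) \<partial>M) =
      2 * (\<integral>\<^sup>+x. ennreal (B x * (u x)\<^sup>2) \<partial>M) + 2 * (\<integral>\<^sup>+x. ennreal (B x * (v x)\<^sup>2) \<partial>M)"
  proof -
    have "(\<integral>\<^sup>+x. ennreal (B x * (?d x)\<^sup>2) + 4 * ennreal (B x * (?m x)\<^sup>2) \<partial>M) =
        (\<integral>\<^sup>+x. 2 * ennreal (B x * (u x)\<^sup>2) + 2 * ennreal (B x * (v x)\<^sup>2) \<partial>M)"
    proof (rule nn_integral_cong)
      fix x assume x: "x \<in> space M"
      have "B x * (?d x)\<^sup>2 + 4 * (B x * (?m x)\<^sup>2) = 2 * (B x * (u x)\<^sup>2) + 2 * (B x * (v x)\<^sup>2)"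
        using arg_cong[OF p[of "u x" "v x"], of "(*) (B x)"] by (simp only: distrib_left mult.left_commute[of "B x"])
      then show "ennreal (B x * (?d x)\<^sup>2) + 4 * ennreal (B x * (?m x)\<^sup>2) =
          2 * ennreal (B x * (u x)\<^sup>2) + 2 * ennreal (B x * (v x)\<^sup>2)"
        using B_nonneg[of x] x
        by (simp flip: ennreal_numeral ennreal_mult ennreal_plus del: power_divide)
    qed
    then show ?thesis by (simp add: nn_integral_add nn_integral_cmult)
  qed
  have 3: "(\<integral>\<^sup>+z. ennreal (?j ?d z) \<partial>W) + 4 * (\<integral>\<^sup>+z. ennreal (?j ?m z) \<partial>W) =
      2 * (\<integral>\<^sup>+z. ennreal (?j u z) \<partial>W) + 2 * (\<integral>\<^sup>+z. ennreal (?j v z) \<partial>W)"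
  proof -
    have "(\<integral>\<^sup>+z. ennreal (?j ?d z) + 4 * ennreal (?j ?m z) \<partial>W) =
        (\<integral>\<^sup>+z. 2 * ennreal (?j u z) + 2 * ennreal (?j v z) \<partial>W)"
    proof (rule nn_integral_cong)
      fix z assume "z \<in> space W"
      then have z: "fst z \<in> \<Omega>" "snd z \<in> \<Omega>" by auto
      have n: "0 \<le> ?j ?d z" "0 \<le> ?j ?m z" "0 \<le> ?j u z" "0 \<le> ?j v z"
        using J_sq_nonneg[OF z, of ?d] J_sq_nonneg[OF z, of ?m] J_sq_nonneg[OF z, of u] J_sq_nonneg[OF z, of v]
        by simp_all
      have "?j ?d z + 4 * ?j ?m z = 2 * ?j u z + 2 * ?j v z"
        by (simp add: power2_eq_square field_simps)
      then show "ennreal (?j ?d z) + 4 * ennreal (?j ?m z) = 2 * ennreal (?j u z) + 2 * ennreal (?j v z)"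
        using n by (simp only: ennreal_numeral[symmetric] ennreal_mult[symmetric] ennreal_plus[symmetric]
            mult_nonneg_nonneg zero_le_numeral)
    qed
    then show ?thesis by (simp add: nn_integral_add nn_integral_cmult del: times_divide_eq_left)
  qed
  have "qe ?d + 4 * qe ?m =
     ((\<integral>\<^sup>+x. ennreal ((?d x)\<^sup>2) \<partial>M) + 4 * (\<integral>\<^sup>+x. ennreal ((?m x)\<^sup>2) \<partial>M)) +
     (((\<integral>\<^sup>+z. ennreal (?j ?d z) \<partial>W) + 4 * (\<integral>\<^sup>+z. ennreal (?j ?m z) \<partial>W)) +
      ((\<integral>\<^sup>+x. ennreal (B x * (?d x)\<^sup>2) \<partial>M) + 4 * (\<integral>\<^sup>+x. ennreal (B x * (?m x)\<^sup>2) \<partial>M)))"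
    unfolding qe_def by (simp only: distrib_left ac_simps)
  also have "\<dots> = 2 * qe u + 2 * qe v"
    unfolding 1 2 3 qe_def by (simp only: distrib_left ac_simps)
  finally show ?thesis by simp
qed

text \<open>Convergence at almost every point of \<Omega> implies convergence at both coordinates of
  almost every pair, so the double integral is lower semicontinuous as well.\<close>

lemma qe_fatou:
  assumes [measurable]: "\<And>n. w n \<in> borel_measurable M" "v \<in> borel_measurable M"
    and lim: "AE x in M. (\<lambda>n. w n x) \<longlonglongrightarrow> v x"
  shows "qe v \<le> liminf (\<lambda>n. qe (w n))"
proof -
  let ?j = "\<lambda>v z. 1 / 2 * (J (fst z) (snd z) * (v (fst z) - v (snd z))\<^sup>2)"
  have 1: "(\<integral>\<^sup>+x. ennreal ((v x)\<^sup>2) \<partial>M) \<le> liminf (\<lambda>n. \<integral>\<^sup>+x. ennreal ((w n x)\<^sup>2) \<partial>M)"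
  proof -
    have "(\<integral>\<^sup>+x. ennreal ((v x)\<^sup>2) \<partial>M) = (\<integral>\<^sup>+x. liminf (\<lambda>n. ennreal ((w n x)\<^sup>2)) \<partial>M)"
      using lim by (intro nn_integral_cong_AE, elim eventually_mono)
        (intro lim_imp_Liminf[symmetric] tendsto_ennrealI tendsto_power, auto)
    then show ?thesis by (simp add: nn_integral_liminf)
  qed
  have 2: "(\<integral>\<^sup>+x. ennreal (B x * (v x)\<^sup>2) \<partial>M) \<le> liminf (\<lambda>n. \<integral>\<^sup>+x. ennreal (B x * (w n x)\<^sup>2) \<partial>M)"
  proof -
    have "(\<integral>\<^sup>+x. ennreal (B x * (v x)\<^sup>2) \<partial>M) = (\<integral>\<^sup>+x. liminf (\<lambda>n. ennreal (B x * (w n x)\<^sup>2)) \<partial>M)"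
      using lim by (intro nn_integral_cong_AE, elim eventually_mono)
        (intro lim_imp_Liminf[symmetric] tendsto_ennrealI tendsto_intros, auto)
    then show ?thesis by (simp add: nn_integral_liminf)
  qed
  have 3: "(\<integral>\<^sup>+z. ennreal (?j v z) \<partial>W) \<le> liminf (\<lambda>n. \<integral>\<^sup>+z. ennreal (?j (w n) z) \<partial>W)"
  proof -
    have "(\<integral>\<^sup>+z. ennreal (?j v z) \<partial>W) = (\<integral>\<^sup>+z. liminf (\<lambda>n. ennreal (?j (w n) z)) \<partial>W)"
      using AE_lebesgue_on_Times[OF open_domain lim] by (intro nn_integral_cong_AE, elim eventually_mono)
        (intro lim_imp_Liminf[symmetric] tendsto_ennrealI tendsto_intros, auto)
    then show ?thesis by (simp add: nn_integral_liminf del: times_divide_eq_left)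
  qed
  have "qe v \<le> liminf (\<lambda>n. \<integral>\<^sup>+x. ennreal ((w n x)\<^sup>2) \<partial>M) +
      (liminf (\<lambda>n. \<integral>\<^sup>+z. ennreal (?j (w n) z) \<partial>W) + liminf (\<lambda>n. \<integral>\<^sup>+x. ennreal (B x * (w n x)\<^sup>2) \<partial>M))"
    unfolding qe_def by (intro add_mono 1 2 3)
  also have "\<dots> \<le> liminf (\<lambda>n. qe (w n))"
    unfolding qe_def by (intro order_trans[OF add_mono[OF order_refl liminf_add_le_ennreal] liminf_add_le_ennreal])
  finally show ?thesis .
qed

end

section \<open>Smooth approximations of the absolute value, the sign and the truncation\<close>

definition jfun :: "real \<Rightarrow> real \<Rightarrow> real" where
  "jfun e t = sqrt (t\<^sup>2 + e\<^sup>2) - e"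

text \<open>The derivative of \<open>jfun e\<close>, a smooth sign. It has a second role:
  \<open>k * pfun k\<close> is a smooth truncation, 1-Lipschitz, bounded by \<open>k\<close> and by
  |t|, and convergent to the identity as \<open>k\<close> grows. The shift by \<open>e\<close> in
  \<open>jfun e\<close> makes it vanish at 0, so that it preserves compact supports.\<close>

definition pfun :: "real \<Rightarrow> real \<Rightarrow> real" where
  "pfun e t = t / sqrt (t\<^sup>2 + e\<^sup>2)"

lemma sqrt_add_square_pos: "e > 0 \<Longrightarrow> 0 < sqrt (t\<^sup>2 + e\<^sup>2)" for t e :: real
  by (simp add: add_nonneg_pos)

lemma abs_le_sqrt_add_square: "\<bar>t\<bar> \<le> sqrt (t\<^sup>2 + e\<^sup>2)" for t e :: real
  by (rule real_le_rsqrt) simp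

lemma jfun_0 [simp]: "e > 0 \<Longrightarrow> jfun e 0 = 0"
  by (simp add: jfun_def)

lemma pfun_0 [simp]: "pfun e 0 = 0"
  by (simp add: pfun_def)

lemma jfun_nonneg: "e > 0 \<Longrightarrow> 0 \<le> jfun e t"
  using real_le_rsqrt[of e "t\<^sup>2 + e\<^sup>2"] by (simp add: jfun_def)

lemma jfun_le: "e > 0 \<Longrightarrow> jfun e t \<le> \<bar>t\<bar>"
  using sqrt_add_le_add_sqrt[of "t\<^sup>2" "e\<^sup>2"] by (simp add: jfun_def)

lemma abs_le_jfun: "\<bar>t\<bar> - e \<le> jfun e t"
  using abs_le_sqrt_add_square[of t e] by (simp add: jfun_def)

lemma abs_pfun_le: "e > 0 \<Longrightarrow> \<bar>pfun e t\<bar> \<le> 1"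
  using abs_le_sqrt_add_square[of t e] sqrt_add_square_pos[of e t] by (simp add: pfun_def)

lemma abs_pfun_le2: "e > 0 \<Longrightarrow> \<bar>e * pfun e t\<bar> \<le> \<bar>t\<bar>"
proof -
  assume e: "e > 0"
  have "e \<le> sqrt (t\<^sup>2 + e\<^sup>2)" using e by (intro real_le_rsqrt) simp
  then have "\<bar>t\<bar> * e \<le> \<bar>t\<bar> * sqrt (t\<^sup>2 + e\<^sup>2)" by (intro mult_left_mono) auto
  then show ?thesis using sqrt_add_square_pos[OF e, of t] e by (simp add: pfun_def abs_mult field_simps)
qed

lemma pfun_deriv:
  assumes e: "e > 0"
  shows "(pfun e has_real_derivative e\<^sup>2 / (sqrt (t\<^sup>2 + e\<^sup>2))^3) (at t)"
proof -
  define r where "r = sqrt (t\<^sup>2 + e\<^sup>2)"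
  have r: "r > 0" "r * r = t\<^sup>2 + e\<^sup>2" using sqrt_add_square_pos[OF e, of t] by (auto simp: r_def)
  have "(pfun e has_real_derivative (1 * r - t * (inverse r / 2 * (2 * t))) / (r * r)) (at t)"
    using r(1) unfolding pfun_def[abs_def] r_def
    by (auto intro!: derivative_eq_intros)
  moreover have "(1 * r - t * (inverse r / 2 * (2 * t))) / (r * r) = e\<^sup>2 / r^3"
  proof -
    have "(1 * r - t * (inverse r / 2 * (2 * t))) = (r * r - t\<^sup>2) / r"
      using r(1) by (simp add: field_simps power2_eq_square)
    then show ?thesis using r by (simp add: field_simps power3_eq_cube)
  qed
  ultimately show ?thesis by (simp add: r_def)
qed

text \<open>This is the tangent line inequality of a convex function. Multiplied by the square root
  at \<open>a\<close>, it becomes the Cauchy-Schwarz inequality for the plane vectors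
  \<open>(a, e)\<close> and \<open>(b, e)\<close>.\<close>

lemma jfun_convex: "e > 0 \<Longrightarrow> jfun e a - jfun e b \<le> pfun e a * (a - b)"
proof -
  assume e: "e > 0"
  have "a * b + e * e \<le> sqrt (a\<^sup>2 + e\<^sup>2) * sqrt (b\<^sup>2 + e\<^sup>2)"
  proof -
    have "(a * b + e * e)\<^sup>2 \<le> (a\<^sup>2 + e\<^sup>2) * (b\<^sup>2 + e\<^sup>2)"
      using zero_le_power2[of "(a - b) * e"] by (simp add: power2_eq_square algebra_simps)
    then show ?thesis by (metis real_le_rsqrt real_sqrt_mult)
  qed
  then have "sqrt (a\<^sup>2 + e\<^sup>2) * (sqrt (a\<^sup>2 + e\<^sup>2) - sqrt (b\<^sup>2 + e\<^sup>2)) \<le> a * (a - b)"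
    by (simp add: algebra_simps power2_eq_square)
  then have "sqrt (a\<^sup>2 + e\<^sup>2) - sqrt (b\<^sup>2 + e\<^sup>2) \<le> a * (a - b) / sqrt (a\<^sup>2 + e\<^sup>2)"
    using sqrt_add_square_pos[OF e, of a] by (subst pos_le_divide_eq) (auto simp: mult.commute)
  then show ?thesis by (simp add: jfun_def pfun_def)
qed

lemma jfun_lipschitz: "e > 0 \<Longrightarrow> \<bar>jfun e a - jfun e b\<bar> \<le> \<bar>a - b\<bar>"
proof -
  assume e: "e > 0"
  have "pfun e a * (a - b) \<le> \<bar>a - b\<bar>" for a b
  proof -
    have "\<bar>pfun e a * (a - b)\<bar> \<le> 1 * \<bar>a - b\<bar>"
      unfolding abs_mult using abs_pfun_le[OF e] by (intro mult_right_mono) auto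
    then show ?thesis by (simp only: mult_1 abs_le_iff)
  qed
  from this[of a b] this[of b a] show ?thesis
    using jfun_convex[OF e, of a b] jfun_convex[OF e, of b a] by linarith
qed

lemma pfun_lipschitz: "e > 0 \<Longrightarrow> \<bar>e * pfun e a - e * pfun e b\<bar> \<le> \<bar>a - b\<bar>"
proof -
  assume e: "e > 0"
  have "norm (pfun e a - pfun e b) \<le> 1 / e * norm (a - b)"
  proof (rule field_differentiable_bound[where S = UNIV])
    fix t
    show "(pfun e has_field_derivative e\<^sup>2 / (sqrt (t\<^sup>2 + e\<^sup>2))^3) (at t within UNIV)"
      using pfun_deriv[OF e] by simp
    have "e \<le> sqrt (t\<^sup>2 + e\<^sup>2)" using e by (intro real_le_rsqrt) simp
    moreover have "norm (e\<^sup>2 / r^3) \<le> 1 / e" if "e \<le> r" for r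
    proof -
      have "r > 0" using that e by simp
      moreover have "e ^ 3 \<le> r ^ 3" using e that by (intro power_mono) auto
      ultimately show ?thesis using e by (simp add: field_simps power3_eq_cube power2_eq_square)
    qed
    ultimately show "norm (e\<^sup>2 / (sqrt (t\<^sup>2 + e\<^sup>2))^3) \<le> 1 / e" by blast
  qed auto
  moreover have "\<bar>e * pfun e a - e * pfun e b\<bar> = e * \<bar>pfun e a - pfun e b\<bar>"
    using e by (simp add: abs_mult flip: right_diff_distrib)
  ultimately show ?thesis using e by (simp add: field_simps)
qed

lemma jfun_measurable [measurable]: "jfun e \<in> borel_measurable borel"
  unfolding jfun_def by measurable

lemma pfun_measurable [measurable]: "pfun e \<in> borel_measurable borel"
  unfolding pfun_def by measurable

lemma continuous_jfun: "continuous_on UNIV (jfun e)"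
  unfolding jfun_def[abs_def] by (intro continuous_intros)

lemma continuous_pfun: "e > 0 \<Longrightarrow> continuous_on UNIV (pfun e)"
  unfolding pfun_def[abs_def] using sqrt_add_square_pos[of e]
  by (intro continuous_intros) (metis less_irrefl)

lemma pfun_tendsto_sgn: "((\<lambda>e. pfun e t) \<longlongrightarrow> sgn t) (at_right 0)"
proof (cases "t = 0")
  case False
  have "((\<lambda>e. t / sqrt (t\<^sup>2 + e\<^sup>2)) \<longlongrightarrow> t / sqrt (t\<^sup>2 + 0\<^sup>2)) (at_right 0)"
    using False by (intro tendsto_intros) auto
  moreover have "t / sqrt (t\<^sup>2 + 0\<^sup>2) = sgn t" using False by (simp add: sgn_if)
  ultimately show ?thesis by (simp add: pfun_def)
qed simp

lemma truncation_tendsto: "(\<lambda>k. real (Suc k) * pfun (real (Suc k)) t) \<longlonglongrightarrow> t"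
proof -
  \<comment> \<open>Division of numerator and denominator by the level n turns the truncation into t
    / sqrt ((t / n)^2 + 1), whose limit is immediate.\<close>
  have "(\<lambda>k. t / sqrt ((t * inverse (real (Suc k)))\<^sup>2 + 1)) \<longlonglongrightarrow> t / sqrt ((t * 0)\<^sup>2 + 1)"
    by (intro tendsto_intros LIMSEQ_inverse_real_of_nat) auto
  moreover have "t / sqrt ((t * inverse (real (Suc k)))\<^sup>2 + 1) = real (Suc k) * pfun (real (Suc k)) t" for k
  proof -
    define n where "n = real (Suc k)"
    have n: "n > 0" by (simp add: n_def)
    have "sqrt ((t * inverse n)\<^sup>2 + 1) = sqrt ((t\<^sup>2 + n\<^sup>2) / n\<^sup>2)"
      using n by (simp add: field_simps)
    also have "\<dots> = sqrt (t\<^sup>2 + n\<^sup>2) / n" using n by (simp add: real_sqrt_divide)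
    finally show ?thesis using n unfolding n_def[symmetric] pfun_def by simp
  qed
  ultimately show ?thesis by simp
qed

text \<open>The algebra has only the inverse square root as a generator, so a root is written as its
  radicand times its inverse.\<close>

lemma jfun_smooth_alg:
  assumes "f \<in> smooth_alg" "e > 0"
  shows "(\<lambda>x. jfun e (f x)) \<in> smooth_alg"
proof -
  have "sqrt (t\<^sup>2 + e\<^sup>2) = (t * t + e * e) * inverse (sqrt (t\<^sup>2 + e\<^sup>2))" for t
    using real_div_sqrt[of "t * t + e * e"] by (simp add: divide_inverse power2_eq_square)
  then have "(\<lambda>x. jfun e (f x)) = (\<lambda>x. (f x * f x + e * e) * inverse (sqrt ((f x)\<^sup>2 + e\<^sup>2)) + - e)"
    by (simp add: jfun_def fun_eq_iff)
  moreover have "\<dots> \<in> smooth_alg"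
    using assms by (intro smooth_alg.add smooth_alg.mult smooth_alg.const smooth_alg.rsqrt)
  ultimately show ?thesis by simp
qed

lemma pfun_smooth_alg:
  assumes "f \<in> smooth_alg" "e > 0"
  shows "(\<lambda>x. pfun e (f x)) \<in> smooth_alg"
  unfolding pfun_def divide_inverse using assms by (intro smooth_alg.mult smooth_alg.rsqrt)

section \<open>Test functions and closedness of the form space\<close>

context energy_form
begin

lemma test_functions_measurable: "\<phi> \<in> test_functions \<Omega> \<Longrightarrow> \<phi> \<in> borel_measurable M"
  by (intro measurable_restrict_space1 measurable_completion)
    (simp add: borel_measurable_continuous_onI test_functions_continuous)

text \<open>Each term is finite for its own reason: \<Omega> has finite measure, \<open>B\<close> is
  bounded on the compact support, and the Lipschitz bound reduces the increments to the second
  moment of \<open>J\<close>.\<close>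

lemma test_functions_qe:
  assumes "\<phi> \<in> test_functions \<Omega>"
  shows "qe \<phi> < \<infinity>"
proof -
  have [measurable]: "\<phi> \<in> borel_measurable M" by (rule test_functions_measurable) fact
  obtain C where C: "\<And>x. \<bar>\<phi> x\<bar> \<le> C" using test_functions_bounded[OF assms] by blast
  obtain L where L: "L \<ge> 0" "\<And>x y. \<bar>\<phi> x - \<phi> y\<bar> \<le> L * dist x y"
    using test_functions_lipschitz[OF assms] by blast
  obtain S where S: "compact S" "S \<subseteq> \<Omega>" "\<And>x. x \<notin> S \<Longrightarrow> \<phi> x = 0"
    using test_functions_outside[OF assms] by blast
  obtain b where b: "\<And>x. x \<in> S \<Longrightarrow> \<bar>B x\<bar> \<le> b"
  proof -
    have "bounded (B ` S)" using cond_L1 S(1,2) by (simp add: cond_L1_def)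
    then show ?thesis using that by (auto simp: bounded_iff)
  qed
  have C0: "0 \<le> C" using C[of undefined] by linarith
  have sq: "(\<phi> x)\<^sup>2 \<le> C\<^sup>2" for x using C[of x] power_mono[of "\<bar>\<phi> x\<bar>" C 2] by simp
  have "integrable M (\<lambda>x. (\<phi> x)\<^sup>2)"
    by (rule integrable_const_bound[where B = "C\<^sup>2"]) (use sq in auto)
  moreover have "integrable M (\<lambda>x. B x * (\<phi> x)\<^sup>2)"
  proof (rule integrable_const_bound[where B = "\<bar>b\<bar> * C\<^sup>2"])
    have "norm (B x * (\<phi> x)\<^sup>2) \<le> \<bar>b\<bar> * C\<^sup>2" for x
    proof (cases "x \<in> S")
      case True
      then have "\<bar>B x\<bar> \<le> \<bar>b\<bar>" using b[of x] by linarith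
      then show ?thesis unfolding real_norm_def abs_mult using sq[of x] by (intro mult_mono) auto
    qed (use S(3) in auto)
    then show "AE x in M. norm (B x * (\<phi> x)\<^sup>2) \<le> \<bar>b\<bar> * C\<^sup>2" by simp
  qed simp
  moreover have "integrable W (\<lambda>z. J (fst z) (snd z) * (\<phi> (fst z) - \<phi> (snd z))\<^sup>2)"
  proof (rule Bochner_Integration.integrable_bound)
    show "integrable W (\<lambda>z. L\<^sup>2 * ((dist (fst z) (snd z))\<^sup>2 * J (fst z) (snd z)))"
      using cond_L1 by (auto simp: cond_L1_def case_prod_beta')
    show "AE z in W. norm (J (fst z) (snd z) * (\<phi> (fst z) - \<phi> (snd z))\<^sup>2)
        \<le> norm (L\<^sup>2 * ((dist (fst z) (snd z))\<^sup>2 * J (fst z) (snd z)))"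
    proof (rule AE_I2)
      fix z
      have "(\<phi> (fst z) - \<phi> (snd z))\<^sup>2 \<le> (L * dist (fst z) (snd z))\<^sup>2"
        using L(2) power_mono[of "\<bar>\<phi> (fst z) - \<phi> (snd z)\<bar>" _ 2] by simp
      then have "\<bar>J (fst z) (snd z)\<bar> * (\<phi> (fst z) - \<phi> (snd z))\<^sup>2 \<le>
          \<bar>J (fst z) (snd z)\<bar> * (L * dist (fst z) (snd z))\<^sup>2" by (intro mult_left_mono) auto
      then show "norm (J (fst z) (snd z) * (\<phi> (fst z) - \<phi> (snd z))\<^sup>2)
        \<le> norm (L\<^sup>2 * ((dist (fst z) (snd z))\<^sup>2 * J (fst z) (snd z)))"
        by (simp add: abs_mult power_mult_distrib mult_ac)
    qed
  qed simp
  ultimately have "\<phi> \<in> energy_domain \<Omega> J B"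
    by (simp add: energy_domain_def L2_space_def case_prod_beta')
  then show ?thesis by (simp add: energy_domain_iff)
qed

lemma qe_diff_le:
  assumes [measurable]: "u \<in> borel_measurable M" "v \<in> borel_measurable M"
  shows "qe (\<lambda>x. u x - v x) \<le> 2 * qe u + 2 * qe v"
proof -
  have "qe (\<lambda>x. u x - v x) \<le> qe (\<lambda>x. u x - v x) + 4 * qe (\<lambda>x. (u x + v x) / 2)" by simp
  then show ?thesis using qe_parallelogram[OF assms] order_trans by blast
qed

text \<open>A Bochner integral is 0 by convention when it does not exist, so a small value of
  \<open>energy_norm_sq\<close> is informative only for functions of finite energy. The difference
  of \<open>u\<close> and a test function has finite energy by \<open>qe_diff_le\<close>, and then
  the two descriptions agree.\<close>

lemma form_space_iff:
  "u \<in> form_space \<Omega> J B \<longleftrightarrow> u \<in> borel_measurable M \<and> qe u < \<infinity> \<and>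
     (\<forall>\<epsilon>>0. \<exists>\<phi>\<in>test_functions \<Omega>. qe (\<lambda>x. u x - \<phi> x) < ennreal \<epsilon>)"
proof -
  have *: "energy_norm_sq \<Omega> J B (\<lambda>x. u x - \<phi> x) < \<epsilon> \<longleftrightarrow> qe (\<lambda>x. u x - \<phi> x) < ennreal \<epsilon>"
    if "u \<in> energy_domain \<Omega> J B" "\<phi> \<in> test_functions \<Omega>" "\<epsilon> > 0" for \<phi> \<epsilon>
  proof -
    have m [measurable]: "u \<in> borel_measurable M" "\<phi> \<in> borel_measurable M"
      using that energy_domain_measurable test_functions_measurable by auto
    have "qe (\<lambda>x. u x - \<phi> x) \<le> 2 * qe u + 2 * qe \<phi>" by (rule qe_diff_le[OF m])
    also have "\<dots> < \<infinity>"
      using that energy_domain_iff[of u] test_functions_qe[of \<phi>] by (simp add: ennreal_mult_less_top)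
    finally have "(\<lambda>x. u x - \<phi> x) \<in> energy_domain \<Omega> J B" by (subst energy_domain_iff) auto
    then have "qe (\<lambda>x. u x - \<phi> x) = ennreal (energy_norm_sq \<Omega> J B (\<lambda>x. u x - \<phi> x))" by (rule qe_eq)
    then show ?thesis
      using ennreal_lessI[OF \<open>\<epsilon> > 0\<close>] ennreal_leI[of \<epsilon> "energy_norm_sq \<Omega> J B (\<lambda>x. u x - \<phi> x)"]
      by (cases "energy_norm_sq \<Omega> J B (\<lambda>x. u x - \<phi> x) < \<epsilon>") (simp_all add: leD)
  qed
  show ?thesis
  proof
    assume u: "u \<in> form_space \<Omega> J B"
    then have ue: "u \<in> energy_domain \<Omega> J B" by (simp add: form_space_def)
    have "\<exists>\<phi>\<in>test_functions \<Omega>. qe (\<lambda>x. u x - \<phi> x) < ennreal \<epsilon>" if "\<epsilon> > 0" for \<epsilon>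
    proof -
      \<comment> \<open>The definition bounds the squared norm by the square of the tolerance, hence
        the root.\<close>
      obtain \<phi> where "\<phi> \<in> test_functions \<Omega>" "energy_norm_sq \<Omega> J B (\<lambda>x. u x - \<phi> x) < (sqrt \<epsilon>)\<^sup>2"
        using u \<open>\<epsilon> > 0\<close> unfolding form_space_def by (auto dest!: spec[of _ "sqrt \<epsilon>"])
      then show ?thesis using *[OF ue _ that] that by auto
    qed
    then show "u \<in> borel_measurable M \<and> qe u < \<infinity> \<and>
        (\<forall>\<epsilon>>0. \<exists>\<phi>\<in>test_functions \<Omega>. qe (\<lambda>x. u x - \<phi> x) < ennreal \<epsilon>)"
      using ue energy_domain_iff energy_domain_measurable by blast
  next
    assume u: "u \<in> borel_measurable M \<and> qe u < \<infinity> \<and>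
        (\<forall>\<epsilon>>0. \<exists>\<phi>\<in>test_functions \<Omega>. qe (\<lambda>x. u x - \<phi> x) < ennreal \<epsilon>)"
    then have ue: "u \<in> energy_domain \<Omega> J B" using energy_domain_iff by blast
    have "\<exists>\<phi>\<in>test_functions \<Omega>. energy_norm_sq \<Omega> J B (\<lambda>x. u x - \<phi> x) < \<epsilon>\<^sup>2" if "\<epsilon> > 0" for \<epsilon> :: real
    proof -
      have p: "0 < \<epsilon>\<^sup>2" using that by simp
      then obtain \<phi> where "\<phi> \<in> test_functions \<Omega>" "qe (\<lambda>x. u x - \<phi> x) < ennreal (\<epsilon>\<^sup>2)" using u by blast
      then show ?thesis using *[OF ue _ p] by blast
    qed
    then show "u \<in> form_space \<Omega> J B" using ue by (simp add: form_space_def)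
  qed
qed

lemma form_space_qe: "u \<in> form_space \<Omega> J B \<Longrightarrow> qe u < \<infinity>"
  and form_space_measurable: "u \<in> form_space \<Omega> J B \<Longrightarrow> u \<in> borel_measurable M"
  and form_space_energy_domain: "u \<in> form_space \<Omega> J B \<Longrightarrow> u \<in> energy_domain \<Omega> J B"
  using form_space_iff energy_domain_iff by blast+

lemma test_functions_form_space: "\<phi> \<in> test_functions \<Omega> \<Longrightarrow> \<phi> \<in> form_space \<Omega> J B"
  unfolding form_space_iff using test_functions_measurable[of \<phi>] test_functions_qe[of \<phi>]
  by (intro conjI allI impI bexI[of _ \<phi>]) (simp_all add: qe_def[of "\<lambda>x. 0"])

lemma form_space_midpoint:
  assumes u: "u \<in> form_space \<Omega> J B" and v: "v \<in> form_space \<Omega> J B"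
  shows "(\<lambda>x. (u x + v x) / 2) \<in> form_space \<Omega> J B"
  unfolding form_space_iff
proof (intro conjI allI impI)
  have [measurable]: "u \<in> borel_measurable M" "v \<in> borel_measurable M"
    using u v form_space_measurable by auto
  show "(\<lambda>x. (u x + v x) / 2) \<in> borel_measurable M" by simp
  have le: "qe (\<lambda>x. (u x + v x) / 2) \<le> qe u + qe v"
    if [measurable]: "u \<in> borel_measurable M" "v \<in> borel_measurable M" for u v
  proof -
    have i: "((a + b) / 2)\<^sup>2 \<le> 1 * a\<^sup>2 + 1 * b\<^sup>2" for a b :: real
      using zero_le_power2[of "a - b"] zero_le_power2[of "a + b"]
      by (simp add: power2_eq_square field_simps)
    have "qe (\<lambda>x. (u x + v x) / 2) \<le> ennreal 1 * qe u + ennreal 1 * qe v"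
    proof (rule qe_combine)
      fix x y
      show "((u x + v x) / 2)\<^sup>2 \<le> 1 * (u x)\<^sup>2 + 1 * (v x)\<^sup>2" by (rule i)
      have "(u x + v x) / 2 - (u y + v y) / 2 = ((u x - u y) + (v x - v y)) / 2" by (simp add: field_simps)
      then show "((u x + v x) / 2 - (u y + v y) / 2)\<^sup>2 \<le> 1 * (u x - u y)\<^sup>2 + 1 * (v x - v y)\<^sup>2"
        using i by presburger
    qed auto
    then show ?thesis by simp
  qed
  show "qe (\<lambda>x. (u x + v x) / 2) < \<infinity>"
    using form_space_qe[OF u] form_space_qe[OF v] by (intro le_less_trans[OF le[of u v]]) simp_all
  fix \<epsilon> :: real assume e: "\<epsilon> > 0"
  then have "\<epsilon> / 2 > 0" by simp
  then obtain \<phi> \<psi> where t: "\<phi> \<in> test_functions \<Omega>" "qe (\<lambda>x. u x - \<phi> x) < ennreal (\<epsilon> / 2)"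
    "\<psi> \<in> test_functions \<Omega>" "qe (\<lambda>x. v x - \<psi> x) < ennreal (\<epsilon> / 2)"
    using u v unfolding form_space_iff by blast
  then have [measurable]: "\<phi> \<in> borel_measurable M" "\<psi> \<in> borel_measurable M"
    using test_functions_measurable by auto
  have "(\<lambda>x. 1 / 2 * (\<phi> x + \<psi> x)) \<in> test_functions \<Omega>"
    using t by (intro test_functions_cmult test_functions_add)
  moreover have "qe (\<lambda>x. (u x + v x) / 2 - 1 / 2 * (\<phi> x + \<psi> x)) < ennreal \<epsilon>"
  proof -
    have "(\<lambda>x. (u x + v x) / 2 - 1 / 2 * (\<phi> x + \<psi> x)) = (\<lambda>x. ((u x - \<phi> x) + (v x - \<psi> x)) / 2)"
      by (auto simp: field_simps)
    then have "qe (\<lambda>x. (u x + v x) / 2 - 1 / 2 * (\<phi> x + \<psi> x)) \<le> qe (\<lambda>x. u x - \<phi> x) + qe (\<lambda>x. v x - \<psi> x)"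
      using le[of "\<lambda>x. u x - \<phi> x" "\<lambda>x. v x - \<psi> x"] by simp
    also have "\<dots> < ennreal (\<epsilon> / 2) + ennreal (\<epsilon> / 2)" using t by (intro add_strict_mono)
    also have "\<dots> = ennreal \<epsilon>" using e by (simp flip: ennreal_plus)
    finally show ?thesis .
  qed
  ultimately show "\<exists>\<phi>\<in>test_functions \<Omega>. qe (\<lambda>x. (u x + v x) / 2 - \<phi> x) < ennreal \<epsilon>"
    by (intro bexI[of _ "\<lambda>x. 1 / 2 * (\<phi> x + \<psi> x)"])
qed

end

lemma ennreal_lincomb:
  "0 \<le> a \<Longrightarrow> 0 \<le> x \<Longrightarrow> 0 \<le> b \<Longrightarrow> 0 \<le> y \<Longrightarrow>
     ennreal a * ennreal x + ennreal b * ennreal y = ennreal (a * x + b * y)"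
  by (simp flip: ennreal_mult ennreal_plus)

context energy_form
begin

text \<open>The L^2 term of \<open>qe\<close> forces convergence in mean, hence almost everywhere
  along a subsequence. Bounded energies together with a pointwise limit are easily seen to survive
  composition with nonlinear functions, and they are what \<open>form_space_closed\<close>
  accepts.\<close>

lemma form_space_approx:
  assumes u: "u \<in> form_space \<Omega> J B"
  shows "\<exists>\<phi> C. (\<forall>n::nat. \<phi> n \<in> test_functions \<Omega> \<and> qe (\<phi> n) \<le> ennreal C) \<and> C \<ge> 0 \<and>
    (AE x in M. (\<lambda>n. \<phi> n x) \<longlonglongrightarrow> u x)"
proof -
  have [measurable]: "u \<in> borel_measurable M" using u by (rule form_space_measurable)
  have "\<exists>\<phi>. \<phi> \<in> test_functions \<Omega> \<and> qe (\<lambda>x. u x - \<phi> x) < ennreal (inverse (real (Suc n)))" for n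
  proof -
    have "0 < inverse (real (Suc n))" by simp
    then show ?thesis using u unfolding form_space_iff by blast
  qed
  then obtain \<phi> where \<phi>: "\<And>n. \<phi> n \<in> test_functions \<Omega>"
    "\<And>n. qe (\<lambda>x. u x - \<phi> n x) < ennreal (inverse (real (Suc n)))"
    by metis
  have [measurable]: "\<phi> n \<in> borel_measurable M" for n using \<phi>(1) by (rule test_functions_measurable)
  have int: "integrable M (\<lambda>x. (u x - \<phi> n x)\<^sup>2)" for n
  proof -
    have "qe (\<lambda>x. u x - \<phi> n x) < \<infinity>" using \<phi>(2)[of n] less_trans by fastforce
    then have "(\<lambda>x. u x - \<phi> n x) \<in> energy_domain \<Omega> J B" by (subst energy_domain_iff) auto
    then show ?thesis by (simp add: energy_domain_def L2_space_def)
  qed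
  have le: "(\<integral>x. (u x - \<phi> n x)\<^sup>2 \<partial>M) \<le> inverse (real (Suc n))" for n
  proof -
    have "ennreal (\<integral>x. (u x - \<phi> n x)\<^sup>2 \<partial>M) = (\<integral>\<^sup>+x. ennreal ((u x - \<phi> n x)\<^sup>2) \<partial>M)"
      using int by (intro nn_integral_eq_integral[symmetric]) auto
    also have "\<dots> \<le> qe (\<lambda>x. u x - \<phi> n x)" unfolding qe_def by simp
    also have "\<dots> \<le> ennreal (inverse (real (Suc n)))" using \<phi>(2)[of n] by simp
    finally show ?thesis by (subst (asm) ennreal_le_iff) auto
  qed
  have "(\<lambda>n. \<integral>x. norm ((u x - \<phi> n x)\<^sup>2) \<partial>M) \<longlonglongrightarrow> 0"
    by (rule tendsto_sandwich[OF _ _ tendsto_const LIMSEQ_inverse_real_of_nat])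
      (use le in \<open>auto intro!: always_eventually\<close>)
  then obtain r where r: "strict_mono r" "AE x in M. (\<lambda>n. (u x - \<phi> (r n) x)\<^sup>2) \<longlonglongrightarrow> 0"
    using tendsto_L1_AE_subseq[of M "\<lambda>n x. (u x - \<phi> n x)\<^sup>2"] int by auto
  obtain c where c: "qe u = ennreal c" "c \<ge> 0"
    using form_space_qe[OF u] by (cases "qe u") auto
  show ?thesis
  \<comment> \<open>The approximant is \<open>u\<close> minus its error; \<open>qe_diff_le\<close>
    bounds its energy by twice \<open>qe u = c\<close> plus twice an error of at most 1.\<close>
  proof (intro exI[of _ "\<lambda>n. \<phi> (r n)"] exI[of _ "2 * c + 2"] conjI allI)
    show "\<phi> (r n) \<in> test_functions \<Omega>" for n by (rule \<phi>)
    show "0 \<le> 2 * c + 2" using c by simp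
    show "qe (\<phi> (r n)) \<le> ennreal (2 * c + 2)" for n
    proof -
      have "qe (\<lambda>x. u x - (u x - \<phi> (r n) x)) \<le> 2 * qe u + 2 * qe (\<lambda>x. u x - \<phi> (r n) x)"
        by (intro qe_diff_le) auto
      also have "\<dots> \<le> 2 * ennreal c + 2 * ennreal 1"
      proof (intro add_mono mult_left_mono)
        have "inverse (real (Suc (r n))) \<le> 1" by (simp add: field_simps)
        then show "qe (\<lambda>x. u x - \<phi> (r n) x) \<le> ennreal 1"
          using less_imp_le[OF \<phi>(2)[of "r n"]] ennreal_leI order_trans by blast
      qed (use c in auto)
      also have "\<dots> = ennreal (2 * c + 2)"
        using c(2) by (simp flip: ennreal_numeral ennreal_mult ennreal_plus)
      finally show ?thesis by simp
    qed
    show "AE x in M. (\<lambda>n. \<phi> (r n) x) \<longlonglongrightarrow> u x"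
      using r(2)
    proof eventually_elim
      case (elim x)
      then have "(\<lambda>n. sqrt ((u x - \<phi> (r n) x)\<^sup>2)) \<longlonglongrightarrow> sqrt 0" by (rule tendsto_real_sqrt)
      then have "(\<lambda>n. u x - \<phi> (r n) x) \<longlonglongrightarrow> 0" by (simp add: tendsto_rabs_zero_iff)
      from tendsto_diff[OF tendsto_const[of "u x"] this] show ?case by simp
    qed
  qed
qed

text \<open>
  A bounded sequence in the form space converges, after passing to convex combinations of its tails
  of almost minimal norm, in the norm: by the parallelogram identity these combinations form a Cauchy
  sequence, and Fatou's lemma replaces completeness.
\<close>

lemma form_space_closed:
  assumes w: "\<And>n. w n \<in> form_space \<Omega> J B" and C: "\<And>n::nat. qe (w n) \<le> ennreal C"
    and v [measurable]: "v \<in> borel_measurable M" and lim: "AE x in M. (\<lambda>n. w n x) \<longlonglongrightarrow> v x"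
  shows "v \<in> form_space \<Omega> J B"
proof -
  have Hfs: "f \<in> form_space \<Omega> J B" if "f \<in> midpoints w n" for f n
    using that by induction (auto intro: w form_space_midpoint)
  have Hm [measurable]: "f \<in> borel_measurable M" if "f \<in> midpoints w n" for f n
    using Hfs[OF that] by (rule form_space_measurable)
  have HC: "qe f \<le> ennreal C" if "f \<in> midpoints w n" for f n
    using that
  proof induction
    case (mid f g)
    have "4 * qe (\<lambda>x. (f x + g x) / 2) \<le> qe (\<lambda>x. f x - g x) + 4 * qe (\<lambda>x. (f x + g x) / 2)" by simp
    also have "\<dots> \<le> 2 * qe f + 2 * qe g" using mid Hm by (intro qe_parallelogram) auto
    also have "\<dots> \<le> 2 * ennreal C + 2 * ennreal C" using mid by (intro add_mono mult_left_mono) auto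
    also have "\<dots> = 4 * ennreal C" by (simp flip: distrib_right)
    finally show ?case by (subst (asm) ennreal_mult_le_mult_iff) auto
  qed (rule C)
  define Q where "Q = (\<lambda>f. enn2real (qe f))"
  have Q: "qe f = ennreal (Q f)" "0 \<le> Q f" "Q f \<le> max C 0" if "f \<in> midpoints w n" for f n
  proof -
    have "qe f < \<infinity>" using HC[OF that] le_less_trans by fastforce
    then show "qe f = ennreal (Q f)" by (simp add: Q_def)
    show "0 \<le> Q f" by (simp add: Q_def)
    show "Q f \<le> max C 0"
      unfolding Q_def using HC[OF that] by (intro enn2real_leI order_trans[OF HC[OF that]] ennreal_leI) auto
  qed
  have ne: "Q ` midpoints w n \<noteq> {}" for n using midpoints.base[of n n w] by auto
  have bdd: "bdd_below (Q ` midpoints w n)" for n using Q(2) by (auto simp: bdd_below_def)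
  define m where "m = (\<lambda>n. Inf (Q ` midpoints w n))"
  have m_le: "m n \<le> Q f" if "f \<in> midpoints w n" for f n
    unfolding m_def using that bdd by (intro cInf_lower) auto
  have "m i \<le> m j" if "i \<le> j" for i j
    unfolding m_def using ne bdd midpoints_antimono[OF that] by (intro cInf_superset_mono image_mono) auto
  moreover have "m n \<le> max C 0" for n
    using m_le[OF midpoints.base[of n n w]] Q(3)[OF midpoints.base[of n n w]] by simp
  ultimately have "\<exists>L. m \<longlonglongrightarrow> L \<and> (\<forall>n. m n \<le> L)"
    using incseq_convergent[of m "max C 0"] by (simp add: incseq_def) blast
  then obtain L where L: "m \<longlonglongrightarrow> L" "\<And>n. m n \<le> L" by blast
  have "\<exists>g\<in>midpoints w n. Q g < m n + inverse (real (Suc n))" for n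
    using cInf_lessD[OF ne[of n], of "m n + inverse (real (Suc n))"] by (auto simp: m_def)
  then obtain g where g: "\<And>n. g n \<in> midpoints w n" "\<And>n. Q (g n) < m n + inverse (real (Suc n))"
    by metis
  have gm [measurable]: "g n \<in> borel_measurable M" for n using Hm g(1) by blast
  \<comment> \<open>In the parallelogram inequality the midpoint of \<open>g k\<close> and
    \<open>g l\<close> contributes at least \<open>4 * m k\<close>, while
    \<open>2 * Q (g k) + 2 * Q (g l)\<close> is at most \<open>2 * m k + 2 * L\<close> plus four
    times \<open>inverse (real (Suc k))\<close>. The difference is \<open>d k\<close>.\<close>
  define d where "d = (\<lambda>k. 2 * (L - m k) + 4 * inverse (real (Suc k)))"
  have key: "qe (\<lambda>x. g k x - g l x) \<le> ennreal (d k)" if "k \<le> l" for k l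
  proof -
    have gl: "g l \<in> midpoints w k" using midpoints_antimono[OF that g(1)] .
    then have mid: "(\<lambda>x. (g k x + g l x) / 2) \<in> midpoints w k" using g(1) by (intro midpoints.mid)
    have p: "qe (\<lambda>x. g k x - g l x) + 4 * qe (\<lambda>x. (g k x + g l x) / 2) \<le> 2 * qe (g k) + 2 * qe (g l)"
      by (intro qe_parallelogram) auto
    also have "\<dots> = ennreal (2 * Q (g k) + 2 * Q (g l))"
      using Q[OF g(1)] by (simp flip: ennreal_numeral ennreal_mult ennreal_plus)
    finally have p: "qe (\<lambda>x. g k x - g l x) + 4 * qe (\<lambda>x. (g k x + g l x) / 2) \<le> ennreal (2 * Q (g k) + 2 * Q (g l))" .
    have "qe (\<lambda>x. g k x - g l x) \<le> qe (\<lambda>x. g k x - g l x) + 4 * qe (\<lambda>x. (g k x + g l x) / 2)" by simp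
    also note p
    finally have "qe (\<lambda>x. g k x - g l x) < \<infinity>" using le_less_trans by fastforce
    then obtain D where D: "qe (\<lambda>x. g k x - g l x) = ennreal D" "D \<ge> 0"
      by (cases "qe (\<lambda>x. g k x - g l x)") auto
    have "ennreal (D + 4 * Q (\<lambda>x. (g k x + g l x) / 2)) \<le> ennreal (2 * Q (g k) + 2 * Q (g l))"
      using p D Q[OF mid] by (simp flip: ennreal_numeral ennreal_mult ennreal_plus)
    then have "D + 4 * Q (\<lambda>x. (g k x + g l x) / 2) \<le> 2 * Q (g k) + 2 * Q (g l)"
      using Q(2)[OF g(1)] by (subst (asm) ennreal_le_iff) auto
    moreover have "inverse (real (Suc l)) \<le> inverse (real (Suc k))" using that by simp
    moreover define i j where "i = inverse (real (Suc k))" and "j = inverse (real (Suc l))"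
    ultimately have "D \<le> 2 * (L - m k) + 4 * i"
      using m_le[OF mid] g(2)[of k, folded i_def] g(2)[of l, folded j_def] L(2)[of l]
      unfolding i_def[symmetric] j_def[symmetric] by argo
    then have "D \<le> d k" by (simp only: d_def i_def)
    then show ?thesis using D by (simp add: ennreal_leI)
  qed
  have "AE x in M. (\<lambda>l. g l x) \<longlonglongrightarrow> v x"
    using lim
  proof eventually_elim
    case (elim x)
    show ?case
    proof (rule LIMSEQ_I)
      fix e :: real assume "e > 0"
      then obtain n0 where "\<forall>n\<ge>n0. norm (w n x - v x) < e / 2" using LIMSEQ_D[OF elim, of "e / 2"] by auto
      then have "\<bar>g n x - v x\<bar> \<le> e / 2" if "n \<ge> n0" for n
        using that by (intro midpoints_close[OF g(1)]) (auto simp: less_imp_le)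
      then show "\<exists>n0. \<forall>n\<ge>n0. norm (g n x - v x) < e" using \<open>e > 0\<close> by (intro exI[of _ n0]) force
    qed
  qed
  then have close: "qe (\<lambda>x. g k x - v x) \<le> ennreal (d k)" for k
  proof -
    have "qe (\<lambda>x. g k x - v x) \<le> liminf (\<lambda>l. qe (\<lambda>x. g k x - g l x))"
    proof (rule qe_fatou)
      show "AE x in M. (\<lambda>l. g k x - g l x) \<longlonglongrightarrow> g k x - v x"
        using \<open>AE x in M. (\<lambda>l. g l x) \<longlonglongrightarrow> v x\<close> by eventually_elim (intro tendsto_intros)
    qed auto
    also have "\<dots> \<le> limsup (\<lambda>l. qe (\<lambda>x. g k x - g l x))" by (rule Liminf_le_Limsup) simp
    also have "\<dots> \<le> ennreal (d k)"
      using key by (intro Limsup_bounded) (auto simp: eventually_sequentially)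
    finally show ?thesis .
  qed
  have d0: "d \<longlonglongrightarrow> 0"
  proof -
    have "(\<lambda>k. 2 * (L - m k) + 4 * inverse (real (Suc k))) \<longlonglongrightarrow> 2 * (L - L) + 4 * 0"
      by (intro tendsto_intros L(1) LIMSEQ_inverse_real_of_nat)
    then show ?thesis by (simp add: d_def)
  qed
  show ?thesis
    unfolding form_space_iff
  proof (intro conjI allI impI)
    have "qe v \<le> liminf (\<lambda>n. qe (w n))" using lim w form_space_measurable by (intro qe_fatou) auto
    also have "\<dots> \<le> limsup (\<lambda>n. qe (w n))" by (rule Liminf_le_Limsup) simp
    also have "\<dots> \<le> ennreal C" using C by (intro Limsup_bounded) auto
    finally show "qe v < \<infinity>" using le_less_trans by fastforce
    fix \<epsilon> :: real assume e: "\<epsilon> > 0"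
    have "\<forall>\<^sub>F k in sequentially. d k < \<epsilon> / 4" using e by (intro order_tendstoD(2)[OF d0]) simp
    then obtain k where k: "d k < \<epsilon> / 4" by (auto simp: eventually_sequentially)
    have "\<epsilon> / 4 > 0" using e by simp
    then obtain \<phi> where \<phi>: "\<phi> \<in> test_functions \<Omega>" "qe (\<lambda>x. g k x - \<phi> x) < ennreal (\<epsilon> / 4)"
      using Hfs[OF g(1)[of k]] unfolding form_space_iff by blast
    have [measurable]: "\<phi> \<in> borel_measurable M" by (rule test_functions_measurable) fact
    have "qe (\<lambda>x. (g k x - \<phi> x) - (g k x - v x)) \<le> 2 * qe (\<lambda>x. g k x - \<phi> x) + 2 * qe (\<lambda>x. g k x - v x)"
      by (intro qe_diff_le) auto
    also have "\<dots> < 2 * ennreal (\<epsilon> / 4) + 2 * ennreal (\<epsilon> / 4)"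
    proof (rule add_strict_mono)
      show "2 * qe (\<lambda>x. g k x - \<phi> x) < 2 * ennreal (\<epsilon> / 4)"
        using \<phi>(2) by (intro ennreal_mult_strict_left_mono) auto
      have "qe (\<lambda>x. g k x - v x) < ennreal (\<epsilon> / 4)"
        using close[of k] ennreal_lessI[of "\<epsilon> / 4" "d k"] k e by (intro le_less_trans[OF close]) auto
      then show "2 * qe (\<lambda>x. g k x - v x) < 2 * ennreal (\<epsilon> / 4)"
        by (intro ennreal_mult_strict_left_mono) auto
    qed
    also have "\<dots> = ennreal \<epsilon>" using e by (simp flip: ennreal_numeral ennreal_mult ennreal_plus)
    finally show "\<exists>\<phi>\<in>test_functions \<Omega>. qe (\<lambda>x. v x - \<phi> x) < ennreal \<epsilon>"
      using \<phi>(1) by (auto intro!: bexI[of _ \<phi>])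
  qed simp
qed

section \<open>Stability of the form space under smooth compositions\<close>

lemma form_space_jfun:
  assumes u: "u \<in> form_space \<Omega> J B" and e: "e > 0"
  shows "(\<lambda>x. jfun e (u x)) \<in> form_space \<Omega> J B"
proof -
  obtain \<phi> C where \<phi>: "\<And>n. \<phi> n \<in> test_functions \<Omega>" "\<And>n::nat. qe (\<phi> n) \<le> ennreal C" "C \<ge> 0"
    "AE x in M. (\<lambda>n. \<phi> n x) \<longlonglongrightarrow> u x"
    using form_space_approx[OF u] by auto
  have [measurable]: "\<phi> n \<in> borel_measurable M" "u \<in> borel_measurable M" for n
    using test_functions_measurable[OF \<phi>(1)] form_space_measurable[OF u] by simp_all
  show ?thesis
  proof (rule form_space_closed[where w = "\<lambda>n x. jfun e (\<phi> n x)" and C = C])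
    show "(\<lambda>x. jfun e (\<phi> n x)) \<in> form_space \<Omega> J B" for n
      using jfun_smooth_alg[OF test_functions_smooth[OF \<phi>(1)] e, of n] e
      by (intro test_functions_form_space test_functionsI[OF \<phi>(1)[of n]]) auto
    \<comment> \<open>\<open>jfun e\<close> is a normal contraction: it shrinks both values and
      increments, so the bound for \<open>\<phi> n\<close> is inherited.\<close>
    show "qe (\<lambda>x. jfun e (\<phi> n x)) \<le> ennreal C" for n
    proof -
      have "qe (\<lambda>x. jfun e (\<phi> n x)) \<le> ennreal 1 * qe (\<phi> n) + ennreal 0 * qe (\<phi> n)"
      proof (rule qe_combine)
        fix x y
        have "\<bar>jfun e (\<phi> n x)\<bar> \<le> \<bar>\<phi> n x\<bar>" using jfun_nonneg[OF e] jfun_le[OF e] by simp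
        then show "(jfun e (\<phi> n x))\<^sup>2 \<le> 1 * (\<phi> n x)\<^sup>2 + 0 * (\<phi> n x)\<^sup>2" by (simp add: abs_le_square_iff)
        show "(jfun e (\<phi> n x) - jfun e (\<phi> n y))\<^sup>2 \<le> 1 * (\<phi> n x - \<phi> n y)\<^sup>2 + 0 * (\<phi> n x - \<phi> n y)\<^sup>2"
          using jfun_lipschitz[OF e] by (simp add: abs_le_square_iff)
      qed auto
      then show ?thesis using \<phi>(2)[of n] by (simp add: order_trans)
    qed
    show "AE x in M. (\<lambda>n. jfun e (\<phi> n x)) \<longlonglongrightarrow> jfun e (u x)"
      using \<phi>(4) by eventually_elim
        (use continuous_jfun[of e] in \<open>auto intro: continuous_on_tendsto_compose\<close>)
  qed simp
qed

lemma prod_diff_sq_le: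
  fixes p q :: "'b \<Rightarrow> real"
  assumes "\<bar>p x\<bar> \<le> 1" "\<bar>q y\<bar> \<le> m"
    "\<bar>p x - p y\<bar> \<le> a" "\<bar>q x - q y\<bar> \<le> b"
  shows "(p x * q x - p y * q y)\<^sup>2 \<le> 2 * m\<^sup>2 * a\<^sup>2 + 2 * b\<^sup>2"
proof -
  have "p x * q x - p y * q y = p x * (q x - q y) + (p x - p y) * q y" by (simp add: algebra_simps)
  also have "\<bar>\<dots>\<bar> \<le> 1 * b + a * m"
  proof (intro order_trans[OF abs_triangle_ineq] add_mono)
    show "\<bar>p x * (q x - q y)\<bar> \<le> 1 * b" unfolding abs_mult using assms by (intro mult_mono) auto
    show "\<bar>(p x - p y) * q y\<bar> \<le> a * m" unfolding abs_mult using assms by (intro mult_mono) auto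
  qed
  finally have "(p x * q x - p y * q y)\<^sup>2 \<le> (b + a * m)\<^sup>2"
    using power_mono[of "\<bar>p x * q x - p y * q y\<bar>" "b + a * m" 2] by simp
  also have "\<dots> \<le> 2 * m\<^sup>2 * a\<^sup>2 + 2 * b\<^sup>2"
    using zero_le_power2[of "b - a * m"] by (simp add: power2_eq_square algebra_simps)
  finally show ?thesis .
qed

text \<open>The increments of a product are controlled when its factors are bounded. Even if
  \<open>v\<close> is bounded, the test functions approximating it need not be uniformly so, and the
  truncation at level \<open>k\<close> supplies the bound. In the constant, \<open>k\<close> bounds
  the truncated factor and \<open>1 / e\<close> is the Lipschitz constant of
  \<open>pfun e\<close>.\<close>

lemma form_space_pfun_truncation:
  assumes u: "u \<in> form_space \<Omega> J B" and v: "v \<in> form_space \<Omega> J B" and e: "e > 0" and k: "k > 0"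
  shows "(\<lambda>x. pfun e (u x) * (k * pfun k (v x))) \<in> form_space \<Omega> J B"
proof -
  obtain \<phi> C where \<phi>: "\<And>n. \<phi> n \<in> test_functions \<Omega>" "\<And>n::nat. qe (\<phi> n) \<le> ennreal C" "C \<ge> 0"
    "AE x in M. (\<lambda>n. \<phi> n x) \<longlonglongrightarrow> u x"
    using form_space_approx[OF u] by auto
  obtain \<psi> D where \<psi>: "\<And>n. \<psi> n \<in> test_functions \<Omega>" "\<And>n::nat. qe (\<psi> n) \<le> ennreal D" "D \<ge> 0"
    "AE x in M. (\<lambda>n. \<psi> n x) \<longlonglongrightarrow> v x"
    using form_space_approx[OF v] by auto
  have [measurable]: "\<phi> n \<in> borel_measurable M" "u \<in> borel_measurable M"
    "\<psi> n \<in> borel_measurable M" "v \<in> borel_measurable M" for n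
    using test_functions_measurable[OF \<phi>(1)] test_functions_measurable[OF \<psi>(1)]
      form_space_measurable[OF u] form_space_measurable[OF v] by simp_all
  show ?thesis
  proof (rule form_space_closed[where w = "\<lambda>n x. pfun e (\<phi> n x) * (k * pfun k (\<psi> n x))"
        and C = "2 * k\<^sup>2 / e\<^sup>2 * C + 2 * D"])
    show "(\<lambda>x. pfun e (\<phi> n x) * (k * pfun k (\<psi> n x))) \<in> form_space \<Omega> J B" for n
    proof (rule test_functions_form_space[OF test_functionsI[OF \<psi>(1)[of n]]])
      show "(\<lambda>x. pfun e (\<phi> n x) * (k * pfun k (\<psi> n x))) \<in> smooth_alg"
        using pfun_smooth_alg[OF test_functions_smooth[OF \<phi>(1)] e, of n]
          pfun_smooth_alg[OF test_functions_smooth[OF \<psi>(1)] k, of n]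
        by (intro smooth_alg.mult smooth_alg.const)
    qed simp
    show "qe (\<lambda>x. pfun e (\<phi> n x) * (k * pfun k (\<psi> n x))) \<le> ennreal (2 * k\<^sup>2 / e\<^sup>2 * C + 2 * D)" for n
    proof -
      have "qe (\<lambda>x. pfun e (\<phi> n x) * (k * pfun k (\<psi> n x))) \<le>
          ennreal (2 * k\<^sup>2 / e\<^sup>2) * qe (\<phi> n) + ennreal 2 * qe (\<psi> n)"
      proof (rule qe_combine)
        fix x y
        have "\<bar>pfun e (\<phi> n x) * (k * pfun k (\<psi> n x))\<bar> \<le> 1 * \<bar>\<psi> n x\<bar>"
          unfolding abs_mult[of "pfun e (\<phi> n x)"]
          using abs_pfun_le[OF e] abs_pfun_le2[OF k] by (intro mult_mono) auto
        then have "(pfun e (\<phi> n x) * (k * pfun k (\<psi> n x)))\<^sup>2 \<le> (\<psi> n x)\<^sup>2" by (simp add: abs_le_square_iff)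
        then show "(pfun e (\<phi> n x) * (k * pfun k (\<psi> n x)))\<^sup>2 \<le> 2 * k\<^sup>2 / e\<^sup>2 * (\<phi> n x)\<^sup>2 + 2 * (\<psi> n x)\<^sup>2"
          by (rule order_trans) (simp add: add_increasing)
        have "(pfun e (\<phi> n x) * (k * pfun k (\<psi> n x)) - pfun e (\<phi> n y) * (k * pfun k (\<psi> n y)))\<^sup>2
            \<le> 2 * k\<^sup>2 * (\<bar>\<phi> n x - \<phi> n y\<bar> / e)\<^sup>2 + 2 * (\<bar>\<psi> n x - \<psi> n y\<bar>)\<^sup>2"
        proof (rule prod_diff_sq_le)
          show "\<bar>pfun e (\<phi> n x)\<bar> \<le> 1" by (rule abs_pfun_le[OF e])
          show "\<bar>k * pfun k (\<psi> n y)\<bar> \<le> k" using abs_pfun_le[OF k, of "\<psi> n y"] k by (simp add: abs_mult)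
          show "\<bar>k * pfun k (\<psi> n x) - k * pfun k (\<psi> n y)\<bar> \<le> \<bar>\<psi> n x - \<psi> n y\<bar>" by (rule pfun_lipschitz[OF k])
          have "e * \<bar>pfun e (\<phi> n x) - pfun e (\<phi> n y)\<bar> \<le> \<bar>\<phi> n x - \<phi> n y\<bar>"
            using pfun_lipschitz[OF e, of "\<phi> n x" "\<phi> n y"] e by (simp add: abs_mult flip: right_diff_distrib)
          then show "\<bar>pfun e (\<phi> n x) - pfun e (\<phi> n y)\<bar> \<le> \<bar>\<phi> n x - \<phi> n y\<bar> / e"
            using e by (simp add: pos_le_divide_eq mult.commute)
        qed
        then show "(pfun e (\<phi> n x) * (k * pfun k (\<psi> n x)) - pfun e (\<phi> n y) * (k * pfun k (\<psi> n y)))\<^sup>2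
            \<le> 2 * k\<^sup>2 / e\<^sup>2 * (\<phi> n x - \<phi> n y)\<^sup>2 + 2 * (\<psi> n x - \<psi> n y)\<^sup>2"
          by (simp add: power_divide)
      qed auto
      also have "\<dots> \<le> ennreal (2 * k\<^sup>2 / e\<^sup>2) * ennreal C + ennreal 2 * ennreal D"
        using \<phi>(2) \<psi>(2) by (intro add_mono mult_left_mono) auto
      also have "\<dots> = ennreal (2 * k\<^sup>2 / e\<^sup>2 * C + 2 * D)"
        using \<phi>(3) \<psi>(3) by (intro ennreal_lincomb) auto
      finally show ?thesis .
    qed
    show "AE x in M. (\<lambda>n. pfun e (\<phi> n x) * (k * pfun k (\<psi> n x))) \<longlonglongrightarrow> pfun e (u x) * (k * pfun k (v x))"
      using \<phi>(4) \<psi>(4)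
    proof eventually_elim
      case (elim x)
      have "(\<lambda>n. pfun e (\<phi> n x)) \<longlonglongrightarrow> pfun e (u x)" "(\<lambda>n. pfun k (\<psi> n x)) \<longlonglongrightarrow> pfun k (v x)"
        using elim continuous_pfun[OF e] continuous_pfun[OF k]
        by (auto intro: continuous_on_tendsto_compose)
      then show ?case by (intro tendsto_mult tendsto_const)
    qed
  qed simp
qed

text \<open>The truncation level now tends to infinity. The truncated factor is bounded by
  \<open>m\<close>, the bound of \<open>v\<close> itself, so the energies are bounded independently
  of the level.\<close>

lemma form_space_pfun_mult:
  assumes u: "u \<in> form_space \<Omega> J B" and v: "v \<in> form_space \<Omega> J B" and e: "e > 0"
    and m: "\<And>x. x \<in> \<Omega> \<Longrightarrow> \<bar>v x\<bar> \<le> m"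
  shows "(\<lambda>x. pfun e (u x) * v x) \<in> form_space \<Omega> J B"
proof -
  have [measurable]: "u \<in> borel_measurable M" "v \<in> borel_measurable M" using u v form_space_measurable by auto
  obtain C D where C: "qe u = ennreal C" "C \<ge> 0" and D: "qe v = ennreal D" "D \<ge> 0"
    using form_space_qe[OF u] form_space_qe[OF v] by (cases "qe u"; cases "qe v") auto
  define q where "q = (\<lambda>n t. real (Suc n) * pfun (real (Suc n)) t)"
  have q: "\<bar>q n t\<bar> \<le> \<bar>t\<bar>" "\<bar>q n t - q n t'\<bar> \<le> \<bar>t - t'\<bar>" for n t t'
    unfolding q_def by (rule abs_pfun_le2 pfun_lipschitz; simp)+
  show ?thesis
  proof (rule form_space_closed[where w = "\<lambda>n x. pfun e (u x) * q n (v x)"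
        and C = "2 * m\<^sup>2 / e\<^sup>2 * C + 2 * D"])
    show "(\<lambda>x. pfun e (u x) * q n (v x)) \<in> form_space \<Omega> J B" for n
      unfolding q_def using u v e by (intro form_space_pfun_truncation) auto
    show "qe (\<lambda>x. pfun e (u x) * q n (v x)) \<le> ennreal (2 * m\<^sup>2 / e\<^sup>2 * C + 2 * D)" for n
    proof -
      have [measurable]: "q n \<in> borel_measurable borel" unfolding q_def by measurable
      have "qe (\<lambda>x. pfun e (u x) * q n (v x)) \<le> ennreal (2 * m\<^sup>2 / e\<^sup>2) * qe u + ennreal 2 * qe v"
      proof (rule qe_combine)
        fix x y assume xy: "x \<in> \<Omega>" "y \<in> \<Omega>"
        show "(pfun e (u x) * q n (v x) - pfun e (u y) * q n (v y))\<^sup>2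
            \<le> 2 * m\<^sup>2 / e\<^sup>2 * (u x - u y)\<^sup>2 + 2 * (v x - v y)\<^sup>2"
        proof -
          have "(pfun e (u x) * q n (v x) - pfun e (u y) * q n (v y))\<^sup>2
            \<le> 2 * m\<^sup>2 * (\<bar>u x - u y\<bar> / e)\<^sup>2 + 2 * (\<bar>v x - v y\<bar>)\<^sup>2"
          proof (rule prod_diff_sq_le)
            show "\<bar>pfun e (u x)\<bar> \<le> 1" by (rule abs_pfun_le[OF e])
            show "\<bar>q n (v y)\<bar> \<le> m" using q(1)[of n "v y"] m[OF xy(2)] by linarith
            show "\<bar>q n (v x) - q n (v y)\<bar> \<le> \<bar>v x - v y\<bar>" by (rule q)
            have "e * \<bar>pfun e (u x) - pfun e (u y)\<bar> \<le> \<bar>u x - u y\<bar>"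
              using pfun_lipschitz[OF e, of "u x" "u y"] e by (simp add: abs_mult flip: right_diff_distrib)
            then show "\<bar>pfun e (u x) - pfun e (u y)\<bar> \<le> \<bar>u x - u y\<bar> / e"
              using e by (simp add: pos_le_divide_eq mult.commute)
          qed
          then show ?thesis by (simp add: power_divide)
        qed
      next
        fix x
        have "\<bar>pfun e (u x) * q n (v x)\<bar> \<le> 1 * \<bar>v x\<bar>"
          unfolding abs_mult using abs_pfun_le[OF e] q(1) by (intro mult_mono) auto
        then have "(pfun e (u x) * q n (v x))\<^sup>2 \<le> (v x)\<^sup>2" by (simp add: abs_le_square_iff)
        then show "(pfun e (u x) * q n (v x))\<^sup>2 \<le> 2 * m\<^sup>2 / e\<^sup>2 * (u x)\<^sup>2 + 2 * (v x)\<^sup>2"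
          by (rule order_trans) (simp add: add_increasing)
      qed auto
      also have "\<dots> = ennreal (2 * m\<^sup>2 / e\<^sup>2 * C + 2 * D)"
        unfolding C(1) D(1) using C(2) D(2) by (intro ennreal_lincomb) auto
      finally show ?thesis .
    qed
    show "AE x in M. (\<lambda>n. pfun e (u x) * q n (v x)) \<longlonglongrightarrow> pfun e (u x) * v x"
      unfolding q_def by (intro AE_I2 tendsto_mult tendsto_const truncation_tendsto)
  qed simp
qed

section \<open>Kato's inequality in the form space\<close>

lemma energy_integrable:
  assumes "u \<in> energy_domain \<Omega> J B" "v \<in> energy_domain \<Omega> J B"
  shows "integrable W (\<lambda>z. J (fst z) (snd z) * (u (fst z) - u (snd z)) * (v (fst z) - v (snd z)))"
    and "integrable M (\<lambda>x. B x * u x * v x)"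
proof -
  have [measurable]: "u \<in> borel_measurable M" "v \<in> borel_measurable M"
    using assms energy_domain_measurable by auto
  have ab: "\<bar>a * b\<bar> \<le> a\<^sup>2 + b\<^sup>2" for a b :: real
  proof -
    have "0 \<le> \<bar>a\<bar> * \<bar>b\<bar>" by simp
    moreover have "2 * (\<bar>a\<bar> * \<bar>b\<bar>) \<le> a\<^sup>2 + b\<^sup>2"
      using zero_le_power2[of "\<bar>a\<bar> - \<bar>b\<bar>"] by (simp add: power2_diff)
    ultimately show ?thesis unfolding abs_mult by linarith
  qed
  \<comment> \<open>The bound holds for either sign of \<open>j\<close>, so the diagonal, where the
    sign of \<open>J\<close> is not prescribed, calls for no separate case.\<close>
  have *: "\<bar>j * a * b\<bar> \<le> \<bar>j * a\<^sup>2 + j * b\<^sup>2\<bar>" for a b j :: real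
  proof -
    have "\<bar>j\<bar> * \<bar>a * b\<bar> \<le> \<bar>j\<bar> * (a\<^sup>2 + b\<^sup>2)" by (intro mult_left_mono ab) auto
    also have "\<dots> = \<bar>j * (a\<^sup>2 + b\<^sup>2)\<bar>" by (simp add: abs_mult)
    finally show ?thesis by (simp add: abs_mult distrib_left mult.assoc)
  qed
  show "integrable W (\<lambda>z. J (fst z) (snd z) * (u (fst z) - u (snd z)) * (v (fst z) - v (snd z)))"
  proof (rule Bochner_Integration.integrable_bound)
    show "integrable W (\<lambda>z. J (fst z) (snd z) * (u (fst z) - u (snd z))\<^sup>2 + J (fst z) (snd z) * (v (fst z) - v (snd z))\<^sup>2)"
      using assms by (auto simp: energy_domain_def case_prod_beta')
  qed (use * in auto)
  show "integrable M (\<lambda>x. B x * u x * v x)"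
  proof (rule Bochner_Integration.integrable_bound)
    show "integrable M (\<lambda>x. B x * (u x)\<^sup>2 + B x * (v x)\<^sup>2)"
      using assms by (auto simp: energy_domain_def)
  qed (use * in auto)
qed

text \<open>The equation of \<open>w\<close> is tested with \<open>jfun e\<close> of
  \<open>u\<close>, that of \<open>u\<close> with \<open>pfun e\<close> of \<open>u\<close> times
  \<open>w\<close>. The energy integrands compare pointwise: collecting the terms with
  \<open>w x\<close> and with \<open>w y\<close>, both nonnegative, leaves the tangent inequality of
  \<open>jfun e\<close> at \<open>u x\<close> and at \<open>u y\<close>. The term with
  \<open>B\<close> is the tangent inequality between \<open>u x\<close> and 0.\<close>

lemma kato_energy:
  assumes u: "is_green_image \<Omega> J B f u" and w: "is_green_image \<Omega> J B r w"
    and m: "\<And>x. x \<in> \<Omega> \<Longrightarrow> 0 \<le> w x" "\<And>x. x \<in> \<Omega> \<Longrightarrow> w x \<le> m" and e: "e > 0"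
  shows "(\<integral>x. r x * jfun e (u x) \<partial>M) \<le> (\<integral>x. f x * (pfun e (u x) * w x) \<partial>M)"
proof -
  have fs: "u \<in> form_space \<Omega> J B" "w \<in> form_space \<Omega> J B" using u w by (auto simp: is_green_image_def)
  let ?j = "\<lambda>x. jfun e (u x)" and ?p = "\<lambda>x. pfun e (u x) * w x"
  have j: "?j \<in> form_space \<Omega> J B" by (intro form_space_jfun fs e)
  have p: "?p \<in> form_space \<Omega> J B" using m by (intro form_space_pfun_mult[where m = m] fs e) auto
  note ed = fs[THEN form_space_energy_domain] j[THEN form_space_energy_domain] p[THEN form_space_energy_domain]
  have "(\<integral>x. r x * ?j x \<partial>M) = energy \<Omega> J B w ?j" using w j by (simp add: is_green_image_def)
  also have "\<dots> \<le> energy \<Omega> J B u ?p"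
    unfolding energy_def case_prod_beta'
  proof (intro add_mono mult_left_mono integral_mono energy_integrable ed)
    fix z assume "z \<in> space W"
    then have z: "fst z \<in> \<Omega>" "snd z \<in> \<Omega>" by auto
    define x y where "x = fst z" and "y = snd z"
    have "(w x - w y) * (?j x - ?j y) = w x * (?j x - ?j y) + w y * (?j y - ?j x)" by (simp add: algebra_simps)
    also have "\<dots> \<le> w x * (pfun e (u x) * (u x - u y)) + w y * (pfun e (u y) * (u y - u x))"
      using m(1) z jfun_convex[OF e] by (intro add_mono mult_left_mono) (auto simp: x_def y_def)
    also have "\<dots> = (u x - u y) * (?p x - ?p y)" by (simp add: algebra_simps)
    finally have le: "(w x - w y) * (?j x - ?j y) \<le> (u x - u y) * (?p x - ?p y)" .
    show "J (fst z) (snd z) * (w (fst z) - w (snd z)) * (?j (fst z) - ?j (snd z))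
        \<le> J (fst z) (snd z) * (u (fst z) - u (snd z)) * (?p (fst z) - ?p (snd z))"
    proof (cases "x = y")
      case False
      then show ?thesis using mult_left_mono[OF le J_nonneg[OF z]] by (simp add: x_def y_def mult.assoc)
    qed (simp add: x_def y_def)
  next
    fix x assume "x \<in> space M"
    then have x: "x \<in> \<Omega>" by simp
    have "w x * ?j x \<le> w x * (pfun e (u x) * u x)"
      using jfun_convex[OF e, of "u x" 0] e m(1)[OF x] by (intro mult_left_mono) auto
    from mult_left_mono[OF this B_nonneg[OF x]] show "B x * w x * ?j x \<le> B x * u x * ?p x"
      by (simp add: mult_ac)
  qed simp
  also have "\<dots> = (\<integral>x. f x * ?p x \<partial>M)" using u p by (simp add: is_green_image_def)
  finally show ?thesis .
qed

text \<open>The integral is the energy of \<open>u\<close>. Positivity makes the quadratic form of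
  the Green operator the square of a seminorm, the one in which the relaxed iteration
  contracts.\<close>

lemma green_image_nonneg:
  assumes u: "is_green_image \<Omega> J B f u"
  shows "0 \<le> (\<integral>x. f x * u x \<partial>M)"
proof -
  have fs: "u \<in> form_space \<Omega> J B" using u by (auto simp: is_green_image_def)
  have "0 \<le> (\<integral>z. J (fst z) (snd z) * (u (fst z) - u (snd z)) * (u (fst z) - u (snd z)) \<partial>W)"
    using J_sq_nonneg by (intro integral_nonneg_AE AE_I2) (auto simp: power2_eq_square mult.assoc)
  moreover have "0 \<le> (\<integral>x. B x * u x * u x \<partial>M)"
    using B_nonneg by (intro integral_nonneg_AE AE_I2) (simp add: mult.assoc)
  ultimately have "0 \<le> energy \<Omega> J B u u"
    by (simp add: energy_def case_prod_beta')
  then show ?thesis using u fs by (simp add: is_green_image_def)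
qed

end

section \<open>Estimates of the kernel\<close>

text \<open>The ball is covered by dyadic shells. On the n-th one the kernel is at most its value at
  the inner radius, and the product with the volume of the outer ball is a geometric sequence of
  ratio \<open>2 powr (\<alpha> - N)\<close>, less than 1.\<close>

lemma nn_integral_riesz_ball_finite:
  fixes \<alpha> R :: real
  assumes "\<alpha> < real DIM('a::euclidean_space)" "0 < \<alpha>" "R > 0"
  shows "(\<integral>\<^sup>+v. ennreal (norm v powr (- \<alpha>)) * indicator (ball 0 R) (v::'a) \<partial>lborel) < \<infinity>"
proof -
  define N where "N = real DIM('a)"
  define a where "a = (\<lambda>n. (R / 2 ^ Suc n) powr (- \<alpha>))"
  define b where "b = (\<lambda>n. unit_ball_vol N * (R / 2 ^ n) ^ DIM('a))"
  have a0: "a n \<ge> 0" for n by (simp add: a_def)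
  have b0: "b n \<ge> 0" for n using assms unit_ball_vol_nonneg[of N] by (simp add: b_def N_def)
  have pt: "ennreal (norm v powr (- \<alpha>)) * indicator (ball 0 R) v \<le>
      (\<Sum>n. ennreal (a n) * indicator (ball 0 (R / 2 ^ n)) v)" for v :: 'a
  proof (cases "v \<in> ball 0 R \<and> v \<noteq> 0")
    case True
    then have v: "0 < norm v" "norm v < R" by auto
    \<comment> \<open>The index of the shell containing \<open>v\<close>: its definition gives the
      inner radius, minimality the outer one.\<close>
    define n where "n = (LEAST n. R / 2 ^ Suc n \<le> norm v)"
    have "\<exists>n. R / 2 ^ Suc n \<le> norm v"
    proof -
      obtain k :: nat where "R / norm v < 2 ^ k" using real_arch_pow[of 2 "R / norm v"] by auto
      then have "R < norm v * 2 ^ k" using v by (simp add: pos_divide_less_eq mult.commute)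
      moreover have "0 \<le> norm v * 2 ^ k" by simp
      ultimately have "R \<le> 2 * (norm v * 2 ^ k)" by linarith
      then have "R / 2 ^ Suc k \<le> norm v" by (simp add: divide_le_eq mult_ac)
      then show ?thesis by blast
    qed
    then have n1: "R / 2 ^ Suc n \<le> norm v" unfolding n_def by (rule LeastI_ex)
    have n2: "norm v < R / 2 ^ n"
    proof (cases n)
      case (Suc m)
      then have "\<not> R / 2 ^ Suc m \<le> norm v" using not_less_Least[of m "\<lambda>n. R / 2 ^ Suc n \<le> norm v"] by (simp add: n_def)
      then show ?thesis by (simp add: Suc)
    qed (use v in simp)
    have "norm v powr (- \<alpha>) \<le> a n"
      unfolding a_def using n1 assms by (intro powr_mono2') auto
    then have "ennreal (norm v powr (- \<alpha>)) * indicator (ball 0 R) v \<le>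
        ennreal (a n) * indicator (ball 0 (R / 2 ^ n)) v"
      using n2 by (auto simp: indicator_def intro: ennreal_leI)
    also have "\<dots> \<le> (\<Sum>n. ennreal (a n) * indicator (ball 0 (R / 2 ^ n)) v)"
      using sum_le_suminf[of "\<lambda>n. ennreal (a n) * indicator (ball 0 (R / 2 ^ n)) v" "{n}"] by (simp del: indicator_simps sum_mult_indicator)
    finally show ?thesis .
  qed (auto simp: indicator_def)
  have ab: "a n * b n = (a 0 * b 0) * (2 powr (\<alpha> - N)) ^ n" for n
  proof -
    have "a n = (R / 2) powr (- \<alpha>) * (2 powr \<alpha>) ^ n"
    proof -
      have "a n = ((R / 2) / 2 ^ n) powr (- \<alpha>)" by (simp add: a_def mult.commute)
      also have "\<dots> = (R / 2) powr (- \<alpha>) / (2 ^ n) powr (- \<alpha>)" using assms by (subst powr_divide) auto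
      also have "((2::real) ^ n) powr (- \<alpha>) = 1 / (2 powr \<alpha>) ^ n"
      proof -
        have "((2::real) ^ n) powr \<alpha> = (2 powr real n) powr \<alpha>" by (simp add: powr_realpow)
        also have "\<dots> = (2 powr \<alpha>) powr real n" by (simp only: powr_powr mult.commute)
        also have "\<dots> = (2 powr \<alpha>) ^ n" by (simp add: powr_realpow)
        finally show ?thesis by (simp add: powr_minus divide_inverse)
      qed
      finally show ?thesis by simp
    qed
    moreover have "b n = unit_ball_vol N * R ^ DIM('a) * (2 powr (- N)) ^ n"
    proof -
      have "((2::real) ^ n) ^ DIM('a) = (2 ^ DIM('a)) ^ n" by (simp add: mult.commute flip: power_mult)
      moreover have "2 powr (- N) = 1 / 2 ^ DIM('a)" by (simp add: N_def powr_minus powr_realpow divide_inverse)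
      ultimately show ?thesis by (simp add: b_def power_divide)
    qed
    moreover have "a 0 * b 0 = (R / 2) powr (- \<alpha>) * (unit_ball_vol N * R ^ DIM('a))" by (simp add: a_def b_def)
    moreover have "(2 powr (\<alpha> - N)) ^ n = (2 powr \<alpha>) ^ n * (2 powr (- N)) ^ n"
      by (simp add: power_mult_distrib[symmetric] powr_add[symmetric])
    ultimately show ?thesis by (simp only: mult_ac)
  qed
  have "(\<integral>\<^sup>+v. ennreal (norm v powr (- \<alpha>)) * indicator (ball 0 R) (v::'a) \<partial>lborel) \<le>
      (\<integral>\<^sup>+v. (\<Sum>n. ennreal (a n) * indicator (ball 0 (R / 2 ^ n)) (v::'a)) \<partial>lborel)"
    by (intro nn_integral_mono pt)
  also have "\<dots> = (\<Sum>n. \<integral>\<^sup>+v. ennreal (a n) * indicator (ball 0 (R / 2 ^ n)) (v::'a) \<partial>lborel)"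
  proof (rule nn_integral_suminf)
    fix n
    have [measurable]: "ball (0::'a) (R / 2 ^ n) \<in> sets borel" by simp
    show "(\<lambda>v::'a. ennreal (a n) * indicator (ball 0 (R / 2 ^ n)) v) \<in> borel_measurable lborel" by measurable
  qed
  also have "\<dots> = (\<Sum>n. ennreal (a n * b n))"
  proof (rule suminf_cong)
    fix n
    have "emeasure lborel (ball (0::'a) (R / 2 ^ n)) = ennreal (b n)"
      using assms by (subst emeasure_ball) (auto simp: b_def N_def)
    then show "(\<integral>\<^sup>+v. ennreal (a n) * indicator (ball 0 (R / 2 ^ n)) (v::'a) \<partial>lborel) = ennreal (a n * b n)"
      using a0 b0 by (subst nn_integral_cmult_indicator) (auto simp: ennreal_mult)
  qed
  also have "\<dots> < \<infinity>"
  proof -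
    have "2 powr (\<alpha> - N) < 1" using powr_less_mono[of "\<alpha> - N" 0 2] assms by (simp add: N_def)
    then have "summable (\<lambda>n. (a 0 * b 0) * (2 powr (\<alpha> - N)) ^ n)"
      by (intro summable_mult summable_geometric) auto
    then have "summable (\<lambda>n. a n * b n)" by (subst ab)
    then show ?thesis using a0 b0 by (subst suminf_ennreal2) auto
  qed
  finally show ?thesis .
qed

text \<open>Translation invariance replaces the moving centre by the origin, so the bounds below are
  uniform in \<open>y\<close>.\<close>

lemma nn_integral_translate_le:
  fixes \<Omega> :: "'a::euclidean_space set" and h :: "'a \<Rightarrow> ennreal"
  assumes [measurable]: "h \<in> borel_measurable borel" and "open \<Omega>" "\<And>x. x \<in> \<Omega> \<Longrightarrow> dist x y < R"
  shows "(\<integral>\<^sup>+x. h (x - y) \<partial>lebesgue_on \<Omega>) \<le> (\<integral>\<^sup>+v. h v * indicator (ball 0 R) v \<partial>lborel)"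
proof -
  have [measurable]: "ball (0::'a) R \<in> sets borel" by simp
  have meas: "(\<lambda>v. h v * indicator (ball 0 R) v) \<in> borel_measurable borel" by measurable
  have "(\<integral>\<^sup>+x. h (x - y) \<partial>lebesgue_on \<Omega>) = (\<integral>\<^sup>+x. h (x - y) * indicator \<Omega> x \<partial>lebesgue)"
    using assms by (intro nn_integral_restrict_space) auto
  also have "\<dots> \<le> (\<integral>\<^sup>+x. h (x - y) * indicator (ball 0 R) (x - y) \<partial>lebesgue)"
    using assms(3) by (intro nn_integral_mono mult_left_mono) (auto simp: indicator_def dist_norm norm_minus_commute)
  also have "\<dots> = (\<integral>\<^sup>+x. h (x - y) * indicator (ball 0 R) (x - y) \<partial>lborel)"
    by (intro nn_integral_completion) measurable
  also have "\<dots> = (\<integral>\<^sup>+v. h v * indicator (ball 0 R) v \<partial>distr lborel borel ((+) (- y)))"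
    using meas by (subst nn_integral_distr) auto
  also have "\<dots> = (\<integral>\<^sup>+v. h v * indicator (ball 0 R) v \<partial>lborel)"
    by (simp add: lborel_distr_plus)
  finally show ?thesis .
qed

lemma riesz_potential_bound:
  fixes \<Omega> :: "'a::euclidean_space set"
  assumes "open \<Omega>" "bounded \<Omega>" "\<alpha> < real DIM('a)" "0 < \<alpha>"
  shows "\<exists>I\<ge>0. \<forall>y\<in>\<Omega>. (\<integral>\<^sup>+x. ennreal (dist x y powr (- \<alpha>)) \<partial>lebesgue_on \<Omega>) \<le> ennreal I"
proof -
  \<comment> \<open>The summand 1 makes \<open>R\<close> positive and the distance bound strict, as
    an open ball requires.\<close>
  define R where "R = diameter \<Omega> + 1"
  have R: "R > 0" using diameter_ge_0[OF assms(2)] by (simp add: R_def)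
  have d: "dist x y < R" if "x \<in> \<Omega>" "y \<in> \<Omega>" for x y
    using diameter_bounded_bound[OF assms(2) that] by (simp add: R_def)
  have "(\<integral>\<^sup>+v. ennreal (norm v powr (- \<alpha>)) * indicator (ball 0 R) (v::'a) \<partial>lborel) < \<infinity>"
    using assms R by (intro nn_integral_riesz_ball_finite)
  then obtain I where I: "I \<ge> 0"
    "(\<integral>\<^sup>+v. ennreal (norm v powr (- \<alpha>)) * indicator (ball 0 R) (v::'a) \<partial>lborel) = ennreal I"
    by (cases "\<integral>\<^sup>+v. ennreal (norm v powr (- \<alpha>)) * indicator (ball 0 R) (v::'a) \<partial>lborel") auto
  have "(\<integral>\<^sup>+x. ennreal (dist x y powr (- \<alpha>)) \<partial>lebesgue_on \<Omega>) \<le> ennreal I" if "y \<in> \<Omega>" for y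
    using nn_integral_translate_le[of "\<lambda>v. ennreal (norm v powr (- \<alpha>))" \<Omega> y R] assms d that
    by (simp add: I dist_norm)
  then show ?thesis using I by blast
qed

text \<open>Uniform integrability of the Riesz kernels. Since \<open>ennreal\<close> sends negative
  reals to 0, the integrand is the excess of the kernel over the level \<open>m\<close>; dominated
  convergence on one fixed ball makes it small for all centres at once.\<close>

lemma riesz_potential_tail:
  fixes \<Omega> :: "'a::euclidean_space set"
  assumes "open \<Omega>" "bounded \<Omega>" "\<alpha> < real DIM('a)" "0 < \<alpha>" "e > 0"
  shows "\<exists>m\<ge>0. \<forall>y\<in>\<Omega>. (\<integral>\<^sup>+x. ennreal (c * dist x y powr (- \<alpha>) - m) \<partial>lebesgue_on \<Omega>) \<le> ennreal e"
proof -
  define R where "R = diameter \<Omega> + 1"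
  have R: "R > 0" using diameter_ge_0[OF assms(2)] by (simp add: R_def)
  have d: "dist x y < R" if "x \<in> \<Omega>" "y \<in> \<Omega>" for x y
    using diameter_bounded_bound[OF assms(2) that] by (simp add: R_def)
  have fin: "(\<integral>\<^sup>+v. ennreal (norm v powr (- \<alpha>)) * indicator (ball 0 R) (v::'a) \<partial>lborel) < \<infinity>"
    using assms R by (intro nn_integral_riesz_ball_finite)
  have [measurable]: "ball (0::'a) R \<in> sets borel" by simp
  let ?h = "\<lambda>n (v::'a). ennreal (c * norm v powr (- \<alpha>) - real n)"
  have "(\<lambda>n. \<integral>\<^sup>+v. ?h n v * indicator (ball 0 R) v \<partial>lborel) \<longlonglongrightarrow> (\<integral>\<^sup>+(v::'a). 0 \<partial>lborel)"
  proof (rule nn_integral_dominated_convergence)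
    show "AE v in lborel. ?h n v * indicator (ball 0 R) v \<le>
        ennreal \<bar>c\<bar> * (ennreal (norm v powr (- \<alpha>)) * indicator (ball 0 R) v)" for n
    proof (rule AE_I2)
      fix v :: 'a
      have "c * norm v powr (- \<alpha>) \<le> \<bar>c\<bar> * norm v powr (- \<alpha>)" by (intro mult_right_mono) auto
      then have "c * norm v powr (- \<alpha>) - real n \<le> \<bar>c\<bar> * norm v powr (- \<alpha>)" by simp
      then show "?h n v * indicator (ball 0 R) v \<le>
          ennreal \<bar>c\<bar> * (ennreal (norm v powr (- \<alpha>)) * indicator (ball 0 R) v)"
        by (simp add: ennreal_leI indicator_def flip: ennreal_mult)
    qed
    show "(\<integral>\<^sup>+v. ennreal \<bar>c\<bar> * (ennreal (norm v powr (- \<alpha>)) * indicator (ball 0 R) (v::'a)) \<partial>lborel) < \<infinity>"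
      using fin by (subst nn_integral_cmult) (measurable, auto simp: ennreal_mult_less_top)
    show "AE v::'a in lborel. (\<lambda>n. ?h n v * indicator (ball 0 R) v) \<longlonglongrightarrow> 0"
    proof (rule AE_I2)
      fix v :: 'a
      obtain n0 where "c * norm v powr (- \<alpha>) \<le> real n0" using real_arch_simple by blast
      then have "c * norm v powr (- \<alpha>) \<le> real n" if "n \<ge> n0" for n
        using that of_nat_mono[OF that, where 'a = real] by linarith
      then have "\<forall>\<^sub>F n in sequentially. c * norm v powr (- \<alpha>) - real n \<le> 0"
        unfolding eventually_sequentially diff_le_0_iff_le by blast
      then have "\<forall>\<^sub>F n in sequentially. ?h n v * indicator (ball 0 R) v = 0"
        by (rule eventually_mono) (simp only: ennreal_neg mult_zero_left)
      then show "(\<lambda>n. ?h n v * indicator (ball 0 R) v) \<longlonglongrightarrow> 0" by (rule tendsto_eventually)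
    qed
  next
    show "(\<lambda>v. ?h n v * indicator (ball 0 R) v) \<in> borel_measurable lborel" for n by measurable
    show "(\<lambda>v::'a. ennreal \<bar>c\<bar> * (ennreal (norm v powr (- \<alpha>)) * indicator (ball 0 R) v)) \<in> borel_measurable lborel"
      by measurable
  qed simp
  then have "\<forall>\<^sub>F n in sequentially. (\<integral>\<^sup>+v. ?h n v * indicator (ball 0 R) v \<partial>lborel) < ennreal e"
    using assms(5) by (intro order_tendstoD(2)) auto
  then obtain n where n: "(\<integral>\<^sup>+v. ?h n v * indicator (ball 0 R) v \<partial>lborel) < ennreal e"
    unfolding eventually_sequentially by blast
  have "(\<integral>\<^sup>+x. ennreal (c * dist x y powr (- \<alpha>) - real n) \<partial>lebesgue_on \<Omega>) \<le> ennreal e" if "y \<in> \<Omega>" for y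
    using nn_integral_translate_le[of "?h n" \<Omega> y R] assms d that n
    by (simp add: dist_norm)
  then show ?thesis by (intro exI[of _ "real n"]) auto
qed

section \<open>The distance to the boundary\<close>

lemma bdist_pos: "open \<Omega> \<Longrightarrow> bounded \<Omega> \<Longrightarrow> x \<in> \<Omega> \<Longrightarrow> 0 < bdist \<Omega> x"
proof -
  assume a: "open \<Omega>" "bounded \<Omega>" "x \<in> \<Omega>"
  then have "\<Omega> \<noteq> UNIV" using not_bounded_UNIV by auto
  then have "- \<Omega> \<noteq> {}" by auto
  then show ?thesis using a infdist_pos_not_in_closed[of "- \<Omega>" x] by (simp add: bdist_def closed_Compl)
qed

lemma bdist_nonneg [simp]: "0 \<le> bdist \<Omega> x"
  by (simp add: bdist_def infdist_nonneg)

lemma bdist_outside: "x \<notin> \<Omega> \<Longrightarrow> bdist \<Omega> x = 0"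
  by (simp add: bdist_def)

lemma bdist_lipschitz: "bdist \<Omega> x \<le> bdist \<Omega> y + dist x y"
  unfolding bdist_def by (rule infdist_triangle)

lemma bdist_bounded:
  assumes "bounded \<Omega>"
  shows "\<exists>D\<ge>1. (\<forall>x\<in>\<Omega>. bdist \<Omega> x \<le> D) \<and> (\<forall>x\<in>\<Omega>. \<forall>y\<in>\<Omega>. dist x y \<le> D)"
proof -
  have "\<Omega> \<noteq> UNIV" using assms not_bounded_UNIV by auto
  then obtain p where p: "p \<notin> \<Omega>" by auto
  obtain e where e: "\<And>x. x \<in> \<Omega> \<Longrightarrow> dist p x \<le> e" using assms bounded_any_center[of \<Omega> p] by auto
  have "bdist \<Omega> x \<le> e" if "x \<in> \<Omega>" for x
    using infdist_le[of p "- \<Omega>" x] p e[OF that] by (simp add: bdist_def dist_commute)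
  moreover have "dist x y \<le> 2 * e" if "x \<in> \<Omega>" "y \<in> \<Omega>" for x y
    using dist_triangle3[of x y p] e[OF that(1)] e[OF that(2)] by simp
  ultimately show ?thesis
    by (intro exI[of _ "max 1 (max e (2 * e))"]) (auto simp: le_max_iff_disj)
qed

lemma bdist_measurable [measurable]: "bdist \<Omega> \<in> borel_measurable borel"
  unfolding bdist_def[abs_def]
  by (intro borel_measurable_continuous_onI continuous_on_infdist continuous_on_id)

section \<open>Kernels with a Kato inequality\<close>

definition bounded_measurable :: "'a::euclidean_space set \<Rightarrow> ('a \<Rightarrow> real) set" where
  "bounded_measurable \<Omega> = {f \<in> borel_measurable (lebesgue_on \<Omega>). \<exists>C. \<forall>x\<in>\<Omega>. \<bar>f x\<bar> \<le> C}"

definition potential :: "('a \<Rightarrow> 'a \<Rightarrow> real) \<Rightarrow> 'a measure \<Rightarrow> ('a \<Rightarrow> real) \<Rightarrow> 'a \<Rightarrow> real" where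
  "potential K N h x = (\<integral>y. K x y * h y \<partial>N)"

text \<open>The semilinear theory sees the operator through these properties of its kernel.
  \<open>K_weight\<close> and \<open>K_lower\<close> make the potential of the weight comparable to
  the weight. \<open>K_integral\<close> serves the bounds for bounded functions and the quadratic
  form. \<open>K_continuous\<close> is what the approximation of measures rests on. The form itself
  survives in two inequalities for bounded functions, Kato's inequality and positivity.\<close>

locale dual_kernel =
  fixes \<Omega> :: "'a::euclidean_space set" and \<gamma> :: real and K :: "'a \<Rightarrow> 'a \<Rightarrow> real"
    and C\<^sub>0 C\<^sub>1 c\<^sub>1 :: real
  assumes open_domain: "open \<Omega>" and bounded_domain: "bounded \<Omega>" and \<gamma>_pos: "0 < \<gamma>"
    and K_borel: "(\<lambda>z. K (fst z) (snd z)) \<in> borel_measurable (borel \<Otimes>\<^sub>M borel)"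
    and K_nonneg: "0 \<le> K x y"
    and K_sym: "K x y = K y x"
    and const_nonneg: "0 \<le> C\<^sub>0" "0 \<le> C\<^sub>1" "0 < c\<^sub>1"
    and K_integral: "x \<in> \<Omega> \<Longrightarrow> (\<integral>\<^sup>+y. ennreal (K x y) \<partial>lebesgue_on \<Omega>) \<le> ennreal C\<^sub>1"
    and K_weight: "x \<in> \<Omega> \<Longrightarrow>
      (\<integral>\<^sup>+y. ennreal (K x y * bdist \<Omega> y powr \<gamma>) \<partial>lebesgue_on \<Omega>) \<le> ennreal (C\<^sub>0 * bdist \<Omega> x powr \<gamma>)"
    and K_lower: "x \<in> \<Omega> \<Longrightarrow>
      c\<^sub>1 * bdist \<Omega> x powr \<gamma> \<le> (\<integral>y. K x y * bdist \<Omega> y powr \<gamma> \<partial>lebesgue_on \<Omega>)"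
    and K_continuous: "y \<in> \<Omega> \<Longrightarrow> 0 < e \<Longrightarrow>
      \<exists>d>0. \<forall>z\<in>\<Omega>. dist z y < d \<longrightarrow> (\<integral>\<^sup>+x. ennreal \<bar>K x z - K x y\<bar> \<partial>lebesgue_on \<Omega>) \<le> ennreal e"
    and kato_bounded: "f \<in> bounded_measurable \<Omega> \<Longrightarrow> 0 < e \<Longrightarrow>
      (\<integral>x. bdist \<Omega> x powr \<gamma> * jfun e (potential K (lebesgue_on \<Omega>) f x) \<partial>lebesgue_on \<Omega>) \<le>
      (\<integral>x. f x * (pfun e (potential K (lebesgue_on \<Omega>) f x) *
         potential K (lebesgue_on \<Omega>) (\<lambda>y. bdist \<Omega> y powr \<gamma>) x) \<partial>lebesgue_on \<Omega>)"
    and potential_form_nonneg: "f \<in> bounded_measurable \<Omega> \<Longrightarrow>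
      0 \<le> (\<integral>x. f x * potential K (lebesgue_on \<Omega>) f x \<partial>lebesgue_on \<Omega>)"
begin

abbreviation M where "M \<equiv> lebesgue_on \<Omega>"
abbreviation \<rho> where "\<rho> x \<equiv> bdist \<Omega> x powr \<gamma>"
abbreviation pot where "pot \<equiv> potential K M"
abbreviation \<phi> where "\<phi> \<equiv> pot \<rho>"
abbreviation Bd where "Bd \<equiv> bounded_measurable \<Omega>"

sublocale finite_measure M
  using open_domain bounded_domain by (intro finite_measure_lebesgue_on lmeasurable_open)

lemma space_M [simp]: "space M = \<Omega>" using open_domain by auto

lemma id_measurable_M [measurable]: "(\<lambda>x. x) \<in> borel_measurable M"
  by (intro measurable_restrict_space1 measurable_completion) simp

lemma K_measurable [measurable (raw)]:
  assumes "f \<in> borel_measurable N" "g \<in> borel_measurable N"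
  shows "(\<lambda>x. K (f x) (g x)) \<in> borel_measurable N"
  using measurable_compose[OF measurable_Pair[OF assms] K_borel] by simp

lemma \<rho>_pos: "x \<in> \<Omega> \<Longrightarrow> 0 < \<rho> x"
  using bdist_pos[OF open_domain bounded_domain, of x] by simp

lemma \<rho>_bounded: "\<exists>R>0. \<forall>x. \<rho> x \<le> R"
proof -
  obtain D where D: "D \<ge> 1" "\<And>x. x \<in> \<Omega> \<Longrightarrow> bdist \<Omega> x \<le> D" using bdist_bounded[OF bounded_domain] by blast
  have "\<rho> x \<le> D powr \<gamma>" for x
    using D(2)[of x] \<gamma>_pos bdist_outside[of x \<Omega>] by (cases "x \<in> \<Omega>") (auto intro: powr_mono2)
  then show ?thesis using D by (intro exI[of _ "D powr \<gamma>"]) auto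
qed

lemma K_weight_swap: "x \<in> \<Omega> \<Longrightarrow> (\<integral>\<^sup>+y. ennreal (K y x * \<rho> y) \<partial>M) \<le> ennreal (C\<^sub>0 * \<rho> x)"
  using K_weight[of x] by (simp only: K_sym[of x])

text \<open>
  The pairs of a measure and a density that represent a signed measure with finite weighted
  variation: both functions and measures enter as right-hand sides.
\<close>

definition weighted :: "'a measure \<Rightarrow> ('a \<Rightarrow> real) \<Rightarrow> bool" where
  "weighted N h \<longleftrightarrow> sigma_finite_measure N \<and> space N = \<Omega> \<and> (\<lambda>x. x) \<in> borel_measurable N \<and>
     h \<in> borel_measurable N \<and> integrable N (\<lambda>y. h y * \<rho> y)"

lemma weighted_M_iff: "weighted M f \<longleftrightarrow> f \<in> borel_measurable M \<and> integrable M (\<lambda>x. f x * \<rho> x)"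
  using sigma_finite_measure_axioms by (simp add: weighted_def)

lemma weighted_M_iff_L1: "weighted M f \<longleftrightarrow> f \<in> L1_weighted \<Omega> \<gamma>"
proof -
  have "integrable M (\<lambda>x. f x * \<rho> x) \<longleftrightarrow> integrable M (\<lambda>x. \<bar>f x\<bar> * \<rho> x)" if [measurable]: "f \<in> borel_measurable M"
    using integrable_norm_iff[of "\<lambda>x. f x * \<rho> x" M] by (simp add: abs_mult)
  then show ?thesis by (auto simp: weighted_M_iff L1_weighted_def)
qed

lemma weighted_cong_AE:
  assumes "weighted M f" "g \<in> borel_measurable M" "AE x in M. f x = g x"
  shows "weighted M g"
proof -
  have [measurable]: "f \<in> borel_measurable M" "g \<in> borel_measurable M" using assms by (auto simp: weighted_M_iff)
  have "integrable M (\<lambda>x. f x * \<rho> x) \<longleftrightarrow> integrable M (\<lambda>x. g x * \<rho> x)"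
    using assms(3) by (intro integrable_cong_AE) (auto elim: eventually_mono)
  then show ?thesis using assms by (simp add: weighted_M_iff)
qed

lemma weighted_bound:
  assumes "weighted M f" "g \<in> borel_measurable M" "AE x in M. \<bar>g x\<bar> \<le> \<bar>f x\<bar>"
  shows "weighted M g"
proof -
  have [measurable]: "f \<in> borel_measurable M" "g \<in> borel_measurable M" using assms by (auto simp: weighted_M_iff)
  have "integrable M (\<lambda>x. g x * \<rho> x)"
  proof (rule Bochner_Integration.integrable_bound)
    show "integrable M (\<lambda>x. f x * \<rho> x)" using assms by (auto simp: weighted_M_iff)
    show "AE x in M. norm (g x * \<rho> x) \<le> norm (f x * \<rho> x)"
      using assms(3) by eventually_elim (simp add: abs_mult mult_right_mono)
  qed simp
  then show ?thesis by (simp add: weighted_M_iff)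
qed

lemma weighted_add: "weighted M f \<Longrightarrow> weighted M g \<Longrightarrow> weighted M (\<lambda>x. f x + g x)"
  by (auto simp: weighted_M_iff distrib_right)

lemma weighted_diff: "weighted M f \<Longrightarrow> weighted M g \<Longrightarrow> weighted M (\<lambda>x. f x - g x)"
  by (auto simp: weighted_M_iff left_diff_distrib)

lemma weighted_uminus: "weighted M f \<Longrightarrow> weighted M (\<lambda>x. - f x)"
  by (auto simp: weighted_M_iff)

lemma weighted_cmult: "weighted M f \<Longrightarrow> weighted M (\<lambda>x. c * f x)"
  by (auto simp: weighted_M_iff mult.assoc)

lemma weighted_abs: "weighted M f \<Longrightarrow> weighted M (\<lambda>x. \<bar>f x\<bar>)"
  by (rule weighted_bound[of f]) (auto simp: weighted_M_iff)

lemma weighted_sign_mult: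
  assumes "weighted M f" "s \<in> borel_measurable M" "\<And>x. \<bar>s x\<bar> \<le> C"
  shows "weighted M (\<lambda>x. f x * s x)"
proof (rule weighted_bound)
  show "weighted M (\<lambda>x. C * f x)" by (rule weighted_cmult) fact
  have "\<bar>f x\<bar> * \<bar>s x\<bar> \<le> \<bar>f x\<bar> * \<bar>C\<bar>" for x using assms(3)[of x] by (intro mult_left_mono) auto
  then show "AE x in M. \<bar>f x * s x\<bar> \<le> \<bar>C * f x\<bar>" by (simp add: abs_mult mult.commute)
qed (use assms in \<open>auto simp: weighted_M_iff\<close>)

lemma Bd_measurable [measurable_dest]: "f \<in> Bd \<Longrightarrow> f \<in> borel_measurable M"
  by (simp add: bounded_measurable_def)

lemma BdI: "f \<in> borel_measurable M \<Longrightarrow> (\<And>x. x \<in> \<Omega> \<Longrightarrow> \<bar>f x\<bar> \<le> C) \<Longrightarrow> f \<in> Bd"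
  by (auto simp: bounded_measurable_def)

lemma Bd_E: "f \<in> Bd \<Longrightarrow> \<exists>C\<ge>0. \<forall>x\<in>\<Omega>. \<bar>f x\<bar> \<le> C"
proof -
  assume "f \<in> Bd"
  then obtain C where "\<forall>x\<in>\<Omega>. \<bar>f x\<bar> \<le> C" by (auto simp: bounded_measurable_def)
  then show ?thesis by (intro exI[of _ "\<bar>C\<bar>"]) (auto intro: order_trans)
qed

lemma Bd_integrable: "f \<in> Bd \<Longrightarrow> integrable M f"
proof -
  assume f: "f \<in> Bd"
  then obtain C where "\<forall>x\<in>\<Omega>. \<bar>f x\<bar> \<le> C" using Bd_E by blast
  then show ?thesis using Bd_measurable[OF f] by (intro integrable_const_bound[where B = C]) auto
qed

lemma Bd_add: "f \<in> Bd \<Longrightarrow> g \<in> Bd \<Longrightarrow> (\<lambda>x. f x + g x) \<in> Bd"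
proof -
  assume fg: "f \<in> Bd" "g \<in> Bd"
  from Bd_E[OF fg(1)] Bd_E[OF fg(2)] obtain C D
    where CD: "\<forall>x\<in>\<Omega>. \<bar>f x\<bar> \<le> C" "\<forall>x\<in>\<Omega>. \<bar>g x\<bar> \<le> D" by blast
  have "\<bar>f x + g x\<bar> \<le> C + D" if "x \<in> \<Omega>" for x
    using CD that abs_triangle_ineq[of "f x" "g x"] by fastforce
  then show ?thesis using fg by (intro BdI[where C = "C + D"]) (auto simp: bounded_measurable_def)
qed

lemma Bd_mult: "f \<in> Bd \<Longrightarrow> g \<in> Bd \<Longrightarrow> (\<lambda>x. f x * g x) \<in> Bd"
proof -
  assume fg: "f \<in> Bd" "g \<in> Bd"
  from Bd_E[OF fg(1)] Bd_E[OF fg(2)] obtain C D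
    where CD: "C \<ge> 0" "\<forall>x\<in>\<Omega>. \<bar>f x\<bar> \<le> C" "\<forall>x\<in>\<Omega>. \<bar>g x\<bar> \<le> D" by blast
  have "\<bar>f x * g x\<bar> \<le> C * D" if "x \<in> \<Omega>" for x
    unfolding abs_mult using CD that by (intro mult_mono) auto
  then show ?thesis using fg by (intro BdI[where C = "C * D"]) (auto simp: bounded_measurable_def)
qed

lemma Bd_const: "(\<lambda>x. c) \<in> Bd"
  by (rule BdI[where C = "\<bar>c\<bar>"]) auto

lemma Bd_cmult: "f \<in> Bd \<Longrightarrow> (\<lambda>x. c * f x) \<in> Bd"
  by (rule Bd_mult[OF Bd_const])

lemma Bd_uminus: "f \<in> Bd \<Longrightarrow> (\<lambda>x. - f x) \<in> Bd"
  using Bd_cmult[of f "-1"] by simp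

lemma Bd_diff: "f \<in> Bd \<Longrightarrow> g \<in> Bd \<Longrightarrow> (\<lambda>x. f x - g x) \<in> Bd"
  using Bd_add[OF _ Bd_uminus, of f g] by simp

lemma \<rho>_Bd: "\<rho> \<in> Bd"
  using \<rho>_bounded by (auto intro!: BdI)

lemma Bd_weighted: "f \<in> Bd \<Longrightarrow> weighted M f"
  using Bd_integrable[OF Bd_mult[OF _ \<rho>_Bd]] by (simp add: weighted_M_iff bounded_measurable_def)

section \<open>Potentials of functions and of measures\<close>

lemma pair_sf: "weighted N h \<Longrightarrow> pair_sigma_finite M N"
  using sigma_finite_measure_axioms by (simp add: weighted_def pair_sigma_finite_def)

lemma potential_fubini:
  assumes w: "weighted N h" and \<xi>: "\<xi> \<in> borel_measurable M" "\<And>x. x \<in> \<Omega> \<Longrightarrow> \<bar>\<xi> x\<bar> \<le> C * \<rho> x"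
  shows "integrable (M \<Otimes>\<^sub>M N) (\<lambda>(x, y). \<xi> x * (K x y * h y))"
proof -
  interpret P: pair_sigma_finite M N using w by (rule pair_sf)
  have [measurable]: "h \<in> borel_measurable N" "(\<lambda>x. x) \<in> borel_measurable N" "\<xi> \<in> borel_measurable M"
    and sp: "space N = \<Omega>" using w \<xi> by (auto simp: weighted_def)
  have [measurable]: "fst \<in> borel_measurable (M \<Otimes>\<^sub>M N)" "snd \<in> borel_measurable (M \<Otimes>\<^sub>M N)"
    using measurable_compose[OF measurable_fst id_measurable_M] measurable_compose[OF measurable_snd, of "\<lambda>x. x" N borel M]
    by auto
  define C' where "C' = \<bar>C\<bar>"
  have C': "\<And>x. x \<in> \<Omega> \<Longrightarrow> \<bar>\<xi> x\<bar> \<le> C' * \<rho> x" "C' \<ge> 0"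
    unfolding C'_def by (rule order_trans[OF \<xi>(2) mult_right_mono[OF abs_ge_self]]; simp) simp
  have "(\<integral>\<^sup>+z. ennreal (norm (\<xi> (fst z) * (K (fst z) (snd z) * h (snd z)))) \<partial>(M \<Otimes>\<^sub>M N)) =
      (\<integral>\<^sup>+y. (\<integral>\<^sup>+x. ennreal (norm (\<xi> x * (K x y * h y))) \<partial>M) \<partial>N)"
    by (subst P.nn_integral_snd[symmetric]) auto
  also have "\<dots> \<le> (\<integral>\<^sup>+y. ennreal (C' * C\<^sub>0) * ennreal \<bar>h y * \<rho> y\<bar> \<partial>N)"
  proof (rule nn_integral_mono)
    fix y assume "y \<in> space N"
    then have y: "y \<in> \<Omega>" using sp by simp
    have "(\<integral>\<^sup>+x. ennreal (norm (\<xi> x * (K x y * h y))) \<partial>M) \<le>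
        (\<integral>\<^sup>+x. ennreal (C' * \<bar>h y\<bar>) * ennreal (K x y * \<rho> x) \<partial>M)"
    proof (rule nn_integral_mono)
      fix x assume "x \<in> space M"
      then have "\<bar>\<xi> x\<bar> * (K x y * \<bar>h y\<bar>) \<le> (C' * \<rho> x) * (K x y * \<bar>h y\<bar>)"
        using C' K_nonneg by (intro mult_right_mono) auto
      then show "ennreal (norm (\<xi> x * (K x y * h y))) \<le> ennreal (C' * \<bar>h y\<bar>) * ennreal (K x y * \<rho> x)"
        using C' K_nonneg by (simp add: abs_mult mult_ac ennreal_leI flip: ennreal_mult)
    qed
    also have "\<dots> = ennreal (C' * \<bar>h y\<bar>) * (\<integral>\<^sup>+x. ennreal (K x y * \<rho> x) \<partial>M)"
      by (intro nn_integral_cmult) auto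
    also have "\<dots> \<le> ennreal (C' * \<bar>h y\<bar>) * ennreal (C\<^sub>0 * \<rho> y)"
      using K_weight_swap[OF y] by (intro mult_left_mono) auto
    also have "\<dots> = ennreal (C' * C\<^sub>0) * ennreal \<bar>h y * \<rho> y\<bar>"
      using C' const_nonneg by (simp add: abs_mult mult_ac flip: ennreal_mult)
    finally show "(\<integral>\<^sup>+x. ennreal (norm (\<xi> x * (K x y * h y))) \<partial>M) \<le> ennreal (C' * C\<^sub>0) * ennreal \<bar>h y * \<rho> y\<bar>" .
  qed
  also have "\<dots> < \<infinity>"
  proof -
    have "integrable N (\<lambda>y. h y * \<rho> y)" using w by (simp add: weighted_def)
    then have "(\<integral>\<^sup>+y. ennreal \<bar>h y * \<rho> y\<bar> \<partial>N) < \<infinity>" by (simp add: integrable_iff_bounded)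
    moreover have "(\<integral>\<^sup>+y. ennreal (C' * C\<^sub>0) * ennreal \<bar>h y * \<rho> y\<bar> \<partial>N) =
        ennreal (C' * C\<^sub>0) * (\<integral>\<^sup>+y. ennreal \<bar>h y * \<rho> y\<bar> \<partial>N)"
      by (intro nn_integral_cmult) auto
    ultimately show ?thesis by (simp add: ennreal_mult_less_top)
  qed
  finally show ?thesis
    by (subst integrable_iff_bounded) (auto simp: case_prod_beta')
qed

lemma potential_weighted_facts:
  assumes w: "weighted N h"
  shows potential_AE_integrable: "AE x in M. integrable N (\<lambda>y. K x y * h y)"
    and potential_weighted: "weighted M (potential K N h)"
proof -
  interpret P: pair_sigma_finite M N using w by (rule pair_sf)
  have [measurable]: "h \<in> borel_measurable N" "(\<lambda>x. x) \<in> borel_measurable N"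
    using w by (auto simp: weighted_def)
  \<comment> \<open>The weight itself is the test function; it is positive on \<Omega> and can be
    divided out again.\<close>
  have i: "integrable (M \<Otimes>\<^sub>M N) (\<lambda>(x, y). \<rho> x * (K x y * h y))"
    by (rule potential_fubini[OF w, of \<rho> 1]) auto
  from P.AE_integrable_fst'[OF i]
  show "AE x in M. integrable N (\<lambda>y. K x y * h y)"
    using AE_space
  proof eventually_elim
    case (elim x)
    then show ?case using \<rho>_pos[of x] by simp
  qed
  have m: "potential K N h \<in> borel_measurable M"
    unfolding potential_def
    by (rule P.M2.borel_measurable_lebesgue_integral) (simp add: case_prod_beta', measurable)
  from P.integrable_fst'[OF i] have "integrable M (\<lambda>x. potential K N h x * \<rho> x)"
    by (simp add: potential_def mult.commute)
  then show "weighted M (potential K N h)" using m by (simp add: weighted_M_iff)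
qed

lemma potential_symmetric:
  assumes w: "weighted N h" and \<xi>: "\<xi> \<in> borel_measurable M" "\<And>x. x \<in> \<Omega> \<Longrightarrow> \<bar>\<xi> x\<bar> \<le> C * \<rho> x"
  shows "(\<integral>x. potential K N h x * \<xi> x \<partial>M) = (\<integral>y. pot \<xi> y * h y \<partial>N)"
    and "integrable M (\<lambda>x. potential K N h x * \<xi> x)"
    and "integrable N (\<lambda>y. pot \<xi> y * h y)"
proof -
  interpret P: pair_sigma_finite M N using w by (rule pair_sf)
  have i: "integrable (M \<Otimes>\<^sub>M N) (\<lambda>(x, y). \<xi> x * (K x y * h y))"
    by (rule potential_fubini[OF w \<xi>])
  have a: "(\<integral>y. \<xi> x * (K x y * h y) \<partial>N) = potential K N h x * \<xi> x" for x
    by (simp add: potential_def mult.commute)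
  have b: "(\<integral>x. \<xi> x * (K x y * h y) \<partial>M) = pot \<xi> y * h y" for y
  proof -
    have "(\<lambda>x. \<xi> x * (K x y * h y)) = (\<lambda>x. K y x * \<xi> x * h y)" by (simp add: K_sym mult_ac)
    then show ?thesis by (simp add: potential_def)
  qed
  show "(\<integral>x. potential K N h x * \<xi> x \<partial>M) = (\<integral>y. pot \<xi> y * h y \<partial>N)"
    using P.Fubini_integral[OF i] unfolding a b by simp
  show "integrable M (\<lambda>x. potential K N h x * \<xi> x)"
    using P.integrable_fst'[OF i] by (simp add: potential_def mult.commute)
  show "integrable N (\<lambda>y. pot \<xi> y * h y)"
    using P.integrable_snd[OF i] by (simp add: b)
qed

lemma potential_Bd_integrable: "f \<in> Bd \<Longrightarrow> x \<in> \<Omega> \<Longrightarrow> integrable M (\<lambda>y. K x y * f y)"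
  and potential_Bd_bound: "f \<in> Bd \<Longrightarrow> x \<in> \<Omega> \<Longrightarrow> (\<And>y. y \<in> \<Omega> \<Longrightarrow> \<bar>f y\<bar> \<le> C) \<Longrightarrow> 0 \<le> C \<Longrightarrow> \<bar>pot f x\<bar> \<le> C\<^sub>1 * C"
proof -
  have K1: "integrable M (\<lambda>y. K x y)" "(\<integral>y. K x y \<partial>M) \<le> C\<^sub>1" if "x \<in> \<Omega>" for x
  proof -
    show i: "integrable M (\<lambda>y. K x y)"
      using K_integral[OF that] K_nonneg le_less_trans[of _ "ennreal C\<^sub>1" \<infinity>]
      by (intro integrableI_nonneg) auto
    have "ennreal (\<integral>y. K x y \<partial>M) = (\<integral>\<^sup>+y. ennreal (K x y) \<partial>M)"
      using i K_nonneg by (intro nn_integral_eq_integral[symmetric]) auto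
    also have "\<dots> \<le> ennreal C\<^sub>1" by (rule K_integral[OF that])
    finally show "(\<integral>y. K x y \<partial>M) \<le> C\<^sub>1" using const_nonneg by simp
  qed
  have dom: "integrable M (\<lambda>y. K x y * f y) \<and> \<bar>pot f x\<bar> \<le> C\<^sub>1 * C"
    if f: "f \<in> Bd" and x: "x \<in> \<Omega>" and C: "\<And>y. y \<in> \<Omega> \<Longrightarrow> \<bar>f y\<bar> \<le> C" "0 \<le> C" for f x C
  proof -
    have [measurable]: "f \<in> borel_measurable M" using f by (rule Bd_measurable)
    have le: "norm (K x y * f y) \<le> K x y * C" if "y \<in> space M" for y
      using C(1)[of y] that K_nonneg[of x y] by (simp add: abs_mult mult_left_mono)
    have i: "integrable M (\<lambda>y. K x y * f y)"
    proof (rule Bochner_Integration.integrable_bound)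
      show "integrable M (\<lambda>y. K x y * C)" using K1(1)[OF x] by simp
      show "AE y in M. norm (K x y * f y) \<le> norm (K x y * C)"
        using le by (intro AE_I2) (metis abs_ge_self order_trans real_norm_def)
    qed simp
    have "norm (pot f x) \<le> (\<integral>y. K x y * C \<partial>M)"
      unfolding potential_def using le K1(1)[OF x]
      by (intro order_trans[OF integral_norm_bound integral_mono] integrable_norm i) auto
    also have "\<dots> \<le> C\<^sub>1 * C" using K1(2)[OF x] C(2) by (simp add: mult_right_mono)
    finally show ?thesis using i by simp
  qed
  show "f \<in> Bd \<Longrightarrow> x \<in> \<Omega> \<Longrightarrow> integrable M (\<lambda>y. K x y * f y)" using Bd_E[of f] dom by blast
  show "f \<in> Bd \<Longrightarrow> x \<in> \<Omega> \<Longrightarrow> (\<And>y. y \<in> \<Omega> \<Longrightarrow> \<bar>f y\<bar> \<le> C) \<Longrightarrow> 0 \<le> C \<Longrightarrow> \<bar>pot f x\<bar> \<le> C\<^sub>1 * C"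
    using dom by blast
qed

lemma pot_measurable: "weighted M f \<Longrightarrow> pot f \<in> borel_measurable M"
  using potential_weighted[of M f] by (simp add: weighted_M_iff)

lemma pot_Bd: "f \<in> Bd \<Longrightarrow> pot f \<in> Bd"
proof -
  assume f: "f \<in> Bd"
  then obtain C where C: "C \<ge> 0" "\<And>x. x \<in> \<Omega> \<Longrightarrow> \<bar>f x\<bar> \<le> C" using Bd_E by blast
  show ?thesis
    by (rule BdI[OF pot_measurable[OF Bd_weighted[OF f]] potential_Bd_bound[OF f _ C(2,1)]])
qed

lemma pot_add: "f \<in> Bd \<Longrightarrow> g \<in> Bd \<Longrightarrow> x \<in> \<Omega> \<Longrightarrow> pot (\<lambda>x. f x + g x) x = pot f x + pot g x"
  unfolding potential_def using potential_Bd_integrable by (simp add: distrib_left)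

lemma pot_diff: "f \<in> Bd \<Longrightarrow> g \<in> Bd \<Longrightarrow> x \<in> \<Omega> \<Longrightarrow> pot (\<lambda>x. f x - g x) x = pot f x - pot g x"
  unfolding potential_def using potential_Bd_integrable by (simp add: right_diff_distrib)

lemma pot_cmult: "pot (\<lambda>x. c * f x) x = c * pot f x"
proof -
  have "(\<lambda>y. K x y * (c * f y)) = (\<lambda>y. c * (K x y * f y))" by (simp add: mult_ac)
  then show ?thesis unfolding potential_def by simp
qed

lemma pot_uminus: "pot (\<lambda>x. - f x) x = - pot f x"
  using pot_cmult[of "-1" f x] by simp

lemma pot_mono: "f \<in> Bd \<Longrightarrow> g \<in> Bd \<Longrightarrow> x \<in> \<Omega> \<Longrightarrow> (\<And>y. y \<in> \<Omega> \<Longrightarrow> f y \<le> g y) \<Longrightarrow> pot f x \<le> pot g x"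
  unfolding potential_def using potential_Bd_integrable K_nonneg
  by (intro integral_mono) (auto intro: mult_left_mono)

lemma \<phi>_bounds:
  assumes "x \<in> \<Omega>"
  shows "c\<^sub>1 * \<rho> x \<le> \<phi> x" "\<phi> x \<le> C\<^sub>0 * \<rho> x" "0 \<le> \<phi> x"
proof -
  show "c\<^sub>1 * \<rho> x \<le> \<phi> x" using K_lower[OF assms] by (simp add: potential_def)
  then show "0 \<le> \<phi> x" using const_nonneg by (meson mult_nonneg_nonneg order_trans powr_ge_zero less_imp_le)
  have "ennreal (\<phi> x) = (\<integral>\<^sup>+y. ennreal (K x y * \<rho> y) \<partial>M)"
    unfolding potential_def using potential_Bd_integrable[OF \<rho>_Bd assms] K_nonneg
    by (intro nn_integral_eq_integral[symmetric]) auto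
  also have "\<dots> \<le> ennreal (C\<^sub>0 * \<rho> x)" by (rule K_weight[OF assms])
  finally show "\<phi> x \<le> C\<^sub>0 * \<rho> x" using const_nonneg by simp
qed

lemma \<phi>_Bd: "\<phi> \<in> Bd"
  by (rule pot_Bd[OF \<rho>_Bd])

lemma weighted_mult_\<phi>: "weighted M f \<Longrightarrow> integrable M (\<lambda>x. f x * \<phi> x)"
proof -
  assume f: "weighted M f"
  then have [measurable]: "f \<in> borel_measurable M" by (simp add: weighted_M_iff)
  have [measurable]: "\<phi> \<in> borel_measurable M" by (rule Bd_measurable[OF \<phi>_Bd])
  show ?thesis
  proof (rule Bochner_Integration.integrable_bound)
    show "integrable M (\<lambda>x. C\<^sub>0 * (f x * \<rho> x))" using f by (simp add: weighted_M_iff)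
    have "\<bar>f x * \<phi> x\<bar> \<le> \<bar>C\<^sub>0 * (f x * \<rho> x)\<bar>" if "x \<in> \<Omega>" for x
    proof -
      have "\<bar>f x\<bar> * \<phi> x \<le> \<bar>f x\<bar> * (C\<^sub>0 * \<rho> x)" using \<phi>_bounds[OF that] by (intro mult_left_mono) auto
      then show ?thesis using \<phi>_bounds[OF that] const_nonneg by (simp add: abs_mult mult_ac)
    qed
    then show "AE x in M. norm (f x * \<phi> x) \<le> norm (C\<^sub>0 * (f x * \<rho> x))" by (intro AE_I2) auto
  qed simp
qed

lemma potential_\<rho>:
  assumes "weighted N h"
  shows "(\<integral>x. potential K N h x * \<rho> x \<partial>M) = (\<integral>y. \<phi> y * h y \<partial>N)"
  using potential_symmetric(1)[OF assms, of \<rho> 1] by simp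

lemma potential_abs_\<rho>:
  assumes "weighted N h"
  shows "(\<integral>x. \<bar>potential K N h x\<bar> * \<rho> x \<partial>M) \<le> C\<^sub>0 * (\<integral>y. \<bar>h y\<bar> * \<rho> y \<partial>N)"
proof -
  have [measurable]: "h \<in> borel_measurable N" "(\<lambda>x. x) \<in> borel_measurable N"
    and sp: "space N = \<Omega>" using assms by (auto simp: weighted_def)
  have i: "integrable N (\<lambda>y. h y * \<rho> y)" using assms by (simp add: weighted_def)
  have i': "integrable N (\<lambda>y. \<bar>h y\<bar> * \<rho> y)" using integrable_norm[OF i] by (simp add: abs_mult)
  have wa: "weighted N (\<lambda>y. \<bar>h y\<bar>)"
    using assms i' by (simp add: weighted_def)
  have "(\<integral>x. \<bar>potential K N h x\<bar> * \<rho> x \<partial>M) \<le> (\<integral>x. potential K N (\<lambda>y. \<bar>h y\<bar>) x * \<rho> x \<partial>M)"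
  proof (rule integral_mono)
    show "integrable M (\<lambda>x. \<bar>potential K N h x\<bar> * \<rho> x)"
      using weighted_abs[OF potential_weighted[OF assms]] by (simp add: weighted_M_iff)
    show "integrable M (\<lambda>x. potential K N (\<lambda>y. \<bar>h y\<bar>) x * \<rho> x)"
      using potential_weighted[OF wa] by (simp add: weighted_M_iff)
    fix x
    have "\<bar>potential K N h x\<bar> \<le> (\<integral>y. norm (K x y * h y) \<partial>N)"
      unfolding potential_def real_norm_def[symmetric] by (rule integral_norm_bound)
    also have "\<dots> = potential K N (\<lambda>y. \<bar>h y\<bar>) x" using K_nonneg by (simp add: potential_def abs_mult)
    finally show "\<bar>potential K N h x\<bar> * \<rho> x \<le> potential K N (\<lambda>y. \<bar>h y\<bar>) x * \<rho> x"
      by (intro mult_right_mono) auto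
  qed
  also have "\<dots> = (\<integral>y. \<phi> y * \<bar>h y\<bar> \<partial>N)" by (rule potential_\<rho>[OF wa])
  also have "\<dots> \<le> (\<integral>y. C\<^sub>0 * (\<bar>h y\<bar> * \<rho> y) \<partial>N)"
  proof (rule integral_mono)
    show "integrable N (\<lambda>y. \<phi> y * \<bar>h y\<bar>)" using potential_symmetric(3)[OF wa, of \<rho> 1] by simp
    show "integrable N (\<lambda>y. C\<^sub>0 * (\<bar>h y\<bar> * \<rho> y))" using i' by simp
    fix y assume "y \<in> space N"
    then show "\<phi> y * \<bar>h y\<bar> \<le> C\<^sub>0 * (\<bar>h y\<bar> * \<rho> y)"
      using mult_right_mono[OF \<phi>_bounds(2), of y "\<bar>h y\<bar>"] sp by (simp add: mult_ac)
  qed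
  finally show ?thesis by simp
qed

end

section \<open>Averages of measures over small balls\<close>

lemma ennreal_abs_diff_le:
  fixes a b :: real
  assumes "0 \<le> a" "0 \<le> b" "ennreal a \<le> ennreal b + E" "ennreal b \<le> ennreal a + E"
  shows "ennreal \<bar>a - b\<bar> \<le> E"
proof (cases E)
  case (real e)
  then have "a \<le> b + e" "b \<le> a + e" using assms by (auto simp flip: ennreal_plus)
  then show ?thesis using real by (auto intro!: ennreal_leI)
qed simp

context dual_kernel
begin

text \<open>The potentials of the bounded nonnegative densities \<open>a n\<close> tend to
  \<open>V\<close> in the weighted L^1 norm, with no convergence of the densities themselves. In
  this form the limit passage in Kato's inequality no longer refers to measures.\<close>

definition approximates :: "(nat \<Rightarrow> 'a \<Rightarrow> real) \<Rightarrow> ('a \<Rightarrow> real) \<Rightarrow> bool" where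
  "approximates a V \<longleftrightarrow> weighted M V \<and> (\<forall>n. a n \<in> Bd \<and> (\<forall>x\<in>\<Omega>. 0 \<le> a n x)) \<and>
     (\<lambda>n. \<integral>x. \<bar>V x - pot (a n) x\<bar> * \<rho> x \<partial>M) \<longlonglongrightarrow> 0"

definition inner_part :: "nat \<Rightarrow> 'a set" where
  "inner_part n = {x \<in> \<Omega>. 1 / real (Suc n) \<le> bdist \<Omega> x}"

text \<open>Half of the least depth \<open>1 / (n + 1)\<close> of a point of
  \<open>inner_part n\<close>. A ball of this radius about such a point stays in \<Omega>, and
  within it the distance to the boundary at most doubles, which is the factor
  \<open>2 powr \<gamma>\<close> of \<open>mollifier_support\<close>.\<close>

definition radius :: "nat \<Rightarrow> real" where
  "radius n = 1 / (2 * real (Suc n))"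

definition volume :: "nat \<Rightarrow> real" where
  "volume n = measure lborel (ball (0::'a) (radius n))"

text \<open>The density of the convolution of the normalised indicator of a ball with the
  restriction of \<open>\<nu>\<close> to \<open>inner_part n\<close>. The restriction makes it
  bounded, and the value at \<open>z\<close> is determined by the measure of a single set, so
  inequalities between measures are inherited.\<close>

definition mollified :: "'a measure \<Rightarrow> nat \<Rightarrow> 'a \<Rightarrow> real" where
  "mollified \<nu> n z = measure \<nu> (inner_part n \<inter> ball z (radius n)) / volume n"

definition mollifier :: "nat \<Rightarrow> 'a \<Rightarrow> 'a \<Rightarrow> real" where
  "mollifier n y z = (if y \<in> inner_part n \<and> dist z y < radius n then 1 / volume n else 0)"

lemma radius_pos: "0 < radius n" by (simp add: radius_def)

lemma volume_pos: "0 < volume n"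
  unfolding volume_def using content_ball_pos[OF radius_pos] by simp

lemma mollifier_nonneg: "0 \<le> mollifier n y z"
  using volume_pos[of n] by (simp add: mollifier_def)

lemma mollifier_measurable [measurable (raw)]:
  assumes [measurable]: "f \<in> borel_measurable N" "g \<in> borel_measurable N"
  shows "(\<lambda>x. mollifier n (f x) (g x)) \<in> borel_measurable N"
proof -
  have [measurable]: "\<Omega> \<in> sets borel" using open_domain by simp
  show ?thesis unfolding mollifier_def inner_part_def by measurable
qed

lemma mollifier_support:
  assumes "mollifier n y z \<noteq> 0"
  shows "y \<in> \<Omega>" "z \<in> \<Omega>" "dist z y < radius n" "\<rho> z \<le> 2 powr \<gamma> * \<rho> y"
proof -
  have y: "y \<in> \<Omega>" "1 / real (Suc n) \<le> bdist \<Omega> y" and d: "dist z y < radius n"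
    using assms by (auto simp: mollifier_def inner_part_def split: if_splits)
  have r: "2 * radius n = 1 / real (Suc n)" by (simp add: radius_def field_simps)
  show "y \<in> \<Omega>" "dist z y < radius n" by fact+
  have "bdist \<Omega> y \<le> bdist \<Omega> z + dist z y" using bdist_lipschitz[of \<Omega> y z] by (simp add: dist_commute)
  then have "bdist \<Omega> z > 0" using y d r radius_pos[of n] by linarith
  then show "z \<in> \<Omega>" using bdist_outside by force
  have "bdist \<Omega> z \<le> bdist \<Omega> y + dist z y" by (rule bdist_lipschitz)
  then have "bdist \<Omega> z \<le> 2 * bdist \<Omega> y" using y d r radius_pos[of n] by linarith
  then have "\<rho> z \<le> (2 * bdist \<Omega> y) powr \<gamma>" using \<gamma>_pos by (intro powr_mono2) auto
  then show "\<rho> z \<le> 2 powr \<gamma> * \<rho> y" by (simp add: powr_mult)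
qed

lemma mollifier_integral:
  "(\<integral>\<^sup>+z. ennreal (mollifier n y z) \<partial>M) = indicator (inner_part n) y"
proof (cases "y \<in> inner_part n")
  case True
  have v: "volume n > 0" by (rule volume_pos)
  have sub: "z \<in> \<Omega>" if "dist z y < radius n" for z
    using mollifier_support(2)[of n y z] True v that by (simp add: mollifier_def)
  have "(\<integral>\<^sup>+z. ennreal (mollifier n y z) \<partial>M) = (\<integral>\<^sup>+z. ennreal (mollifier n y z) * indicator \<Omega> z \<partial>lebesgue)"
    using open_domain by (intro nn_integral_restrict_space) auto
  also have "\<dots> = (\<integral>\<^sup>+z. ennreal (1 / volume n) * indicator (ball y (radius n)) z \<partial>lebesgue)"
    using True sub by (intro nn_integral_cong) (auto simp: mollifier_def indicator_def dist_commute)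
  also have "\<dots> = ennreal (1 / volume n) * emeasure lebesgue (ball y (radius n))"
    by (subst nn_integral_cmult_indicator) auto
  also have "emeasure lebesgue (ball y (radius n)) = ennreal (volume n)"
    using radius_pos[of n] by (simp add: emeasure_ball volume_def content_ball)
  also have "ennreal (1 / volume n) * ennreal (volume n) = 1"
    using v by (simp flip: ennreal_mult)
  finally show ?thesis using True by simp
qed (simp add: mollifier_def)

lemma compact_inner_part: "compact (inner_part n)"
proof -
  have "x \<in> \<Omega>" if "1 / real (Suc n) \<le> bdist \<Omega> x" for x
    using that bdist_outside[of x \<Omega>] by (cases "x \<in> \<Omega>") (auto simp: field_simps)
  then have "inner_part n = {x. 1 / real (Suc n) \<le> bdist \<Omega> x}" by (auto simp: inner_part_def)
  moreover have "closed {x. 1 / real (Suc n) \<le> bdist \<Omega> x}"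
    unfolding bdist_def by (intro closed_Collect_le continuous_intros)
  moreover have "bounded (inner_part n)"
    by (rule bounded_subset[OF bounded_domain]) (auto simp: inner_part_def)
  ultimately show ?thesis by (simp add: compact_eq_bounded_closed)
qed

lemma weighted_sets:
  assumes "weighted \<nu> h" "A \<in> sets borel"
  shows "\<Omega> \<inter> A \<in> sets \<nu>"
proof -
  have "(\<lambda>x. x) -` A \<inter> space \<nu> \<in> sets \<nu>"
    using assms by (intro measurable_sets) (auto simp: weighted_def)
  then show ?thesis using assms by (simp add: weighted_def Int_commute)
qed

lemma inner_part_sets: "weighted \<nu> h \<Longrightarrow> inner_part n \<in> sets \<nu>"
  using weighted_sets[of \<nu> h "{x. 1 / real (Suc n) \<le> bdist \<Omega> x}"]
  by (simp add: inner_part_def Int_def)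

text \<open>Markov's inequality: on \<open>inner_part n\<close> the weight has a positive lower
  bound, and its integral is finite.\<close>

lemma inner_part_finite:
  assumes "weighted \<nu> (\<lambda>x. 1)"
  shows "emeasure \<nu> (inner_part n) < \<infinity>"
proof -
  have [measurable]: "(\<lambda>x. x) \<in> borel_measurable \<nu>" using assms by (simp add: weighted_def)
  have i: "integrable \<nu> \<rho>" using assms by (simp add: weighted_def)
  define k where "k = (1 / real (Suc n)) powr \<gamma>"
  have k: "k > 0" by (simp add: k_def)
  have "emeasure \<nu> (inner_part n) = (\<integral>\<^sup>+x. indicator (inner_part n) x \<partial>\<nu>)"
    using inner_part_sets[OF assms] by simp
  also have "\<dots> \<le> (\<integral>\<^sup>+x. ennreal (1 / k * \<rho> x) \<partial>\<nu>)"
  proof (rule nn_integral_mono)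
    fix x
    show "indicator (inner_part n) x \<le> ennreal (1 / k * \<rho> x)"
    proof (cases "x \<in> inner_part n")
      case True
      then have "k \<le> \<rho> x" unfolding k_def using \<gamma>_pos by (intro powr_mono2) (auto simp: inner_part_def)
      then have "1 \<le> 1 / k * \<rho> x" using k by (simp add: field_simps)
      then show ?thesis using True ennreal_leI by fastforce
    qed simp
  qed
  also have "\<dots> < \<infinity>"
    using integrable_mult_right[OF i, of "1 / k"] k by (subst (asm) integrable_iff_bounded) auto
  finally show ?thesis .
qed

lemma mollified_eq:
  assumes "weighted \<nu> (\<lambda>x. 1)"
  shows "ennreal (mollified \<nu> n z) = (\<integral>\<^sup>+y. ennreal (mollifier n y z) \<partial>\<nu>)"
    and "mollified \<nu> n z \<le> measure \<nu> (inner_part n) / volume n" "0 \<le> mollified \<nu> n z"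
proof -
  let ?A = "inner_part n \<inter> ball z (radius n)"
  have eq: "?A = \<Omega> \<inter> ({x. 1 / real (Suc n) \<le> bdist \<Omega> x} \<inter> ball z (radius n))"
    by (auto simp: inner_part_def)
  have A: "?A \<in> sets \<nu>" unfolding eq by (intro weighted_sets[OF assms]) measurable
  have "emeasure \<nu> ?A \<le> emeasure \<nu> (inner_part n)" using inner_part_sets[OF assms] by (intro emeasure_mono) auto
  then have fin: "emeasure \<nu> ?A < \<infinity>" using inner_part_finite[OF assms] le_less_trans by blast
  have "(\<integral>\<^sup>+y. ennreal (mollifier n y z) \<partial>\<nu>) = (\<integral>\<^sup>+y. ennreal (1 / volume n) * indicator ?A y \<partial>\<nu>)"
    by (intro nn_integral_cong) (auto simp: mollifier_def indicator_def dist_commute)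
  also have "\<dots> = ennreal (1 / volume n) * emeasure \<nu> ?A" using A by (rule nn_integral_cmult_indicator)
  also have "\<dots> = ennreal (mollified \<nu> n z)"
    using fin volume_pos[of n] by (simp add: mollified_def emeasure_eq_ennreal_measure flip: ennreal_mult)
  finally show "ennreal (mollified \<nu> n z) = (\<integral>\<^sup>+y. ennreal (mollifier n y z) \<partial>\<nu>)" by simp
  have "measure \<nu> ?A \<le> measure \<nu> (inner_part n)"
    using A inner_part_sets[OF assms] inner_part_finite[OF assms]
    by (intro measure_mono_fmeasurable) (auto simp: fmeasurable_def)
  then show "mollified \<nu> n z \<le> measure \<nu> (inner_part n) / volume n"
    using volume_pos[of n] by (simp add: mollified_def divide_right_mono)
  show "0 \<le> mollified \<nu> n z" using volume_pos[of n] by (simp add: mollified_def)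
qed

lemma mollified_Bd:
  assumes "weighted \<nu> (\<lambda>x. 1)"
  shows "mollified \<nu> n \<in> Bd"
proof (rule BdI)
  interpret \<nu>: sigma_finite_measure \<nu> using assms by (simp add: weighted_def)
  have [measurable]: "(\<lambda>x. x) \<in> borel_measurable \<nu>" using assms by (simp add: weighted_def)
  have [measurable]: "fst \<in> borel_measurable (M \<Otimes>\<^sub>M \<nu>)" "snd \<in> borel_measurable (M \<Otimes>\<^sub>M \<nu>)"
    using measurable_compose[OF measurable_fst id_measurable_M] measurable_compose[OF measurable_snd, of "\<lambda>x. x" \<nu> borel M]
    by auto
  have "mollified \<nu> n = (\<lambda>z. enn2real (\<integral>\<^sup>+y. ennreal (mollifier n y z) \<partial>\<nu>))"
    using mollified_eq[OF assms, of n] by (metis enn2real_ennreal)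
  also have "\<dots> \<in> borel_measurable M"
    by measurable
  finally show "mollified \<nu> n \<in> borel_measurable M" .
  show "\<bar>mollified \<nu> n x\<bar> \<le> measure \<nu> (inner_part n) / volume n" for x
    using mollified_eq(2,3)[OF assms, of n x] by simp
qed

text \<open>Averaging \<open>\<nu>\<close> amounts to averaging the kernel in its second variable.
  The weighted error is thus at most the \<open>\<nu>\<close>-integral of \<open>\<Psi> n y\<close>,
  the averaged L^1 distance of the kernels with poles near \<open>y\<close> and at \<open>y\<close>.
  It tends to 0 pointwise by \<open>K_continuous\<close> and is dominated by a multiple of the
  weight, which is \<open>\<nu>\<close>-integrable.\<close>

lemma approximates_mollified:
  assumes w: "weighted \<nu> (\<lambda>x. 1)"
  shows "approximates (mollified \<nu>) (potential K \<nu> (\<lambda>x. 1))"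
proof -
  interpret P: pair_sigma_finite M \<nu> using w by (rule pair_sf)
  interpret Q: pair_sigma_finite M M by unfold_locales
  let ?V = "potential K \<nu> (\<lambda>x. 1)"
  have sp: "space \<nu> = \<Omega>" using w by (simp add: weighted_def)
  have id\<nu> [measurable]: "(\<lambda>x. x) \<in> borel_measurable \<nu>" using w by (simp add: weighted_def)
  have [measurable]: "fst \<in> borel_measurable (M \<Otimes>\<^sub>M \<nu>)" "snd \<in> borel_measurable (M \<Otimes>\<^sub>M \<nu>)"
    "fst \<in> borel_measurable (M \<Otimes>\<^sub>M M)" "snd \<in> borel_measurable (M \<Otimes>\<^sub>M M)"
    "fst \<in> borel_measurable (\<nu> \<Otimes>\<^sub>M M)" "snd \<in> borel_measurable (\<nu> \<Otimes>\<^sub>M M)"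
    using measurable_compose[OF measurable_fst id_measurable_M] measurable_compose[OF measurable_snd id_measurable_M]
      measurable_compose[OF measurable_fst id\<nu>] measurable_compose[OF measurable_snd id\<nu>]
    by auto
  have [measurable]: "(\<lambda>p. fst (fst p)) \<in> borel_measurable ((M \<Otimes>\<^sub>M \<nu>) \<Otimes>\<^sub>M M)"
    "(\<lambda>p. snd (fst p)) \<in> borel_measurable ((M \<Otimes>\<^sub>M \<nu>) \<Otimes>\<^sub>M M)"
    "snd \<in> borel_measurable ((M \<Otimes>\<^sub>M \<nu>) \<Otimes>\<^sub>M M)"
    using measurable_compose[OF measurable_compose[OF measurable_fst measurable_fst] id_measurable_M]
      measurable_compose[OF measurable_compose[OF measurable_fst measurable_snd] id\<nu>]
      measurable_compose[OF measurable_snd id_measurable_M]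
    by auto
  \<comment> \<open>\<open>D\<close> is the mean oscillation of the kernel around \<open>y\<close>;
    \<open>F\<close> adds the whole kernel at those \<open>y\<close> which the restriction to
    \<open>inner_part n\<close> discards.\<close>
  define D where "D = (\<lambda>n x y. \<integral>\<^sup>+z. ennreal (\<bar>K x z - K x y\<bar> * mollifier n y z) \<partial>M)"
  define F where "F = (\<lambda>n x y. D n x y + ennreal (K x y) * indicator (- inner_part n) y)"
  have [measurable]: "\<Omega> \<in> sets borel" using open_domain by simp
  have ip [measurable]: "inner_part n \<in> sets borel" for n unfolding inner_part_def by measurable
  have Dm: "(\<lambda>p. D n (fst p) (snd p)) \<in> borel_measurable (M \<Otimes>\<^sub>M \<nu>)" for n
    unfolding D_def by measurable
  have Fm [measurable]: "(\<lambda>p. F n (fst p) (snd p)) \<in> borel_measurable (M \<Otimes>\<^sub>M \<nu>)" for n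
    unfolding F_def using Dm by measurable
  have Dm2: "D n x \<in> borel_measurable \<nu>" if "x \<in> \<Omega>" for n x
    using measurable_compose[OF measurable_Pair1'[of x M \<nu>] Dm[of n]] that by simp
  have Fm2: "F n x \<in> borel_measurable \<nu>" if "x \<in> \<Omega>" for n x
    using measurable_compose[OF measurable_Pair1'[of x M \<nu>] Fm[of n]] that by simp
  have Dm3: "(\<lambda>x. D n x y) \<in> borel_measurable M" if "y \<in> \<Omega>" for n y
    using measurable_compose[OF measurable_Pair2'[of y \<nu> M] Dm[of n]] that sp by simp

  have split: "ennreal (K x y) * indicator (inner_part n) y = (\<integral>\<^sup>+z. ennreal (K x y * mollifier n y z) \<partial>M)" for n x y
    using K_nonneg mollifier_nonneg
    by (simp add: ennreal_mult nn_integral_cmult mollifier_integral)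

  \<comment> \<open>The comparison stays in the extended reals, since the integral of
    \<open>F n x\<close> over \<open>\<nu>\<close> is not known to be finite at a given
    \<open>x\<close>.\<close>
  have close: "AE x in M. ennreal (\<bar>?V x - pot (mollified \<nu> n) x\<bar> * \<rho> x) \<le> (\<integral>\<^sup>+y. F n x y \<partial>\<nu>) * ennreal (\<rho> x)" for n
    using potential_AE_integrable[OF w] AE_space
  proof eventually_elim
    case (elim x)
    then have x: "x \<in> \<Omega>" by simp
    define A where "A = (\<integral>\<^sup>+y. (\<integral>\<^sup>+z. ennreal (K x z * mollifier n y z) \<partial>M) \<partial>\<nu>)"
    define B where "B = (\<integral>\<^sup>+y. ennreal (K x y) \<partial>\<nu>)"
    have V: "ennreal (?V x) = B" "0 \<le> ?V x"
      unfolding B_def potential_def using elim(1) K_nonneg by (auto intro!: nn_integral_eq_integral[symmetric])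
    have P: "ennreal (pot (mollified \<nu> n) x) = A" "0 \<le> pot (mollified \<nu> n) x"
    proof -
      have nn: "0 \<le> K x y * mollified \<nu> n y" for y using K_nonneg mollified_eq(3)[OF w] by simp
      show "0 \<le> pot (mollified \<nu> n) x" unfolding potential_def using nn by simp
      have "ennreal (pot (mollified \<nu> n) x) = (\<integral>\<^sup>+z. ennreal (K x z * mollified \<nu> n z) \<partial>M)"
        unfolding potential_def using potential_Bd_integrable[OF mollified_Bd[OF w] x] nn
        by (intro nn_integral_eq_integral[symmetric]) auto
      also have "\<dots> = (\<integral>\<^sup>+z. (\<integral>\<^sup>+y. ennreal (K x z * mollifier n y z) \<partial>\<nu>) \<partial>M)"
      proof (rule nn_integral_cong)
        fix z
        show "ennreal (K x z * mollified \<nu> n z) = (\<integral>\<^sup>+y. ennreal (K x z * mollifier n y z) \<partial>\<nu>)"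
          using K_nonneg mollifier_nonneg mollified_eq(3)[OF w]
          by (simp add: ennreal_mult nn_integral_cmult mollified_eq(1)[OF w])
      qed
      also have "\<dots> = A"
        unfolding A_def by (rule P.Fubini'[symmetric]) (simp add: case_prod_beta')
      finally show "ennreal (pot (mollified \<nu> n) x) = A" .
    qed
    have tri: "K x z * mollifier n y z \<le> \<bar>K x z - K x y\<bar> * mollifier n y z + K x y * mollifier n y z"
      "K x y * mollifier n y z \<le> \<bar>K x z - K x y\<bar> * mollifier n y z + K x z * mollifier n y z" for y z
      unfolding distrib_right[symmetric] by (intro mult_right_mono mollifier_nonneg; simp)+
    have le1: "(\<integral>\<^sup>+z. ennreal (K x z * mollifier n y z) \<partial>M) \<le> D n x y + ennreal (K x y) * indicator (inner_part n) y" for y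
    proof -
      have "(\<integral>\<^sup>+z. ennreal (K x z * mollifier n y z) \<partial>M) \<le>
          (\<integral>\<^sup>+z. ennreal (\<bar>K x z - K x y\<bar> * mollifier n y z) + ennreal (K x y * mollifier n y z) \<partial>M)"
        using tri(1) mollifier_nonneg K_nonneg by (intro nn_integral_mono) (simp flip: ennreal_plus add: ennreal_leI)
      also have "\<dots> = D n x y + ennreal (K x y) * indicator (inner_part n) y"
        unfolding D_def split by (intro nn_integral_add) auto
      finally show ?thesis .
    qed
    have le2: "ennreal (K x y) * indicator (inner_part n) y \<le> D n x y + (\<integral>\<^sup>+z. ennreal (K x z * mollifier n y z) \<partial>M)" for y
    proof -
      have "ennreal (K x y) * indicator (inner_part n) y \<le>
          (\<integral>\<^sup>+z. ennreal (\<bar>K x z - K x y\<bar> * mollifier n y z) + ennreal (K x z * mollifier n y z) \<partial>M)"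
        unfolding split
        using tri(2) mollifier_nonneg K_nonneg by (intro nn_integral_mono) (simp flip: ennreal_plus add: ennreal_leI)
      also have "\<dots> = D n x y + (\<integral>\<^sup>+z. ennreal (K x z * mollifier n y z) \<partial>M)"
        unfolding D_def by (intro nn_integral_add) auto
      finally show ?thesis .
    qed
    have Am: "(\<lambda>y. \<integral>\<^sup>+z. ennreal (K x z * mollifier n y z) \<partial>M) \<in> borel_measurable \<nu>"
      by measurable
    have AB: "A \<le> B + (\<integral>\<^sup>+y. F n x y \<partial>\<nu>)"
    proof -
      have "A \<le> (\<integral>\<^sup>+y. ennreal (K x y) + F n x y \<partial>\<nu>)"
        unfolding A_def
      proof (rule nn_integral_mono)
        fix y
        have "D n x y + ennreal (K x y) * indicator (inner_part n) y \<le> ennreal (K x y) + F n x y"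
          unfolding F_def by (auto simp: indicator_def add.commute)
        then show "(\<integral>\<^sup>+z. ennreal (K x z * mollifier n y z) \<partial>M) \<le> ennreal (K x y) + F n x y"
          using le1 order_trans by blast
      qed
      also have "\<dots> = B + (\<integral>\<^sup>+y. F n x y \<partial>\<nu>)"
        unfolding B_def using Fm2[OF x] by (intro nn_integral_add) auto
      finally show ?thesis .
    qed
    have BA: "B \<le> A + (\<integral>\<^sup>+y. F n x y \<partial>\<nu>)"
    proof -
      have "B \<le> (\<integral>\<^sup>+y. (\<integral>\<^sup>+z. ennreal (K x z * mollifier n y z) \<partial>M) + F n x y \<partial>\<nu>)"
        unfolding B_def
      proof (rule nn_integral_mono)
        fix y
        have "ennreal (K x y) = ennreal (K x y) * indicator (inner_part n) y + ennreal (K x y) * indicator (- inner_part n) y"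
          by (auto simp: indicator_def)
        also have "\<dots> \<le> (D n x y + (\<integral>\<^sup>+z. ennreal (K x z * mollifier n y z) \<partial>M)) + ennreal (K x y) * indicator (- inner_part n) y"
          by (intro add_mono le2 order_refl)
        also have "\<dots> = (\<integral>\<^sup>+z. ennreal (K x z * mollifier n y z) \<partial>M) + F n x y"
          unfolding F_def by (simp add: ac_simps)
        finally show "ennreal (K x y) \<le> (\<integral>\<^sup>+z. ennreal (K x z * mollifier n y z) \<partial>M) + F n x y" .
      qed
      also have "\<dots> = A + (\<integral>\<^sup>+y. F n x y \<partial>\<nu>)"
        unfolding A_def using Fm2[OF x] Am by (intro nn_integral_add) auto
      finally show ?thesis .
    qed
    have "ennreal \<bar>?V x - pot (mollified \<nu> n) x\<bar> \<le> (\<integral>\<^sup>+y. F n x y \<partial>\<nu>)"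
      using V P AB BA by (intro ennreal_abs_diff_le) auto
    then show ?case by (simp add: ennreal_mult mult_right_mono)
  qed

  define \<Psi> where "\<Psi> = (\<lambda>n y. \<integral>\<^sup>+x. F n x y * ennreal (\<rho> x) \<partial>M)"
  have \<Psi>m: "\<Psi> n \<in> borel_measurable \<nu>" for n
  proof -
    have [measurable]: "(\<lambda>p. F n (snd p) (fst p)) \<in> borel_measurable (\<nu> \<Otimes>\<^sub>M M)"
      using measurable_compose[OF measurable_pair_swap' Fm[of n]] by (simp add: case_prod_beta')
    have "(\<lambda>p. F n (snd p) (fst p) * ennreal (\<rho> (snd p))) \<in> borel_measurable (\<nu> \<Otimes>\<^sub>M M)"
      by measurable
    then show ?thesis
      unfolding \<Psi>_def by (intro borel_measurable_nn_integral) (simp add: case_prod_beta')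
  qed
  have bound: "(\<integral>\<^sup>+x. ennreal (\<bar>?V x - pot (mollified \<nu> n) x\<bar> * \<rho> x) \<partial>M) \<le> (\<integral>\<^sup>+y. \<Psi> n y \<partial>\<nu>)" for n
  proof -
    have "(\<integral>\<^sup>+x. ennreal (\<bar>?V x - pot (mollified \<nu> n) x\<bar> * \<rho> x) \<partial>M) \<le> (\<integral>\<^sup>+x. (\<integral>\<^sup>+y. F n x y \<partial>\<nu>) * ennreal (\<rho> x) \<partial>M)"
      using close by (rule nn_integral_mono_AE)
    also have "\<dots> = (\<integral>\<^sup>+x. (\<integral>\<^sup>+y. F n x y * ennreal (\<rho> x) \<partial>\<nu>) \<partial>M)"
      using Fm2 by (intro nn_integral_cong nn_integral_multc[symmetric]) auto
    also have "\<dots> = (\<integral>\<^sup>+y. \<Psi> n y \<partial>\<nu>)"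
      unfolding \<Psi>_def by (rule P.Fubini'[symmetric]) (simp add: case_prod_beta', measurable)
    finally show ?thesis .
  qed

  have inner: "\<Psi> n y = (\<integral>\<^sup>+z. ennreal (mollifier n y z) * (\<integral>\<^sup>+x. ennreal (\<bar>K x z - K x y\<bar> * \<rho> x) \<partial>M) \<partial>M)"
    if "y \<in> inner_part n" for n y
  proof -
    have "\<Psi> n y = (\<integral>\<^sup>+x. (\<integral>\<^sup>+z. ennreal (\<bar>K x z - K x y\<bar> * mollifier n y z) * ennreal (\<rho> x) \<partial>M) \<partial>M)"
      using that unfolding \<Psi>_def F_def D_def
      by (intro nn_integral_cong) (simp add: nn_integral_multc)
    also have "\<dots> = (\<integral>\<^sup>+z. (\<integral>\<^sup>+x. ennreal (\<bar>K x z - K x y\<bar> * mollifier n y z) * ennreal (\<rho> x) \<partial>M) \<partial>M)"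
      by (rule Q.Fubini'[symmetric]) (simp add: case_prod_beta')
    also have "\<dots> = (\<integral>\<^sup>+z. (\<integral>\<^sup>+x. ennreal (mollifier n y z) * ennreal (\<bar>K x z - K x y\<bar> * \<rho> x) \<partial>M) \<partial>M)"
      using mollifier_nonneg by (intro nn_integral_cong) (simp add: mult_ac flip: ennreal_mult)
    also have "\<dots> = (\<integral>\<^sup>+z. ennreal (mollifier n y z) * (\<integral>\<^sup>+x. ennreal (\<bar>K x z - K x y\<bar> * \<rho> x) \<partial>M) \<partial>M)"
      by (intro nn_integral_cong nn_integral_cmult) auto
    finally show ?thesis .
  qed

  have avg: "(\<integral>\<^sup>+z. ennreal (mollifier n y z) * h z \<partial>M) \<le> c"
    if "y \<in> inner_part n" "\<And>z. z \<in> \<Omega> \<Longrightarrow> mollifier n y z \<noteq> 0 \<Longrightarrow> h z \<le> c" for n y h c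
  proof -
    have "(\<integral>\<^sup>+z. ennreal (mollifier n y z) * h z \<partial>M) \<le> (\<integral>\<^sup>+z. ennreal (mollifier n y z) * c \<partial>M)"
      using that(2) by (intro nn_integral_mono) (metis ennreal_0 mult_left_mono mult_zero_left order_refl space_M zero_le)
    also have "\<dots> = c" using that(1) by (simp add: nn_integral_multc mollifier_integral)
    finally show ?thesis .
  qed

  \<comment> \<open>Inside, the oscillation is bounded by the sum of the kernels with poles
    \<open>z\<close> and \<open>y\<close>, and the weight at \<open>z\<close> is at most
    \<open>2 powr \<gamma>\<close> times that at \<open>y\<close>; this gives the factor
    \<open>2 powr \<gamma> + 1\<close>. Outside, only the discarded kernel remains.\<close>
  have dom: "\<Psi> n y \<le> ennreal (C\<^sub>0 * (2 powr \<gamma> + 1) * \<rho> y)" if y: "y \<in> \<Omega>" for n y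
  proof (cases "y \<in> inner_part n")
    case True
    show ?thesis
      unfolding inner[OF True]
    proof (rule avg[OF True])
      fix z assume z: "z \<in> \<Omega>" "mollifier n y z \<noteq> 0"
      have "(\<integral>\<^sup>+x. ennreal (\<bar>K x z - K x y\<bar> * \<rho> x) \<partial>M) \<le> (\<integral>\<^sup>+x. ennreal (K x z * \<rho> x) + ennreal (K x y * \<rho> x) \<partial>M)"
      proof (rule nn_integral_mono)
        fix x
        have "\<bar>K x z - K x y\<bar> * \<rho> x \<le> (K x z + K x y) * \<rho> x"
          using K_nonneg[of x z] K_nonneg[of x y] by (intro mult_right_mono) auto
        then show "ennreal (\<bar>K x z - K x y\<bar> * \<rho> x) \<le> ennreal (K x z * \<rho> x) + ennreal (K x y * \<rho> x)"
          using K_nonneg by (simp add: distrib_right ennreal_leI flip: ennreal_plus)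
      qed
      also have "\<dots> = (\<integral>\<^sup>+x. ennreal (K x z * \<rho> x) \<partial>M) + (\<integral>\<^sup>+x. ennreal (K x y * \<rho> x) \<partial>M)"
        by (intro nn_integral_add) auto
      also have "\<dots> \<le> ennreal (C\<^sub>0 * \<rho> z) + ennreal (C\<^sub>0 * \<rho> y)"
        by (intro add_mono K_weight_swap z y)
      also have "\<dots> = ennreal (C\<^sub>0 * \<rho> z + C\<^sub>0 * \<rho> y)" using const_nonneg by simp
      also have "\<dots> \<le> ennreal (C\<^sub>0 * (2 powr \<gamma> + 1) * \<rho> y)"
        using mult_left_mono[OF mollifier_support(4)[OF z(2)] const_nonneg(1)]
        by (intro ennreal_leI) (simp add: algebra_simps)
      finally show "(\<integral>\<^sup>+x. ennreal (\<bar>K x z - K x y\<bar> * \<rho> x) \<partial>M) \<le> ennreal (C\<^sub>0 * (2 powr \<gamma> + 1) * \<rho> y)" .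
    qed
  next
    case False
    then have "mollifier n y z = 0" for z by (simp add: mollifier_def)
    then have "\<Psi> n y = (\<integral>\<^sup>+x. ennreal (K x y * \<rho> x) \<partial>M)"
      using False K_nonneg unfolding \<Psi>_def F_def D_def by (simp add: ennreal_mult)
    also have "\<dots> \<le> ennreal (C\<^sub>0 * \<rho> y)" by (rule K_weight_swap[OF y])
    also have "\<dots> \<le> ennreal (C\<^sub>0 * (2 powr \<gamma> + 1) * \<rho> y)"
      using const_nonneg by (intro ennreal_leI mult_right_mono) (auto simp: mult_le_cancel_left1)
    finally show ?thesis .
  qed

  have lim: "(\<lambda>n. \<Psi> n y) \<longlonglongrightarrow> 0" if y: "y \<in> \<Omega>" for y
  proof (rule order_tendstoI)
    fix a :: ennreal assume "0 < a"
    \<comment> \<open>The bound \<open>a\<close> may be infinite; a smaller one is finite and can be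
      used in \<open>K_continuous\<close>.\<close>
    then obtain b where b: "0 < b" "b < a" using dense by blast
    then obtain e where "b = ennreal e" "0 \<le> e" by (cases b) auto
    then have e: "0 < e" "ennreal e < a" using b by auto
    \<comment> \<open>The weight is at most \<open>R\<close>, so continuity in the unweighted norm
      up to \<open>e / R\<close> suffices.\<close>
    obtain R where R: "R > 0" "\<And>x. \<rho> x \<le> R" using \<rho>_bounded by blast
    then obtain d where d: "d > 0"
      "\<And>z. z \<in> \<Omega> \<Longrightarrow> dist z y < d \<Longrightarrow> (\<integral>\<^sup>+x. ennreal \<bar>K x z - K x y\<bar> \<partial>M) \<le> ennreal (e / R)"
      using K_continuous[OF y, of "e / R"] e by auto
    have "bdist \<Omega> y > 0" by (rule bdist_pos[OF open_domain bounded_domain y])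
    then have "min d (bdist \<Omega> y) > 0" using d by simp
    then obtain n0 where n0: "inverse (real (Suc n0)) < min d (bdist \<Omega> y)" using reals_Archimedean by blast
    have "\<Psi> n y < a" if n: "n \<ge> n0" for n
    proof -
      have "inverse (real (Suc n)) \<le> inverse (real (Suc n0))" using n by simp
      then have i: "1 / real (Suc n) < d" "1 / real (Suc n) < bdist \<Omega> y" using n0 by (auto simp: inverse_eq_divide)
      then have yi: "y \<in> inner_part n" using y by (simp add: inner_part_def)
      have rd: "radius n < d"
      proof -
        have "radius n = (1 / real (Suc n)) / 2" by (simp add: radius_def)
        moreover have "t / 2 < d" if "t < d" for t using that d(1) by linarith
        ultimately show ?thesis using i(1) by metis
      qed
      have "\<Psi> n y \<le> ennreal e"
        unfolding inner[OF yi]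
      proof (rule avg[OF yi])
        fix z assume z: "z \<in> \<Omega>" "mollifier n y z \<noteq> 0"
        have "(\<integral>\<^sup>+x. ennreal (\<bar>K x z - K x y\<bar> * \<rho> x) \<partial>M) \<le> (\<integral>\<^sup>+x. ennreal R * ennreal \<bar>K x z - K x y\<bar> \<partial>M)"
        proof (rule nn_integral_mono)
          fix x
          have "\<bar>K x z - K x y\<bar> * \<rho> x \<le> \<bar>K x z - K x y\<bar> * R" using R by (intro mult_left_mono) auto
          then show "ennreal (\<bar>K x z - K x y\<bar> * \<rho> x) \<le> ennreal R * ennreal \<bar>K x z - K x y\<bar>"
            using R by (simp add: mult.commute ennreal_leI flip: ennreal_mult)
        qed
        also have "\<dots> = ennreal R * (\<integral>\<^sup>+x. ennreal \<bar>K x z - K x y\<bar> \<partial>M)" by (intro nn_integral_cmult) auto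
        also have "\<dots> \<le> ennreal R * ennreal (e / R)"
          using d(2)[OF z(1)] mollifier_support(3)[OF z(2)] rd by (intro mult_left_mono) auto
        also have "\<dots> = ennreal e" using R e by (simp flip: ennreal_mult)
        finally show "(\<integral>\<^sup>+x. ennreal (\<bar>K x z - K x y\<bar> * \<rho> x) \<partial>M) \<le> ennreal e" .
      qed
      then show ?thesis using e(2) by (rule le_less_trans)
    qed
    then show "\<forall>\<^sub>F n in sequentially. \<Psi> n y < a" by (auto simp: eventually_sequentially)
  qed simp

  have "(\<lambda>n. \<integral>\<^sup>+y. \<Psi> n y \<partial>\<nu>) \<longlonglongrightarrow> (\<integral>\<^sup>+y. 0 \<partial>\<nu>)"
  proof (rule nn_integral_dominated_convergence[where w = "\<lambda>y. ennreal (C\<^sub>0 * (2 powr \<gamma> + 1) * \<rho> y)"])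
    have "integrable \<nu> \<rho>" using w by (simp add: weighted_def)
    then have "integrable \<nu> (\<lambda>y. C\<^sub>0 * (2 powr \<gamma> + 1) * \<rho> y)" by (rule integrable_mult_right)
    then show "(\<integral>\<^sup>+y. ennreal (C\<^sub>0 * (2 powr \<gamma> + 1) * \<rho> y) \<partial>\<nu>) < \<infinity>"
      using const_nonneg by (subst (asm) integrable_iff_bounded) (auto simp: abs_mult)
    show "AE y in \<nu>. \<Psi> n y \<le> ennreal (C\<^sub>0 * (2 powr \<gamma> + 1) * \<rho> y)" for n using dom sp by (intro AE_I2) auto
    show "AE y in \<nu>. (\<lambda>n. \<Psi> n y) \<longlonglongrightarrow> 0" using lim sp by (intro AE_I2) auto
  qed (use \<Psi>m in auto)
  then have l0: "(\<lambda>n. \<integral>\<^sup>+y. \<Psi> n y \<partial>\<nu>) \<longlonglongrightarrow> 0" by simp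
  have wV: "weighted M ?V" by (rule potential_weighted[OF w])
  have wd: "weighted M (\<lambda>x. \<bar>?V x - pot (mollified \<nu> n) x\<bar>)" for n
    by (intro weighted_abs weighted_diff wV Bd_weighted pot_Bd mollified_Bd w)
  have eq: "ennreal (\<integral>x. \<bar>?V x - pot (mollified \<nu> n) x\<bar> * \<rho> x \<partial>M) = (\<integral>\<^sup>+x. ennreal (\<bar>?V x - pot (mollified \<nu> n) x\<bar> * \<rho> x) \<partial>M)" for n
    using wd[of n] by (intro nn_integral_eq_integral[symmetric]) (auto simp: weighted_M_iff)
  have "(\<lambda>n. ennreal (\<integral>x. \<bar>?V x - pot (mollified \<nu> n) x\<bar> * \<rho> x \<partial>M)) \<longlonglongrightarrow> 0"
    unfolding eq using bound by (intro tendsto_sandwich[OF _ _ tendsto_const l0]) auto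
  then have "(\<lambda>n. \<integral>x. \<bar>?V x - pot (mollified \<nu> n) x\<bar> * \<rho> x \<partial>M) \<longlonglongrightarrow> 0"
    by (subst (asm) tendsto_ennreal_iff[of _ _ 0, unfolded ennreal_0]) auto
  then show ?thesis
    unfolding approximates_def using wV mollified_Bd[OF w] mollified_eq(3)[OF w] by blast
qed

end

section \<open>Kato's inequality with measure data\<close>

lemma tendsto_0_le:
  fixes f g :: "nat \<Rightarrow> real"
  assumes "g \<longlonglongrightarrow> 0" "\<And>n. 0 \<le> f n" "\<And>n. f n \<le> g n"
  shows "f \<longlonglongrightarrow> 0"
  by (rule tendsto_sandwich[OF _ _ tendsto_const assms(1)]) (use assms(2,3) in auto)

lemma tendsto_diff_le:
  fixes f g :: "nat \<Rightarrow> real"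
  assumes "g \<longlonglongrightarrow> 0" "\<And>n. \<bar>x - f n\<bar> \<le> g n"
  shows "f \<longlonglongrightarrow> x"
proof -
  have "(\<lambda>n. \<bar>x - f n\<bar>) \<longlonglongrightarrow> 0" by (rule tendsto_0_le[OF assms(1)]) (use assms(2) in auto)
  then have "(\<lambda>n. x - f n) \<longlonglongrightarrow> 0" by (rule tendsto_rabs_zero_cancel)
  from tendsto_diff[OF tendsto_const[of x] this] show ?thesis by simp
qed

lemma abs_add_diff_le: "\<bar>a - b\<bar> \<le> \<bar>u - v\<bar> \<Longrightarrow> \<bar>(a + u) - (b + v)\<bar> \<le> 2 * \<bar>u - v\<bar>"
  for a b u v :: real
proof -
  assume "\<bar>a - b\<bar> \<le> \<bar>u - v\<bar>"
  moreover have "(a + u) - (b + v) = (a - b) + (u - v)" by simp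
  ultimately show ?thesis using abs_triangle_ineq[of "a - b" "u - v"] by argo
qed

context dual_kernel
begin

lemma approximates_add:
  assumes a: "approximates a V" and b: "approximates b U"
  shows "approximates (\<lambda>n x. a n x + b n x) (\<lambda>x. V x + U x)"
proof -
  have aB: "a n \<in> Bd" "b n \<in> Bd" and n: "x \<in> \<Omega> \<Longrightarrow> 0 \<le> a n x" "x \<in> \<Omega> \<Longrightarrow> 0 \<le> b n x"
    and w: "weighted M V" "weighted M U" for n x
    using a b by (auto simp: approximates_def)
  have i: "integrable M (\<lambda>x. \<bar>V x - pot (a n) x\<bar> * \<rho> x)" "integrable M (\<lambda>x. \<bar>U x - pot (b n) x\<bar> * \<rho> x)"
    "integrable M (\<lambda>x. \<bar>(V x + U x) - (pot (a n) x + pot (b n) x)\<bar> * \<rho> x)" for n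
    using weighted_abs[OF weighted_diff[OF w(1) Bd_weighted[OF pot_Bd[OF aB(1)]]]]
      weighted_abs[OF weighted_diff[OF w(2) Bd_weighted[OF pot_Bd[OF aB(2)]]]]
      weighted_abs[OF weighted_diff[OF weighted_add[OF w] weighted_add[OF Bd_weighted[OF pot_Bd[OF aB(1)]] Bd_weighted[OF pot_Bd[OF aB(2)]]]]]
    by (simp_all add: weighted_M_iff)
  have le: "(\<integral>x. \<bar>(V x + U x) - pot (\<lambda>x. a n x + b n x) x\<bar> * \<rho> x \<partial>M) \<le>
      (\<integral>x. \<bar>V x - pot (a n) x\<bar> * \<rho> x \<partial>M) + (\<integral>x. \<bar>U x - pot (b n) x\<bar> * \<rho> x \<partial>M)" for n
  proof -
    have "(\<integral>x. \<bar>(V x + U x) - pot (\<lambda>x. a n x + b n x) x\<bar> * \<rho> x \<partial>M) =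
        (\<integral>x. \<bar>(V x + U x) - (pot (a n) x + pot (b n) x)\<bar> * \<rho> x \<partial>M)"
      using aB by (intro Bochner_Integration.integral_cong) (simp_all add: pot_add)
    also have "\<dots> \<le> (\<integral>x. \<bar>V x - pot (a n) x\<bar> * \<rho> x + \<bar>U x - pot (b n) x\<bar> * \<rho> x \<partial>M)"
    proof (rule integral_mono[OF i(3) Bochner_Integration.integrable_add[OF i(1,2)]])
      fix x
      show "\<bar>(V x + U x) - (pot (a n) x + pot (b n) x)\<bar> * \<rho> x \<le>
          \<bar>V x - pot (a n) x\<bar> * \<rho> x + \<bar>U x - pot (b n) x\<bar> * \<rho> x"
        unfolding distrib_right[symmetric] by (intro mult_right_mono) auto
    qed
    also have "\<dots> = (\<integral>x. \<bar>V x - pot (a n) x\<bar> * \<rho> x \<partial>M) + (\<integral>x. \<bar>U x - pot (b n) x\<bar> * \<rho> x \<partial>M)"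
      using i by simp
    finally show ?thesis .
  qed
  have "(\<lambda>n. (\<integral>x. \<bar>V x - pot (a n) x\<bar> * \<rho> x \<partial>M) + (\<integral>x. \<bar>U x - pot (b n) x\<bar> * \<rho> x \<partial>M)) \<longlonglongrightarrow> 0"
    using a b unfolding approximates_def by (intro tendsto_add_zero) auto
  from tendsto_0_le[OF this _ le]
  have "(\<lambda>n. \<integral>x. \<bar>(V x + U x) - pot (\<lambda>x. a n x + b n x) x\<bar> * \<rho> x \<partial>M) \<longlonglongrightarrow> 0"
    by simp
  then show ?thesis
    unfolding approximates_def using weighted_add[OF w] Bd_add[OF aB] n by simp
qed

lemma approximates_zero: "approximates (\<lambda>n x. 0) (\<lambda>x. 0)"
  by (simp add: approximates_def Bd_const Bd_weighted potential_def)

text \<open>By symmetry the integral of a source against \<open>\<phi>\<close> is that of its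
  potential against the weight, and it is the potentials that converge.\<close>

lemma approximates_integral:
  assumes a: "approximates a V"
  shows "(\<lambda>n. \<integral>x. a n x * \<phi> x \<partial>M) \<longlonglongrightarrow> (\<integral>x. V x * \<rho> x \<partial>M)"
proof -
  have aB: "a n \<in> Bd" and w: "weighted M V" for n using a by (auto simp: approximates_def)
  have wd: "weighted M (\<lambda>x. V x - pot (a n) x)" for n
    by (intro weighted_diff w Bd_weighted pot_Bd aB)
  have le: "\<bar>(\<integral>x. V x * \<rho> x \<partial>M) - (\<integral>x. a n x * \<phi> x \<partial>M)\<bar> \<le> (\<integral>x. \<bar>V x - pot (a n) x\<bar> * \<rho> x \<partial>M)" for n
  proof -
    have "(\<integral>x. a n x * \<phi> x \<partial>M) = (\<integral>x. pot (a n) x * \<rho> x \<partial>M)"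
      using potential_\<rho>[OF Bd_weighted[OF aB]] by (simp add: mult.commute)
    then have "(\<integral>x. V x * \<rho> x \<partial>M) - (\<integral>x. a n x * \<phi> x \<partial>M) = (\<integral>x. (V x - pot (a n) x) * \<rho> x \<partial>M)"
      using w Bd_weighted[OF pot_Bd[OF aB]] by (simp add: left_diff_distrib weighted_M_iff)
    also have "\<bar>\<dots>\<bar> \<le> (\<integral>x. norm ((V x - pot (a n) x) * \<rho> x) \<partial>M)"
      unfolding real_norm_def[symmetric] by (rule integral_norm_bound)
    finally show ?thesis by (simp add: abs_mult)
  qed
  have "(\<lambda>n. \<integral>x. \<bar>V x - pot (a n) x\<bar> * \<rho> x \<partial>M) \<longlonglongrightarrow> 0" using a by (simp add: approximates_def)
  from tendsto_diff_le[OF this le] show ?thesis .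
qed

text \<open>Kato's inequality is added to the linear identity obtained by testing with
  \<open>\<phi>\<close>. The result controls |w| + w, twice the positive part, and the factor
  \<open>1 + pfun\<close> of the source becomes nonnegative.\<close>

lemma kato_bounded_plus:
  assumes f: "f \<in> Bd" and e: "0 < e"
  shows "(\<integral>x. (jfun e (pot f x) + pot f x) * \<rho> x \<partial>M) \<le> (\<integral>x. f x * (1 + pfun e (pot f x)) * \<phi> x \<partial>M)"
proof -
  have pB: "pot f \<in> Bd" by (rule pot_Bd[OF f])
  have [measurable]: "pot f \<in> borel_measurable M" by (rule Bd_measurable[OF pB])
  have jw: "weighted M (\<lambda>x. jfun e (pot f x))"
    using jfun_nonneg[OF e] jfun_le[OF e] by (intro weighted_bound[OF Bd_weighted[OF pB]]) auto
  have fp: "integrable M (\<lambda>x. f x * \<phi> x)" "integrable M (\<lambda>x. f x * pfun e (pot f x) * \<phi> x)"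
    using weighted_mult_\<phi>[OF Bd_weighted[OF f]]
      weighted_mult_\<phi>[OF weighted_sign_mult[OF Bd_weighted[OF f], of "\<lambda>x. pfun e (pot f x)" 1]] abs_pfun_le[OF e]
    by auto
  have "(\<integral>x. (jfun e (pot f x) + pot f x) * \<rho> x \<partial>M) =
      (\<integral>x. \<rho> x * jfun e (pot f x) \<partial>M) + (\<integral>x. pot f x * \<rho> x \<partial>M)"
    using jw Bd_weighted[OF pB] by (simp add: distrib_left distrib_right weighted_M_iff mult.commute)
  also have "\<dots> \<le> (\<integral>x. f x * (pfun e (pot f x) * \<phi> x) \<partial>M) + (\<integral>x. \<phi> x * f x \<partial>M)"
    using kato_bounded[OF f e] potential_\<rho>[OF Bd_weighted[OF f]] by simp
  also have "\<dots> = (\<integral>x. f x * (1 + pfun e (pot f x)) * \<phi> x \<partial>M)"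
    using fp by (simp add: distrib_left distrib_right mult_ac)
  finally show ?thesis .
qed

text \<open>
  Only the part of the right-hand side that dominates the sources \<open>a n - b n\<close> survives in the limit,
  because \<open>1 + pfun\<close> takes its values between \<open>0\<close> and \<open>2\<close>.
\<close>

lemma kato:
  assumes f: "weighted M f"
    and a: "approximates a V\<^sub>1" and b: "approximates b V\<^sub>2" and c: "approximates c V\<^sub>3"
    and le: "\<And>n x. x \<in> \<Omega> \<Longrightarrow> a n x - b n x \<le> c n x"
    and w: "w \<in> borel_measurable M" "AE x in M. w x = pot f x + V\<^sub>1 x - V\<^sub>2 x"
  shows "(\<integral>x. (\<bar>w x\<bar> + w x) * \<rho> x \<partial>M) \<le>
    (\<integral>x. f x * (1 + sgn (w x)) * \<phi> x \<partial>M) + 2 * (\<integral>x. V\<^sub>3 x * \<rho> x \<partial>M)"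
proof -
  have [measurable]: "f \<in> borel_measurable M" "w \<in> borel_measurable M" using f w by (auto simp: weighted_M_iff)
  have [measurable]: "\<phi> \<in> borel_measurable M" by (rule Bd_measurable[OF \<phi>_Bd])
  have Bds: "a n \<in> Bd" "b n \<in> Bd" "c n \<in> Bd" for n using a b c by (auto simp: approximates_def)
  have c0: "x \<in> \<Omega> \<Longrightarrow> 0 \<le> c n x" for n x using c by (auto simp: approximates_def)
  have wV: "weighted M V\<^sub>1" "weighted M V\<^sub>2" using a b by (auto simp: approximates_def)
  have ww: "weighted M w"
    by (rule weighted_cong_AE[OF weighted_diff[OF weighted_add[OF potential_weighted[OF f] wV(1)] wV(2)] w(1)])
      (use w(2) in \<open>auto elim: eventually_mono\<close>)
  \<comment> \<open>Clipping at level n makes the density bounded, as \<open>kato_bounded\<close>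
    requires; clipping does not enlarge it, so \<open>\<bar>f\<bar>\<close> dominates.\<close>
  define fn where "fn = (\<lambda>(n::nat) x. max (- real n) (min (f x) (real n)))"
  have fnB: "fn n \<in> Bd" for n
    by (rule BdI[where C = "real n"]) (auto simp: fn_def)
  have fn_le: "\<bar>fn n x\<bar> \<le> \<bar>f x\<bar>" for n x by (auto simp: fn_def)
  have fn_lim: "(\<lambda>n. fn n x) \<longlonglongrightarrow> f x" for x
  proof -
    obtain n0 where "\<bar>f x\<bar> \<le> real n0" using real_arch_simple by blast
    then have "fn n x = f x" if "n \<ge> n0" for n using that by (auto simp: fn_def)
    then show ?thesis by (intro tendsto_eventually) (auto simp: eventually_sequentially)
  qed
  define d where "d = (\<lambda>n x. fn n x + a n x - b n x)"
  have dB: "d n \<in> Bd" for n unfolding d_def by (intro Bd_add Bd_diff fnB Bds)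
  have pd: "pot (d n) x = pot (fn n) x + pot (a n) x - pot (b n) x" if "x \<in> \<Omega>" for n x
    unfolding d_def using pot_diff[OF Bd_add[OF fnB Bds(1)] Bds(2) that] pot_add[OF fnB Bds(1) that] by simp
  have dm [measurable]: "pot (d n) \<in> borel_measurable M" for n by (rule Bd_measurable[OF pot_Bd[OF dB]])
  have wdiff: "weighted M (\<lambda>x. w x - pot (d n) x)" for n
    by (intro weighted_diff ww Bd_weighted pot_Bd dB)
  have wf: "weighted M (\<lambda>x. f x - fn n x)" for n by (intro weighted_diff f Bd_weighted fnB)
  have conv: "(\<lambda>n. \<integral>x. \<bar>w x - pot (d n) x\<bar> * \<rho> x \<partial>M) \<longlonglongrightarrow> 0"
  proof -
    let ?X = "\<lambda>n x. \<bar>pot (\<lambda>x. f x - fn n x) x\<bar> * \<rho> x" and ?Y = "\<lambda>n x. \<bar>V\<^sub>1 x - pot (a n) x\<bar> * \<rho> x"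
      and ?Z = "\<lambda>n x. \<bar>V\<^sub>2 x - pot (b n) x\<bar> * \<rho> x"
    have i: "integrable M (?X n)" "integrable M (?Y n)" "integrable M (?Z n)" for n
      using weighted_abs[OF potential_weighted[OF wf]]
        weighted_abs[OF weighted_diff[OF wV(1) Bd_weighted[OF pot_Bd[OF Bds(1)]]]]
        weighted_abs[OF weighted_diff[OF wV(2) Bd_weighted[OF pot_Bd[OF Bds(2)]]]]
      by (simp_all add: weighted_M_iff)
    have le: "(\<integral>x. \<bar>w x - pot (d n) x\<bar> * \<rho> x \<partial>M) \<le> C\<^sub>0 * (\<integral>x. \<bar>f x - fn n x\<bar> * \<rho> x \<partial>M) + (\<integral>x. ?Y n x \<partial>M) + (\<integral>x. ?Z n x \<partial>M)" for n
    proof -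
      have "(\<integral>x. \<bar>w x - pot (d n) x\<bar> * \<rho> x \<partial>M) \<le> (\<integral>x. ?X n x + ?Y n x + ?Z n x \<partial>M)"
      proof (rule integral_mono_AE)
        show "integrable M (\<lambda>x. \<bar>w x - pot (d n) x\<bar> * \<rho> x)" using weighted_abs[OF wdiff] by (simp add: weighted_M_iff)
        show "integrable M (\<lambda>x. ?X n x + ?Y n x + ?Z n x)" using i by auto
        show "AE x in M. \<bar>w x - pot (d n) x\<bar> * \<rho> x \<le> ?X n x + ?Y n x + ?Z n x"
          using w(2) potential_AE_integrable[OF f] AE_space
        proof eventually_elim
          case (elim x)
          then have x: "x \<in> \<Omega>" by simp
          have "pot (\<lambda>x. f x - fn n x) x = pot f x - pot (fn n) x"
            unfolding potential_def using elim(2) potential_Bd_integrable[OF fnB x]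
            by (simp add: right_diff_distrib)
          then have "\<bar>w x - pot (d n) x\<bar> \<le> \<bar>pot (\<lambda>x. f x - fn n x) x\<bar> + \<bar>V\<^sub>1 x - pot (a n) x\<bar> + \<bar>V\<^sub>2 x - pot (b n) x\<bar>"
            unfolding pd[OF x] elim(1) by linarith
          then show ?case unfolding distrib_right[symmetric] by (intro mult_right_mono) auto
        qed
      qed
      also have "\<dots> = (\<integral>x. ?X n x \<partial>M) + (\<integral>x. ?Y n x \<partial>M) + (\<integral>x. ?Z n x \<partial>M)" using i by simp
      also have "\<dots> \<le> C\<^sub>0 * (\<integral>x. \<bar>f x - fn n x\<bar> * \<rho> x \<partial>M) + (\<integral>x. ?Y n x \<partial>M) + (\<integral>x. ?Z n x \<partial>M)"
        using potential_abs_\<rho>[OF wf] by simp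
      finally show ?thesis .
    qed
    have "(\<lambda>n. \<integral>x. \<bar>f x - fn n x\<bar> * \<rho> x \<partial>M) \<longlonglongrightarrow> (\<integral>x. 0 \<partial>M)"
    proof (rule integral_dominated_convergence[where w = "\<lambda>x. 2 * (\<bar>f x\<bar> * \<rho> x)"])
      show "integrable M (\<lambda>x. 2 * (\<bar>f x\<bar> * \<rho> x))" using weighted_abs[OF f] by (simp add: weighted_M_iff)
      show "(\<lambda>x. \<bar>f x - fn n x\<bar> * \<rho> x) \<in> borel_measurable M" for n unfolding fn_def by measurable
      have "\<bar>f x - fn n x\<bar> * \<rho> x \<le> (2 * \<bar>f x\<bar>) * \<rho> x" for n x
        using fn_le[of n x] by (intro mult_right_mono) auto
      then show "AE x in M. norm (\<bar>f x - fn n x\<bar> * \<rho> x) \<le> 2 * (\<bar>f x\<bar> * \<rho> x)" for n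
        by (intro AE_I2) (simp add: mult.assoc)
      show "AE x in M. (\<lambda>n. \<bar>f x - fn n x\<bar> * \<rho> x) \<longlonglongrightarrow> 0"
      proof (rule AE_I2)
        fix x
        have "(\<lambda>n. \<bar>f x - fn n x\<bar> * \<rho> x) \<longlonglongrightarrow> \<bar>f x - f x\<bar> * \<rho> x" by (intro tendsto_intros fn_lim)
        then show "(\<lambda>n. \<bar>f x - fn n x\<bar> * \<rho> x) \<longlonglongrightarrow> 0" by simp
      qed
    qed simp
    then have "(\<lambda>n. C\<^sub>0 * (\<integral>x. \<bar>f x - fn n x\<bar> * \<rho> x \<partial>M) + (\<integral>x. ?Y n x \<partial>M) + (\<integral>x. ?Z n x \<partial>M)) \<longlonglongrightarrow> 0"
      using a b unfolding approximates_def by (intro tendsto_add_zero tendsto_mult_right_zero) auto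
    from tendsto_0_le[OF this _ le] show ?thesis by simp
  qed
  \<comment> \<open>On the right-hand side \<open>pfun e\<close> of the approximate solution
    multiplies a fixed integrable function, so pointwise convergence is wanted and a subsequence is
    taken.\<close>
  have "\<exists>r. strict_mono r \<and> (AE x in M. (\<lambda>n. (w x - pot (d (r n)) x) * \<rho> x) \<longlonglongrightarrow> 0)"
    using wdiff conv by (intro tendsto_L1_AE_subseq) (auto simp: weighted_M_iff abs_mult)
  then obtain r where r: "strict_mono r" "AE x in M. (\<lambda>n. (w x - pot (d (r n)) x) * \<rho> x) \<longlonglongrightarrow> 0" by blast
  have wlim: "AE x in M. (\<lambda>n. pot (d (r n)) x) \<longlonglongrightarrow> w x"
    using r(2) AE_space
  proof eventually_elim
    case (elim x)
    then have \<rho>: "\<rho> x > 0" using \<rho>_pos by simp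
    have "(\<lambda>n. w x - (w x - pot (d (r n)) x) * \<rho> x / \<rho> x) \<longlonglongrightarrow> w x - 0 / \<rho> x"
      using \<rho> by (intro tendsto_intros elim(1)) auto
    then show ?case using \<rho> by simp
  qed

  \<comment> \<open>The limit in n is taken for fixed \<open>e\<close>, while the sign is still
    continuous; \<open>e\<close> tends to 0 only afterwards, when \<open>w\<close> is fixed.\<close>
  have main: "(\<integral>x. (jfun e (w x) + w x) * \<rho> x \<partial>M) \<le> (\<integral>x. f x * (1 + pfun e (w x)) * \<phi> x \<partial>M) + 2 * (\<integral>x. V\<^sub>3 x * \<rho> x \<partial>M)"
    if e: "0 < e" for e
  proof -
    have p01: "0 \<le> 1 + pfun e t" "1 + pfun e t \<le> 2" "\<bar>1 + pfun e t\<bar> \<le> 2" for t using abs_pfun_le[OF e, of t] by auto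
    have wj: "weighted M (\<lambda>x. jfun e (g x) + g x)" if g: "weighted M g" for g
    proof (rule weighted_add[OF weighted_bound[OF g] g])
      have "g \<in> borel_measurable M" using g by (simp add: weighted_M_iff)
      then show "(\<lambda>x. jfun e (g x)) \<in> borel_measurable M" by measurable
      show "AE x in M. \<bar>jfun e (g x)\<bar> \<le> \<bar>g x\<bar>" using jfun_nonneg[OF e] jfun_le[OF e] by simp
    qed
    have step: "(\<integral>x. (jfun e (pot (d n) x) + pot (d n) x) * \<rho> x \<partial>M) \<le>
        (\<integral>x. fn n x * (1 + pfun e (pot (d n) x)) * \<phi> x \<partial>M) + 2 * (\<integral>x. c n x * \<phi> x \<partial>M)" for n
    proof -
      have iF: "integrable M (\<lambda>x. g x * (1 + pfun e (pot (d n) x)) * \<phi> x)" if "g \<in> Bd" for g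
        using p01 by (intro weighted_mult_\<phi> weighted_sign_mult[where C = 2] Bd_weighted that) auto
      have iC: "integrable M (\<lambda>x. c n x * \<phi> x)" by (intro weighted_mult_\<phi> Bd_weighted Bds)
      have "(\<integral>x. (jfun e (pot (d n) x) + pot (d n) x) * \<rho> x \<partial>M) \<le> (\<integral>x. d n x * (1 + pfun e (pot (d n) x)) * \<phi> x \<partial>M)"
        by (rule kato_bounded_plus[OF dB e])
      also have "\<dots> \<le> (\<integral>x. fn n x * (1 + pfun e (pot (d n) x)) * \<phi> x + 2 * (c n x * \<phi> x) \<partial>M)"
      proof (rule integral_mono)
        show "integrable M (\<lambda>x. d n x * (1 + pfun e (pot (d n) x)) * \<phi> x)" by (rule iF[OF dB])
        show "integrable M (\<lambda>x. fn n x * (1 + pfun e (pot (d n) x)) * \<phi> x + 2 * (c n x * \<phi> x))"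
          using iF[OF fnB] iC by auto
        fix x assume "x \<in> space M"
        then have x: "x \<in> \<Omega>" by simp
        have dx: "d n x = fn n x + a n x - b n x" by (simp add: d_def)
        define p where "p = 1 + pfun e (pot (d n) x)"
        have p: "0 \<le> p" "p \<le> 2" unfolding p_def by (rule p01)+
        have "(a n x - b n x) * p \<le> c n x * p" using le[OF x] p by (intro mult_right_mono) auto
        also have "\<dots> \<le> c n x * 2" using c0[OF x] p by (intro mult_left_mono) auto
        finally have "((a n x - b n x) * p) * \<phi> x \<le> (c n x * 2) * \<phi> x"
          using \<phi>_bounds(3)[OF x] by (intro mult_right_mono)
        then show "d n x * (1 + pfun e (pot (d n) x)) * \<phi> x \<le> fn n x * (1 + pfun e (pot (d n) x)) * \<phi> x + 2 * (c n x * \<phi> x)"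
          unfolding p_def[symmetric] dx by (simp add: algebra_simps)
      qed
      also have "\<dots> = (\<integral>x. fn n x * (1 + pfun e (pot (d n) x)) * \<phi> x \<partial>M) + 2 * (\<integral>x. c n x * \<phi> x \<partial>M)"
        using iF[OF fnB] iC by simp
      finally show ?thesis .
    qed
    have L: "(\<lambda>n. \<integral>x. (jfun e (pot (d (r n)) x) + pot (d (r n)) x) * \<rho> x \<partial>M) \<longlonglongrightarrow> (\<integral>x. (jfun e (w x) + w x) * \<rho> x \<partial>M)"
    proof -
      have le: "\<bar>(\<integral>x. (jfun e (w x) + w x) * \<rho> x \<partial>M) - (\<integral>x. (jfun e (pot (d n) x) + pot (d n) x) * \<rho> x \<partial>M)\<bar>
          \<le> 2 * (\<integral>x. \<bar>w x - pot (d n) x\<bar> * \<rho> x \<partial>M)" for n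
      proof -
        have i1: "integrable M (\<lambda>x. (jfun e (w x) + w x) * \<rho> x)"
          "integrable M (\<lambda>x. (jfun e (pot (d n) x) + pot (d n) x) * \<rho> x)"
          using wj[OF ww] wj[OF Bd_weighted[OF pot_Bd[OF dB]]] by (auto simp: weighted_M_iff)
        have "\<bar>(\<integral>x. (jfun e (w x) + w x) * \<rho> x \<partial>M) - (\<integral>x. (jfun e (pot (d n) x) + pot (d n) x) * \<rho> x \<partial>M)\<bar>
            = norm (\<integral>x. (jfun e (w x) + w x) * \<rho> x - (jfun e (pot (d n) x) + pot (d n) x) * \<rho> x \<partial>M)"
          using i1 by simp
        also have "\<dots> \<le> (\<integral>x. norm ((jfun e (w x) + w x) * \<rho> x - (jfun e (pot (d n) x) + pot (d n) x) * \<rho> x) \<partial>M)"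
          by (rule integral_norm_bound)
        also have "\<dots> \<le> (\<integral>x. 2 * (\<bar>w x - pot (d n) x\<bar> * \<rho> x) \<partial>M)"
        proof (rule integral_mono)
          show "integrable M (\<lambda>x. 2 * (\<bar>w x - pot (d n) x\<bar> * \<rho> x))" using weighted_abs[OF wdiff] by (simp add: weighted_M_iff)
          fix x
          have "\<bar>(jfun e (w x) + w x) - (jfun e (pot (d n) x) + pot (d n) x)\<bar> \<le> 2 * \<bar>w x - pot (d n) x\<bar>"
            using jfun_lipschitz[OF e, of "w x" "pot (d n) x"] by (rule abs_add_diff_le)
          from mult_right_mono[OF this, of "\<rho> x"]
          show "norm ((jfun e (w x) + w x) * \<rho> x - (jfun e (pot (d n) x) + pot (d n) x) * \<rho> x) \<le> 2 * (\<bar>w x - pot (d n) x\<bar> * \<rho> x)"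
            by (simp add: abs_mult flip: left_diff_distrib)
        qed (use i1 in auto)
        finally show ?thesis by simp
      qed
      have "(\<lambda>n. 2 * (\<integral>x. \<bar>w x - pot (d n) x\<bar> * \<rho> x \<partial>M)) \<longlonglongrightarrow> 0"
        by (rule tendsto_mult_right_zero[OF conv])
      from tendsto_diff_le[OF this le]
      have "(\<lambda>n. \<integral>x. (jfun e (pot (d n) x) + pot (d n) x) * \<rho> x \<partial>M) \<longlonglongrightarrow> (\<integral>x. (jfun e (w x) + w x) * \<rho> x \<partial>M)" .
      from LIMSEQ_subseq_LIMSEQ[OF this r(1)] show ?thesis by (simp add: o_def)
    qed
    have R: "(\<lambda>n. \<integral>x. fn (r n) x * (1 + pfun e (pot (d (r n)) x)) * \<phi> x \<partial>M) \<longlonglongrightarrow> (\<integral>x. f x * (1 + pfun e (w x)) * \<phi> x \<partial>M)"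
    proof (rule integral_dominated_convergence[where w = "\<lambda>x. 2 * (\<bar>f x\<bar> * \<phi> x)"])
      show "integrable M (\<lambda>x. 2 * (\<bar>f x\<bar> * \<phi> x))" using weighted_mult_\<phi>[OF weighted_abs[OF f]] by simp
      show "(\<lambda>x. fn (r n) x * (1 + pfun e (pot (d (r n)) x)) * \<phi> x) \<in> borel_measurable M" for n
        unfolding fn_def by measurable
      show "AE x in M. norm (fn (r n) x * (1 + pfun e (pot (d (r n)) x)) * \<phi> x) \<le> 2 * (\<bar>f x\<bar> * \<phi> x)" for n
        using AE_space
      proof eventually_elim
        case (elim x)
        then have x: "x \<in> \<Omega>" by simp
        have "\<bar>fn (r n) x\<bar> * \<bar>1 + pfun e (pot (d (r n)) x)\<bar> \<le> \<bar>f x\<bar> * 2"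
          using fn_le p01 by (intro mult_mono) auto
        from mult_right_mono[OF this \<phi>_bounds(3)[OF x]] show ?case
          using \<phi>_bounds(3)[OF x] by (simp add: abs_mult mult_ac)
      qed
      show "AE x in M. (\<lambda>n. fn (r n) x * (1 + pfun e (pot (d (r n)) x)) * \<phi> x) \<longlonglongrightarrow> f x * (1 + pfun e (w x)) * \<phi> x"
        using wlim
      proof eventually_elim
        case (elim x)
        have "(\<lambda>n. fn (r n) x) \<longlonglongrightarrow> f x" using LIMSEQ_subseq_LIMSEQ[OF fn_lim r(1)] by (simp add: o_def)
        moreover have "(\<lambda>n. pfun e (pot (d (r n)) x)) \<longlonglongrightarrow> pfun e (w x)"
          by (rule continuous_on_tendsto_compose[OF continuous_pfun[OF e] elim]) auto
        ultimately show ?case by (intro tendsto_intros)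
      qed
    qed measurable
    have C: "(\<lambda>n. \<integral>x. c (r n) x * \<phi> x \<partial>M) \<longlonglongrightarrow> (\<integral>x. V\<^sub>3 x * \<rho> x \<partial>M)"
      using LIMSEQ_subseq_LIMSEQ[OF approximates_integral[OF c] r(1)] by (simp add: o_def)
    show ?thesis
      by (rule LIMSEQ_le[OF L tendsto_add[OF R tendsto_mult[OF tendsto_const[of 2] C]]]) (use step in blast)
  qed

  let ?e = "\<lambda>k. inverse (real (Suc k))"
  have e0: "(\<lambda>k. ?e k) \<longlonglongrightarrow> 0" by (rule LIMSEQ_inverse_real_of_nat)
  have e1: "filterlim ?e (at_right 0) sequentially"
    using e0 by (auto simp: filterlim_at intro!: always_eventually)
  have "(\<lambda>k. \<integral>x. (jfun (?e k) (w x) + w x) * \<rho> x \<partial>M) \<longlonglongrightarrow> (\<integral>x. (\<bar>w x\<bar> + w x) * \<rho> x \<partial>M)"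
  proof (rule integral_dominated_convergence[where w = "\<lambda>x. 2 * (\<bar>w x\<bar> * \<rho> x)"])
    show "integrable M (\<lambda>x. 2 * (\<bar>w x\<bar> * \<rho> x))" using weighted_abs[OF ww] by (simp add: weighted_M_iff)
    show "AE x in M. norm ((jfun (?e k) (w x) + w x) * \<rho> x) \<le> 2 * (\<bar>w x\<bar> * \<rho> x)" for k
    proof (rule AE_I2)
      fix x
      have "\<bar>jfun (?e k) (w x) + w x\<bar> \<le> 2 * \<bar>w x\<bar>"
        using jfun_nonneg[of "?e k" "w x"] jfun_le[of "?e k" "w x"] by simp
      from mult_right_mono[OF this, of "\<rho> x"] show "norm ((jfun (?e k) (w x) + w x) * \<rho> x) \<le> 2 * (\<bar>w x\<bar> * \<rho> x)"
        by (simp add: abs_mult)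
    qed
    show "AE x in M. (\<lambda>k. (jfun (?e k) (w x) + w x) * \<rho> x) \<longlonglongrightarrow> (\<bar>w x\<bar> + w x) * \<rho> x"
    proof (rule AE_I2)
      fix x
      have "(\<lambda>k. jfun (?e k) (w x)) \<longlonglongrightarrow> \<bar>w x\<bar>"
      proof (rule tendsto_sandwich)
        show "(\<lambda>k. \<bar>w x\<bar> - ?e k) \<longlonglongrightarrow> \<bar>w x\<bar>" using tendsto_diff[OF tendsto_const e0] by simp
        show "\<forall>\<^sub>F k in sequentially. \<bar>w x\<bar> - ?e k \<le> jfun (?e k) (w x)" by (intro always_eventually allI abs_le_jfun)
        show "\<forall>\<^sub>F k in sequentially. jfun (?e k) (w x) \<le> \<bar>w x\<bar>" by (intro always_eventually allI jfun_le) simp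
      qed simp
      then show "(\<lambda>k. (jfun (?e k) (w x) + w x) * \<rho> x) \<longlonglongrightarrow> (\<bar>w x\<bar> + w x) * \<rho> x" by (intro tendsto_intros)
    qed
  qed measurable
  moreover have "(\<lambda>k. \<integral>x. f x * (1 + pfun (?e k) (w x)) * \<phi> x \<partial>M) \<longlonglongrightarrow> (\<integral>x. f x * (1 + sgn (w x)) * \<phi> x \<partial>M)"
  proof (rule integral_dominated_convergence[where w = "\<lambda>x. 2 * (\<bar>f x\<bar> * \<phi> x)"])
    show "integrable M (\<lambda>x. 2 * (\<bar>f x\<bar> * \<phi> x))" using weighted_mult_\<phi>[OF weighted_abs[OF f]] by simp
    show "AE x in M. norm (f x * (1 + pfun (?e k) (w x)) * \<phi> x) \<le> 2 * (\<bar>f x\<bar> * \<phi> x)" for k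
      using AE_space
    proof eventually_elim
      case (elim x)
      then have x: "x \<in> \<Omega>" by simp
      have "\<bar>f x\<bar> * \<bar>1 + pfun (?e k) (w x)\<bar> \<le> \<bar>f x\<bar> * 2"
        using abs_pfun_le[of "?e k" "w x"] by (intro mult_left_mono) auto
      from mult_right_mono[OF this \<phi>_bounds(3)[OF x]] show ?case
        using \<phi>_bounds(3)[OF x] by (simp add: abs_mult mult_ac)
    qed
    show "AE x in M. (\<lambda>k. f x * (1 + pfun (?e k) (w x)) * \<phi> x) \<longlonglongrightarrow> f x * (1 + sgn (w x)) * \<phi> x"
      by (intro AE_I2 tendsto_intros filterlim_compose[OF pfun_tendsto_sgn e1])
  qed measurable
  ultimately show ?thesis
    by (intro LIMSEQ_le[OF _ tendsto_add[OF _ tendsto_const]]) (use main in auto)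
qed

end

section \<open>Existence for a truncated nonlinearity\<close>

text \<open>Summable L^1 norms give an almost everywhere finite sum of absolute values. For
  increments with geometrically small norms this yields convergence of the whole sequence almost
  everywhere.\<close>

lemma AE_summable_L1:
  fixes g :: "nat \<Rightarrow> 'b \<Rightarrow> real"
  assumes i: "\<And>j. integrable N (g j)" and s: "summable (\<lambda>j. \<integral>x. \<bar>g j x\<bar> \<partial>N)"
  shows "AE x in N. summable (\<lambda>j. \<bar>g j x\<bar>)"
proof -
  have [measurable]: "g j \<in> borel_measurable N" for j using i by auto
  have "(\<integral>\<^sup>+x. (\<Sum>j. ennreal \<bar>g j x\<bar>) \<partial>N) = (\<Sum>j. \<integral>\<^sup>+x. ennreal \<bar>g j x\<bar> \<partial>N)"
    by (intro nn_integral_suminf) auto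
  also have "\<dots> = (\<Sum>j. ennreal (\<integral>x. \<bar>g j x\<bar> \<partial>N))"
    using i by (intro suminf_cong nn_integral_eq_integral) auto
  also have "\<dots> \<noteq> \<infinity>" using s by (subst suminf_ennreal2) auto
  finally have "AE x in N. (\<Sum>j. ennreal \<bar>g j x\<bar>) \<noteq> \<infinity>"
    by (intro nn_integral_PInf_AE) auto
  then show ?thesis
    by eventually_elim (intro summable_suminf_not_top, auto)
qed

lemma convergent_of_summable_diff:
  fixes a :: "nat \<Rightarrow> real"
  assumes "summable (\<lambda>n. \<bar>a (Suc n) - a n\<bar>)"
  shows "convergent a"
proof -
  have "summable (\<lambda>n. a (Suc n) - a n)" using assms by (rule summable_rabs_cancel)
  then have "convergent (\<lambda>n. \<Sum>i<n. a (Suc i) - a i)" by (simp add: summable_iff_convergent)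
  then have "convergent (\<lambda>n. (a n - a 0) + a 0)" unfolding sum_lessThan_telescope by (intro convergent_add convergent_const)
  then show ?thesis by simp
qed

text \<open>Young's inequality with a free scale; it turns a geometric bound for a mean square into
  one for the mean at the rate of the root.\<close>

lemma abs_le_scaled:
  fixes a b :: real
  assumes "0 < a"
  shows "\<bar>b\<bar> \<le> (a / 2) * 1 + 1 / (2 * a) * b\<^sup>2"
proof -
  have "\<bar>b\<bar> * (2 * a) \<le> a * a + b\<^sup>2"
    using zero_le_power2[of "a - \<bar>b\<bar>"] by (simp add: power2_eq_square algebra_simps)
  then have "\<bar>b\<bar> \<le> (a * a + b\<^sup>2) / (2 * a)" using assms by (subst pos_le_divide_eq) auto
  also have "\<dots> = (a / 2) * 1 + 1 / (2 * a) * b\<^sup>2" using assms by (simp add: field_simps)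
  finally show ?thesis .
qed

section \<open>The quadratic form of the kernel and the Lipschitz problem\<close>

context dual_kernel
begin

text \<open>Functions bounded by a multiple of the weight: the potential operator maps this class
  into itself by \<open>K_weight\<close>, and \<open>potential_symmetric\<close> pairs it with all
  weighted data, so the quadratic form is symmetric there.\<close>

definition dominated :: "('a \<Rightarrow> real) \<Rightarrow> bool" where
  "dominated h \<longleftrightarrow> h \<in> borel_measurable M \<and> (\<exists>C. \<forall>x\<in>\<Omega>. \<bar>h x\<bar> \<le> C * \<rho> x)"

lemma dominated_Bd: "dominated h \<Longrightarrow> h \<in> Bd"
proof -
  assume "dominated h"
  then obtain C where C: "\<forall>x\<in>\<Omega>. \<bar>h x\<bar> \<le> C * \<rho> x" and m: "h \<in> borel_measurable M" by (auto simp: dominated_def)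
  obtain R where R: "R > 0" "\<And>x. \<rho> x \<le> R" using \<rho>_bounded by blast
  have "\<bar>h x\<bar> \<le> \<bar>C\<bar> * R" if "x \<in> \<Omega>" for x
  proof -
    have "\<bar>h x\<bar> \<le> C * \<rho> x" using C that by blast
    also have "\<dots> \<le> \<bar>C\<bar> * \<rho> x" by (intro mult_right_mono) auto
    also have "\<dots> \<le> \<bar>C\<bar> * R" using R by (intro mult_left_mono) auto
    finally show ?thesis .
  qed
  then show ?thesis using m by (intro BdI)
qed

lemma dominated_cmult:
  assumes "dominated f"
  shows "dominated (\<lambda>x. c * f x)"
proof -
  from assms obtain C where C: "\<forall>x\<in>\<Omega>. \<bar>f x\<bar> \<le> C * \<rho> x" and m: "f \<in> borel_measurable M" by (auto simp: dominated_def)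
  have "\<bar>c * f x\<bar> \<le> (\<bar>c\<bar> * C) * \<rho> x" if "x \<in> \<Omega>" for x
    using C that by (simp add: abs_mult mult.assoc mult_left_mono)
  then show ?thesis using m by (auto simp: dominated_def)
qed

lemma dominated_add:
  assumes "dominated f" "dominated g"
  shows "dominated (\<lambda>x. f x + g x)"
proof -
  from assms obtain C D where C: "\<forall>x\<in>\<Omega>. \<bar>f x\<bar> \<le> C * \<rho> x" and D: "\<forall>x\<in>\<Omega>. \<bar>g x\<bar> \<le> D * \<rho> x"
    and m: "f \<in> borel_measurable M" "g \<in> borel_measurable M" by (auto simp: dominated_def)
  have "\<bar>f x + g x\<bar> \<le> (C + D) * \<rho> x" if "x \<in> \<Omega>" for x
  proof -
    have "\<bar>f x\<bar> \<le> C * \<rho> x" "\<bar>g x\<bar> \<le> D * \<rho> x" using C D that by auto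
    then show ?thesis using abs_triangle_ineq[of "f x" "g x"] by (simp add: distrib_right)
  qed
  then show ?thesis using m by (auto simp: dominated_def)
qed

lemma dominated_diff: "dominated f \<Longrightarrow> dominated g \<Longrightarrow> dominated (\<lambda>x. f x - g x)"
  using dominated_add[OF _ dominated_cmult[of g "-1"], of f] by simp

lemma dominated_pot:
  assumes "dominated f"
  shows "dominated (pot f)"
proof -
  from assms obtain C where C: "\<forall>x\<in>\<Omega>. \<bar>f x\<bar> \<le> C * \<rho> x" by (auto simp: dominated_def)
  have fB: "f \<in> Bd" by (rule dominated_Bd) fact
  have CB: "(\<lambda>x. C * \<rho> x) \<in> Bd" by (intro Bd_cmult \<rho>_Bd)
  have "\<bar>pot f x\<bar> \<le> (\<bar>C\<bar> * C\<^sub>0) * \<rho> x" if x: "x \<in> \<Omega>" for x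
  proof -
    have "pot f x \<le> pot (\<lambda>x. C * \<rho> x) x" using C by (intro pot_mono fB CB x) (auto simp: abs_le_iff)
    moreover have "pot (\<lambda>x. - f x) x \<le> pot (\<lambda>x. C * \<rho> x) x" using C by (intro pot_mono Bd_uminus fB CB x) (auto simp: abs_le_iff)
    ultimately have "\<bar>pot f x\<bar> \<le> C * \<phi> x" by (simp add: pot_cmult pot_uminus)
    also have "\<dots> \<le> \<bar>C\<bar> * \<phi> x" using \<phi>_bounds(3)[OF x] by (intro mult_right_mono) auto
    also have "\<dots> \<le> \<bar>C\<bar> * (C\<^sub>0 * \<rho> x)" using \<phi>_bounds(2)[OF x] by (intro mult_left_mono) auto
    finally show ?thesis by (simp add: mult.assoc)
  qed
  then show ?thesis using Bd_measurable[OF pot_Bd[OF fB]] by (auto simp: dominated_def)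
qed

lemma form_symmetric:
  assumes "dominated f" "h \<in> Bd"
  shows "(\<integral>x. f x * pot h x \<partial>M) = (\<integral>x. h x * pot f x \<partial>M)"
proof -
  from assms(1) obtain C where "f \<in> borel_measurable M" "\<And>x. x \<in> \<Omega> \<Longrightarrow> \<bar>f x\<bar> \<le> C * \<rho> x" by (auto simp: dominated_def)
  from potential_symmetric(1)[OF Bd_weighted[OF assms(2)] this] show ?thesis by (simp add: mult.commute)
qed

lemma form_le:
  assumes h: "dominated h"
  shows "(\<integral>x. h x * pot h x \<partial>M) \<le> (C\<^sub>1 + 1) * (\<integral>x. (h x)\<^sup>2 \<partial>M)"
proof -
  have hB: "h \<in> Bd" by (rule dominated_Bd[OF h])
  have h2B: "(\<lambda>x. (h x)\<^sup>2) \<in> Bd" using Bd_mult[OF hB hB] by (simp add: power2_eq_square)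
  have oneB: "(\<lambda>x. 1) \<in> Bd" by (rule Bd_const)
  from h obtain C where C: "\<forall>x\<in>\<Omega>. \<bar>h x\<bar> \<le> C * \<rho> x" by (auto simp: dominated_def)
  obtain D where D: "D \<ge> 0" "\<forall>x\<in>\<Omega>. \<bar>h x\<bar> \<le> D" using Bd_E[OF hB] by blast
  have h2d: "dominated (\<lambda>x. (h x)\<^sup>2)"
  proof -
    have "\<bar>(h x)\<^sup>2\<bar> \<le> (D * C) * \<rho> x" if x: "x \<in> \<Omega>" for x
    proof -
      have "\<bar>h x\<bar> * \<bar>h x\<bar> \<le> D * (C * \<rho> x)" using C D x by (intro mult_mono) auto
      then show ?thesis by (simp add: power2_eq_square mult.assoc)
    qed
    then show ?thesis using Bd_measurable[OF h2B] by (auto simp: dominated_def)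
  qed
  have pt: "h x * pot h x \<le> ((h x)\<^sup>2 * pot (\<lambda>x. 1) x + 1 * pot (\<lambda>x. (h x)\<^sup>2) x) / 2" if x: "x \<in> \<Omega>" for x
  proof -
    have "h x * pot h x = (\<integral>y. K x y * h y * h x \<partial>M)" unfolding potential_def by (simp add: mult.commute)
    also have "\<dots> \<le> (\<integral>y. (K x y * 1) * ((h x)\<^sup>2 / 2) + (K x y * (h y)\<^sup>2) * (1 / 2) \<partial>M)"
    proof (rule integral_mono)
      show "integrable M (\<lambda>y. K x y * h y * h x)" using potential_Bd_integrable[OF hB x] by simp
      show "integrable M (\<lambda>y. (K x y * 1) * ((h x)\<^sup>2 / 2) + (K x y * (h y)\<^sup>2) * (1 / 2))"
        using potential_Bd_integrable[OF oneB x] potential_Bd_integrable[OF h2B x] by auto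
      fix y
      have "h y * h x \<le> ((h x)\<^sup>2 + (h y)\<^sup>2) / 2" using zero_le_power2[of "h x - h y"] by (simp add: power2_eq_square algebra_simps)
      from mult_left_mono[OF this K_nonneg[of x y]]
      show "K x y * h y * h x \<le> (K x y * 1) * ((h x)\<^sup>2 / 2) + (K x y * (h y)\<^sup>2) * (1 / 2)"
        by (simp add: algebra_simps add_divide_distrib)
    qed
    also have "\<dots> = ((h x)\<^sup>2 * pot (\<lambda>x. 1) x + 1 * pot (\<lambda>x. (h x)\<^sup>2) x) / 2"
      unfolding potential_def
      using potential_Bd_integrable[OF oneB x] potential_Bd_integrable[OF h2B x] by (simp add: add_divide_distrib)
    finally show ?thesis .
  qed
  have i: "integrable M (\<lambda>x. h x * pot h x)" "integrable M (\<lambda>x. (h x)\<^sup>2 * pot (\<lambda>x. 1) x)"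
    "integrable M (\<lambda>x. 1 * pot (\<lambda>x. (h x)\<^sup>2) x)" "integrable M (\<lambda>x. (h x)\<^sup>2)"
    using hB h2B oneB by (auto intro!: Bd_integrable Bd_mult pot_Bd simp del: mult_1)
  have "(\<integral>x. h x * pot h x \<partial>M) \<le> (\<integral>x. ((h x)\<^sup>2 * pot (\<lambda>x. 1) x + 1 * pot (\<lambda>x. (h x)\<^sup>2) x) / 2 \<partial>M)"
    using i pt by (intro integral_mono) auto
  also have "\<dots> = ((\<integral>x. (h x)\<^sup>2 * pot (\<lambda>x. 1) x \<partial>M) + (\<integral>x. 1 * pot (\<lambda>x. (h x)\<^sup>2) x \<partial>M)) / 2" using i by simp
  also have "\<dots> = (\<integral>x. (h x)\<^sup>2 * pot (\<lambda>x. 1) x \<partial>M)" using form_symmetric[OF h2d oneB] by simp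
  also have "\<dots> \<le> (\<integral>x. (C\<^sub>1 + 1) * (h x)\<^sup>2 \<partial>M)"
  proof (rule integral_mono)
    fix x assume "x \<in> space M"
    then have "\<bar>pot (\<lambda>x. 1) x\<bar> \<le> C\<^sub>1 * 1" by (intro potential_Bd_bound oneB) auto
    then have "pot (\<lambda>x. 1) x \<le> C\<^sub>1 + 1" by simp
    then have "pot (\<lambda>x. 1) x * (h x)\<^sup>2 \<le> (C\<^sub>1 + 1) * (h x)\<^sup>2" by (intro mult_right_mono) auto
    then show "(h x)\<^sup>2 * pot (\<lambda>x. 1) x \<le> (C\<^sub>1 + 1) * (h x)\<^sup>2" by (simp only: mult.commute)
  qed (use i in auto)
  finally show ?thesis by simp
qed

text \<open>For a nonnegative symmetric operator T with norm at most S this is T^2 \<le> S T. The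
  proof evaluates the form at \<open>h - t * pot h\<close>; with \<open>t = 1 / S\<close> the
  quadratic term, bounded by \<open>form_le\<close>, cancels one of the two cross terms.\<close>

lemma pot_sq_le_form:
  assumes h: "dominated h"
  shows "(\<integral>x. (pot h x)\<^sup>2 \<partial>M) \<le> (C\<^sub>1 + 1) * (\<integral>x. h x * pot h x \<partial>M)"
proof -
  define S where "S = C\<^sub>1 + 1"
  have S: "S > 0" using const_nonneg by (simp add: S_def)
  define u where "u = pot h"
  have u: "dominated u" unfolding u_def by (rule dominated_pot[OF h])
  define t where "t = 1 / S"
  have B: "h \<in> Bd" "u \<in> Bd" "pot u \<in> Bd" using h u by (auto intro: dominated_Bd pot_Bd)
  have i: "integrable M (\<lambda>x. h x * u x)" "integrable M (\<lambda>x. h x * pot u x)"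
    "integrable M (\<lambda>x. u x * u x)" "integrable M (\<lambda>x. u x * pot u x)"
    by (intro Bd_integrable Bd_mult B)+
  have "0 \<le> (\<integral>x. (h x - t * u x) * pot (\<lambda>x. h x - t * u x) x \<partial>M)"
    by (intro potential_form_nonneg Bd_diff Bd_cmult B)
  also have "\<dots> = (\<integral>x. h x * u x - t * (h x * pot u x) - t * (u x * u x) + t * t * (u x * pot u x) \<partial>M)"
  proof (rule Bochner_Integration.integral_cong[OF refl])
    fix x assume "x \<in> space M"
    then have eq: "pot (\<lambda>x. h x - t * u x) x = u x - t * pot u x"
      using B by (subst pot_diff) (auto simp: pot_cmult u_def[symmetric] intro: Bd_cmult)
    show "(h x - t * u x) * pot (\<lambda>x. h x - t * u x) x =
        h x * u x - t * (h x * pot u x) - t * (u x * u x) + t * t * (u x * pot u x)"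
      unfolding eq by (simp add: algebra_simps)
  qed
  also have "\<dots> = (\<integral>x. h x * u x \<partial>M) - t * (\<integral>x. h x * pot u x \<partial>M) - t * (\<integral>x. u x * u x \<partial>M) + t * t * (\<integral>x. u x * pot u x \<partial>M)"
    using i by simp
  also have "(\<integral>x. h x * pot u x \<partial>M) = (\<integral>x. u x * u x \<partial>M)"
    using form_symmetric[OF h B(2)] by (simp add: u_def)
  also have "t * t * (\<integral>x. u x * pot u x \<partial>M) \<le> t * t * (S * (\<integral>x. (u x)\<^sup>2 \<partial>M))"
    using form_le[OF u] by (intro mult_left_mono) (auto simp: S_def)
  also have "\<dots> = t * (\<integral>x. (u x)\<^sup>2 \<partial>M)" using S by (simp add: t_def)
  finally have "0 \<le> (\<integral>x. h x * u x \<partial>M) - t * (\<integral>x. (u x)\<^sup>2 \<partial>M)" by (simp add: power2_eq_square)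
  then have "S * (t * (\<integral>x. (u x)\<^sup>2 \<partial>M)) \<le> S * (\<integral>x. h x * u x \<partial>M)" using S by (intro mult_left_mono) auto
  then show ?thesis using S by (simp add: t_def S_def u_def)
qed

text \<open>
  For \<open>q\<close> nonincreasing and Lipschitz, the relaxed iteration \<open>h \<mapsto> (1 - \<theta>) h + \<theta> q(x, pot h)\<close> is a
  contraction in the seminorm \<open>h \<mapsto> \<integral> h * pot h\<close>: the cross term is at most
  \<open>- (1/L) \<integral> D\<^sup>2\<close>, where \<open>D\<close> is the increment of \<open>q\<close>, and this absorbs \<open>\<theta> \<integral> D * pot D\<close> for small \<open>\<theta>\<close>.
\<close>

lemma lipschitz_solution:
  fixes q :: "'a \<Rightarrow> real \<Rightarrow> real"
  assumes meas: "\<And>v. v \<in> borel_measurable M \<Longrightarrow> (\<lambda>x. q x (v x)) \<in> borel_measurable M"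
    and dom: "\<And>x t. x \<in> \<Omega> \<Longrightarrow> \<bar>q x t\<bar> \<le> C * \<rho> x"
    and anti: "\<And>x s t. x \<in> \<Omega> \<Longrightarrow> s \<le> t \<Longrightarrow> q x t \<le> q x s"
    and lip: "\<And>x s t. x \<in> \<Omega> \<Longrightarrow> \<bar>q x s - q x t\<bar> \<le> L * \<bar>s - t\<bar>" and L: "0 < L"
  shows "\<exists>h. dominated h \<and> (AE x in M. h x = q x (pot h x))"
proof -
  define S where "S = C\<^sub>1 + 1"
  have S: "S > 0" using const_nonneg by (simp add: S_def)
  define \<theta> where "\<theta> = 1 / (1 + S * L)"
  have SL: "S * L > 0" using S L by simp
  have \<theta>: "0 < \<theta>" "\<theta> < 1" using SL by (auto simp: \<theta>_def divide_less_eq)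
  have \<theta>S: "\<theta> * S \<le> 2 * (1 - \<theta>) / L"
  proof -
    have "\<theta> * (S * L) = 1 - \<theta>" using SL by (simp add: \<theta>_def field_simps)
    then have "\<theta> * S * L \<le> 2 * (1 - \<theta>)" using \<theta> by (simp add: mult.assoc)
    then show ?thesis using L by (simp add: pos_le_divide_eq)
  qed
  define r where "r = 1 - \<theta>"
  have r: "0 < r" "r < 1" using \<theta> by (auto simp: r_def)
  have qd: "dominated (\<lambda>x. q x (pot h x))" if "dominated h" for h
    using meas[OF Bd_measurable[OF pot_Bd[OF dominated_Bd[OF that]]]] dom by (auto simp: dominated_def)
  define it where "it = rec_nat (\<lambda>x. 0) (\<lambda>j h x. r * h x + \<theta> * q x (pot h x))"
  have it0: "it 0 = (\<lambda>x. 0)" and itS: "it (Suc j) = (\<lambda>x. r * it j x + \<theta> * q x (pot (it j) x))" for j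
    by (simp_all add: it_def)
  have itd: "dominated (it j)" for j
  proof (induction j)
    case 0
    show ?case by (auto simp: it0 dominated_def intro!: exI[of _ 0])
  next
    case (Suc j)
    then show ?case unfolding itS by (intro dominated_add dominated_cmult qd)
  qed
  have itB: "it j \<in> Bd" for j by (rule dominated_Bd[OF itd])
  define d where "d = (\<lambda>j x. it (Suc j) x - it j x)"
  have dd: "dominated (d j)" for j unfolding d_def by (intro dominated_diff itd)
  have dB: "d j \<in> Bd" for j by (rule dominated_Bd[OF dd])
  have potd: "pot (d j) x = pot (it (Suc j)) x - pot (it j) x" if "x \<in> \<Omega>" for j x
    unfolding d_def by (rule pot_diff[OF itB itB that])
  define A where "A = (\<lambda>j. \<integral>x. d j x * pot (d j) x \<partial>M)"
  have A0: "0 \<le> A j" for j unfolding A_def by (rule potential_form_nonneg[OF dB])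
  have A_step: "A (Suc j) \<le> r\<^sup>2 * A j" for j
  proof -
    define D where "D = (\<lambda>x. q x (pot (it (Suc j)) x) - q x (pot (it j) x))"
    have Dd: "dominated D" unfolding D_def by (intro dominated_diff qd itd)
    have DB: "D \<in> Bd" by (rule dominated_Bd[OF Dd])
    have dS: "d (Suc j) = (\<lambda>x. r * d j x + \<theta> * D x)"
      unfolding d_def D_def itS[of "Suc j"] itS[of j] by (auto simp: algebra_simps fun_eq_iff itS[of j, symmetric])
    have i: "integrable M (\<lambda>x. d j x * pot (d j) x)" "integrable M (\<lambda>x. d j x * pot D x)"
      "integrable M (\<lambda>x. D x * pot (d j) x)" "integrable M (\<lambda>x. D x * pot D x)" "integrable M (\<lambda>x. (D x)\<^sup>2)"
      using Bd_mult[OF DB DB] by (auto intro!: Bd_integrable Bd_mult pot_Bd dB DB simp: power2_eq_square)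
    have "A (Suc j) = (\<integral>x. r\<^sup>2 * (d j x * pot (d j) x) + r * \<theta> * (d j x * pot D x) + r * \<theta> * (D x * pot (d j) x) + \<theta>\<^sup>2 * (D x * pot D x) \<partial>M)"
      unfolding A_def
    proof (rule Bochner_Integration.integral_cong[OF refl])
      fix x assume "x \<in> space M"
      then have "pot (\<lambda>x. r * d j x + \<theta> * D x) x = r * pot (d j) x + \<theta> * pot D x"
        using dB DB by (subst pot_add) (auto simp: pot_cmult intro: Bd_cmult)
      then show "d (Suc j) x * pot (d (Suc j)) x =
          r\<^sup>2 * (d j x * pot (d j) x) + r * \<theta> * (d j x * pot D x) + r * \<theta> * (D x * pot (d j) x) + \<theta>\<^sup>2 * (D x * pot D x)"
        unfolding dS by (simp add: algebra_simps power2_eq_square)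
    qed
    also have "\<dots> = r\<^sup>2 * A j + 2 * r * \<theta> * (\<integral>x. D x * pot (d j) x \<partial>M) + \<theta>\<^sup>2 * (\<integral>x. D x * pot D x \<partial>M)"
      using i form_symmetric[OF dd DB, of j] by (simp add: A_def)
    also have "\<dots> \<le> r\<^sup>2 * A j + 2 * r * \<theta> * (- (1 / L) * (\<integral>x. (D x)\<^sup>2 \<partial>M)) + \<theta>\<^sup>2 * (S * (\<integral>x. (D x)\<^sup>2 \<partial>M))"
    proof (intro add_mono mult_left_mono order_refl)
      have "(\<integral>x. D x * pot (d j) x \<partial>M) \<le> (\<integral>x. - (1 / L) * (D x)\<^sup>2 \<partial>M)"
      proof (rule integral_mono)
        fix x assume "x \<in> space M"
        then have x: "x \<in> \<Omega>" by simp
        let ?s = "pot (it (Suc j)) x" and ?t = "pot (it j) x"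
        have "\<bar>D x\<bar> \<le> L * \<bar>?s - ?t\<bar>" unfolding D_def by (rule lip[OF x])
        then have "\<bar>D x\<bar> * \<bar>D x\<bar> \<le> \<bar>D x\<bar> * (L * \<bar>?s - ?t\<bar>)" by (intro mult_left_mono) auto
        moreover have "D x * (?s - ?t) = - (\<bar>D x\<bar> * \<bar>?s - ?t\<bar>)"
        proof (cases "?t \<le> ?s")
          case True
          then have "D x \<le> 0" using anti[OF x True] by (simp add: D_def)
          then show ?thesis using True by (simp add: abs_of_nonpos)
        next
          case False
          then have "D x \<ge> 0" using anti[OF x, of ?s ?t] by (simp add: D_def)
          then show ?thesis using False by (simp add: abs_of_neg right_diff_distrib)
        qed
        ultimately have "(D x)\<^sup>2 \<le> - (L * (D x * (?s - ?t)))" by (simp add: power2_eq_square mult_ac)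
        then show "D x * pot (d j) x \<le> - (1 / L) * (D x)\<^sup>2"
          using L by (simp add: potd[OF x] field_simps)
      qed (use i in auto)
      then show "(\<integral>x. D x * pot (d j) x \<partial>M) \<le> - (1 / L) * (\<integral>x. (D x)\<^sup>2 \<partial>M)" by simp
      show "(\<integral>x. D x * pot D x \<partial>M) \<le> S * (\<integral>x. (D x)\<^sup>2 \<partial>M)" unfolding S_def by (rule form_le[OF Dd])
    qed (use r \<theta> in auto)
    also have "\<dots> = r\<^sup>2 * A j + \<theta> * (\<integral>x. (D x)\<^sup>2 \<partial>M) * (\<theta> * S - 2 * (1 - \<theta>) / L)"
      by (simp add: r_def power2_eq_square algebra_simps diff_divide_distrib)
    also have "\<dots> \<le> r\<^sup>2 * A j"
      using \<theta> \<theta>S by (simp add: mult_nonneg_nonpos)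
    finally show ?thesis .
  qed
  have A_le: "A j \<le> A 0 * r ^ j * r ^ j" for j
  proof (induction j)
    case (Suc j)
    have "A (Suc j) \<le> r\<^sup>2 * (A 0 * r ^ j * r ^ j)"
      using A_step[of j] mult_left_mono[OF Suc, of "r\<^sup>2"] by simp
    then show ?case by (simp add: power2_eq_square mult_ac)
  qed simp
  define m where "m = (\<integral>x. (1::real) \<partial>M)"
  \<comment> \<open>The mean square of \<open>pot (d j)\<close> decays like the square of
    \<open>r ^ j\<close>, and Young's inequality with scale \<open>r ^ j\<close> gives the rate
    \<open>r ^ j\<close> for the mean.\<close>
  have L1: "(\<integral>x. \<bar>pot (d j) x\<bar> \<partial>M) \<le> (m + S * A 0) / 2 * r ^ j" for j
  proof -
    have rj: "r ^ j > 0" using r by simp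
    have i: "integrable M (\<lambda>x. (pot (d j) x)\<^sup>2)" "integrable M (pot (d j))"
      using Bd_integrable[OF Bd_mult[OF pot_Bd[OF dB] pot_Bd[OF dB]]] Bd_integrable[OF pot_Bd[OF dB]]
      by (auto simp: power2_eq_square)
    have "(\<integral>x. \<bar>pot (d j) x\<bar> \<partial>M) \<le> (\<integral>x. (r ^ j / 2) * 1 + 1 / (2 * r ^ j) * (pot (d j) x)\<^sup>2 \<partial>M)"
    proof (rule integral_mono)
      fix x
      show "\<bar>pot (d j) x\<bar> \<le> (r ^ j / 2) * 1 + 1 / (2 * r ^ j) * (pot (d j) x)\<^sup>2"
        by (rule abs_le_scaled[OF rj])
    qed (use i in auto)
    also have "\<dots> = (r ^ j / 2) * m + 1 / (2 * r ^ j) * (\<integral>x. (pot (d j) x)\<^sup>2 \<partial>M)"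
      using i by (simp add: m_def)
    also have "\<dots> \<le> (r ^ j / 2) * m + 1 / (2 * r ^ j) * (S * (A 0 * r ^ j * r ^ j))"
    proof (intro add_mono mult_left_mono order_refl)
      have "(\<integral>x. (pot (d j) x)\<^sup>2 \<partial>M) \<le> S * A j" unfolding S_def A_def by (rule pot_sq_le_form[OF dd])
      also have "\<dots> \<le> S * (A 0 * r ^ j * r ^ j)" using A_le S by (intro mult_left_mono) auto
      finally show "(\<integral>x. (pot (d j) x)\<^sup>2 \<partial>M) \<le> S * (A 0 * r ^ j * r ^ j)" .
    qed (use rj in auto)
    also have "\<dots> = (m + S * A 0) / 2 * r ^ j" using rj by (simp add: field_simps)
    finally show ?thesis .
  qed
  have "AE x in M. summable (\<lambda>j. \<bar>pot (d j) x\<bar>)"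
  proof (rule AE_summable_L1)
    show "integrable M (pot (d j))" for j by (rule Bd_integrable[OF pot_Bd[OF dB]])
    have "summable (\<lambda>j. (m + S * A 0) / 2 * r ^ j)" using r by (intro summable_mult summable_geometric) auto
    then show "summable (\<lambda>j. \<integral>x. \<bar>pot (d j) x\<bar> \<partial>M)"
      by (rule summable_comparison_test'[where N = 0]) (use L1 in simp)
  qed
  then have conv: "AE x in M. convergent (\<lambda>j. pot (it j) x)"
    using AE_space
  proof eventually_elim
    case (elim x)
    then show ?case using potd[of x] by (intro convergent_of_summable_diff) simp
  qed
  \<comment> \<open>The seminorm controls the potentials of the iterates, not the iterates. Hence
    the limit is formed for the potentials, and the density is recovered as
    \<open>q x (z x)\<close>.\<close>
  define z where "z = (\<lambda>x. lim (\<lambda>j. pot (it j) x))"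
  have zl: "AE x in M. (\<lambda>j. pot (it j) x) \<longlonglongrightarrow> z x"
    using conv by eventually_elim (simp add: z_def convergent_LIMSEQ_iff)
  have pm [measurable]: "pot (it j) \<in> borel_measurable M" for j by (rule Bd_measurable[OF pot_Bd[OF itB]])
  have zm: "z \<in> borel_measurable M"
    unfolding z_def by measurable
  define h where "h = (\<lambda>x. q x (z x))"
  have hd: "dominated h" unfolding h_def using meas[OF zm] dom by (auto simp: dominated_def)
  have qlim: "AE x in M. (\<lambda>j. q x (pot (it j) x)) \<longlonglongrightarrow> h x"
    using zl AE_space
  proof eventually_elim
    case (elim x)
    then have x: "x \<in> \<Omega>" by simp
    have "(\<lambda>j. L * \<bar>z x - pot (it j) x\<bar>) \<longlonglongrightarrow> L * \<bar>z x - z x\<bar>" by (intro tendsto_intros elim)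
    then have "(\<lambda>j. L * \<bar>z x - pot (it j) x\<bar>) \<longlonglongrightarrow> 0" by simp
    then show ?case unfolding h_def by (rule tendsto_diff_le) (rule lip[OF x])
  qed
  have potlim: "(\<lambda>j. pot (\<lambda>x. q x (pot (it j) x)) x) \<longlonglongrightarrow> pot h x" if x: "x \<in> \<Omega>" for x
    unfolding potential_def[of K M "\<lambda>x. q x (pot (it _) x)"] potential_def[of K M h]
  proof (rule integral_dominated_convergence[where w = "\<lambda>y. K x y * (\<bar>C\<bar> * \<rho> y)"])
    show "integrable M (\<lambda>y. K x y * (\<bar>C\<bar> * \<rho> y))" by (intro potential_Bd_integrable Bd_cmult \<rho>_Bd x)
    have [measurable]: "(\<lambda>x. q x (pot (it j) x)) \<in> borel_measurable M" for j by (intro meas pm)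
    have [measurable]: "h \<in> borel_measurable M" using hd by (simp add: dominated_def)
    show "(\<lambda>y. K x y * q y (pot (it j) y)) \<in> borel_measurable M" for j by measurable
    show "(\<lambda>y. K x y * h y) \<in> borel_measurable M" by measurable
    show "AE y in M. (\<lambda>j. K x y * q y (pot (it j) y)) \<longlonglongrightarrow> K x y * h y"
      using qlim by eventually_elim (intro tendsto_intros)
    show "AE y in M. norm (K x y * q y (pot (it j) y)) \<le> K x y * (\<bar>C\<bar> * \<rho> y)" for j
      using AE_space
    proof eventually_elim
      case (elim y)
      then have "\<bar>q y (pot (it j) y)\<bar> \<le> C * \<rho> y" using dom by simp
      also have "\<dots> \<le> \<bar>C\<bar> * \<rho> y" by (intro mult_right_mono) auto
      finally show ?case using K_nonneg[of x y] by (simp add: abs_mult mult_left_mono)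
    qed
  qed
  have "AE x in M. z x = pot h x"
    using zl AE_space
  proof eventually_elim
    case (elim x)
    then have x: "x \<in> \<Omega>" by simp
    have "pot (it (Suc j)) x = r * pot (it j) x + \<theta> * pot (\<lambda>x. q x (pot (it j) x)) x" for j
      unfolding itS using itB dominated_Bd[OF qd[OF itd]] x
      by (subst pot_add) (auto simp: pot_cmult intro: Bd_cmult)
    moreover have "(\<lambda>j. r * pot (it j) x + \<theta> * pot (\<lambda>x. q x (pot (it j) x)) x) \<longlonglongrightarrow> r * z x + \<theta> * pot h x"
      by (intro tendsto_intros elim potlim x)
    moreover have "(\<lambda>j. pot (it (Suc j)) x) \<longlonglongrightarrow> z x" using elim(1) by (rule LIMSEQ_Suc)
    ultimately have "z x = r * z x + \<theta> * pot h x" using LIMSEQ_unique by auto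
    then have "\<theta> * z x = \<theta> * pot h x" by (simp add: r_def algebra_simps)
    then show ?case using \<theta> by simp
  qed
  then have "AE x in M. h x = q x (pot h x)" by eventually_elim (simp add: h_def)
  then show ?thesis using hd by blast
qed

end

section \<open>Lipschitz approximation of the nonlinearity\<close>

lemma yosida_resolvent:
  fixes g :: "real \<Rightarrow> real"
  assumes "mono g" "continuous_on UNIV g" "g 0 = 0" "0 < l"
  shows "\<exists>s. s + l * g s = t \<and> \<bar>s\<bar> \<le> \<bar>t\<bar> \<and> \<bar>g s\<bar> \<le> \<bar>g t\<bar>"
proof (cases "0 \<le> t")
  case True
  then have gt: "0 \<le> g t" using assms(1,3) by (metis monoD)
  have "\<exists>s\<ge>0. s \<le> t \<and> s + l * g s = t"
    using True gt assms by (intro IVT') (auto intro!: continuous_intros intro: continuous_on_subset)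
  then obtain s where s: "0 \<le> s" "s \<le> t" "s + l * g s = t" by blast
  then have "0 \<le> g s" "g s \<le> g t" using assms(1,3) by (metis monoD)+
  then show ?thesis using s True by (intro exI[of _ s]) auto
next
  case False
  then have gt: "g t \<le> 0" using assms(1,3) by (metis linear monoD)
  have "\<exists>s\<ge>t. s \<le> 0 \<and> s + l * g s = t"
    using False gt assms by (intro IVT')
      (auto intro!: continuous_intros intro: continuous_on_subset simp: mult_nonneg_nonpos)
  then obtain s where s: "t \<le> s" "s \<le> 0" "s + l * g s = t" by blast
  then have "g s \<le> 0" "g t \<le> g s" using assms(1,3) by (metis monoD)+
  then show ?thesis using s False by (intro exI[of _ s]) auto
qed

text \<open>The Yosida approximation \<open>g (r t)\<close>, where \<open>s = r t\<close> solves
  \<open>s + l * g s = t\<close>. It equals \<open>(t - r t) / l\<close>, and both \<open>r\<close>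
  and \<open>g\<close> are nondecreasing, which gives the Lipschitz constant \<open>1 / l\<close>.
  Its values are values of \<open>g\<close> at points displaced by at most
  \<open>l * \<bar>g t\<bar>\<close>.\<close>

lemma yosida:
  fixes g :: "real \<Rightarrow> real"
  assumes g: "mono g" "continuous_on UNIV g" "g 0 = 0" and l: "0 < l"
  shows "\<exists>y. mono y \<and> (\<forall>a b. \<bar>y a - y b\<bar> \<le> 1 / l * \<bar>a - b\<bar>) \<and> (\<forall>t. \<bar>y t\<bar> \<le> \<bar>g t\<bar>) \<and>
    (\<forall>t. \<exists>s. \<bar>t - s\<bar> \<le> l * \<bar>g t\<bar> \<and> \<bar>s\<bar> \<le> \<bar>t\<bar> \<and> y t = g s)"
proof -
  from yosida_resolvent[OF g l] obtain r
    where r: "\<And>t. r t + l * g (r t) = t" "\<And>t. \<bar>r t\<bar> \<le> \<bar>t\<bar>" "\<And>t. \<bar>g (r t)\<bar> \<le> \<bar>g t\<bar>"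
    by metis
  have rm: "r a \<le> r b" if "a \<le> b" for a b
  proof (rule ccontr)
    assume c: "\<not> r a \<le> r b"
    then have "g (r b) \<le> g (r a)" using g(1) by (auto intro: monoD)
    then have "l * g (r b) \<le> l * g (r a)" using l by (intro mult_left_mono) auto
    then show False using r(1)[of a] r(1)[of b] c that by linarith
  qed
  have mono_y: "g (r a) \<le> g (r b)" if "a \<le> b" for a b using monoD[OF g(1) rm[OF that]] .
  have lip: "\<bar>g (r a) - g (r b)\<bar> \<le> 1 / l * \<bar>a - b\<bar>" for a b
  proof -
    have *: "l * (g (r b) - g (r a)) \<le> b - a" if "a \<le> b" for a b
      using r(1)[of a] r(1)[of b] rm[OF that] by (simp add: right_diff_distrib)
    have "l * \<bar>g (r a) - g (r b)\<bar> \<le> \<bar>a - b\<bar>"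
      using *[of a b] *[of b a] mono_y[of a b] mono_y[of b a] by (cases "a \<le> b") (auto simp: abs_if)
    then show ?thesis using l by (simp add: field_simps)
  qed
  have near: "\<bar>t - r t\<bar> \<le> l * \<bar>g t\<bar>" for t
  proof -
    have "t - r t = l * g (r t)" using r(1)[of t] by linarith
    then have "\<bar>t - r t\<bar> = l * \<bar>g (r t)\<bar>" using l by (simp add: abs_mult)
    also have "\<dots> \<le> l * \<bar>g t\<bar>" using l r(3) by (intro mult_left_mono) auto
    finally show ?thesis .
  qed
  have "\<exists>s. \<bar>t - s\<bar> \<le> l * \<bar>g t\<bar> \<and> \<bar>s\<bar> \<le> \<bar>t\<bar> \<and> g (r t) = g s" for t
    using near r(2) by (intro exI[of _ "r t"]) simp
  then show ?thesis
    by (intro exI[of _ "\<lambda>t. g (r t)"] conjI allI monoI mono_y lip r(3))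
qed

lemma lipschitz_approximation:
  fixes g :: "real \<Rightarrow> real"
  assumes g: "mono g" "continuous_on UNIV g" "g 0 = 0"
  shows "\<exists>y e. (\<forall>n. mono (y n) \<and> mono (e n) \<and> (\<forall>a b. \<bar>y n a - y n b\<bar> \<le> real (Suc n) * \<bar>a - b\<bar>) \<and>
    (\<forall>t. \<bar>y n t\<bar> \<le> \<bar>g t\<bar>) \<and> (\<forall>R t. \<bar>t\<bar> \<le> R \<longrightarrow> \<bar>y n t - g t\<bar> \<le> e n R)) \<and>
    (\<forall>R\<ge>0. (\<lambda>n::nat. e n R) \<longlonglongrightarrow> (0::real))"
proof -
  have "\<forall>n. \<exists>y. mono y \<and> (\<forall>a b. \<bar>y a - y b\<bar> \<le> 1 / (1 / real (Suc n)) * \<bar>a - b\<bar>) \<and> (\<forall>t. \<bar>y t\<bar> \<le> \<bar>g t\<bar>) \<and>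
    (\<forall>t. \<exists>s. \<bar>t - s\<bar> \<le> 1 / real (Suc n) * \<bar>g t\<bar> \<and> \<bar>s\<bar> \<le> \<bar>t\<bar> \<and> y t = g s)"
    by (intro allI yosida[OF g]) simp
  then obtain y where y: "\<And>n. mono (y n)" "\<And>n a b. \<bar>y n a - y n b\<bar> \<le> 1 / (1 / real (Suc n)) * \<bar>a - b\<bar>"
    "\<And>n t. \<bar>y n t\<bar> \<le> \<bar>g t\<bar>"
    "\<And>n t. \<exists>s. \<bar>t - s\<bar> \<le> 1 / real (Suc n) * \<bar>g t\<bar> \<and> \<bar>s\<bar> \<le> \<bar>t\<bar> \<and> y n t = g s"
    by metis
  define b where "b = (\<lambda>R. \<bar>g R\<bar> + \<bar>g (- R)\<bar>)"
  have b: "\<bar>g t\<bar> \<le> b R" if "\<bar>t\<bar> \<le> R" for t R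
  proof -
    have "g t \<le> g R" "g (- R) \<le> g t" using that by (auto intro: monoD[OF g(1)])
    then show ?thesis unfolding b_def by linarith
  qed
  \<comment> \<open>The largest error on the interval of radius \<open>R\<close>. Monotonicity in
    \<open>R\<close> makes it Borel measurable, so that it can be composed with a measurable radius;
    the maximum with 0 keeps the interval nonempty.\<close>
  define e where "e = (\<lambda>n R. Sup ((\<lambda>t. \<bar>y n t - g t\<bar>) ` {- max R 0..max R 0}))"
  have bdd: "bdd_above ((\<lambda>t. \<bar>y n t - g t\<bar>) ` {- R..R})" for n R
  proof (rule bdd_aboveI2)
    fix t assume "t \<in> {- R..R}"
    then have "\<bar>g t\<bar> \<le> b R" by (intro b) auto
    then show "\<bar>y n t - g t\<bar> \<le> 2 * b R" using y(3)[of n t] by linarith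
  qed
  have em: "mono (e n)" for n
    unfolding e_def by (intro monoI cSup_subset_mono bdd image_mono) auto
  have eu: "\<bar>y n t - g t\<bar> \<le> e n R" if "\<bar>t\<bar> \<le> R" for n R t
    unfolding e_def using that by (intro cSup_upper bdd imageI) auto
  have el: "(\<lambda>n. e n R) \<longlonglongrightarrow> 0" if R: "0 \<le> R" for R
  proof (rule LIMSEQ_I)
    fix \<epsilon> :: real assume eps: "0 < \<epsilon>"
    have "uniformly_continuous_on {- R..R} g"
      using g(2) by (intro compact_uniformly_continuous) (auto intro: continuous_on_subset)
    then obtain d where d: "0 < d" "\<And>s t. s \<in> {- R..R} \<Longrightarrow> t \<in> {- R..R} \<Longrightarrow> dist s t < d \<Longrightarrow> dist (g s) (g t) < \<epsilon> / 2"
      using eps unfolding uniformly_continuous_on_def by (metis half_gt_zero)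
    \<comment> \<open>On the interval \<open>y n t\<close> is the value of \<open>g\<close> at a
      point within \<open>b R / Suc n\<close> of \<open>t\<close>; from \<open>n0\<close> on this is
      below the modulus \<open>d\<close> of uniform continuity.\<close>
    obtain n0 :: nat where n0: "b R / d < real n0" using reals_Archimedean2 by blast
    have b0: "0 \<le> b R" by (simp add: b_def)
    have "norm (e n R - 0) < \<epsilon>" if n: "n \<ge> n0" for n
    proof -
      have "real n0 < real (Suc n)" using n by simp
      then have "b R / d < real (Suc n)" using n0 by linarith
      then have "b R < real (Suc n) * d" using d(1) by (simp only: pos_divide_less_eq)
      then have bd: "1 / real (Suc n) * b R < d" by (simp add: divide_less_eq mult.commute)
      have "\<bar>y n t - g t\<bar> \<le> \<epsilon> / 2" if t: "t \<in> {- R..R}" for t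
      proof -
        obtain s where s: "\<bar>t - s\<bar> \<le> 1 / real (Suc n) * \<bar>g t\<bar>" "\<bar>s\<bar> \<le> \<bar>t\<bar>" "y n t = g s" using y(4) by blast
        have "1 / real (Suc n) * \<bar>g t\<bar> \<le> 1 / real (Suc n) * b R"
          using t by (intro mult_left_mono b) auto
        then have "dist s t < d" using s(1) bd by (simp add: dist_real_def abs_minus_commute)
        moreover have "s \<in> {- R..R}" using s(2) t by auto
        ultimately show ?thesis using d(2)[of s t] t s(3) by (simp add: dist_real_def)
      qed
      then have "e n R \<le> \<epsilon> / 2"
        unfolding e_def using R by (intro cSup_least) auto
      moreover have "0 \<le> e n R" using eu[of 0 R n] R by linarith
      ultimately show ?thesis using eps by simp
    qed
    then show "\<exists>n0. \<forall>n\<ge>n0. norm (e n R - 0) < \<epsilon>" by blast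
  qed
  show ?thesis
    using y(1,2,3) em eu el by (intro exI[of _ y] exI[of _ e]) auto
qed

section \<open>From Lipschitz to integrable nonlinearities\<close>

context dual_kernel
begin

text \<open>The one-sided inequality is used for \<open>f\<close> and for \<open>- f\<close>,
  without sources; the linear terms cancel in the sum.\<close>

lemma kato_abs:
  assumes f: "weighted M f"
  shows "(\<integral>x. \<bar>pot f x\<bar> * \<rho> x \<partial>M) \<le> (\<integral>x. f x * sgn (pot f x) * \<phi> x \<partial>M)"
proof -
  have [measurable]: "pot f \<in> borel_measurable M" by (rule pot_measurable[OF f])
  have [measurable]: "f \<in> borel_measurable M" using f by (simp add: weighted_M_iff)
  have wp: "weighted M (pot f)" by (rule potential_weighted[OF f])
  have ws: "weighted M (\<lambda>x. f x * sgn (pot f x))"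
    by (rule weighted_sign_mult[OF f, where C = 1]) (auto simp: sgn_if)
  have i: "integrable M (\<lambda>x. \<bar>pot f x\<bar> * \<rho> x)" "integrable M (\<lambda>x. pot f x * \<rho> x)"
    "integrable M (\<lambda>x. f x * \<phi> x)" "integrable M (\<lambda>x. f x * sgn (pot f x) * \<phi> x)"
    using wp weighted_abs[OF wp] weighted_mult_\<phi>[OF f] weighted_mult_\<phi>[OF ws] by (auto simp: weighted_M_iff)
  have "(\<integral>x. (\<bar>pot f x\<bar> + pot f x) * \<rho> x \<partial>M) \<le> (\<integral>x. f x * (1 + sgn (pot f x)) * \<phi> x \<partial>M)"
    using kato[OF f approximates_zero approximates_zero approximates_zero, of "pot f"] by simp
  then have 1: "(\<integral>x. \<bar>pot f x\<bar> * \<rho> x \<partial>M) + (\<integral>x. pot f x * \<rho> x \<partial>M) \<le> (\<integral>x. f x * \<phi> x \<partial>M) + (\<integral>x. f x * sgn (pot f x) * \<phi> x \<partial>M)"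
    using i by (simp add: distrib_right distrib_left)
  have "(\<integral>x. (\<bar>- pot f x\<bar> + - pot f x) * \<rho> x \<partial>M) \<le> (\<integral>x. - f x * (1 + sgn (- pot f x)) * \<phi> x \<partial>M)"
    using kato[OF weighted_uminus[OF f] approximates_zero approximates_zero approximates_zero, of "\<lambda>x. - pot f x"]
    by (simp add: pot_uminus)
  then have 2: "(\<integral>x. \<bar>pot f x\<bar> * \<rho> x \<partial>M) - (\<integral>x. pot f x * \<rho> x \<partial>M) \<le> (\<integral>x. f x * sgn (pot f x) * \<phi> x \<partial>M) - (\<integral>x. f x * \<phi> x \<partial>M)"
    using i by (simp add: distrib_right distrib_left left_diff_distrib right_diff_distrib sgn_minus)
  from 1 2 show ?thesis by linarith
qed

text \<open>Consecutive approximate solutions are compared by \<open>kato_abs\<close>. The monotone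
  part of the difference of their densities has the favourable sign, so only the approximation
  errors remain; these are summable, and the potentials converge almost everywhere. The common bound
  \<open>\<Gamma>\<close> then lets the densities pass to the limit under the potential.\<close>

lemma caratheodory_solution:
  fixes q :: "nat \<Rightarrow> 'a \<Rightarrow> real \<Rightarrow> real"
  assumes meas: "\<And>k v. v \<in> borel_measurable M \<Longrightarrow> (\<lambda>x. q k x (v x)) \<in> borel_measurable M"
    and dom: "\<And>k x t. x \<in> \<Omega> \<Longrightarrow> \<bar>q k x t\<bar> \<le> C k * \<rho> x"
    and anti: "\<And>k x s t. x \<in> \<Omega> \<Longrightarrow> s \<le> t \<Longrightarrow> q k x t \<le> q k x s"
    and lip: "\<And>k x s t. x \<in> \<Omega> \<Longrightarrow> \<bar>q k x s - q k x t\<bar> \<le> L k * \<bar>s - t\<bar>" "\<And>k. 0 < L k"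
    and \<Gamma>: "weighted M \<Gamma>" "\<And>k x t. x \<in> \<Omega> \<Longrightarrow> \<bar>q k x t\<bar> \<le> \<Gamma> x"
    and E: "\<And>k. weighted M (E k)" "\<And>k. (\<integral>x. E k x * \<rho> x \<partial>M) \<le> (1 / 2) ^ k"
      "\<And>k x t. x \<in> \<Omega> \<Longrightarrow> \<bar>q k x t - p x t\<bar> \<le> E k x"
    and p: "\<And>x. x \<in> \<Omega> \<Longrightarrow> continuous_on UNIV (p x)"
  shows "\<exists>h. weighted M h \<and> (AE x in M. h x = p x (pot h x))"
proof -
  have "\<exists>h. dominated h \<and> (AE x in M. h x = q k x (pot h x))" for k
    by (rule lipschitz_solution[where C = "C k" and L = "L k"]) (use meas dom anti lip in auto)
  then obtain h where hd: "\<And>k. dominated (h k)" and hq: "\<And>k. AE x in M. h k x = q k x (pot (h k) x)" by metis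
  have hB: "h k \<in> Bd" for k by (rule dominated_Bd[OF hd])
  have E0: "0 \<le> E k x" if "x \<in> \<Omega>" for k x using E(3)[OF that, of k 0] by (meson abs_ge_zero order_trans)
  have [measurable]: "h k \<in> borel_measurable M" "pot (h k) \<in> borel_measurable M" "E k \<in> borel_measurable M" for k
    using Bd_measurable[OF hB] Bd_measurable[OF pot_Bd[OF hB]] E(1) by (auto simp: weighted_M_iff)
  have [measurable]: "\<phi> \<in> borel_measurable M" by (rule Bd_measurable[OF \<phi>_Bd])
  have step: "(\<integral>x. \<bar>pot (h (Suc k)) x - pot (h k) x\<bar> * \<rho> x \<partial>M) \<le> 2 * C\<^sub>0 * (1 / 2) ^ k" for k
  proof -
    define f where "f = (\<lambda>x. h (Suc k) x - h k x)"
    have fB: "f \<in> Bd" unfolding f_def by (intro Bd_diff hB)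
    have pf: "pot f x = pot (h (Suc k)) x - pot (h k) x" if "x \<in> \<Omega>" for x
      unfolding f_def by (rule pot_diff[OF hB hB that])
    have ws: "weighted M (\<lambda>x. f x * sgn (pot f x))"
      using pot_measurable[OF Bd_weighted[OF fB]]
      by (intro weighted_sign_mult[OF Bd_weighted[OF fB], where C = 1]) (auto simp: sgn_if)
    have wE: "weighted M (\<lambda>x. E (Suc k) x + E k x)" by (intro weighted_add E)
    have "(\<integral>x. \<bar>pot (h (Suc k)) x - pot (h k) x\<bar> * \<rho> x \<partial>M) = (\<integral>x. \<bar>pot f x\<bar> * \<rho> x \<partial>M)"
      by (intro Bochner_Integration.integral_cong) (auto simp: pf)
    also have "\<dots> \<le> (\<integral>x. f x * sgn (pot f x) * \<phi> x \<partial>M)" by (rule kato_abs[OF Bd_weighted[OF fB]])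
    also have "\<dots> \<le> (\<integral>x. C\<^sub>0 * ((E (Suc k) x + E k x) * \<rho> x) \<partial>M)"
    proof (rule integral_mono_AE)
      show "integrable M (\<lambda>x. f x * sgn (pot f x) * \<phi> x)" by (rule weighted_mult_\<phi>[OF ws])
      show "integrable M (\<lambda>x. C\<^sub>0 * ((E (Suc k) x + E k x) * \<rho> x))" using wE by (simp add: weighted_M_iff)
      show "AE x in M. f x * sgn (pot f x) * \<phi> x \<le> C\<^sub>0 * ((E (Suc k) x + E k x) * \<rho> x)"
        using hq[of "Suc k"] hq[of k] AE_space
      proof eventually_elim
        case (elim x)
        then have x: "x \<in> \<Omega>" by simp
        define a b where "a = pot (h (Suc k)) x" and "b = pot (h k) x"
        have s: "sgn (pot f x) = sgn (a - b)" using pf[OF x] by (simp add: a_def b_def)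
        \<comment> \<open>The intermediate value separates a change of the argument in the same
          function, which has the sign opposite to \<open>a - b\<close>, from a change of the
          function at the same argument.\<close>
        have fx: "f x = (q (Suc k) x a - q (Suc k) x b) + (q (Suc k) x b - q k x b)"
          using elim by (simp add: f_def a_def b_def)
        have "(q (Suc k) x a - q (Suc k) x b) * sgn (a - b) \<le> 0"
          using anti[OF x, of a b "Suc k"] anti[OF x, of b a "Suc k"] by (auto simp: sgn_if)
        moreover have "(q (Suc k) x b - q k x b) * sgn (a - b) \<le> \<bar>q (Suc k) x b - q k x b\<bar>"
          by (auto simp: sgn_if)
        moreover have "\<bar>q (Suc k) x b - q k x b\<bar> \<le> E (Suc k) x + E k x"
          using E(3)[OF x, of "Suc k" b] E(3)[OF x, of k b] by linarith
        ultimately have le: "f x * sgn (pot f x) \<le> E (Suc k) x + E k x"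
          unfolding s fx distrib_right by linarith
        have "f x * sgn (pot f x) * \<phi> x \<le> (E (Suc k) x + E k x) * \<phi> x"
          using le \<phi>_bounds(3)[OF x] by (intro mult_right_mono)
        also have "\<dots> \<le> (E (Suc k) x + E k x) * (C\<^sub>0 * \<rho> x)"
          using \<phi>_bounds(2)[OF x] E0[OF x] by (intro mult_left_mono) auto
        finally show ?case by (simp add: mult_ac)
      qed
    qed
    also have "\<dots> = C\<^sub>0 * ((\<integral>x. E (Suc k) x * \<rho> x \<partial>M) + (\<integral>x. E k x * \<rho> x \<partial>M))"
      using E(1)[of k] E(1)[of "Suc k"] by (simp add: distrib_right weighted_M_iff)
    also have "\<dots> \<le> C\<^sub>0 * ((1 / 2) ^ Suc k + (1 / 2) ^ k)"
      by (intro mult_left_mono add_mono E const_nonneg)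
    also have "\<dots> \<le> C\<^sub>0 * (2 * (1 / 2) ^ k)"
      using const_nonneg by (intro mult_left_mono) auto
    also have "\<dots> = 2 * C\<^sub>0 * (1 / 2) ^ k" by (simp only: mult_ac)
    finally show ?thesis .
  qed
  have sumE: "AE x in M. (\<lambda>k. E k x) \<longlonglongrightarrow> 0"
  proof -
    have "AE x in M. summable (\<lambda>k. \<bar>E k x * \<rho> x\<bar>)"
    proof (rule AE_summable_L1)
      show "integrable M (\<lambda>x. E k x * \<rho> x)" for k using E(1)[of k] by (simp add: weighted_M_iff)
      have eq: "(\<integral>x. \<bar>E k x * \<rho> x\<bar> \<partial>M) = (\<integral>x. E k x * \<rho> x \<partial>M)" for k
        using E0 by (intro Bochner_Integration.integral_cong) auto
      have le: "norm (\<integral>x. \<bar>E k x * \<rho> x\<bar> \<partial>M) \<le> (1 / 2) ^ k" for k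
      proof -
        have "0 \<le> (\<integral>x. \<bar>E k x * \<rho> x\<bar> \<partial>M)" by (rule Bochner_Integration.integral_nonneg) simp
        then show ?thesis using E(2)[of k] eq[of k] unfolding real_norm_def by linarith
      qed
      have "summable (\<lambda>k. (1 / 2 :: real) ^ k)" by (intro summable_geometric) simp
      then show "summable (\<lambda>k. \<integral>x. \<bar>E k x * \<rho> x\<bar> \<partial>M)"
        by (rule summable_comparison_test'[where N = 0]) (rule le)
    qed
    then show ?thesis
      using AE_space
    proof eventually_elim
      case (elim x)
      then have \<rho>: "\<rho> x > 0" using \<rho>_pos by simp
      have "(\<lambda>k. \<bar>E k x * \<rho> x\<bar>) \<longlonglongrightarrow> 0" using elim(1) by (rule summable_LIMSEQ_zero)
      then have "(\<lambda>k. E k x * \<rho> x) \<longlonglongrightarrow> 0" by (rule tendsto_rabs_zero_cancel)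
      from tendsto_divide[OF this tendsto_const[of "\<rho> x"]] show ?case using \<rho> by simp
    qed
  qed
  have "AE x in M. summable (\<lambda>k. \<bar>(pot (h (Suc k)) x - pot (h k) x) * \<rho> x\<bar>)"
  proof (rule AE_summable_L1)
    show "integrable M (\<lambda>x. (pot (h (Suc k)) x - pot (h k) x) * \<rho> x)" for k
      by (intro Bd_integrable Bd_mult Bd_diff pot_Bd hB \<rho>_Bd)
    have le: "norm (\<integral>x. \<bar>(pot (h (Suc k)) x - pot (h k) x) * \<rho> x\<bar> \<partial>M) \<le> 2 * C\<^sub>0 * (1 / 2) ^ k" for k
      using step[of k] by (simp add: abs_mult)
    have "summable (\<lambda>k. 2 * C\<^sub>0 * (1 / 2) ^ k)" by (intro summable_mult summable_geometric) simp
    then show "summable (\<lambda>k. \<integral>x. \<bar>(pot (h (Suc k)) x - pot (h k) x) * \<rho> x\<bar> \<partial>M)"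
      by (rule summable_comparison_test'[where N = 0]) (rule le)
  qed
  then have conv: "AE x in M. convergent (\<lambda>k. pot (h k) x)"
    using AE_space
  proof eventually_elim
    case (elim x)
    then have \<rho>: "\<rho> x > 0" using \<rho>_pos by simp
    have "summable (\<lambda>k. \<bar>(pot (h (Suc k)) x - pot (h k) x) * \<rho> x\<bar> / \<rho> x)"
      using elim(1) by (rule summable_divide)
    then show ?case using \<rho> by (intro convergent_of_summable_diff) (simp add: abs_mult)
  qed
  define z where "z = (\<lambda>x. lim (\<lambda>k. pot (h k) x))"
  have zl: "AE x in M. (\<lambda>k. pot (h k) x) \<longlonglongrightarrow> z x"
    using conv by eventually_elim (simp add: z_def convergent_LIMSEQ_iff)
  \<comment> \<open>The limit of the measurable densities is measurable by construction; its
    identification with \<open>p x (z x)\<close> holds almost everywhere and is made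
    afterwards.\<close>
  define u where "u = (\<lambda>x. lim (\<lambda>k. h k x))"
  have um [measurable]: "u \<in> borel_measurable M" unfolding u_def by measurable
  have hl: "AE x in M. (\<lambda>k. h k x) \<longlonglongrightarrow> p x (z x)"
  proof -
    have "AE x in M. \<forall>k. h k x = q k x (pot (h k) x)" using hq by (simp add: AE_all_countable)
    then show ?thesis
      using zl sumE AE_space
    proof eventually_elim
      case (elim x)
      then have x: "x \<in> \<Omega>" by simp
      have "(\<lambda>k. p x (pot (h k) x)) \<longlonglongrightarrow> p x (z x)"
        by (rule continuous_on_tendsto_compose[OF p[OF x] elim(2)]) auto
      moreover have "(\<lambda>k. q k x (pot (h k) x) - p x (pot (h k) x)) \<longlonglongrightarrow> 0"
        by (rule tendsto_rabs_zero_cancel[OF tendsto_0_le[OF elim(3)]]) (use E(3)[OF x] in auto)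
      ultimately have "(\<lambda>k. (q k x (pot (h k) x) - p x (pot (h k) x)) + p x (pot (h k) x)) \<longlonglongrightarrow> 0 + p x (z x)"
        by (intro tendsto_add)
      then show ?case using elim(1) by simp
    qed
  qed
  have up: "AE x in M. u x = p x (z x)"
    using hl by eventually_elim (simp add: u_def limI)
  have h\<Gamma>: "AE x in M. \<bar>h k x\<bar> \<le> \<Gamma> x" for k
    using hq[of k] AE_space by eventually_elim (use \<Gamma>(2) in simp)
  have "AE x in M. \<forall>k. \<bar>h k x\<bar> \<le> \<Gamma> x" using h\<Gamma> by (simp add: AE_all_countable)
  then have u\<Gamma>: "AE x in M. \<bar>u x\<bar> \<le> \<bar>\<Gamma> x\<bar>"
    using hl up
  proof eventually_elim
    case (elim x)
    have "(\<lambda>k. \<bar>h k x\<bar>) \<longlonglongrightarrow> \<bar>u x\<bar>" using elim by (intro tendsto_rabs) simp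
    then have "\<bar>u x\<bar> \<le> \<Gamma> x" using elim(1) by (intro LIMSEQ_le_const2) auto
    then show ?case by simp
  qed
  have uw: "weighted M u" by (rule weighted_bound[OF \<Gamma>(1) um u\<Gamma>])
  have "AE x in M. z x = pot u x"
    using potential_AE_integrable[OF \<Gamma>(1)] zl AE_space
  proof eventually_elim
    case (elim x)
    have [measurable]: "\<Gamma> \<in> borel_measurable M" using \<Gamma>(1) by (simp add: weighted_M_iff)
    have "(\<lambda>k. \<integral>y. K x y * h k y \<partial>M) \<longlonglongrightarrow> (\<integral>y. K x y * u y \<partial>M)"
    proof (rule integral_dominated_convergence[where w = "\<lambda>y. K x y * \<Gamma> y"])
      show "AE y in M. (\<lambda>k. K x y * h k y) \<longlonglongrightarrow> K x y * u y"
        using hl up by eventually_elim (intro tendsto_intros, simp)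
      show "AE y in M. norm (K x y * h k y) \<le> K x y * \<Gamma> y" for k
        using h\<Gamma>[of k] by eventually_elim (simp add: abs_mult K_nonneg mult_left_mono)
    qed (use elim in auto)
    then show ?case using elim(2) LIMSEQ_unique unfolding potential_def by blast
  qed
  then have "AE x in M. u x = p x (pot u x)" using up by eventually_elim simp
  then show ?thesis using uw by blast
qed

text \<open>The clamped argument lies between \<open>- V x\<close> and \<open>U x\<close>, so by
  monotonicity the nonlinearity is bounded by the integrable \<open>\<Gamma>\<close>, whatever the
  unknown is. It is approximated by functions that satisfy the two demands of
  \<open>lipschitz_solution\<close>, a Lipschitz bound and domination by the weight.\<close>

lemma truncated_solution:
  assumes g: "mono g" "continuous_on UNIV g" "g 0 = 0"
    and m [measurable]: "U \<in> borel_measurable M" "V \<in> borel_measurable M" "F \<in> borel_measurable M"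
    and pos: "\<And>x. x \<in> \<Omega> \<Longrightarrow> 0 \<le> U x" "\<And>x. x \<in> \<Omega> \<Longrightarrow> 0 \<le> V x"
    and w: "weighted M (\<lambda>x. g (U x))" "weighted M (\<lambda>x. g (- V x))"
  shows "\<exists>h. weighted M h \<and> (AE x in M. h x = g (max (- V x) (min (F x - pot h x) (U x))))"
proof -
  from lipschitz_approximation[OF g] obtain y e
    where y: "\<And>n. mono (y n)" "\<And>n a b. \<bar>y n a - y n b\<bar> \<le> real (Suc n) * \<bar>a - b\<bar>" "\<And>n t. \<bar>y n t\<bar> \<le> \<bar>g t\<bar>"
      and e: "\<And>n. mono (e n)" "\<And>n R t. \<bar>t\<bar> \<le> R \<Longrightarrow> \<bar>y n t - g t\<bar> \<le> e n R" "\<And>R. R \<ge> 0 \<Longrightarrow> (\<lambda>n::nat. e n R) \<longlonglongrightarrow> 0"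
    by blast
  have [measurable]: "y n \<in> borel_measurable borel" "e n \<in> borel_measurable borel" for n
    using y(1) e(1) borel_measurable_mono by auto
  have [measurable]: "g \<in> borel_measurable borel" using g(1) by (rule borel_measurable_mono)
  define cl where "cl = (\<lambda>x t. max (- V x) (min (F x - t) (U x)))"
  define \<Gamma> where "\<Gamma> = (\<lambda>x. \<bar>g (U x)\<bar> + \<bar>g (- V x)\<bar>)"
  define R where "R = (\<lambda>x. max (U x) (V x))"
  have wg: "weighted M \<Gamma>" unfolding \<Gamma>_def by (intro weighted_add weighted_abs w)
  have \<Gamma>0: "0 \<le> \<Gamma> x" for x by (simp add: \<Gamma>_def)
  have clR: "\<bar>cl x t\<bar> \<le> R x" and g\<Gamma>: "\<bar>g (cl x t)\<bar> \<le> \<Gamma> x" if "x \<in> \<Omega>" for x t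
  proof -
    have c: "- V x \<le> cl x t" "cl x t \<le> U x" using pos[OF that] by (auto simp: cl_def)
    then show "\<bar>cl x t\<bar> \<le> R x" by (auto simp: R_def)
    show "\<bar>g (cl x t)\<bar> \<le> \<Gamma> x"
      using monoD[OF g(1) c(1)] monoD[OF g(1) c(2)] by (auto simp: \<Gamma>_def)
  qed
  have cl_anti: "cl x t \<le> cl x s" if "s \<le> t" for x s t using that by (auto simp: cl_def)
  have cl_lip: "\<bar>cl x s - cl x t\<bar> \<le> \<bar>s - t\<bar>" for x s t by (auto simp: cl_def)
  \<comment> \<open>Setting the nonlinearity to 0 where \<open>\<Gamma> x\<close> exceeds
    \<open>n\<close> times the weight gives the domination by the weight; every point of \<Omega> is
    eventually kept.\<close>
  define q where "q = (\<lambda>n x t. if \<Gamma> x \<le> real n * \<rho> x then y n (cl x t) else 0)"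
  \<comment> \<open>The radius \<open>R x\<close> varies with the point and \<open>e n (R x)\<close>
    need not be integrable; the minimum with \<open>2 * \<Gamma> x\<close> makes dominated
    convergence applicable.\<close>
  define E where "E = (\<lambda>n x. if \<Gamma> x \<le> real n * \<rho> x then min (e n (R x)) (2 * \<Gamma> x) else \<Gamma> x)"
  have [measurable]: "\<Gamma> \<in> borel_measurable M" "R \<in> borel_measurable M" unfolding \<Gamma>_def R_def by measurable
  have Em [measurable]: "E n \<in> borel_measurable M" for n unfolding E_def by measurable
  have qE: "\<bar>q n x t - g (cl x t)\<bar> \<le> E n x" if x: "x \<in> \<Omega>" for n x t
  proof -
    have "\<bar>y n (cl x t) - g (cl x t)\<bar> \<le> 2 * \<Gamma> x" using y(3)[of n "cl x t"] g\<Gamma>[OF x, of t] by linarith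
    then show ?thesis using e(2)[OF clR[OF x]] g\<Gamma>[OF x] by (simp add: q_def E_def)
  qed
  have q\<Gamma>: "\<bar>q n x t\<bar> \<le> \<Gamma> x" if x: "x \<in> \<Omega>" for n x t
    using order_trans[OF y(3) g\<Gamma>[OF x]] \<Gamma>0[of x] by (simp add: q_def)
  have E0: "0 \<le> E n x" if x: "x \<in> \<Omega>" for n x using qE[OF x, of n 0] by (meson abs_ge_zero order_trans)
  have E2: "\<bar>E n x\<bar> \<le> \<bar>2 * \<Gamma> x\<bar>" if x: "x \<in> \<Omega>" for n x using E0[OF x, of n] \<Gamma>0[of x] by (simp add: E_def)
  have wE: "weighted M (E n)" for n
    by (rule weighted_bound[OF weighted_cmult[OF wg, of 2]]) (use E2 in \<open>auto intro!: AE_I2\<close>)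
  have El: "(\<lambda>n. E n x) \<longlonglongrightarrow> 0" if x: "x \<in> \<Omega>" for x
  proof (rule tendsto_sandwich[OF _ _ tendsto_const e(3)[of "R x"]])
    obtain n0 :: nat where n0: "\<Gamma> x / \<rho> x \<le> real n0" using real_arch_simple by blast
    have "E n x \<le> e n (R x)" if "n \<ge> n0" for n
    proof -
      have "real n0 \<le> real n" using that by simp
      then have "\<Gamma> x / \<rho> x \<le> real n" using n0 by linarith
      then have "\<Gamma> x \<le> real n * \<rho> x" using \<rho>_pos[OF x] by (simp only: pos_divide_le_eq)
      then show ?thesis by (simp add: E_def)
    qed
    then show "\<forall>\<^sub>F n in sequentially. E n x \<le> e n (R x)" by (auto simp: eventually_sequentially)
    show "\<forall>\<^sub>F n in sequentially. 0 \<le> E n x" using E0[OF x] by simp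
    show "0 \<le> R x" using pos[OF x] by (simp add: R_def le_max_iff_disj)
  qed
  have "(\<lambda>n. \<integral>x. E n x * \<rho> x \<partial>M) \<longlonglongrightarrow> (\<integral>x. 0 \<partial>M)"
  proof (rule integral_dominated_convergence[where w = "\<lambda>x. 2 * (\<Gamma> x * \<rho> x)"])
    show "integrable M (\<lambda>x. 2 * (\<Gamma> x * \<rho> x))" using wg by (simp add: weighted_M_iff)
    show "AE x in M. norm (E n x * \<rho> x) \<le> 2 * (\<Gamma> x * \<rho> x)" for n
    proof (rule AE_I2)
      fix x assume "x \<in> space M"
      then have "\<bar>E n x\<bar> * \<rho> x \<le> \<bar>2 * \<Gamma> x\<bar> * \<rho> x" using E2 by (intro mult_right_mono) auto
      then show "norm (E n x * \<rho> x) \<le> 2 * (\<Gamma> x * \<rho> x)" using \<Gamma>0[of x] by (simp add: abs_mult)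
    qed
    show "AE x in M. (\<lambda>n. E n x * \<rho> x) \<longlonglongrightarrow> 0"
      using El by (intro AE_I2 tendsto_mult_left_zero) simp
  qed measurable
  then have lim: "(\<lambda>n. \<integral>x. E n x * \<rho> x \<partial>M) \<longlonglongrightarrow> 0" by simp
  \<comment> \<open>The subsequence makes the weighted errors geometrically small, as
    \<open>caratheodory_solution\<close> demands.\<close>
  have "\<exists>n. (\<integral>x. E n x * \<rho> x \<partial>M) \<le> (1 / 2) ^ k" for k
  proof -
    have "\<forall>\<^sub>F n in sequentially. (\<integral>x. E n x * \<rho> x \<partial>M) < (1 / 2) ^ k" by (rule order_tendstoD(2)[OF lim]) simp
    then show ?thesis unfolding eventually_sequentially using less_imp_le by blast
  qed
  then obtain n where n: "\<And>k. (\<integral>x. E (n k) x * \<rho> x \<partial>M) \<le> (1 / 2) ^ k" by metis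
  have "\<exists>h. weighted M h \<and> (AE x in M. h x = g (cl x (pot h x)))"
  proof (rule caratheodory_solution[where q = "\<lambda>k. q (n k)" and E = "\<lambda>k. E (n k)" and \<Gamma> = \<Gamma>
        and C = "\<lambda>k. real (n k)" and L = "\<lambda>k. real (Suc (n k))"])
    show "(\<lambda>x. q (n k) x (v x)) \<in> borel_measurable M" if [measurable]: "v \<in> borel_measurable M" for k v
      unfolding q_def cl_def by measurable
    show "\<bar>q (n k) x t\<bar> \<le> real (n k) * \<rho> x" if x: "x \<in> \<Omega>" for k x t
      using order_trans[OF y(3) g\<Gamma>[OF x]] by (auto simp: q_def intro: order_trans)
    show "q (n k) x t \<le> q (n k) x s" if "s \<le> t" for k x s t
      using monoD[OF y(1) cl_anti[OF that]] by (simp add: q_def)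
    show "\<bar>q (n k) x s - q (n k) x t\<bar> \<le> real (Suc (n k)) * \<bar>s - t\<bar>" for k x s t
    proof -
      have "real (Suc (n k)) * \<bar>cl x s - cl x t\<bar> \<le> real (Suc (n k)) * \<bar>s - t\<bar>"
        using cl_lip by (intro mult_left_mono) auto
      then have "\<bar>y (n k) (cl x s) - y (n k) (cl x t)\<bar> \<le> real (Suc (n k)) * \<bar>s - t\<bar>"
        using y(2) order_trans by blast
      then show ?thesis by (simp add: q_def)
    qed
    show "continuous_on UNIV (\<lambda>t. g (cl x t))" for x
      by (rule continuous_on_compose2[OF g(2)]) (auto simp: cl_def intro!: continuous_intros)
  qed (use wg q\<Gamma> wE n qE in auto)
  then show ?thesis by (simp add: cl_def)
qed

end

section \<open>The semilinear problem\<close>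

context dual_kernel
begin

abbreviation green :: "'a measure \<Rightarrow> 'a \<Rightarrow> real" where
  "green \<nu> \<equiv> potential K \<nu> (\<lambda>x. 1)"

definition mild_solution :: "(real \<Rightarrow> real) \<Rightarrow> 'a measure \<Rightarrow> 'a measure \<Rightarrow> ('a \<Rightarrow> real) \<Rightarrow> bool" where
  "mild_solution g P N u \<longleftrightarrow> weighted M u \<and> weighted M (\<lambda>x. g (u x)) \<and>
     (AE x in M. u x = green P x - green N x - pot (\<lambda>x. g (u x)) x)"

lemma positive_part_zero:
  assumes w: "weighted M w" and le: "(\<integral>x. (\<bar>w x\<bar> + w x) * \<rho> x \<partial>M) \<le> 0"
  shows "AE x in M. w x \<le> 0"
proof -
  have i: "integrable M (\<lambda>x. (\<bar>w x\<bar> + w x) * \<rho> x)"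
    using weighted_add[OF weighted_abs[OF w] w] by (simp add: weighted_M_iff)
  have nn: "AE x in M. 0 \<le> (\<bar>w x\<bar> + w x) * \<rho> x" by (intro AE_I2 mult_nonneg_nonneg) auto
  have "0 \<le> (\<integral>x. (\<bar>w x\<bar> + w x) * \<rho> x \<partial>M)" using nn by (rule integral_nonneg_AE)
  then have "(\<integral>x. (\<bar>w x\<bar> + w x) * \<rho> x \<partial>M) = 0" using le by (intro antisym)
  then have "AE x in M. (\<bar>w x\<bar> + w x) * \<rho> x = 0"
    using integral_nonneg_eq_0_iff_AE[OF i nn] by blast
  then show ?thesis
    using AE_space
  proof eventually_elim
    case (elim x)
    then have "\<bar>w x\<bar> + w x = 0" using \<rho>_pos[of x] by simp
    then show ?case by linarith
  qed
qed

lemma integral_nonpos_AE: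
  fixes f :: "'a \<Rightarrow> real"
  assumes "AE x in M. f x \<le> 0"
  shows "(\<integral>x. f x \<partial>M) \<le> 0"
proof -
  have "0 \<le> (\<integral>x. - f x \<partial>M)" using assms by (intro integral_nonneg_AE) (auto elim: eventually_mono)
  then show ?thesis by simp
qed

lemma green_nonneg: "0 \<le> green \<nu> x"
  unfolding potential_def using K_nonneg by (intro Bochner_Integration.integral_nonneg) auto

lemma green_\<rho>:
  assumes "weighted \<nu> (\<lambda>x. 1)"
  shows "(\<integral>x. green \<nu> x * \<rho> x \<partial>M) \<le> C\<^sub>0 * (\<integral>x. \<rho> x \<partial>\<nu>)"
  using potential_abs_\<rho>[OF assms] green_nonneg[of \<nu>] by simp

lemma comparison:
  assumes g: "mono g"
    and W: "weighted P\<^sub>1 (\<lambda>x. 1)" "weighted N\<^sub>1 (\<lambda>x. 1)" "weighted P\<^sub>2 (\<lambda>x. 1)" "weighted N\<^sub>2 (\<lambda>x. 1)"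
    and le: "signed_le \<Omega> (Jordan P\<^sub>1 N\<^sub>1) (Jordan P\<^sub>2 N\<^sub>2)"
    and u: "mild_solution g P\<^sub>1 N\<^sub>1 u\<^sub>1" "mild_solution g P\<^sub>2 N\<^sub>2 u\<^sub>2"
  shows "AE x in M. u\<^sub>1 x \<le> u\<^sub>2 x"
proof -
  define w where "w = (\<lambda>x. u\<^sub>1 x - u\<^sub>2 x)"
  define f where "f = (\<lambda>x. g (u\<^sub>2 x) - g (u\<^sub>1 x))"
  have wf: "weighted M f" and ww: "weighted M w"
    using u unfolding f_def w_def mild_solution_def by (auto intro: weighted_diff)
  have "(\<integral>x. (\<bar>w x\<bar> + w x) * \<rho> x \<partial>M) \<le> (\<integral>x. f x * (1 + sgn (w x)) * \<phi> x \<partial>M) + 2 * (\<integral>x. 0 * \<rho> x \<partial>M)"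
  proof (rule kato[OF wf approximates_add[OF approximates_mollified[OF W(1)] approximates_mollified[OF W(4)]]
        approximates_add[OF approximates_mollified[OF W(3)] approximates_mollified[OF W(2)]] approximates_zero])
    fix n z
    let ?A = "inner_part n \<inter> ball z (radius n)"
    have cl: "closed (inner_part n)" by (rule compact_imp_closed[OF compact_inner_part])
    \<comment> \<open>\<open>signed_le\<close> speaks of sets whose closure is compact in \<Omega>;
      the restriction of the averages to \<open>inner_part n\<close> provides exactly such
      sets.\<close>
    have sub: "closure ?A \<subseteq> inner_part n" using cl by (simp add: closure_minimal)
    have io: "inner_part n \<subseteq> \<Omega>" by (auto simp: inner_part_def)
    have "compact (closure ?A)"
      using compact_Int_closed[OF compact_inner_part[of n] closed_closure[of ?A]] sub by (simp add: Int_absorb1)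
    moreover have "?A \<in> sets borel" using cl by (intro sets.Int) auto
    ultimately have "signed_value (Jordan P\<^sub>1 N\<^sub>1) ?A \<le> signed_value (Jordan P\<^sub>2 N\<^sub>2) ?A"
      using le sub io unfolding signed_le_def by blast
    then have "(measure P\<^sub>1 ?A + measure N\<^sub>2 ?A) / volume n \<le> (measure P\<^sub>2 ?A + measure N\<^sub>1 ?A) / volume n"
      using volume_pos[of n] by (intro divide_right_mono) (auto simp: signed_value_def)
    then show "(mollified P\<^sub>1 n z + mollified N\<^sub>2 n z) - (mollified P\<^sub>2 n z + mollified N\<^sub>1 n z) \<le> 0"
      by (simp add: mollified_def add_divide_distrib)
  next
    show "w \<in> borel_measurable M" using ww by (simp add: weighted_M_iff)
    have "weighted M (\<lambda>x. g (u\<^sub>1 x))" "weighted M (\<lambda>x. g (u\<^sub>2 x))" using u by (auto simp: mild_solution_def)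
    from potential_AE_integrable[OF this(1)] potential_AE_integrable[OF this(2)]
    have "AE x in M. pot f x = pot (\<lambda>x. g (u\<^sub>2 x)) x - pot (\<lambda>x. g (u\<^sub>1 x)) x"
      by eventually_elim (simp add: potential_def f_def right_diff_distrib)
    moreover have "AE x in M. u\<^sub>1 x = green P\<^sub>1 x - green N\<^sub>1 x - pot (\<lambda>x. g (u\<^sub>1 x)) x"
      "AE x in M. u\<^sub>2 x = green P\<^sub>2 x - green N\<^sub>2 x - pot (\<lambda>x. g (u\<^sub>2 x)) x"
      using u by (auto simp: mild_solution_def)
    ultimately show "AE x in M. w x = pot f x + (green P\<^sub>1 x + green N\<^sub>2 x) - (green P\<^sub>2 x + green N\<^sub>1 x)"
      by eventually_elim (simp add: w_def)
  qed
  also have "\<dots> \<le> 0"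
  proof -
    have "f x * (1 + sgn (w x)) * \<phi> x \<le> 0" if "x \<in> \<Omega>" for x
    proof -
      have "f x * (1 + sgn (w x)) \<le> 0"
        using monoD[OF g, of "u\<^sub>1 x" "u\<^sub>2 x"] monoD[OF g, of "u\<^sub>2 x" "u\<^sub>1 x"] by (auto simp: f_def w_def sgn_if)
      then show ?thesis by (rule mult_nonpos_nonneg[OF _ \<phi>_bounds(3)[OF that]])
    qed
    then have "(\<integral>x. f x * (1 + sgn (w x)) * \<phi> x \<partial>M) \<le> 0" by (intro integral_nonpos_AE AE_I2) auto
    then show ?thesis by simp
  qed
  finally have "AE x in M. w x \<le> 0" by (rule positive_part_zero[OF ww])
  then show ?thesis by eventually_elim (simp add: w_def)
qed

lemma uniqueness:
  assumes "mono g" "weighted P (\<lambda>x. 1)" "weighted N (\<lambda>x. 1)"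
    "mild_solution g P N u" "mild_solution g P N v"
  shows "AE x in M. v x = u x"
proof -
  have "signed_le \<Omega> (Jordan P N) (Jordan P N)" by (simp add: signed_le_def)
  from comparison[OF assms(1) assms(2,3,2,3) this assms(4,5)] comparison[OF assms(1) assms(2,3,2,3) this assms(5,4)]
  show ?thesis by eventually_elim simp
qed

lemma existence:
  assumes g: "mono g" "continuous_on UNIV g" "g 0 = 0"
    and W: "weighted P (\<lambda>x. 1)" "weighted N (\<lambda>x. 1)"
    and adm: "weighted M (\<lambda>x. g (green P x))" "weighted M (\<lambda>x. g (- green N x))"
  shows "\<exists>u. mild_solution g P N u \<and> (AE x in M. - green N x \<le> u x \<and> u x \<le> green P x)"
proof -
  let ?U = "green P" and ?V = "green N"
  have wU: "weighted M ?U" "weighted M ?V" using potential_weighted W by auto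
  have m [measurable]: "?U \<in> borel_measurable M" "?V \<in> borel_measurable M" "g \<in> borel_measurable borel"
    using wU g(1) by (auto simp: weighted_M_iff intro: borel_measurable_mono)
  obtain h where h: "weighted M h"
    "AE x in M. h x = g (max (- ?V x) (min (?U x - ?V x - pot h x) (?U x)))"
    using truncated_solution[OF g m(1,2), of "\<lambda>x. ?U x - ?V x"] green_nonneg adm by auto
  define u where "u = (\<lambda>x. ?U x - ?V x - pot h x)"
  have wp: "weighted M (pot h)" by (rule potential_weighted[OF h(1)])
  have wu: "weighted M u" unfolding u_def by (intro weighted_diff wU wp)
  have [measurable]: "u \<in> borel_measurable M" using wu by (simp add: weighted_M_iff)
  have hu: "AE x in M. h x = g (max (- ?V x) (min (u x) (?U x)))" using h(2) by (simp add: u_def)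
  \<comment> \<open>The function \<open>u - ?U\<close> has the density \<open>- h\<close> and the
    measure \<open>- N\<close> as sources. Where it is nonnegative, the clamp returns
    \<open>?U x\<close>, so \<open>h x = g (?U x)\<close> is nonnegative; elsewhere the factor
    \<open>1 + sgn\<close> is 0.\<close>
  have upper: "AE x in M. u x - ?U x \<le> 0"
  proof (rule positive_part_zero)
    show "weighted M (\<lambda>x. u x - ?U x)" by (intro weighted_diff wu wU)
    have "(\<integral>x. (\<bar>u x - ?U x\<bar> + (u x - ?U x)) * \<rho> x \<partial>M) \<le>
        (\<integral>x. - h x * (1 + sgn (u x - ?U x)) * \<phi> x \<partial>M) + 2 * (\<integral>x. 0 * \<rho> x \<partial>M)"
    proof (rule kato[OF weighted_uminus[OF h(1)] approximates_zero approximates_mollified[OF W(2)] approximates_zero])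
      show "0 - mollified N n x \<le> 0" for n x using mollified_eq(3)[OF W(2)] by simp
      show "AE x in M. u x - ?U x = pot (\<lambda>x. - h x) x + 0 - ?V x" by (simp add: u_def pot_uminus)
    qed measurable
    also have "\<dots> \<le> 0"
    proof -
      have "AE x in M. - h x * (1 + sgn (u x - ?U x)) * \<phi> x \<le> 0"
        using hu AE_space
      proof eventually_elim
        case (elim x)
        have pos: "0 \<le> ?U x" "0 \<le> ?V x" by (rule green_nonneg)+
        have "- h x * (1 + sgn (u x - ?U x)) \<le> 0"
        proof (cases "?U x \<le> u x")
          case True
          then have "h x = g (?U x)" using elim(1) pos by (simp add: max_def min_def)
          then have "0 \<le> h x" using monoD[OF g(1) pos(1)] g(3) by simp
          then show ?thesis by (auto simp: sgn_if)
        qed (auto simp: sgn_if)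
        moreover have "0 \<le> \<phi> x" using elim(2) by (intro \<phi>_bounds(3)) simp
        ultimately show ?case by (rule mult_nonpos_nonneg)
      qed
      from integral_nonpos_AE[OF this] show ?thesis by simp
    qed
    finally show "(\<integral>x. (\<bar>u x - ?U x\<bar> + (u x - ?U x)) * \<rho> x \<partial>M) \<le> 0" .
  qed
  have lower: "AE x in M. - ?V x - u x \<le> 0"
  proof (rule positive_part_zero)
    show "weighted M (\<lambda>x. - ?V x - u x)" by (intro weighted_diff weighted_uminus wu wU)
    have "(\<integral>x. (\<bar>- ?V x - u x\<bar> + (- ?V x - u x)) * \<rho> x \<partial>M) \<le>
        (\<integral>x. h x * (1 + sgn (- ?V x - u x)) * \<phi> x \<partial>M) + 2 * (\<integral>x. 0 * \<rho> x \<partial>M)"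
    proof (rule kato[OF h(1) approximates_zero approximates_mollified[OF W(1)] approximates_zero])
      show "0 - mollified P n x \<le> 0" for n x using mollified_eq(3)[OF W(1)] by simp
      show "AE x in M. - ?V x - u x = pot h x + 0 - ?U x" by (simp add: u_def)
    qed measurable
    also have "\<dots> \<le> 0"
    proof -
      have "AE x in M. h x * (1 + sgn (- ?V x - u x)) * \<phi> x \<le> 0"
        using hu AE_space
      proof eventually_elim
        case (elim x)
        have pos: "0 \<le> ?U x" "0 \<le> ?V x" by (rule green_nonneg)+
        have "h x * (1 + sgn (- ?V x - u x)) \<le> 0"
        proof (cases "u x \<le> - ?V x")
          case True
          then have "h x = g (- ?V x)" using elim(1) pos by (simp add: max_def min_def)
          then have "h x \<le> 0" using monoD[OF g(1), of "- ?V x" 0] pos(2) g(3) by simp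
          then show ?thesis by (auto simp: sgn_if)
        qed (auto simp: sgn_if)
        moreover have "0 \<le> \<phi> x" using elim(2) by (intro \<phi>_bounds(3)) simp
        ultimately show ?case by (rule mult_nonpos_nonneg)
      qed
      from integral_nonpos_AE[OF this] show ?thesis by simp
    qed
    finally show "(\<integral>x. (\<bar>- ?V x - u x\<bar> + (- ?V x - u x)) * \<rho> x \<partial>M) \<le> 0" .
  qed
  have bounds: "AE x in M. - ?V x \<le> u x \<and> u x \<le> ?U x"
    using upper lower by eventually_elim simp
  \<comment> \<open>Between the two barriers the clamp acts as the identity, so the truncated
    equation is the original one.\<close>
  have hg: "AE x in M. h x = g (u x)"
    using hu bounds by eventually_elim simp
  have wgu: "weighted M (\<lambda>x. g (u x))"
    by (rule weighted_cong_AE[OF h(1) _ hg]) measurable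
  have eq: "pot h x = pot (\<lambda>x. g (u x)) x" for x
    unfolding potential_def
  proof (rule integral_cong_AE)
    have [measurable]: "h \<in> borel_measurable M" using h(1) by (simp add: weighted_M_iff)
    show "(\<lambda>y. K x y * h y) \<in> borel_measurable M" "(\<lambda>y. K x y * g (u y)) \<in> borel_measurable M" by measurable
    show "AE y in M. K x y * h y = K x y * g (u y)" using hg by eventually_elim simp
  qed
  have u_eq: "u x = ?U x - ?V x - pot h x" for x by (simp add: u_def)
  have "u x = ?U x - ?V x - pot (\<lambda>x. g (u x)) x" for x using u_eq[of x] eq[of x] by linarith
  then have "AE x in M. u x = ?U x - ?V x - pot (\<lambda>x. g (u x)) x" by (intro AE_I2)
  then have "mild_solution g P N u"
    unfolding mild_solution_def using wu wgu by blast
  then show ?thesis using bounds by blast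
qed

lemma estimate:
  assumes g: "mono g" "g 0 = 0"
    and W: "weighted P (\<lambda>x. 1)" "weighted N (\<lambda>x. 1)"
    and u: "mild_solution g P N u" and b: "AE x in M. - green N x \<le> u x \<and> u x \<le> green P x"
  shows "L1_weighted_norm \<Omega> \<gamma> u + L1_weighted_norm \<Omega> \<gamma> (\<lambda>x. g (u x)) \<le>
    (C\<^sub>0 + C\<^sub>0 / c\<^sub>1) * ((\<integral>x. \<rho> x \<partial>P) + (\<integral>x. \<rho> x \<partial>N))"
proof -
  let ?U = "green P" and ?V = "green N"
  define m where "m = (\<integral>x. \<rho> x \<partial>P) + (\<integral>x. \<rho> x \<partial>N)"
  have wU: "weighted M ?U" "weighted M ?V" using potential_weighted W by auto
  have wu: "weighted M u" and wg: "weighted M (\<lambda>x. g (u x))"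
    and eq: "AE x in M. u x = ?U x - ?V x - pot (\<lambda>x. g (u x)) x"
    using u by (auto simp: mild_solution_def)
  have [measurable]: "u \<in> borel_measurable M" using wu by (simp add: weighted_M_iff)
  have i: "integrable M (\<lambda>x. ?U x * \<rho> x)" "integrable M (\<lambda>x. ?V x * \<rho> x)"
    using wU by (auto simp: weighted_M_iff)
  have UV: "(\<integral>x. ?U x * \<rho> x \<partial>M) + (\<integral>x. ?V x * \<rho> x \<partial>M) \<le> C\<^sub>0 * m"
    using green_\<rho>[OF W(1)] green_\<rho>[OF W(2)] by (simp add: m_def distrib_left)
  have 1: "L1_weighted_norm \<Omega> \<gamma> u \<le> C\<^sub>0 * m"
  proof -
    have "L1_weighted_norm \<Omega> \<gamma> u \<le> (\<integral>x. ?U x * \<rho> x + ?V x * \<rho> x \<partial>M)"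
      unfolding L1_weighted_norm_def
    proof (rule integral_mono_AE)
      show "integrable M (\<lambda>x. \<bar>u x\<bar> * \<rho> x)" using weighted_abs[OF wu] by (simp add: weighted_M_iff)
      show "integrable M (\<lambda>x. ?U x * \<rho> x + ?V x * \<rho> x)" using i by auto
      show "AE x in M. \<bar>u x\<bar> * \<rho> x \<le> ?U x * \<rho> x + ?V x * \<rho> x"
        using b
      proof eventually_elim
        case (elim x)
        then have "\<bar>u x\<bar> \<le> ?U x + ?V x" using green_nonneg[of P x] green_nonneg[of N x] by linarith
        from mult_right_mono[OF this, of "\<rho> x"] show ?case by (simp add: distrib_right)
      qed
    qed
    also have "\<dots> = (\<integral>x. ?U x * \<rho> x \<partial>M) + (\<integral>x. ?V x * \<rho> x \<partial>M)" using i by simp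
    finally show ?thesis using UV by simp
  qed
  have sg: "g t * sgn t = \<bar>g t\<bar>" for t
    using monoD[OF g(1), of 0 t] monoD[OF g(1), of t 0] g(2) by (auto simp: sgn_if)
  have wgs: "weighted M (\<lambda>x. g (u x) * sgn (u x))" using weighted_abs[OF wg] by (simp add: sg)
  have ig: "integrable M (\<lambda>x. g (u x) * \<phi> x)" "integrable M (\<lambda>x. g (u x) * sgn (u x) * \<phi> x)"
    using weighted_mult_\<phi>[OF wg] weighted_mult_\<phi>[OF wgs] by auto
  have nn: "0 \<le> (\<integral>x. (\<bar>v x\<bar> + v x) * \<rho> x \<partial>M)" for v
    by (intro integral_nonneg_AE AE_I2 mult_nonneg_nonneg) auto
  have "0 \<le> (\<integral>x. - g (u x) * (1 + sgn (u x)) * \<phi> x \<partial>M) + 2 * (\<integral>x. ?U x * \<rho> x \<partial>M)"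
  proof (rule order_trans[OF nn kato[OF weighted_uminus[OF wg] approximates_mollified[OF W(1)]
          approximates_mollified[OF W(2)] approximates_mollified[OF W(1)]]])
    show "mollified P n x - mollified N n x \<le> mollified P n x" for n x using mollified_eq(3)[OF W(2)] by simp
    show "AE x in M. u x = pot (\<lambda>x. - g (u x)) x + ?U x - ?V x" using eq by eventually_elim (simp add: pot_uminus)
  qed measurable
  then have a: "(\<integral>x. g (u x) * \<phi> x \<partial>M) + (\<integral>x. g (u x) * sgn (u x) * \<phi> x \<partial>M) \<le> 2 * (\<integral>x. ?U x * \<rho> x \<partial>M)"
    using ig by (simp add: distrib_left left_diff_distrib)
  have "0 \<le> (\<integral>x. g (u x) * (1 + sgn (- u x)) * \<phi> x \<partial>M) + 2 * (\<integral>x. ?V x * \<rho> x \<partial>M)"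
  proof (rule order_trans[OF nn kato[OF wg approximates_mollified[OF W(2)]
          approximates_mollified[OF W(1)] approximates_mollified[OF W(2)]]])
    show "mollified N n x - mollified P n x \<le> mollified N n x" for n x using mollified_eq(3)[OF W(1)] by simp
    show "AE x in M. - u x = pot (\<lambda>x. g (u x)) x + ?V x - ?U x" using eq by eventually_elim simp
  qed measurable
  then have b: "(\<integral>x. g (u x) * sgn (u x) * \<phi> x \<partial>M) - (\<integral>x. g (u x) * \<phi> x \<partial>M) \<le> 2 * (\<integral>x. ?V x * \<rho> x \<partial>M)"
    using ig by (simp add: right_diff_distrib left_diff_distrib sgn_minus)
  have "c\<^sub>1 * L1_weighted_norm \<Omega> \<gamma> (\<lambda>x. g (u x)) = (\<integral>x. \<bar>g (u x)\<bar> * (c\<^sub>1 * \<rho> x) \<partial>M)"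
    unfolding L1_weighted_norm_def by (simp add: mult.left_commute)
  also have "\<dots> \<le> (\<integral>x. g (u x) * sgn (u x) * \<phi> x \<partial>M)"
  proof (rule integral_mono)
    show "integrable M (\<lambda>x. \<bar>g (u x)\<bar> * (c\<^sub>1 * \<rho> x))"
      using weighted_cmult[OF weighted_abs[OF wg], of c\<^sub>1] by (simp add: weighted_M_iff mult_ac)
    show "integrable M (\<lambda>x. g (u x) * sgn (u x) * \<phi> x)" by (rule ig)
    fix x assume "x \<in> space M"
    then show "\<bar>g (u x)\<bar> * (c\<^sub>1 * \<rho> x) \<le> g (u x) * sgn (u x) * \<phi> x"
      unfolding sg using \<phi>_bounds(1)[of x] by (intro mult_left_mono) auto
  qed
  also have "\<dots> \<le> C\<^sub>0 * m" using a b UV by linarith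
  finally have "L1_weighted_norm \<Omega> \<gamma> (\<lambda>x. g (u x)) \<le> C\<^sub>0 / c\<^sub>1 * m"
    using const_nonneg by (simp add: field_simps)
  then show ?thesis using 1 unfolding m_def[symmetric] by (simp add: distrib_right)
qed

text \<open>Test functions are bounded only almost everywhere, but their potentials are integrated
  against measures that may charge Lebesgue null sets. Changing the function on a null set leaves
  its potential unchanged at every point, so a representative with a bound everywhere may be
  used.\<close>

lemma pot_bounded_ae:
  assumes "\<xi> \<in> borel_measurable M" "AE x in M. \<bar>\<xi> x\<bar> \<le> C * \<rho> x"
  obtains \<xi>' where "\<xi>' \<in> borel_measurable M" "\<And>x. \<bar>\<xi>' x\<bar> \<le> \<bar>C\<bar> * \<rho> x" "AE x in M. \<xi>' x = \<xi> x" "pot \<xi>' = pot \<xi>"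
proof
  have [measurable]: "\<xi> \<in> borel_measurable M" by fact
  define \<xi>' where "\<xi>' = (\<lambda>x. if \<bar>\<xi> x\<bar> \<le> C * \<rho> x then \<xi> x else 0)"
  show m [measurable]: "\<xi>' \<in> borel_measurable M" unfolding \<xi>'_def by measurable
  have "C * \<rho> x \<le> \<bar>C\<bar> * \<rho> x" for x by (intro mult_right_mono) auto
  then show "\<bar>\<xi>' x\<bar> \<le> \<bar>C\<bar> * \<rho> x" for x by (auto simp: \<xi>'_def intro: order_trans)
  show ae: "AE x in M. \<xi>' x = \<xi> x" using assms(2) by eventually_elim (simp add: \<xi>'_def)
  show "pot \<xi>' = pot \<xi>"
  proof
    fix x
    show "pot \<xi>' x = pot \<xi> x"
      unfolding potential_def by (rule integral_cong_AE) (measurable, use ae in \<open>auto elim: eventually_mono\<close>)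
  qed
qed

text \<open>Moving the potential from the test function to the data by symmetry turns the weak-dual
  identity into the vanishing of the integral of \<open>D\<close> against each test function, where
  \<open>D\<close> is the defect in the integral equation.\<close>

lemma weak_iff_mild:
  assumes g: "mono g" and W: "weighted P (\<lambda>x. 1)" "weighted N (\<lambda>x. 1)"
  shows "(weighted M u \<and> weighted M (\<lambda>x. g (u x)) \<and>
      (\<forall>\<xi>\<in>weighted_Linfty \<Omega> \<gamma>. (\<integral>x. u x * \<xi> x \<partial>M) + (\<integral>x. g (u x) * pot \<xi> x \<partial>M) =
         (\<integral>x. pot \<xi> x \<partial>P) - (\<integral>x. pot \<xi> x \<partial>N))) \<longleftrightarrow> mild_solution g P N u"
    (is "(?a \<and> ?b \<and> ?c) \<longleftrightarrow> _")
proof -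
  have "?c \<longleftrightarrow> (AE x in M. u x = green P x - green N x - pot (\<lambda>x. g (u x)) x)"
    if wu: "weighted M u" and wg: "weighted M (\<lambda>x. g (u x))"
  proof -
    define D where "D = (\<lambda>x. u x - (green P x - green N x - pot (\<lambda>x. g (u x)) x))"
    have wG: "weighted M (green P)" "weighted M (green N)" "weighted M (pot (\<lambda>x. g (u x)))"
      using potential_weighted W wg by auto
    have wD: "weighted M D" unfolding D_def by (intro weighted_diff wu wG)
    have [measurable]: "D \<in> borel_measurable M" "u \<in> borel_measurable M" using wD wu by (auto simp: weighted_M_iff)
    have key: "(\<integral>x. D x * \<xi> x \<partial>M) = (\<integral>x. u x * \<xi> x \<partial>M) + (\<integral>x. g (u x) * pot \<xi> x \<partial>M) - ((\<integral>x. pot \<xi> x \<partial>P) - (\<integral>x. pot \<xi> x \<partial>N))"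
      if \<xi> [measurable]: "\<xi> \<in> borel_measurable M" and ae: "AE x in M. \<bar>\<xi> x\<bar> \<le> C * \<rho> x" for \<xi> C
    proof -
      obtain \<xi>' where [measurable]: "\<xi>' \<in> borel_measurable M" and b: "\<And>x. \<bar>\<xi>' x\<bar> \<le> \<bar>C\<bar> * \<rho> x"
        and ae': "AE x in M. \<xi>' x = \<xi> x" and p: "pot \<xi>' = pot \<xi>"
        using pot_bounded_ae[OF \<xi> ae] by blast
      have c: "(\<integral>x. f x * \<xi>' x \<partial>M) = (\<integral>x. f x * \<xi> x \<partial>M)" if [measurable]: "f \<in> borel_measurable M" for f
        by (rule integral_cong_AE) (measurable, use ae' in \<open>auto elim: eventually_mono\<close>)
      have sy: "(\<integral>x. potential K \<nu> k x * \<xi>' x \<partial>M) = (\<integral>y. pot \<xi> y * k y \<partial>\<nu>)"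
        "integrable M (\<lambda>x. potential K \<nu> k x * \<xi>' x)" if "weighted \<nu> k" for \<nu> k
        using potential_symmetric[OF that, of \<xi>' "\<bar>C\<bar>"] b by (auto simp: p)
      have iu: "integrable M (\<lambda>x. u x * \<xi>' x)"
      proof (rule Bochner_Integration.integrable_bound)
        show "integrable M (\<lambda>x. \<bar>C\<bar> * (u x * \<rho> x))" using wu by (simp add: weighted_M_iff)
        have "\<bar>u x\<bar> * \<bar>\<xi>' x\<bar> \<le> \<bar>u x\<bar> * (\<bar>C\<bar> * \<rho> x)" for x using b by (intro mult_left_mono) auto
        then show "AE x in M. norm (u x * \<xi>' x) \<le> norm (\<bar>C\<bar> * (u x * \<rho> x))" by (simp add: abs_mult mult_ac)
      qed measurable
      have "(\<integral>x. D x * \<xi> x \<partial>M) = (\<integral>x. D x * \<xi>' x \<partial>M)" by (rule c[symmetric]) measurable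
      also have "\<dots> = (\<integral>x. u x * \<xi>' x - (green P x * \<xi>' x - green N x * \<xi>' x - pot (\<lambda>x. g (u x)) x * \<xi>' x) \<partial>M)"
        by (intro Bochner_Integration.integral_cong) (auto simp: D_def left_diff_distrib)
      also have "\<dots> = (\<integral>x. u x * \<xi>' x \<partial>M) - ((\<integral>x. green P x * \<xi>' x \<partial>M) - (\<integral>x. green N x * \<xi>' x \<partial>M) - (\<integral>x. pot (\<lambda>x. g (u x)) x * \<xi>' x \<partial>M))"
        using iu sy(2)[OF W(1)] sy(2)[OF W(2)] sy(2)[OF wg] by simp
      also have "\<dots> = (\<integral>x. u x * \<xi> x \<partial>M) - ((\<integral>x. pot \<xi> x \<partial>P) - (\<integral>x. pot \<xi> x \<partial>N) - (\<integral>x. pot \<xi> x * g (u x) \<partial>M))"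
        using sy(1)[OF W(1)] sy(1)[OF W(2)] sy(1)[OF wg] c[of u] by simp
      finally show ?thesis by (simp add: mult.commute)
    qed
    show ?thesis
    proof
      assume C: ?c
      \<comment> \<open>The sign of the defect times the weight is an admissible test function, and
        pairing \<open>D\<close> with it gives the weighted norm of \<open>D\<close>.\<close>
      define s where "s = (\<lambda>x. \<rho> x * sgn (D x))"
      have ms [measurable]: "s \<in> borel_measurable M" unfolding s_def by measurable
      have sL: "s \<in> weighted_Linfty \<Omega> \<gamma>"
      proof -
        have "(\<lambda>x. sgn (D x)) \<in> Linfty \<Omega>"
          by (auto simp: Linfty_def sgn_if intro!: exI[of _ 1])
        then show ?thesis
          unfolding weighted_Linfty_def s_def by (rule image_eqI[where f = "\<lambda>w x. \<rho> x * w x", OF refl])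
      qed
      have sb: "AE x in M. \<bar>s x\<bar> \<le> 1 * \<rho> x" by (intro AE_I2) (auto simp: s_def sgn_if)
      have "(\<integral>x. D x * s x \<partial>M) = 0" using key[OF ms sb] bspec[OF C sL] by linarith
      moreover have "D x * s x = \<bar>D x\<bar> * \<rho> x" for x by (auto simp: s_def sgn_if)
      ultimately have z: "(\<integral>x. \<bar>D x\<bar> * \<rho> x \<partial>M) = 0" by simp
      have i: "integrable M (\<lambda>x. \<bar>D x\<bar> * \<rho> x)" using weighted_abs[OF wD] by (simp add: weighted_M_iff)
      have "AE x in M. \<bar>D x\<bar> * \<rho> x = 0"
        using z integral_nonneg_eq_0_iff_AE[OF i] by auto
      then show "AE x in M. u x = green P x - green N x - pot (\<lambda>x. g (u x)) x"
        using AE_space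
      proof eventually_elim
        case (elim x)
        then have "D x = 0" using \<rho>_pos[of x] by simp
        then show ?case by (simp add: D_def)
      qed
    next
      assume A: "AE x in M. u x = green P x - green N x - pot (\<lambda>x. g (u x)) x"
      show ?c
      proof
        fix \<xi> assume "\<xi> \<in> weighted_Linfty \<Omega> \<gamma>"
        then obtain v C where v: "\<xi> = (\<lambda>x. \<rho> x * v x)" "v \<in> borel_measurable M" "AE x in M. \<bar>v x\<bar> \<le> C"
          by (auto simp: weighted_Linfty_def Linfty_def)
        have m: "\<xi> \<in> borel_measurable M" using v(2) unfolding v(1) by measurable
        have ae: "AE x in M. \<bar>\<xi> x\<bar> \<le> C * \<rho> x"
          using v(3) unfolding v(1) by eventually_elim (simp add: abs_mult mult.commute mult_right_mono)
        have "(\<integral>x. D x * \<xi> x \<partial>M) = (\<integral>x. 0 \<partial>M)"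
        proof (rule integral_cong_AE)
          show "(\<lambda>x. D x * \<xi> x) \<in> borel_measurable M" using m by measurable
          show "AE x in M. D x * \<xi> x = 0" using A by eventually_elim (simp add: D_def)
        qed simp
        then show "(\<integral>x. u x * \<xi> x \<partial>M) + (\<integral>x. g (u x) * pot \<xi> x \<partial>M) = (\<integral>x. pot \<xi> x \<partial>P) - (\<integral>x. pot \<xi> x \<partial>N)"
          using key[OF m ae] by simp
      qed
    qed
  qed
  then show ?thesis by (auto simp: mild_solution_def)
qed

end

section \<open>The Green function as a dual kernel\<close>

text \<open>\<open>G\<close> has arbitrary values on the diagonal and outside \<Omega>. Replacing
  them by 0 gives a kernel that is Borel, symmetric and nonnegative on the whole space.\<close>

definition off_kernel :: "'a set \<Rightarrow> ('a \<Rightarrow> 'a \<Rightarrow> real) \<Rightarrow> 'a \<Rightarrow> 'a \<Rightarrow> real" where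
  "off_kernel \<Omega> G x y = (if x \<in> \<Omega> \<and> y \<in> \<Omega> \<and> x \<noteq> y then G x y else 0)"

lemma green_model_le:
  fixes x y :: "'a::euclidean_space"
  assumes "0 < \<gamma>"
  shows "green_model \<Omega> s \<gamma> x y \<le> dist x y powr (- (real DIM('a) - 2 * s))"
proof -
  have p: "(min t 1) powr \<gamma> \<le> 1" if "0 \<le> t" for t :: real
    using powr_mono2[of \<gamma> "min t 1" 1] that assms by simp
  have "green_model \<Omega> s \<gamma> x y \<le> 1 / dist x y powr (real DIM('a) - 2 * s) * 1 * 1"
    unfolding green_model_def by (intro mult_mono p) auto
  then show ?thesis by (simp only: powr_minus_divide mult_1_right)
qed

lemma min_quotient_mult_le:
  fixes a b r :: real
  assumes "0 \<le> a" "0 \<le> b" "0 < r" "b \<le> a + r"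
  shows "min (a / r) 1 * b \<le> 2 * a"
proof (cases "r \<le> a")
  case True
  then have "min (a / r) 1 = 1" using assms by simp
  then show ?thesis using assms True by simp
next
  case False
  then have "min (a / r) 1 = a / r" using assms by simp
  moreover have "a / r * b \<le> a / r * (2 * r)" using assms False by (intro mult_left_mono) auto
  ultimately show ?thesis using assms by simp
qed

text \<open>The weight moves from \<open>y\<close> to \<open>x\<close>: the boundary factor at
  \<open>x\<close> times the distance at \<open>y\<close> is at most twice the distance at
  \<open>x\<close>, by the triangle inequality when \<open>x\<close> is far from the boundary
  compared with \<open>r\<close> and directly otherwise. This is the origin of
  \<open>2 powr \<gamma>\<close> in the constant.\<close>

lemma green_model_weight:
  fixes x y :: "'a::euclidean_space"
  assumes "0 < \<gamma>" "x \<noteq> y"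
  shows "green_model \<Omega> s \<gamma> x y * bdist \<Omega> y powr \<gamma> \<le>
    2 powr \<gamma> * bdist \<Omega> x powr \<gamma> * dist x y powr (- (real DIM('a) - 2 * s))"
proof -
  define r where "r = dist x y"
  have r: "r > 0" using assms by (simp add: r_def)
  have p: "(min t 1) powr \<gamma> \<le> 1" if "0 \<le> t" for t :: real
    using powr_mono2[of \<gamma> "min t 1" 1] that assms by simp
  have "bdist \<Omega> y \<le> bdist \<Omega> x + r" using bdist_lipschitz[of \<Omega> y x] by (simp add: r_def dist_commute)
  then have "min (bdist \<Omega> x / r) 1 * bdist \<Omega> y \<le> 2 * bdist \<Omega> x"
    using r by (intro min_quotient_mult_le) auto
  then have "(min (bdist \<Omega> x / r) 1 * bdist \<Omega> y) powr \<gamma> \<le> (2 * bdist \<Omega> x) powr \<gamma>"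
    using assms r by (intro powr_mono2) auto
  then have k: "(min (bdist \<Omega> x / r) 1) powr \<gamma> * bdist \<Omega> y powr \<gamma> \<le> 2 powr \<gamma> * bdist \<Omega> x powr \<gamma>"
    using r by (simp add: powr_mult)
  have "green_model \<Omega> s \<gamma> x y * bdist \<Omega> y powr \<gamma> =
      1 / r powr (real DIM('a) - 2 * s) * ((min (bdist \<Omega> y / r) 1) powr \<gamma> *
        ((min (bdist \<Omega> x / r) 1) powr \<gamma> * bdist \<Omega> y powr \<gamma>))"
    by (simp add: green_model_def r_def)
  also have "\<dots> \<le> 1 / r powr (real DIM('a) - 2 * s) * (1 * (2 powr \<gamma> * bdist \<Omega> x powr \<gamma>))"
    using r by (intro mult_left_mono mult_mono k p) auto
  also have "\<dots> = 2 powr \<gamma> * bdist \<Omega> x powr \<gamma> * r powr (- (real DIM('a) - 2 * s))"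
    by (simp only: powr_minus_divide mult_1_left mult.commute)
  finally show ?thesis by (simp only: r_def)
qed

text \<open>All distances are at most \<open>D\<close>. Replacing \<open>r\<close> by
  \<open>D\<close> lowers the Riesz factor, and each of the two boundary factors is at least the
  weight times \<open>D powr (- \<gamma>)\<close>; this accounts for the exponent.\<close>

lemma green_model_lower:
  fixes x y :: "'a::euclidean_space"
  assumes "0 < \<gamma>" "2 * s < real DIM('a)" "x \<noteq> y" "dist x y \<le> D" "bdist \<Omega> x \<le> D" "bdist \<Omega> y \<le> D"
  shows "D powr (- (real DIM('a) - 2 * s) - 2 * \<gamma>) * bdist \<Omega> x powr \<gamma> * bdist \<Omega> y powr \<gamma> \<le> green_model \<Omega> s \<gamma> x y"
proof -
  define r where "r = dist x y"
  have r: "0 < r" "r \<le> D" using assms by (auto simp: r_def)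
  have D: "D > 0" using r by simp
  have m: "bdist \<Omega> z powr \<gamma> * D powr (- \<gamma>) \<le> (min (bdist \<Omega> z / r) 1) powr \<gamma>" if "bdist \<Omega> z \<le> D" for z
  proof -
    have "bdist \<Omega> z / D \<le> bdist \<Omega> z / r" using r by (intro divide_left_mono) auto
    moreover have "bdist \<Omega> z / D \<le> 1" using that D by simp
    ultimately have "(bdist \<Omega> z / D) powr \<gamma> \<le> (min (bdist \<Omega> z / r) 1) powr \<gamma>"
      using assms(1) D by (intro powr_mono2) auto
    moreover have "(bdist \<Omega> z / D) powr \<gamma> = bdist \<Omega> z powr \<gamma> / D powr \<gamma>"
      by (rule powr_divide)
    ultimately show ?thesis by (simp add: powr_minus_divide)
  qed
  have "D powr (- (real DIM('a) - 2 * s)) \<le> r powr (- (real DIM('a) - 2 * s))"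
    using r assms by (intro powr_mono2') auto
  then have d: "D powr (- (real DIM('a) - 2 * s)) \<le> 1 / r powr (real DIM('a) - 2 * s)"
    using powr_minus_divide[of r "real DIM('a) - 2 * s"] by simp
  have "D powr (- (real DIM('a) - 2 * s) - 2 * \<gamma>) =
      D powr (- (real DIM('a) - 2 * s)) * D powr (- \<gamma>) * D powr (- \<gamma>)"
    by (simp flip: powr_add)
  then have "D powr (- (real DIM('a) - 2 * s) - 2 * \<gamma>) * bdist \<Omega> x powr \<gamma> * bdist \<Omega> y powr \<gamma> =
      D powr (- (real DIM('a) - 2 * s)) * (bdist \<Omega> x powr \<gamma> * D powr (- \<gamma>)) * (bdist \<Omega> y powr \<gamma> * D powr (- \<gamma>))"
    by (simp add: mult_ac)
  also have "\<dots> \<le> green_model \<Omega> s \<gamma> x y"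
    unfolding green_model_def r_def[symmetric] using assms by (intro mult_mono m d) auto
  finally show ?thesis .
qed

lemma open_off_diag: "open \<Omega> \<Longrightarrow> open (off_diag \<Omega>)" for \<Omega> :: "'a::euclidean_space set"
proof -
  assume o: "open \<Omega>"
  have "closed {p :: 'a \<times> 'a. fst p = snd p}" by (intro closed_Collect_eq continuous_intros)
  then have "open (\<Omega> \<times> \<Omega> - {p. fst p = snd p})" using o by (intro open_Diff open_Times)
  moreover have "off_diag \<Omega> = \<Omega> \<times> \<Omega> - {p. fst p = snd p}" by (auto simp: off_diag_def)
  ultimately show ?thesis by simp
qed

lemma off_kernel_borel:
  fixes \<Omega> :: "'a::euclidean_space set"
  assumes "open \<Omega>" "(\<lambda>(x, y). G x y) \<in> borel_measurable (restrict_space borel (off_diag \<Omega>))"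
  shows "(\<lambda>z. off_kernel \<Omega> G (fst z) (snd z)) \<in> borel_measurable (borel \<Otimes>\<^sub>M borel)"
proof -
  have "(\<lambda>z. indicator (off_diag \<Omega>) z *\<^sub>R (case z of (x, y) \<Rightarrow> G x y)) \<in> borel_measurable borel"
    using assms open_off_diag[OF assms(1)] by (subst (asm) borel_measurable_restrict_space_iff) auto
  moreover have "(\<lambda>z. indicator (off_diag \<Omega>) z *\<^sub>R (case z of (x, y) \<Rightarrow> G x y)) = (\<lambda>z. off_kernel \<Omega> G (fst z) (snd z))"
    by (auto simp: off_kernel_def off_diag_def indicator_def fun_eq_iff)
  ultimately show ?thesis by (simp add: borel_prod)
qed

text \<open>On \<Omega> the section of \<open>G\<close> differs from that of
  \<open>off_kernel\<close> at the single point \<open>x\<close>, so a multiple of the indicator of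
  \<open>{x}\<close> restores it.\<close>

lemma green_section_measurable:
  fixes \<Omega> :: "'a::euclidean_space set"
  assumes K: "(\<lambda>z. off_kernel \<Omega> G (fst z) (snd z)) \<in> borel_measurable (borel \<Otimes>\<^sub>M borel)"
    and N: "(\<lambda>x. x) \<in> borel_measurable N" "space N = \<Omega>" and x: "x \<in> \<Omega>"
  shows "off_kernel \<Omega> G x \<in> borel_measurable N" and "G x \<in> borel_measurable N"
proof -
  show m [measurable]: "off_kernel \<Omega> G x \<in> borel_measurable N"
    using measurable_compose[OF measurable_Pair[OF measurable_const N(1)] K] by simp
  have [measurable]: "(\<lambda>x. x) \<in> borel_measurable N" by (rule N)
  have "(\<lambda>y. off_kernel \<Omega> G x y + indicator {x} y * G x x) \<in> borel_measurable N"
    by measurable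
  moreover have "off_kernel \<Omega> G x y + indicator {x} y * G x x = G x y" if "y \<in> space N" for y
    using that N(2) x by (auto simp: off_kernel_def)
  ultimately show "G x \<in> borel_measurable N" by (subst measurable_cong[where g = "\<lambda>y. off_kernel \<Omega> G x y + indicator {x} y * G x x"]) auto
qed

lemma AE_lebesgue_on_neq:
  fixes \<Omega> :: "'a::euclidean_space set"
  assumes "open \<Omega>"
  shows "AE y in lebesgue_on \<Omega>. y \<noteq> x"
proof -
  have "AE y in lborel. y \<noteq> x" by (rule AE_lborel_singleton)
  then have "AE y in lebesgue. y \<noteq> x" by (rule AE_completion)
  then show ?thesis using assms by (subst AE_restrict_space_iff) (auto elim: eventually_mono)
qed

text \<open>The two kernels differ at one point \<open>y = x\<close>, a Lebesgue null set. The
  potentials therefore agree at every \<open>x\<close> of \<Omega>, which matters when they are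
  integrated against a measure.\<close>

lemma green_fun_eq:
  fixes \<Omega> :: "'a::euclidean_space set"
  assumes "open \<Omega>" and K: "(\<lambda>z. off_kernel \<Omega> G (fst z) (snd z)) \<in> borel_measurable (borel \<Otimes>\<^sub>M borel)"
    and [measurable]: "f \<in> borel_measurable (lebesgue_on \<Omega>)" and x: "x \<in> \<Omega>"
  shows "green_fun \<Omega> G f x = potential (off_kernel \<Omega> G) (lebesgue_on \<Omega>) f x"
  unfolding green_fun_def potential_def
proof (rule integral_cong_AE)
  have N: "(\<lambda>x. x) \<in> borel_measurable (lebesgue_on \<Omega>)" "space (lebesgue_on \<Omega>) = \<Omega>"
    using assms(1) by (auto intro!: measurable_restrict_space1 measurable_completion)
  note [measurable] = green_section_measurable[OF K N x]
  show "(\<lambda>y. G x y * f y) \<in> borel_measurable (lebesgue_on \<Omega>)"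
    "(\<lambda>y. off_kernel \<Omega> G x y * f y) \<in> borel_measurable (lebesgue_on \<Omega>)" by measurable
  show "AE y in lebesgue_on \<Omega>. G x y * f y = off_kernel \<Omega> G x y * f y"
    using AE_lebesgue_on_neq[OF assms(1), of x] AE_space
    by eventually_elim (use x N(2) in \<open>auto simp: off_kernel_def\<close>)
qed

lemma green_dual_kernel:
  fixes \<Omega> :: "'a::euclidean_space set" and s \<gamma> c I D :: real
  assumes \<Omega>: "open \<Omega>" "bounded \<Omega>" "\<Omega> \<noteq> {}"
    and par: "0 < s" "0 < \<gamma>" "2 * s < real DIM('a)" "0 < c"
    and I: "0 \<le> I" "\<And>y. y \<in> \<Omega> \<Longrightarrow>
      (\<integral>\<^sup>+x. ennreal (dist x y powr (- (real DIM('a) - 2 * s))) \<partial>lebesgue_on \<Omega>) \<le> ennreal I"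
    and D: "1 \<le> D" "\<And>x. x \<in> \<Omega> \<Longrightarrow> bdist \<Omega> x \<le> D" "\<And>x y. x \<in> \<Omega> \<Longrightarrow> y \<in> \<Omega> \<Longrightarrow> dist x y \<le> D"
    and L1: "cond_L1 \<Omega> J B" and G1: "cond_G1 \<Omega> J B s \<gamma> c G" and G2: "cond_G2 \<Omega> G"
  shows "dual_kernel \<Omega> \<gamma> (off_kernel \<Omega> G) (c * 2 powr \<gamma> * I) (c * I)
    (inverse c * D powr (- (real DIM('a) - 2 * s) - 2 * \<gamma>) *
      (\<integral>x. bdist \<Omega> x powr \<gamma> * bdist \<Omega> x powr \<gamma> \<partial>lebesgue_on \<Omega>))"
proof -
  define \<alpha> where "\<alpha> = real DIM('a) - 2 * s"
  have \<alpha>: "0 < \<alpha>" "\<alpha> < real DIM('a)" using par by (auto simp: \<alpha>_def)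
  let ?M = "lebesgue_on \<Omega>" and ?\<rho> = "\<lambda>x. bdist \<Omega> x powr \<gamma>"
  let ?K = "off_kernel \<Omega> G"
  interpret E: energy_form \<Omega> J B by unfold_locales (use \<Omega> L1 in auto)
  have sp: "space ?M = \<Omega>" by simp
  have idM [measurable]: "(\<lambda>x. x) \<in> borel_measurable ?M"
    by (intro measurable_restrict_space1 measurable_completion) simp
  have K_borel: "(\<lambda>z. ?K (fst z) (snd z)) \<in> borel_measurable (borel \<Otimes>\<^sub>M borel)"
    using G1 unfolding cond_G1_def by (intro off_kernel_borel \<Omega>) auto
  have Km [measurable]: "?K x \<in> borel_measurable ?M" "(\<lambda>y. ?K y x) \<in> borel_measurable ?M" for x
    using measurable_compose[OF measurable_Pair[OF measurable_const idM] K_borel, of x]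
      measurable_compose[OF measurable_Pair[OF idM measurable_const] K_borel, of x] by auto
  have G: "0 < G x y" "G x y = G y x" "inverse c * green_model \<Omega> s \<gamma> x y \<le> G x y" "G x y \<le> c * green_model \<Omega> s \<gamma> x y"
    if "x \<in> \<Omega>" "y \<in> \<Omega>" "x \<noteq> y" for x y
    using G1 that unfolding cond_G1_def off_diag_def by auto
  have K_nonneg: "0 \<le> ?K x y" for x y using G(1)[of x y] by (auto simp: off_kernel_def intro: less_imp_le)
  have K_sym: "?K x y = ?K y x" for x y using G(2)[of x y] by (auto simp: off_kernel_def)
  have K_le: "?K x y \<le> c * dist x y powr (- \<alpha>)" for x y
  proof (cases "x \<in> \<Omega> \<and> y \<in> \<Omega> \<and> x \<noteq> y")
    case True
    then have "?K x y \<le> c * green_model \<Omega> s \<gamma> x y" using G(4) by (simp add: off_kernel_def)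
    also have "\<dots> \<le> c * dist x y powr (- \<alpha>)"
      unfolding \<alpha>_def using par by (intro mult_left_mono green_model_le) auto
    finally show ?thesis .
  next
    case False
    then have "?K x y = 0" by (auto simp: off_kernel_def)
    then show ?thesis using par by simp
  qed
  have K_weight_le: "?K x y * ?\<rho> y \<le> c * 2 powr \<gamma> * ?\<rho> x * dist x y powr (- \<alpha>)" for x y
  proof (cases "x \<in> \<Omega> \<and> y \<in> \<Omega> \<and> x \<noteq> y")
    case True
    then have "?K x y * ?\<rho> y \<le> c * green_model \<Omega> s \<gamma> x y * ?\<rho> y"
      using G(4) by (intro mult_right_mono) (auto simp: off_kernel_def)
    also have "\<dots> = c * (green_model \<Omega> s \<gamma> x y * ?\<rho> y)" by simp
    also have "\<dots> \<le> c * (2 powr \<gamma> * ?\<rho> x * dist x y powr (- \<alpha>))"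
      unfolding \<alpha>_def using par True by (intro mult_left_mono green_model_weight) auto
    finally show ?thesis by (simp add: mult_ac)
  next
    case False
    then have "?K x y = 0" by (auto simp: off_kernel_def)
    then show ?thesis using par by simp
  qed
  have I': "(\<integral>\<^sup>+y. ennreal (dist x y powr (- \<alpha>)) \<partial>?M) \<le> ennreal I" if "x \<in> \<Omega>" for x
    using I(2)[OF that] by (simp add: \<alpha>_def dist_commute)
  have riesz_cmult: "(\<integral>\<^sup>+y. ennreal (a * dist x y powr (- \<alpha>)) \<partial>?M) \<le> ennreal (a * I)" if "x \<in> \<Omega>" "0 \<le> a" for x a
  proof -
    have "(\<integral>\<^sup>+y. ennreal (a * dist x y powr (- \<alpha>)) \<partial>?M) = ennreal a * (\<integral>\<^sup>+y. ennreal (dist x y powr (- \<alpha>)) \<partial>?M)"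
      using that by (simp add: ennreal_mult nn_integral_cmult)
    also have "\<dots> \<le> ennreal a * ennreal I" by (intro mult_left_mono I' that) simp
    also have "\<dots> = ennreal (a * I)" using that I(1) by (simp add: ennreal_mult)
    finally show ?thesis .
  qed
  have K_integral: "(\<integral>\<^sup>+y. ennreal (?K x y) \<partial>?M) \<le> ennreal (c * I)" if "x \<in> \<Omega>" for x
    by (rule order_trans[OF nn_integral_mono riesz_cmult[OF that]]) (use K_le par in \<open>auto intro!: ennreal_leI\<close>)
  have K_weight: "(\<integral>\<^sup>+y. ennreal (?K x y * ?\<rho> y) \<partial>?M) \<le> ennreal (c * 2 powr \<gamma> * I * ?\<rho> x)" if "x \<in> \<Omega>" for x
  proof -
    have "(\<integral>\<^sup>+y. ennreal (?K x y * ?\<rho> y) \<partial>?M) \<le> ennreal ((c * 2 powr \<gamma> * ?\<rho> x) * I)"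
      by (rule order_trans[OF nn_integral_mono riesz_cmult[OF that]])
        (use K_weight_le par in \<open>auto intro!: ennreal_leI\<close>)
    then show ?thesis by (simp add: mult_ac)
  qed
  have \<rho>m [measurable]: "?\<rho> \<in> borel_measurable ?M"
    using measurable_compose[OF idM, of ?\<rho> borel] by simp
  have \<rho>_pos: "0 < ?\<rho> x" if "x \<in> \<Omega>" for x using bdist_pos[OF \<Omega>(1,2) that] by simp
  have \<rho>_le: "?\<rho> x \<le> D powr \<gamma>" if "x \<in> \<Omega>" for x using D(2)[OF that] par by (intro powr_mono2) auto
  have pot_\<rho>: "0 \<le> potential ?K ?M ?\<rho> x" "potential ?K ?M ?\<rho> x \<le> c * 2 powr \<gamma> * I * D powr \<gamma>"
    and int_\<rho>: "integrable ?M (\<lambda>y. ?K x y * ?\<rho> y)" if x: "x \<in> \<Omega>" for x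
  proof -
    show "0 \<le> potential ?K ?M ?\<rho> x" unfolding potential_def
      using K_nonneg by (intro Bochner_Integration.integral_nonneg) auto
    show i: "integrable ?M (\<lambda>y. ?K x y * ?\<rho> y)"
    proof (rule integrableI_nonneg)
      show "(\<integral>\<^sup>+y. ennreal (?K x y * ?\<rho> y) \<partial>?M) < \<infinity>" using K_weight[OF x] le_less_trans by fastforce
    qed (use K_nonneg in auto)
    have "ennreal (potential ?K ?M ?\<rho> x) = (\<integral>\<^sup>+y. ennreal (?K x y * ?\<rho> y) \<partial>?M)"
      unfolding potential_def using i K_nonneg by (intro nn_integral_eq_integral[symmetric]) auto
    also have "\<dots> \<le> ennreal (c * 2 powr \<gamma> * I * ?\<rho> x)" by (rule K_weight[OF x])
    also have "\<dots> \<le> ennreal (c * 2 powr \<gamma> * I * D powr \<gamma>)"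
      using par I(1) \<rho>_le[OF x] by (intro ennreal_leI mult_left_mono) auto
    finally show "potential ?K ?M ?\<rho> x \<le> c * 2 powr \<gamma> * I * D powr \<gamma>"
      using par I(1) by (subst (asm) ennreal_le_iff) auto
  qed
  have int_\<rho>\<rho>: "integrable ?M (\<lambda>x. ?\<rho> x * ?\<rho> x)"
  proof (rule E.integrable_const_bound[where B = "D powr \<gamma> * D powr \<gamma>"])
    show "AE x in ?M. norm (?\<rho> x * ?\<rho> x) \<le> D powr \<gamma> * D powr \<gamma>"
      using \<rho>_le by (intro AE_I2) (auto simp: abs_mult intro!: mult_mono)
  qed simp
  have pos_\<rho>\<rho>: "0 < (\<integral>x. ?\<rho> x * ?\<rho> x \<partial>?M)"
  proof (rule ccontr)
    assume "\<not> ?thesis"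
    moreover have "0 \<le> (\<integral>x. ?\<rho> x * ?\<rho> x \<partial>?M)" by (intro Bochner_Integration.integral_nonneg) auto
    ultimately have "(\<integral>x. ?\<rho> x * ?\<rho> x \<partial>?M) = 0" by linarith
    then have "AE x in ?M. ?\<rho> x * ?\<rho> x = 0"
      using integral_nonneg_eq_0_iff_AE[OF int_\<rho>\<rho>] by auto
    then have "AE x in ?M. False"
      using AE_space
    proof eventually_elim
      case (elim x)
      then show ?case using \<rho>_pos[of x] by simp
    qed
    then have "AE x in lebesgue. x \<notin> \<Omega>" using \<Omega>(1) by (subst (asm) AE_restrict_space_iff) auto
    then have "negligible \<Omega>"
      using \<Omega>(1) by (subst negligible_iff_null_sets) (auto simp: AE_iff_null_sets[of \<Omega> lebesgue])
    then show False using \<Omega> open_not_negligible by blast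
  qed
  have green_eq: "green_fun \<Omega> G f x = potential ?K ?M f x" if "f \<in> borel_measurable ?M" "x \<in> \<Omega>" for f x
    by (rule green_fun_eq[OF \<Omega>(1) K_borel that])
  have L2: "f \<in> L2_space \<Omega>" if f: "f \<in> borel_measurable ?M" "\<And>x. x \<in> \<Omega> \<Longrightarrow> \<bar>f x\<bar> \<le> b" for f b
  proof -
    have "(f x)\<^sup>2 \<le> b\<^sup>2" if "x \<in> \<Omega>" for x using f(2)[OF that] power_mono[of "\<bar>f x\<bar>" b 2] by simp
    then have "integrable ?M (\<lambda>x. (f x)\<^sup>2)"
      using f(1) by (intro E.integrable_const_bound[where B = "b\<^sup>2"]) auto
    then show ?thesis using f(1) by (simp add: L2_space_def)
  qed
  have image: "is_green_image \<Omega> J B f (green_fun \<Omega> G f)" if "f \<in> bounded_measurable \<Omega>" for f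
    using that L2 G1 unfolding bounded_measurable_def cond_G1_def by blast
  have \<rho>_bm: "?\<rho> \<in> bounded_measurable \<Omega>"
    using \<rho>_le \<rho>m unfolding bounded_measurable_def by (auto intro!: exI[of _ "D powr \<gamma>"])
  show ?thesis
  proof
    show "open \<Omega>" "bounded \<Omega>" "0 < \<gamma>" by fact+
    show "(\<lambda>z. ?K (fst z) (snd z)) \<in> borel_measurable (borel \<Otimes>\<^sub>M borel)" by (rule K_borel)
    show "0 \<le> ?K x y" "?K x y = ?K y x" for x y by (rule K_nonneg, rule K_sym)
    show "0 \<le> c * 2 powr \<gamma> * I" "0 \<le> c * I" using par I(1) by auto
    show "0 < inverse c * D powr (- (real DIM('a) - 2 * s) - 2 * \<gamma>) * (\<integral>x. ?\<rho> x * ?\<rho> x \<partial>?M)"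
      using par D(1) pos_\<rho>\<rho> by (intro mult_pos_pos) auto
    show "(\<integral>\<^sup>+y. ennreal (?K x y) \<partial>?M) \<le> ennreal (c * I)" if "x \<in> \<Omega>" for x by (rule K_integral[OF that])
    show "(\<integral>\<^sup>+y. ennreal (?K x y * ?\<rho> y) \<partial>?M) \<le> ennreal (c * 2 powr \<gamma> * I * ?\<rho> x)" if "x \<in> \<Omega>" for x
      by (rule K_weight[OF that])
    show "inverse c * D powr (- (real DIM('a) - 2 * s) - 2 * \<gamma>) * (\<integral>x. ?\<rho> x * ?\<rho> x \<partial>?M) * ?\<rho> x \<le>
        (\<integral>y. ?K x y * ?\<rho> y \<partial>?M)" if x: "x \<in> \<Omega>" for x
    proof -
      define k where "k = inverse c * D powr (- (real DIM('a) - 2 * s) - 2 * \<gamma>)"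
      have "k * (\<integral>y. ?\<rho> y * ?\<rho> y \<partial>?M) * ?\<rho> x = (k * ?\<rho> x) * (\<integral>y. ?\<rho> y * ?\<rho> y \<partial>?M)"
        by (simp only: mult_ac)
      also have "\<dots> = (\<integral>y. (k * ?\<rho> x) * (?\<rho> y * ?\<rho> y) \<partial>?M)"
        by (rule integral_mult_right_zero[symmetric])
      also have "\<dots> \<le> (\<integral>y. ?K x y * ?\<rho> y \<partial>?M)"
      proof (rule integral_mono_AE)
        show "integrable ?M (\<lambda>y. (k * ?\<rho> x) * (?\<rho> y * ?\<rho> y))" using int_\<rho>\<rho> by (rule integrable_mult_right)
        show "integrable ?M (\<lambda>y. ?K x y * ?\<rho> y)" by (rule int_\<rho>[OF x])
        show "AE y in ?M. (k * ?\<rho> x) * (?\<rho> y * ?\<rho> y) \<le> ?K x y * ?\<rho> y"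
          using AE_lebesgue_on_neq[OF \<Omega>(1), of x] AE_space
        proof eventually_elim
          case (elim y)
          then have y: "y \<in> \<Omega>" "x \<noteq> y" by auto
          have "inverse c * (D powr (- (real DIM('a) - 2 * s) - 2 * \<gamma>) * ?\<rho> x * ?\<rho> y) \<le> inverse c * green_model \<Omega> s \<gamma> x y"
            using par by (intro mult_left_mono green_model_lower y D x) auto
          also have "\<dots> \<le> ?K x y" using G(3)[OF x y] x y by (simp add: off_kernel_def)
          finally have "k * ?\<rho> x * ?\<rho> y \<le> ?K x y" by (simp add: k_def mult_ac)
          from mult_right_mono[OF this, of "?\<rho> y"] show ?case by (simp add: mult_ac)
        qed
      qed
      finally show ?thesis unfolding k_def .
    qed
    show "\<exists>d>0. \<forall>z\<in>\<Omega>. dist z y < d \<longrightarrow> (\<integral>\<^sup>+x. ennreal \<bar>?K x z - ?K x y\<bar> \<partial>?M) \<le> ennreal e"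
      if y: "y \<in> \<Omega>" and e: "0 < e" for y e
    proof -
      \<comment> \<open>Truncation at level \<open>m\<close> splits the kernel. The excess over
        \<open>m\<close> has integral at most \<open>e / 3\<close> for every pole, since
        \<open>off_kernel\<close> lies below a multiple of the Riesz kernel, and the truncated part
        \<open>T\<close> can be treated by dominated convergence.\<close>
      obtain m where m: "0 \<le> m" "\<And>y. y \<in> \<Omega> \<Longrightarrow> (\<integral>\<^sup>+x. ennreal (c * dist x y powr (- \<alpha>) - m) \<partial>?M) \<le> ennreal (e / 3)"
        using riesz_potential_tail[OF \<Omega>(1,2) \<alpha>(2,1), of "e / 3" c] e by auto
      define T where "T = (\<lambda>z. \<integral>x. \<bar>min (?K x z) m - min (?K x y) m\<bar> \<partial>?M)"
      have Tb: "\<bar>min (?K x z) m - min (?K x y) m\<bar> \<le> m" for x z using K_nonneg[of x z] K_nonneg[of x y] m(1) by auto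
      have Ti: "integrable ?M (\<lambda>x. \<bar>min (?K x z) m - min (?K x y) m\<bar>)" for z
        using Tb by (intro E.integrable_const_bound[where B = m]) auto
      have tail: "(\<integral>\<^sup>+x. ennreal (?K x z - m) \<partial>?M) \<le> ennreal (e / 3)" if "z \<in> \<Omega>" for z
        by (rule order_trans[OF nn_integral_mono m(2)[OF that]]) (use K_le in \<open>auto intro!: ennreal_leI\<close>)
      have split: "(\<integral>\<^sup>+x. ennreal \<bar>?K x z - ?K x y\<bar> \<partial>?M) \<le> ennreal (T z) + ennreal (e / 3) + ennreal (e / 3)" if z: "z \<in> \<Omega>" for z
      proof -
        have "(\<integral>\<^sup>+x. ennreal \<bar>?K x z - ?K x y\<bar> \<partial>?M) \<le>
            (\<integral>\<^sup>+x. ennreal \<bar>min (?K x z) m - min (?K x y) m\<bar> + ennreal (?K x z - m) + ennreal (?K x y - m) \<partial>?M)"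
        proof (rule nn_integral_mono)
          fix x
          have "\<bar>a - b\<bar> \<le> \<bar>min a m - min b m\<bar> + max 0 (a - m) + max 0 (b - m)" for a b :: real by linarith
          then have "ennreal \<bar>?K x z - ?K x y\<bar> \<le> ennreal (\<bar>min (?K x z) m - min (?K x y) m\<bar> + max 0 (?K x z - m) + max 0 (?K x y - m))"
            by (intro ennreal_leI)
          also have "\<dots> = ennreal \<bar>min (?K x z) m - min (?K x y) m\<bar> + ennreal (max 0 (?K x z - m)) + ennreal (max 0 (?K x y - m))"
            by (simp add: ennreal_plus)
          finally show "ennreal \<bar>?K x z - ?K x y\<bar> \<le> ennreal \<bar>min (?K x z) m - min (?K x y) m\<bar> + ennreal (?K x z - m) + ennreal (?K x y - m)"
            by (simp only: ennreal_max_0)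
        qed
        also have "\<dots> = (\<integral>\<^sup>+x. ennreal \<bar>min (?K x z) m - min (?K x y) m\<bar> \<partial>?M) + (\<integral>\<^sup>+x. ennreal (?K x z - m) \<partial>?M) + (\<integral>\<^sup>+x. ennreal (?K x y - m) \<partial>?M)"
          by (subst nn_integral_add; (subst nn_integral_add)?) auto
        also have "\<dots> \<le> ennreal (T z) + ennreal (e / 3) + ennreal (e / 3)"
          using tail[OF z] tail[OF y] Ti[of z] by (intro add_mono) (auto simp: T_def nn_integral_eq_integral)
        finally show ?thesis .
      qed
      \<comment> \<open>Along a sequence of poles tending to \<open>y\<close>, the kernel converges
        at every \<open>x\<close> other than \<open>y\<close> by \<open>cond_G2\<close>, and
        \<open>m\<close> is an integrable bound on a set of finite measure.\<close>
      have "\<forall>\<^sub>F z in at y within \<Omega>. T z < e / 3"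
      proof (rule sequentially_imp_eventually_within, safe)
        fix w assume w: "\<forall>n. w n \<in> \<Omega> \<and> w n \<noteq> y" "w \<longlonglongrightarrow> y"
        have "(\<lambda>n. T (w n)) \<longlonglongrightarrow> (\<integral>x. 0 \<partial>?M)"
          unfolding T_def
        proof (rule integral_dominated_convergence[where w = "\<lambda>x. m"])
          show "AE x in ?M. norm \<bar>min (?K x (w n)) m - min (?K x y) m\<bar> \<le> m" for n using Tb by simp
          show "AE x in ?M. (\<lambda>n. \<bar>min (?K x (w n)) m - min (?K x y) m\<bar>) \<longlonglongrightarrow> 0"
            using AE_lebesgue_on_neq[OF \<Omega>(1), of y] AE_space
          proof eventually_elim
            case (elim x)
            then have x: "x \<in> \<Omega>" "x \<noteq> y" by auto
            have "continuous (at (x, y) within off_diag \<Omega>) (\<lambda>(x, y). G x y)"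
              using G2 x y unfolding cond_G2_def continuous_on_eq_continuous_within by (auto simp: off_diag_def)
            then have c: "((\<lambda>(x, y). G x y) \<longlongrightarrow> G x y) (at (x, y) within off_diag \<Omega>)" by (simp add: continuous_within)
            have ev: "\<forall>\<^sub>F n in sequentially. w n \<noteq> x"
              using tendsto_imp_eventually_ne[OF w(2) x(2)[symmetric]] .
            have "(\<lambda>n. (x, w n)) \<longlonglongrightarrow> (x, y)" by (intro tendsto_intros w(2))
            then have "filterlim (\<lambda>n. (x, w n)) (at (x, y) within off_diag \<Omega>) sequentially"
              unfolding filterlim_at using ev
              by (intro conjI) (auto elim!: eventually_mono simp: off_diag_def x w(1))
            from filterlim_compose[OF c this] have "(\<lambda>n. G x (w n)) \<longlonglongrightarrow> G x y" by simp
            moreover have "\<forall>\<^sub>F n in sequentially. G x (w n) = ?K x (w n)"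
              using ev by eventually_elim (use x w(1) in \<open>auto simp: off_kernel_def\<close>)
            ultimately have "(\<lambda>n. ?K x (w n)) \<longlonglongrightarrow> G x y" by (rule Lim_transform_eventually)
            moreover have "G x y = ?K x y" using x y by (simp add: off_kernel_def)
            ultimately have "(\<lambda>n. \<bar>min (?K x (w n)) m - min (?K x y) m\<bar>) \<longlonglongrightarrow> \<bar>min (?K x y) m - min (?K x y) m\<bar>"
              by (intro tendsto_intros) auto
            then show ?case by simp
          qed
        qed auto
        then have "(\<lambda>n. T (w n)) \<longlonglongrightarrow> 0" by simp
        then show "\<forall>\<^sub>F n in sequentially. T (w n) < e / 3" using e by (intro order_tendstoD(2)) auto
      qed
      then obtain d where d: "d > 0" "\<And>z. z \<in> \<Omega> \<Longrightarrow> z \<noteq> y \<Longrightarrow> dist z y < d \<Longrightarrow> T z < e / 3"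
        unfolding eventually_at by blast
      have "(\<integral>\<^sup>+x. ennreal \<bar>?K x z - ?K x y\<bar> \<partial>?M) \<le> ennreal e" if z: "z \<in> \<Omega>" "dist z y < d" for z
      proof (cases "z = y")
        case False
        have T0: "0 \<le> T z" unfolding T_def by (intro Bochner_Integration.integral_nonneg) auto
        have "ennreal (T z) + ennreal (e / 3) + ennreal (e / 3) = ennreal (T z + e / 3 + e / 3)"
          using T0 e by (simp add: add_nonneg_nonneg del: ennreal_plus flip: ennreal_plus)
        also have "\<dots> \<le> ennreal e" using d(2)[OF z(1) False z(2)] by (intro ennreal_leI) linarith
        finally show ?thesis using split[OF z(1)] by (rule order_trans[rotated])
      qed simp
      then show ?thesis using d(1) by blast
    qed
    fix f assume f: "f \<in> bounded_measurable \<Omega>"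
    have fm: "f \<in> borel_measurable ?M" using f by (simp add: bounded_measurable_def)
    show "0 \<le> (\<integral>x. f x * potential ?K ?M f x \<partial>?M)"
    proof -
      have "0 \<le> (\<integral>x. f x * green_fun \<Omega> G f x \<partial>?M)" by (rule E.green_image_nonneg[OF image[OF f]])
      also have "\<dots> = (\<integral>x. f x * potential ?K ?M f x \<partial>?M)"
        using green_eq[OF fm] by (intro Bochner_Integration.integral_cong) auto
      finally show ?thesis .
    qed
    fix e :: real assume e: "0 < e"
    show "(\<integral>x. ?\<rho> x * jfun e (potential ?K ?M f x) \<partial>?M) \<le>
        (\<integral>x. f x * (pfun e (potential ?K ?M f x) * potential ?K ?M ?\<rho> x) \<partial>?M)"
    proof -
      have "(\<integral>x. ?\<rho> x * jfun e (potential ?K ?M f x) \<partial>?M) = (\<integral>x. ?\<rho> x * jfun e (green_fun \<Omega> G f x) \<partial>?M)"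
        using green_eq[OF fm] by (intro Bochner_Integration.integral_cong) auto
      \<comment> \<open>The form inequality is used with the weight as second datum; its Green image
        is nonnegative and bounded, as the product test function requires.\<close>
      also have "\<dots> \<le> (\<integral>x. f x * (pfun e (green_fun \<Omega> G f x) * green_fun \<Omega> G ?\<rho> x) \<partial>?M)"
        using pot_\<rho> green_eq[OF \<rho>m]
        by (intro E.kato_energy[OF image[OF f] image[OF \<rho>_bm] _ _ e, where m = "c * 2 powr \<gamma> * I * D powr \<gamma>"]) auto
      also have "\<dots> = (\<integral>x. f x * (pfun e (potential ?K ?M f x) * potential ?K ?M ?\<rho> x) \<partial>?M)"
        using green_eq[OF fm] green_eq[OF \<rho>m] by (intro Bochner_Integration.integral_cong) auto
      finally show ?thesis .
    qed
  qed
qed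

section \<open>Weak-dual solutions\<close>

context dual_kernel
begin

lemma Union_inner_part: "(\<Union>n. inner_part n) = \<Omega>"
proof -
  have "\<exists>n. x \<in> inner_part n" if x: "x \<in> \<Omega>" for x
  proof -
    have "0 < bdist \<Omega> x" by (rule bdist_pos[OF open_domain bounded_domain x])
    then obtain n where "inverse (real (Suc n)) < bdist \<Omega> x" using reals_Archimedean by blast
    then have "x \<in> inner_part n" using x by (simp add: inner_part_def inverse_eq_divide)
    then show ?thesis by blast
  qed
  then show ?thesis by (auto simp: inner_part_def)
qed

text \<open>Finiteness on compact sets gives sigma-finiteness through the compact exhaustion by the
  sets \<open>inner_part n\<close>.\<close>

lemma radon_measure_weighted:
  assumes r: "radon_measure \<Omega> \<nu>" and i: "integrable \<nu> \<rho>"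
  shows "weighted \<nu> (\<lambda>x. 1)"
proof -
  have s: "sets \<nu> = sets (restrict_space borel \<Omega>)"
    and f: "\<And>L. compact L \<Longrightarrow> L \<subseteq> \<Omega> \<Longrightarrow> emeasure \<nu> L < \<infinity>"
    using r by (auto simp: radon_measure_def)
  have sp: "space \<nu> = \<Omega>" using sets_eq_imp_space_eq[OF s] by (simp add: space_restrict_space)
  have ip: "inner_part n \<subseteq> \<Omega>" for n by (auto simp: inner_part_def)
  have in_sets: "inner_part n \<in> sets \<nu>" for n
    unfolding s using open_domain borel_compact[OF compact_inner_part[of n]] ip[of n]
    by (subst sets_restrict_space_iff) auto
  have fin: "emeasure \<nu> (inner_part n) \<noteq> \<infinity>" for n
    using f[OF compact_inner_part[of n] ip[of n]] by simp
  have sf: "sigma_finite_measure \<nu>"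
  proof
    show "\<exists>A. countable A \<and> A \<subseteq> sets \<nu> \<and> \<Union> A = space \<nu> \<and> (\<forall>a\<in>A. emeasure \<nu> a \<noteq> \<infinity>)"
      using in_sets fin Union_inner_part sp by (intro exI[of _ "range inner_part"]) auto
  qed
  have "(\<lambda>x. x) \<in> borel_measurable (restrict_space borel \<Omega>)" by (intro measurable_restrict_space1) simp
  then have "(\<lambda>x. x) \<in> borel_measurable \<nu>" using measurable_cong_sets[OF s refl] by blast
  then show ?thesis using sf sp i by (simp add: weighted_def)
qed

lemma weighted_measures_weighted:
  assumes "\<mu> \<in> weighted_measures \<Omega> \<gamma>"
  shows "weighted (pos_part \<mu>) (\<lambda>x. 1)" "weighted (neg_part \<mu>) (\<lambda>x. 1)"
  using assms by (auto simp: weighted_measures_def signed_radon_measure_def intro: radon_measure_weighted)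

text \<open>By Fubini's theorem only a null set of points \<open>x\<close> carries an atom of \<open>\<nu>\<close>.\<close>

lemma AE_not_atom:
  assumes w: "weighted \<nu> (\<lambda>x. 1)"
  shows "AE x in M. AE y in \<nu>. x \<noteq> y"
proof -
  interpret P: pair_sigma_finite M \<nu> using w by (rule pair_sf)
  have [measurable]: "(\<lambda>x. x) \<in> borel_measurable \<nu>" using w by (simp add: weighted_def)
  have m: "{p \<in> space (M \<Otimes>\<^sub>M \<nu>). fst p \<noteq> snd p} \<in> sets (M \<Otimes>\<^sub>M \<nu>)" by measurable
  have "AE y in \<nu>. AE x in M. x \<noteq> y"
    by (intro AE_I2 AE_lebesgue_on_neq open_domain)
  then show ?thesis using P.AE_commute[of "\<lambda>x y. x \<noteq> y", OF m] by blast
qed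

text \<open>At a point that is not an atom of \<open>\<nu>\<close> the diagonal value of
  \<open>G\<close> is not seen.\<close>

lemma green_meas_AE:
  assumes K: "K = off_kernel \<Omega> G" and w: "weighted \<nu> (\<lambda>x. 1)"
  shows "AE x in M. green_meas G \<nu> x = green \<nu> x"
  using AE_not_atom[OF w] AE_space
proof eventually_elim
  case (elim x)
  have N: "(\<lambda>x. x) \<in> borel_measurable \<nu>" "space \<nu> = \<Omega>" using w by (auto simp: weighted_def)
  have x: "x \<in> \<Omega>" using elim(2) by simp
  have [measurable]: "off_kernel \<Omega> G x \<in> borel_measurable \<nu>" "G x \<in> borel_measurable \<nu>"
    using green_section_measurable[OF K_borel[unfolded K] N x] by auto
  have ae: "AE y in \<nu>. G x y = off_kernel \<Omega> G x y * 1"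
    using elim(1) AE_space by eventually_elim (use x N(2) in \<open>simp add: off_kernel_def\<close>)
  show ?case
    unfolding green_meas_def potential_def K by (rule integral_cong_AE[OF _ _ ae]) measurable
qed

text \<open>\<open>green_fun\<close> and the potential of a test function agree at every point of
  \<Omega>, so the integrals against the parts of \<open>\<mu>\<close> agree too, even where these
  charge Lebesgue null sets.\<close>

lemma weak_dual_solution_iff:
  assumes K: "K = off_kernel \<Omega> G" and g: "mono g" and \<mu>: "\<mu> \<in> weighted_measures \<Omega> \<gamma>"
  shows "weak_dual_solution \<Omega> \<gamma> G g \<mu> u \<longleftrightarrow> mild_solution g (pos_part \<mu>) (neg_part \<mu>) u"
proof -
  note W = weighted_measures_weighted[OF \<mu>]
  have sp: "space (pos_part \<mu>) = \<Omega>" "space (neg_part \<mu>) = \<Omega>" using W by (auto simp: weighted_def)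
  have "((\<integral>x. u x * \<xi> x \<partial>M) + (\<integral>x. g (u x) * green_fun \<Omega> G \<xi> x \<partial>M) = signed_integral \<mu> (green_fun \<Omega> G \<xi>)) \<longleftrightarrow>
      ((\<integral>x. u x * \<xi> x \<partial>M) + (\<integral>x. g (u x) * pot \<xi> x \<partial>M) =
        (\<integral>x. pot \<xi> x \<partial>pos_part \<mu>) - (\<integral>x. pot \<xi> x \<partial>neg_part \<mu>))"
    if \<xi>: "\<xi> \<in> weighted_Linfty \<Omega> \<gamma>" for \<xi>
  proof -
    obtain v where v: "\<xi> = (\<lambda>x. \<rho> x * v x)" "v \<in> borel_measurable M"
      using \<xi> by (auto simp: weighted_Linfty_def Linfty_def)
    have m: "\<xi> \<in> borel_measurable M" using v(2) unfolding v(1) by measurable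
    have e: "green_fun \<Omega> G \<xi> x = pot \<xi> x" if "x \<in> \<Omega>" for x
      using green_fun_eq[OF open_domain K_borel[unfolded K] m that] by (simp only: K)
    have "(\<integral>x. g (u x) * green_fun \<Omega> G \<xi> x \<partial>M) = (\<integral>x. g (u x) * pot \<xi> x \<partial>M)"
      by (rule Bochner_Integration.integral_cong[OF refl]) (simp add: e)
    moreover have "(\<integral>x. green_fun \<Omega> G \<xi> x \<partial>pos_part \<mu>) = (\<integral>x. pot \<xi> x \<partial>pos_part \<mu>)"
      by (rule Bochner_Integration.integral_cong[OF refl]) (simp add: e sp)
    moreover have "(\<integral>x. green_fun \<Omega> G \<xi> x \<partial>neg_part \<mu>) = (\<integral>x. pot \<xi> x \<partial>neg_part \<mu>)"
      by (rule Bochner_Integration.integral_cong[OF refl]) (simp add: e sp)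
    ultimately show ?thesis by (simp only: signed_integral_def)
  qed
  then show ?thesis
    unfolding weak_iff_mild[OF g W, symmetric] weak_dual_solution_def weighted_M_iff_L1
    by (simp cong: ball_cong)
qed

lemma weak_dual_solution_exists:
  assumes K: "K = off_kernel \<Omega> G" and g: "mono g" "continuous_on UNIV g" "g 0 = 0"
    and adm: "admissible_measure \<Omega> \<gamma> G g \<mu>"
  shows "\<exists>u. weak_dual_solution \<Omega> \<gamma> G g \<mu> u \<and>
    (\<forall>v. weak_dual_solution \<Omega> \<gamma> G g \<mu> v \<longrightarrow> (AE x in M. v x = u x)) \<and>
    (AE x in M. - green_meas G (neg_part \<mu>) x \<le> u x \<and> u x \<le> green_meas G (pos_part \<mu>) x) \<and>
    L1_weighted_norm \<Omega> \<gamma> u + L1_weighted_norm \<Omega> \<gamma> (\<lambda>x. g (u x)) \<le>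
      (C\<^sub>0 + C\<^sub>0 / c\<^sub>1) * weighted_measure_norm \<Omega> \<gamma> \<mu>"
proof -
  have \<mu>: "\<mu> \<in> weighted_measures \<Omega> \<gamma>" using adm by (simp add: admissible_measure_def)
  note W = weighted_measures_weighted[OF \<mu>]
  note eqP = green_meas_AE[OF K W(1)] and eqN = green_meas_AE[OF K W(2)]
  have gm [measurable]: "g \<in> borel_measurable borel" by (rule borel_measurable_mono[OF g(1)])
  have [measurable]: "green (pos_part \<mu>) \<in> borel_measurable M" "green (neg_part \<mu>) \<in> borel_measurable M"
    using potential_weighted[OF W(1)] potential_weighted[OF W(2)] by (auto simp: weighted_M_iff)
  have a: "weighted M (\<lambda>x. g (green_meas G (pos_part \<mu>) x))" "weighted M (\<lambda>x. g (- green_meas G (neg_part \<mu>) x))"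
    using adm by (simp_all add: admissible_measure_def weighted_M_iff_L1)
  have 1: "weighted M (\<lambda>x. g (green (pos_part \<mu>) x))"
    by (rule weighted_cong_AE[OF a(1)]) (measurable, use eqP in eventually_elim, simp)
  have 2: "weighted M (\<lambda>x. g (- green (neg_part \<mu>) x))"
    by (rule weighted_cong_AE[OF a(2)]) (measurable, use eqN in eventually_elim, simp)
  obtain u where u: "mild_solution g (pos_part \<mu>) (neg_part \<mu>) u"
    "AE x in M. - green (neg_part \<mu>) x \<le> u x \<and> u x \<le> green (pos_part \<mu>) x"
    using existence[OF g W 1 2] by blast
  have "AE x in M. - green_meas G (neg_part \<mu>) x \<le> u x \<and> u x \<le> green_meas G (pos_part \<mu>) x"
    using u(2) eqP eqN by eventually_elim simp
  moreover have "AE x in M. v x = u x" if "weak_dual_solution \<Omega> \<gamma> G g \<mu> v" for v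
    by (rule uniqueness[OF g(1) W u(1)]) (use that weak_dual_solution_iff[OF K g(1) \<mu>] in blast)
  moreover have "L1_weighted_norm \<Omega> \<gamma> u + L1_weighted_norm \<Omega> \<gamma> (\<lambda>x. g (u x)) \<le>
      (C\<^sub>0 + C\<^sub>0 / c\<^sub>1) * weighted_measure_norm \<Omega> \<gamma> \<mu>"
    using estimate[OF g(1,3) W u] by (simp only: weighted_measure_norm_def)
  ultimately show ?thesis using u(1) weak_dual_solution_iff[OF K g(1) \<mu>] by blast
qed

lemma weak_dual_solution_mono:
  assumes K: "K = off_kernel \<Omega> G" and g: "mono g"
    and \<mu>: "\<mu>\<^sub>1 \<in> weighted_measures \<Omega> \<gamma>" "\<mu>\<^sub>2 \<in> weighted_measures \<Omega> \<gamma>" "signed_le \<Omega> \<mu>\<^sub>1 \<mu>\<^sub>2"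
    and u: "weak_dual_solution \<Omega> \<gamma> G g \<mu>\<^sub>1 u\<^sub>1" "weak_dual_solution \<Omega> \<gamma> G g \<mu>\<^sub>2 u\<^sub>2"
  shows "AE x in M. u\<^sub>1 x \<le> u\<^sub>2 x"
proof (rule comparison[OF g])
  show "signed_le \<Omega> (Jordan (pos_part \<mu>\<^sub>1) (neg_part \<mu>\<^sub>1)) (Jordan (pos_part \<mu>\<^sub>2) (neg_part \<mu>\<^sub>2))"
    using \<mu>(3) by simp
qed (use weighted_measures_weighted \<mu> u weak_dual_solution_iff[OF K g] in blast)+

end

theorem theorem3p3:
  fixes \<Omega> :: "'a::euclidean_space set" and s \<gamma> c :: real
  assumes "DIM('a) \<ge> 3"
    and "bounded_C2_domain \<Omega>"
    and "0 < s" "s \<le> 1" "0 < \<gamma>" "\<gamma> \<le> 1"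
    and "real DIM('a) > 2 * s"
    and "c > 0"
  shows "\<exists>C>0. \<forall>(J :: 'a \<Rightarrow> 'a \<Rightarrow> real) (B :: 'a \<Rightarrow> real) (G :: 'a \<Rightarrow> 'a \<Rightarrow> real) (g :: real \<Rightarrow> real).
    cond_L1 \<Omega> J B \<and> cond_L2 \<Omega> J B \<and> cond_L3 \<Omega> J B \<and> cond_L4 \<Omega> J B s \<and>
    cond_G1 \<Omega> J B s \<gamma> c G \<and> cond_G2 \<Omega> G \<and> cond_G3 \<Omega> \<gamma> G \<and>
    mono g \<and> continuous_on UNIV g \<and> g 0 = 0 \<longrightarrow>
    (\<forall>\<mu>. admissible_measure \<Omega> \<gamma> G g \<mu> \<longrightarrow>
       (\<exists>u. weak_dual_solution \<Omega> \<gamma> G g \<mu> u \<and>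
          (\<forall>v. weak_dual_solution \<Omega> \<gamma> G g \<mu> v \<longrightarrow> (AE x in lebesgue_on \<Omega>. v x = u x)) \<and>
          (AE x in lebesgue_on \<Omega>.
             - green_meas G (neg_part \<mu>) x \<le> u x \<and> u x \<le> green_meas G (pos_part \<mu>) x) \<and>
          L1_weighted_norm \<Omega> \<gamma> u + L1_weighted_norm \<Omega> \<gamma> (\<lambda>x. g (u x))
            \<le> C * weighted_measure_norm \<Omega> \<gamma> \<mu>)) \<and>
    (\<forall>\<mu>\<^sub>1 \<mu>\<^sub>2 u\<^sub>1 u\<^sub>2.
       admissible_measure \<Omega> \<gamma> G g \<mu>\<^sub>1 \<and> admissible_measure \<Omega> \<gamma> G g \<mu>\<^sub>2 \<and> signed_le \<Omega> \<mu>\<^sub>1 \<mu>\<^sub>2 \<and>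
       weak_dual_solution \<Omega> \<gamma> G g \<mu>\<^sub>1 u\<^sub>1 \<and> weak_dual_solution \<Omega> \<gamma> G g \<mu>\<^sub>2 u\<^sub>2 \<longrightarrow>
       (AE x in lebesgue_on \<Omega>. u\<^sub>1 x \<le> u\<^sub>2 x))"
proof -
  have \<Omega>: "open \<Omega>" "bounded \<Omega>" "\<Omega> \<noteq> {}" using assms(2) by (auto simp: bounded_C2_domain_def)
  \<comment> \<open>\<open>I\<close> and \<open>D\<close> depend on the domain, the dimension and
    \<open>s\<close>. They are fixed before the operator, the kernel and the nonlinearity are
    introduced, so the constant is uniform in these.\<close>
  obtain I where I: "0 \<le> I" "\<And>y. y \<in> \<Omega> \<Longrightarrow>
      (\<integral>\<^sup>+x. ennreal (dist x y powr (- (real DIM('a) - 2 * s))) \<partial>lebesgue_on \<Omega>) \<le> ennreal I"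
    using riesz_potential_bound[OF \<Omega>(1,2), of "real DIM('a) - 2 * s"] assms by auto
  obtain D where D: "1 \<le> D" "\<And>x. x \<in> \<Omega> \<Longrightarrow> bdist \<Omega> x \<le> D" "\<And>x y. x \<in> \<Omega> \<Longrightarrow> y \<in> \<Omega> \<Longrightarrow> dist x y \<le> D"
    using bdist_bounded[OF \<Omega>(2)] by blast
  define C\<^sub>0 where "C\<^sub>0 = c * 2 powr \<gamma> * I"
  define c\<^sub>1 where "c\<^sub>1 = inverse c * D powr (- (real DIM('a) - 2 * s) - 2 * \<gamma>) *
    (\<integral>x. bdist \<Omega> x powr \<gamma> * bdist \<Omega> x powr \<gamma> \<partial>lebesgue_on \<Omega>)"
  define C where "C = max 1 (C\<^sub>0 + C\<^sub>0 / c\<^sub>1)"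
  have kernel: "dual_kernel \<Omega> \<gamma> (off_kernel \<Omega> G) C\<^sub>0 (c * I) c\<^sub>1"
    if "cond_L1 \<Omega> J B" "cond_G1 \<Omega> J B s \<gamma> c G" "cond_G2 \<Omega> G" for J B G
    unfolding C\<^sub>0_def c\<^sub>1_def by (rule green_dual_kernel[OF \<Omega> assms(3,5,7,8) I D that])
  show ?thesis
  proof (intro exI[of _ C] conjI allI impI; (elim conjE)?)
    show "C > 0" by (simp add: C_def)
  next
    fix J :: "'a \<Rightarrow> 'a \<Rightarrow> real" and B :: "'a \<Rightarrow> real" and G :: "'a \<Rightarrow> 'a \<Rightarrow> real" and g :: "real \<Rightarrow> real" and \<mu>
    assume L: "cond_L1 \<Omega> J B" "cond_G1 \<Omega> J B s \<gamma> c G" "cond_G2 \<Omega> G"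
      and g: "mono g" "continuous_on UNIV g" "g 0 = 0" and \<mu>: "admissible_measure \<Omega> \<gamma> G g \<mu>"
    interpret dual_kernel \<Omega> \<gamma> "off_kernel \<Omega> G" C\<^sub>0 "c * I" c\<^sub>1 by (rule kernel[OF L])
    have "0 \<le> weighted_measure_norm \<Omega> \<gamma> \<mu>"
      unfolding weighted_measure_norm_def by (intro add_nonneg_nonneg Bochner_Integration.integral_nonneg) auto
    then have "(C\<^sub>0 + C\<^sub>0 / c\<^sub>1) * weighted_measure_norm \<Omega> \<gamma> \<mu> \<le> C * weighted_measure_norm \<Omega> \<gamma> \<mu>"
      by (intro mult_right_mono) (simp add: C_def)
    with weak_dual_solution_exists[OF refl g \<mu>]
    show "\<exists>u. weak_dual_solution \<Omega> \<gamma> G g \<mu> u \<and>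
          (\<forall>v. weak_dual_solution \<Omega> \<gamma> G g \<mu> v \<longrightarrow> (AE x in lebesgue_on \<Omega>. v x = u x)) \<and>
          (AE x in lebesgue_on \<Omega>.
             - green_meas G (neg_part \<mu>) x \<le> u x \<and> u x \<le> green_meas G (pos_part \<mu>) x) \<and>
          L1_weighted_norm \<Omega> \<gamma> u + L1_weighted_norm \<Omega> \<gamma> (\<lambda>x. g (u x))
            \<le> C * weighted_measure_norm \<Omega> \<gamma> \<mu>"
      by (meson order_trans)
  next
    fix J :: "'a \<Rightarrow> 'a \<Rightarrow> real" and B :: "'a \<Rightarrow> real" and G :: "'a \<Rightarrow> 'a \<Rightarrow> real" and g :: "real \<Rightarrow> real"
      and \<mu>\<^sub>1 \<mu>\<^sub>2 u\<^sub>1 u\<^sub>2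
    assume L: "cond_L1 \<Omega> J B" "cond_G1 \<Omega> J B s \<gamma> c G" "cond_G2 \<Omega> G" and g: "mono g"
      and \<mu>: "admissible_measure \<Omega> \<gamma> G g \<mu>\<^sub>1" "admissible_measure \<Omega> \<gamma> G g \<mu>\<^sub>2" "signed_le \<Omega> \<mu>\<^sub>1 \<mu>\<^sub>2"
      and u: "weak_dual_solution \<Omega> \<gamma> G g \<mu>\<^sub>1 u\<^sub>1" "weak_dual_solution \<Omega> \<gamma> G g \<mu>\<^sub>2 u\<^sub>2"
    interpret dual_kernel \<Omega> \<gamma> "off_kernel \<Omega> G" C\<^sub>0 "c * I" c\<^sub>1 by (rule kernel[OF L])
    show "AE x in lebesgue_on \<Omega>. u\<^sub>1 x \<le> u\<^sub>2 x"
      by (rule weak_dual_solution_mono[OF refl g _ _ \<mu>(3) u]) (use \<mu> in \<open>simp_all add: admissible_measure_def\<close>)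
  qed
qed

end
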